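(* Assume the standing assumptions (H$_p$) below. Then there exists a solution $u$ of $$-\operatorname{div}(a(x,u,\nabla u))+g(u)|\nabla u|^p=h(u)f\ \text{in }\Omega,\quad u\ge0\ \text{in }\Omega,\quad u=0\ \text{on }\partial\Omega,$$ in the sense of the Definition below, which moreover satisfies $g(u)|\nabla u|^p\in L^1(\Omega)$.
   Context: Standing assumptions (H$_p$): $\Omega\subset\mathbb{R}^N$, $N\ge2$, is a bounded open set, $1<p<N$, $p'=p/(p-1)$. $a:\Omega\times\mathbb{R}\times\mathbb{R}^N\to\mathbb{R}^N$ is a Carathéodory function and there exist $\alpha,\beta>0$ and a nonnegative $b\in L^{p'}(\Omega)$ such that for a.e. $x\in\Omega$, every $s\in\mathbb{R}$ and every $\xi,\xi'\in\mathbb{R}^N$ with $\xi\neq\xi'$: (A1) $a(x,s,\xi)\cdot\xi\ge\alpha|\xi|^p$; (A2) $|a(x,s,\xi)|\le\beta(b(x)+|s|^{p-1}+|\xi|^{p-1})$; (A3) $(a(x,s,\xi)-a(x,s,\xi'))\cdot(\xi-\xi')>0$. The function $g:[0,\infty)\to[0,\infty)$ is continuous with $\liminf_{s\to\infty}g(s)>0$. The function $h:[0,\infty)\to[0,\infty]$ is continuous, finite on $(0,\infty)$, with $h(0)>0$; there exist $\gamma\in[0,1]$ and $c_1,s_1>0$ with $h(s)\le c_1 s^{-\gamma}$ for all $0<s\le s_1$; and $h$ is bounded on $[\delta,\infty)$ for every $\delta>0$. Finally $f\in L^1(\Omega)$ and $f\ge0$. Definition (solution, $p>1$): a nonnegative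 $u\in W^{1,p}_0(\Omega)$ is a solution if $a(x,u,\nabla u)\in L^1_{\rm loc}(\Omega)^N$, $g(u)|\nabla u|^p\in L^1_{\rm loc}(\Omega)$, $h(u)f\in L^1_{\rm loc}(\Omega)$ and $$\int_\Omega a(x,u,\nabla u)\cdot\nabla\varphi+\int_\Omega g(u)|\nabla u|^p\varphi=\int_\Omega h(u)f\varphi\quad\forall\varphi\in C^1_c(\Omega).$$ *)

theory Defs
  imports "HOL-Analysis.Analysis"
begin

text \<open>Functions on Omega are functions on the whole euclidean space 'a (dimension N = DIM('a));
  only their values on Omega matter.  Integrals over Omega are w.r.t. lebesgue_on Omega.\<close>

definition Lp_on :: "real \<Rightarrow> 'a::euclidean_space set \<Rightarrow> ('a \<Rightarrow> 'b::real_normed_vector) \<Rightarrow> bool" where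
  "Lp_on p \<Omega> f \<longleftrightarrow> f \<in> borel_measurable (lebesgue_on \<Omega>) \<and>
      integrable (lebesgue_on \<Omega>) (\<lambda>x. norm (f x) powr p)"

definition L1loc_on :: "'a::euclidean_space set \<Rightarrow> ('a \<Rightarrow> 'b::{banach,second_countable_topology}) \<Rightarrow> bool" where
  "L1loc_on \<Omega> f \<longleftrightarrow> f \<in> borel_measurable (lebesgue_on \<Omega>) \<and>
      (\<forall>K. compact K \<and> K \<subseteq> \<Omega> \<longrightarrow> integrable (lebesgue_on K) f)"

definition C1c :: "'a::euclidean_space set \<Rightarrow> ('a \<Rightarrow> real) \<Rightarrow> bool" where
  "C1c \<Omega> \<phi> \<longleftrightarrow> (\<exists>D. continuous_on UNIV D \<and> (\<forall>x. (\<phi> has_derivative (\<lambda>h. D x \<bullet> h)) (at x)))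
      \<and> compact (closure {x. \<phi> x \<noteq> 0}) \<and> closure {x. \<phi> x \<noteq> 0} \<subseteq> \<Omega>"

definition grad :: "('a::euclidean_space \<Rightarrow> real) \<Rightarrow> 'a \<Rightarrow> 'a" where
  "grad \<phi> x = (SOME g. (\<phi> has_derivative (\<lambda>h. g \<bullet> h)) (at x))"

definition weak_grad :: "'a::euclidean_space set \<Rightarrow> ('a \<Rightarrow> real) \<Rightarrow> ('a \<Rightarrow> 'a) \<Rightarrow> bool" where
  "weak_grad \<Omega> u G \<longleftrightarrow> L1loc_on \<Omega> u \<and> L1loc_on \<Omega> G \<and>
     (\<forall>\<phi>. C1c \<Omega> \<phi> \<longrightarrow>
        (LINT x|lebesgue_on \<Omega>. u x *\<^sub>R grad \<phi> x) = - (LINT x|lebesgue_on \<Omega>. \<phi> x *\<^sub>R G x))"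

definition W1p0 :: "real \<Rightarrow> 'a::euclidean_space set \<Rightarrow> ('a \<Rightarrow> real) \<Rightarrow> ('a \<Rightarrow> 'a) \<Rightarrow> bool" where
  "W1p0 p \<Omega> u G \<longleftrightarrow> Lp_on p \<Omega> u \<and> Lp_on p \<Omega> G \<and> weak_grad \<Omega> u G \<and>
     (\<exists>\<phi>s. (\<forall>k. C1c \<Omega> (\<phi>s k)) \<and>
        (\<lambda>k. LINT x|lebesgue_on \<Omega>. \<bar>\<phi>s k x - u x\<bar> powr p) \<longlonglongrightarrow> 0 \<and>
        (\<lambda>k. LINT x|lebesgue_on \<Omega>. norm (grad (\<phi>s k) x - G x) powr p) \<longlonglongrightarrow> 0)"

definition Hp :: "real \<Rightarrow> 'a::euclidean_space set \<Rightarrow> ('a \<Rightarrow> real \<Rightarrow> 'a \<Rightarrow> 'a) \<Rightarrow>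
    (real \<Rightarrow> real) \<Rightarrow> (real \<Rightarrow> ennreal) \<Rightarrow> ('a \<Rightarrow> real) \<Rightarrow> bool" where
  "Hp p \<Omega> a g h f \<longleftrightarrow>
     DIM('a) \<ge> 2 \<and> bounded \<Omega> \<and> open \<Omega> \<and> 1 < p \<and> p < real DIM('a) \<and>
     \<comment> \<open>Caratheodory\<close>
     (\<forall>s \<xi>. (\<lambda>x. a x s \<xi>) \<in> borel_measurable (lebesgue_on \<Omega>)) \<and>
     (AE x in lebesgue_on \<Omega>. continuous_on UNIV (\<lambda>(s, \<xi>). a x s \<xi>)) \<and>
     (\<exists>\<alpha> \<beta> b. \<alpha> > 0 \<and> \<beta> > 0 \<and> Lp_on (p / (p - 1)) \<Omega> b \<and> (\<forall>x. b x \<ge> 0) \<and>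
        (AE x in lebesgue_on \<Omega>. \<forall>s \<xi> \<xi>'.
            a x s \<xi> \<bullet> \<xi> \<ge> \<alpha> * norm \<xi> powr p \<and>
            norm (a x s \<xi>) \<le> \<beta> * (b x + \<bar>s\<bar> powr (p - 1) + norm \<xi> powr (p - 1)) \<and>
            (\<xi> \<noteq> \<xi>' \<longrightarrow> (a x s \<xi> - a x s \<xi>') \<bullet> (\<xi> - \<xi>') > 0))) \<and>
     \<comment> \<open>g\<close>
     continuous_on {0..} g \<and> (\<forall>s\<ge>0. g s \<ge> 0) \<and> Liminf at_top (\<lambda>s. ereal (g s)) > 0 \<and>
     \<comment> \<open>h : [0,\<infinity>) \<rightarrow> [0,\<infinity>]\<close>
     continuous_on {0..} h \<and> (\<forall>s>0. h s < \<infinity>) \<and> h 0 > 0 \<and>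
     (\<exists>\<gamma> c1 s1. 0 \<le> \<gamma> \<and> \<gamma> \<le> 1 \<and> c1 > 0 \<and> s1 > 0 \<and>
        (\<forall>s. 0 < s \<and> s \<le> s1 \<longrightarrow> h s \<le> ennreal (c1 * s powr (- \<gamma>)))) \<and>
     (\<forall>\<delta>>0. \<exists>M. \<forall>s\<ge>\<delta>. h s \<le> ennreal M) \<and>
     \<comment> \<open>f\<close>
     integrable (lebesgue_on \<Omega>) f \<and> (AE x in lebesgue_on \<Omega>. f x \<ge> 0)"

text \<open>u (with weak gradient G) is a solution in the sense of the Definition.  The product
  h(u) f is taken in [0,\<infinity>] (with \<infinity> \<cdot> 0 = 0); its local integrability forces it to be finite a.e.\<close>
definition is_solution :: "real \<Rightarrow> 'a::euclidean_space set \<Rightarrow> ('a \<Rightarrow> real \<Rightarrow> 'a \<Rightarrow> 'a) \<Rightarrow>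
    (real \<Rightarrow> real) \<Rightarrow> (real \<Rightarrow> ennreal) \<Rightarrow> ('a \<Rightarrow> real) \<Rightarrow> ('a \<Rightarrow> real) \<Rightarrow> ('a \<Rightarrow> 'a) \<Rightarrow> bool" where
  "is_solution p \<Omega> a g h f u G \<longleftrightarrow>
     W1p0 p \<Omega> u G \<and> (AE x in lebesgue_on \<Omega>. u x \<ge> 0) \<and>
     L1loc_on \<Omega> (\<lambda>x. a x (u x) (G x)) \<and>
     L1loc_on \<Omega> (\<lambda>x. g (u x) * norm (G x) powr p) \<and>
     (\<lambda>x. h (u x) * ennreal (f x)) \<in> borel_measurable (lebesgue_on \<Omega>) \<and>
     (\<forall>K. compact K \<and> K \<subseteq> \<Omega> \<longrightarrow> (\<integral>\<^sup>+ x. h (u x) * ennreal (f x) \<partial>lebesgue_on K) < \<infinity>) \<and>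
     (\<forall>\<phi>. C1c \<Omega> \<phi> \<longrightarrow>
        (LINT x|lebesgue_on \<Omega>. a x (u x) (G x) \<bullet> grad \<phi> x)
        + (LINT x|lebesgue_on \<Omega>. g (u x) * norm (G x) powr p * \<phi> x)
        = (LINT x|lebesgue_on \<Omega>. enn2real (h (u x) * ennreal (f x)) * \<phi> x))"

end

(* W is the closure of the jets (u, grad u) of test functions in L^p.  A Galerkin scheme with
  Poincare-Miranda and Minty monotonicity solves bounded Leray-Lions problems; it is applied with the
  source and the gradient term truncated at level n, plus a flux E n that vanishes for
  |xi| <= RE n and controls the part of |grad u|^p that the truncation discards.
  The test functions arctan u and its variants give energy bounds independent of n (this uses
  gamma <= 1), and testing with phi T(u_n - w_n), w_n smooth and close to the limit, gives
  convergence of the gradients a.e. on compact sets.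

  The limit equation is proved as two inequalities by Fatou.  For the upper one the test function
  vanishes where u_n is small, so h(u_n) stays bounded.  For the lower one it carries the weight
  exp(-Lambda(u_n)), alpha Lambda' = g, for which the gradient terms have a sign. *)
theory Submission
 imports Defs "HOL-Complex_Analysis.Great_Picard"
begin

text \<open>The obstacle is the set where the limit u vanishes. As f may vanish on part of \<Omega>,
  no positive lower bound for u on compact sets is at hand, h(u_n) f has no evident majorant there,
  and the gradient term is bounded in L^1 only. Neither term passes to the limit by itself, and
  Fatou gives one inequality for each kind of test function. What saves the argument is that grad u
  = 0 a.e. where u = 0, so flux and gradient term carry nothing there.

  For large u_n the derivative 1/(1 + u_n^2) of arctan ruins coercivity, and the energy bound comes
  from g being bounded below. The truncated gradient term sees |grad u_n|^p only up to a threshold;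
  the flux \<open>E n\<close> supplies the excess, so it needs a factor of order n^2 against that
  derivative, yet it must vanish in L^1. Choosing the threshold on the gradient one power larger
  than this factor reconciles the two demands.\<close>

notation (ASCII) LIMSEQ ("((_)/ ----> (_))" [60, 60] 60)

abbreviation (input) "BM \<equiv> borel_measurable"

lemmas lint_nonneg = Bochner_Integration.integral_nonneg and lint_bound = Bochner_Integration.integrable_bound

section \<open>Spaces of p-integrable functions\<close>

text \<open>Homogeneity reduces to c = 1, where this is Bernoulli's inequality with a real exponent.
  Strictness is what makes \<open>cvx_gap\<close> positive later.\<close>

lemma powr_strict_tangent:
 fixes t c p :: real
 assumes "p > 1" "c > 0" "t >= 0" "t \<noteq> c"
 shows "t powr p > c powr p + p * c powr (p - 1) * (t - c)"
proof -
 have bern: "x powr p > 1 + p * (x - 1)" if "x >= 0" "x \<noteq> 1" for x :: real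
 proof -
  let ?f = "%x. x powr p - 1 - p * (x - 1)"
  have d: "DERIV ?f z :> p * (z powr (p - 1) - 1)" if "z > 0" for z
   using that by (auto intro!: derivative_eq_intros simp: algebra_simps)
  consider "x = 0" | "0 < x" "x < 1" | "x > 1" using \<open>x >= 0\<close> \<open>x \<noteq> 1\<close> by linarith
  then show ?thesis
  proof cases
   case 1 then show ?thesis using \<open>p > 1\<close> by simp
  next
   case 2
   then obtain z where z: "x < z" "z < 1" "?f 1 - ?f x = (1 - x) * (p * (z powr (p - 1) - 1))"
    using MVT2[of x 1 ?f "%z. p * (z powr (p - 1) - 1)"] d by fastforce
   have "z powr (p - 1) < 1 powr (p - 1)" using z 2 \<open>p > 1\<close> by (intro powr_less_mono2) auto
   then have "(1 - x) * (p * (z powr (p - 1) - 1)) < 0"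
    using 2 \<open>p > 1\<close> by (intro mult_pos_neg) auto
   then show ?thesis using z by simp
  next
   case 3
   then obtain z where z: "1 < z" "z < x" "?f x - ?f 1 = (x - 1) * (p * (z powr (p - 1) - 1))"
    using MVT2[of 1 x ?f "%z. p * (z powr (p - 1) - 1)"] d by fastforce
   have "1 powr (p - 1) < z powr (p - 1)" using z \<open>p > 1\<close> by (intro powr_less_mono2) auto
   then have "(x - 1) * (p * (z powr (p - 1) - 1)) > 0"
    using 3 \<open>p > 1\<close> by auto
   then show ?thesis using z by simp
  qed
 qed
 have "(t / c) powr p > 1 + p * (t / c - 1)" using assms by (intro bern) auto
 then have "c powr p * (t / c) powr p > c powr p * (1 + p * (t / c - 1))"
  using assms by (intro mult_strict_left_mono) auto
 moreover have "c powr p * (t / c) powr p = t powr p"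
  using assms by (simp add: powr_divide)
 moreover have "c powr p = c * c powr (p - 1)"
  using assms by (simp add: powr_mult_base)
 then have "c powr p * (1 + p * (t / c - 1)) = c powr p + p * c powr (p - 1) * (t - c)"
  using assms by (simp add: field_simps)
 ultimately show ?thesis by simp
qed

lemma powr_tangent:
 fixes t c p :: real
 assumes "p > 1" "c >= 0" "t >= 0"
 shows "t powr p >= c powr p + p * c powr (p - 1) * (t - c)"
proof (cases "c = 0 \<or> t = c")
 case True then show ?thesis using assms by auto
next
 case False then show ?thesis using powr_strict_tangent[of p c t] assms by auto
qed

lemma powr_add_le:
 fixes a b p :: real
 assumes "a >= 0" "b >= 0" "p >= 0"
 shows "(a + b) powr p <= 2 powr p * (a powr p + b powr p)"
proof -
 have "(a + b) powr p <= (2 * max a b) powr p" using assms by (intro powr_mono2) auto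
 also have "... = 2 powr p * max a b powr p" using assms by (simp add: powr_mult)
 also have "... <= 2 powr p * (a powr p + b powr p)" by (intro mult_left_mono) (auto simp: max_def)
 finally show ?thesis .
qed

lemma norm_add_powr_le:
 assumes "p >= 0"
 shows "norm (x + y) powr p <= 2 powr p * (norm x powr p + norm y powr p)"
 by (rule order_trans[OF powr_mono2 powr_add_le]) (use assms norm_triangle_ineq in auto)

lemma norm_diff_powr_le:
 assumes "p >= 0"
 shows "norm (x - y) powr p <= 2 powr p * (norm x powr p + norm y powr p)"
 using norm_add_powr_le[OF assms, of x "- y"] by simp

text \<open>Whichever of a and b^(p-1) is the larger, the product is bounded by one of the two
  powers; the sharp factors 1/q and 1/p are given up.\<close>

lemma young_powr:
 fixes a b p q :: real
 assumes "p > 1" "q = p / (p - 1)" "a >= 0" "b >= 0"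
 shows "a * b <= a powr q + b powr p"
proof (cases "a = 0 \<or> b = 0")
 case False
 then have ab: "a > 0" "b > 0" using assms by auto
 have q1: "q > 0" using assms by simp
 show ?thesis
 proof (cases "a <= b powr (p - 1)")
  case True
  then have "a * b <= b powr (p - 1) * b" using ab by simp
  also have "... = b powr p" using ab by (simp add: powr_mult_base mult.commute)
  finally show ?thesis by (smt (verit) powr_ge_zero)
 next
  case False
  then have "(b powr (p - 1)) powr (1/(p-1)) <= a powr (1/(p-1))"
   using assms by (intro powr_mono2) auto
  then have "b <= a powr (1/(p-1))" using ab assms by (simp add: powr_powr)
  then have "a * b <= a * a powr (1/(p-1))" using ab by simp
  also have "... = a powr (1 + 1/(p-1))" using ab by (simp add: powr_mult_base)
  also have "1 + 1/(p-1) = q" using assms by (simp add: field_simps)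
  finally show ?thesis by (smt (verit) powr_ge_zero)
 qed
qed auto

text \<open>The free parameter t plays the part of Hoelder's inequality: a small t makes the p-term
  small at the cost of a large factor on the q-term.\<close>

lemma young_scaled:
 fixes a b p q t :: real
 assumes "p > 1" "q = p / (p - 1)" "a >= 0" "b >= 0" "t > 0"
 shows "a * b <= t powr (- q) * a powr q + t powr p * b powr p"
proof -
 have "a * b = (a / t) * (t * b)" using assms by simp
 also have "... <= (a / t) powr q + (t * b) powr p" using assms by (intro young_powr) auto
 also have "... = t powr (- q) * a powr q + t powr p * b powr p"
  using assms by (simp add: powr_divide powr_mult powr_minus_divide)
 finally show ?thesis .
qed

lemma le_one_plus_powr:
 fixes t p :: real assumes "p >= 1" "t >= 0" shows "t <= 1 + t powr p"
proof (cases "t <= 1")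
 case False
 then have "t powr 1 <= t powr p" using assms by (intro powr_mono) auto
 then show ?thesis using False by auto
qed (smt (verit) powr_ge_zero)

section \<open>Functions with integrable p-th power\<close>

definition LP :: "real => 'm measure => ('m => 'b::euclidean_space) => bool" where
 "LP p M f \<longleftrightarrow> f \<in> BM M \<and> integrable M (%x. norm (f x) powr p)"

lemma LP_meas: "LP p M f ==> f \<in> BM M"
 and LP_int: "LP p M f ==> integrable M (%x. norm (f x) powr p)"
 by (auto simp: LP_def)

lemma LP_boundI:
 assumes "f \<in> BM M" "integrable M g" "AE x in M. norm (f x) powr p <= g x"
 shows "LP p M f"
 unfolding LP_def
proof (intro conjI)
 show "integrable M (%x. norm (f x) powr p)"
  by (rule lint_bound[OF assms(2)]) (use assms in auto)
qed (use assms in auto)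

lemma LP_add: "LP p M f ==> LP p M g ==> p >= 0 ==> LP p M (%x. f x + g x)"
 by (rule LP_boundI[where g="%x. 2 powr p * (norm (f x) powr p + norm (g x) powr p)"])
   (auto simp: LP_def norm_add_powr_le)

lemma LP_diff: "LP p M f ==> LP p M g ==> p >= 0 ==> LP p M (%x. f x - g x)"
 by (rule LP_boundI[where g="%x. 2 powr p * (norm (f x) powr p + norm (g x) powr p)"])
   (auto simp: LP_def norm_diff_powr_le)

lemma LP_scaleR: "LP p M f ==> LP p M (%x. c *\<^sub>R f x)"
 by (auto simp: LP_def powr_mult)

lemma LP_mult_bounded:
 assumes "LP p M f" "c \<in> BM M" "!!x. \<bar>c x\<bar> <= B" "p >= 0"
 shows "LP p M (%x. c x *\<^sub>R f x)"
proof (rule LP_boundI[where g="%x. B powr p * norm (f x) powr p"])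
 have "\<bar>c x\<bar> * norm (f x) <= B * norm (f x)" for x using assms by (intro mult_right_mono) auto
 moreover have "B >= 0" using assms(3) abs_ge_zero order_trans by blast
 ultimately show "AE x in M. norm (c x *\<^sub>R f x) powr p <= B powr p * norm (f x) powr p"
  using assms by (auto simp: powr_mult[symmetric] intro!: powr_mono2)
qed (use assms in \<open>auto simp: LP_def\<close>)

lemma (in finite_measure) LP_bounded:
 assumes "f \<in> BM M" "!!x. x \<in> space M ==> norm (f x) <= B" "p >= 0"
 shows "LP p M f"
 by (rule LP_boundI[where g="%x. B powr p"]) (use assms in \<open>auto intro!: powr_mono2\<close>)

lemma borel_measurable_fst_snd:
 fixes X :: "'m => 'b::euclidean_space \<times> 'c::euclidean_space"
 assumes "X \<in> BM M"
 shows "(%x. fst (X x)) \<in> BM M" "(%x. snd (X x)) \<in> BM M"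
 using assms by (auto intro!: borel_measurable_continuous_on[OF _ assms] continuous_intros)

lemma norm_fst_snd_le: "norm (fst z) <= norm z" "norm (snd z) <= norm z"
 by (metis norm_fst_le prod.collapse) (metis norm_snd_le prod.collapse)

lemma LP_fst: "LP p M X ==> p >= 0 ==> LP p M (%x. fst (X x))"
 by (rule LP_boundI[where g="%x. norm (X x) powr p"]) (auto simp: LP_def norm_fst_snd_le intro!: powr_mono2 borel_measurable_fst_snd)

lemma LP_snd: "LP p M X ==> p >= 0 ==> LP p M (%x. snd (X x))"
 by (rule LP_boundI[where g="%x. norm (X x) powr p"]) (auto simp: LP_def norm_fst_snd_le intro!: powr_mono2 borel_measurable_fst_snd)

lemma norm_Pair_powr_le:
 assumes "p >= 0"
 shows "norm (x, y) powr p <= 2 powr p * (norm x powr p + norm y powr p)"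
 by (rule order_trans[OF powr_mono2 powr_add_le]) (use assms norm_Pair_le in auto)

lemma LP_Pair: "LP p M f ==> LP p M g ==> p >= 0 ==> LP p M (%x. (f x, g x))"
 by (rule LP_boundI[where g="%x. 2 powr p * (norm (f x) powr p + norm (g x) powr p)"])
   (auto simp: LP_def norm_Pair_powr_le)

lemma (in finite_measure) LP_integrable:
 assumes "LP p M f" "p >= 1"
 shows "integrable M f"
proof (rule lint_bound)
 show "integrable M (%x. 1 + norm (f x) powr p)" using assms by (auto simp: LP_def)
 show "AE x in M. norm (f x) <= norm (1 + norm (f x) powr p)"
  using le_one_plus_powr[OF assms(2)] by (auto intro!: AE_I2 order_trans[OF _ abs_ge_self])
qed (use assms in \<open>auto simp: LP_def\<close>)

lemma LP_inner_integrable: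
 assumes "LP q M Z" "LP p M V" "p > 1" "q = p / (p - 1)"
 shows "integrable M (%x. Z x \<bullet> V x)" "integrable M (%x. norm (Z x) * norm (V x))"
proof -
 have *: "norm (Z x) * norm (V x) <= norm (Z x) powr q + norm (V x) powr p" for x
  using young_powr[OF assms(3,4)] by simp
 have i: "integrable M (%x. norm (Z x) powr q + norm (V x) powr p)" using assms by (auto simp: LP_def)
 show "integrable M (%x. Z x \<bullet> V x)"
  by (rule lint_bound[OF i])
    (use assms * Cauchy_Schwarz_ineq2 in \<open>auto simp: LP_def intro!: AE_I2 intro: order_trans\<close>)
 show "integrable M (%x. norm (Z x) * norm (V x))"
  by (rule lint_bound[OF i])
    (use assms * in \<open>auto simp: LP_def intro!: AE_I2\<close>)
qed

lemma LP_inner_bound: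
 assumes "LP q M Z" "LP p M V" "p > 1" "q = p / (p - 1)" "t > 0"
 shows "\<bar>LINT x|M. Z x \<bullet> V x\<bar> <= t powr (- q) * (LINT x|M. norm (Z x) powr q)
      + t powr p * (LINT x|M. norm (V x) powr p)"
proof -
 have "\<bar>LINT x|M. Z x \<bullet> V x\<bar> <= (LINT x|M. \<bar>Z x \<bullet> V x\<bar>)" by (rule integral_abs_bound)
 also have "... <= (LINT x|M. t powr (- q) * norm (Z x) powr q + t powr p * norm (V x) powr p)"
 proof (rule integral_mono)
  show "integrable M (%x. \<bar>Z x \<bullet> V x\<bar>)" using LP_inner_integrable[OF assms(1-4)] by auto
  show "\<bar>Z x \<bullet> V x\<bar> <= t powr (- q) * norm (Z x) powr q + t powr p * norm (V x) powr p" for x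
   by (rule order_trans[OF Cauchy_Schwarz_ineq2 young_scaled[OF assms(3,4) _ _ assms(5)]]) auto
 qed (use assms in \<open>auto simp: LP_def\<close>)
 also have "... = t powr (- q) * (LINT x|M. norm (Z x) powr q) + t powr p * (LINT x|M. norm (V x) powr p)"
  using assms by (subst Bochner_Integration.integral_add) (auto simp: LP_def)
 finally show ?thesis .
qed

text \<open>Lets an error be split into a null sequence, which may depend on e, and a remainder of
  size e. The limit arguments with a tuned parameter all end here.\<close>

lemma tendsto_zero_approxI:
 fixes x :: "nat => real"
 assumes "!!e. e > 0 ==> \<exists>b. b ----> 0 \<and> (\<forall>\<^sub>F n in sequentially. \<bar>x n\<bar> <= b n + e)"
 shows "x ----> 0"
proof (rule LIMSEQ_I)
 fix r :: real assume "r > 0"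
 then obtain b where b: "b ----> 0" "\<forall>\<^sub>F n in sequentially. \<bar>x n\<bar> <= b n + r/2"
  using assms[of "r/2"] by auto
 have "\<forall>\<^sub>F n in sequentially. b n < r/2" using b \<open>r > 0\<close> by (intro order_tendstoD) auto
 with b(2) have "\<forall>\<^sub>F n in sequentially. norm (x n - 0) < r" by eventually_elim auto
 then show "\<exists>no. \<forall>n\<ge>no. norm (x n - 0) < r" by (simp add: eventually_sequentially)
qed

text \<open>A strongly convergent factor against a weakly convergent one. The error
  \<open>Zn n - Z\<close> is paired with functions bounded in L^p, so Young's inequality bounds it
  by a null sequence plus \<open>t powr p * C\<close>, and t is chosen to make the latter at most
  e.\<close>

lemma inner_limit_zero:
 assumes "LP q M Z" "!!n. LP q M (Zn n)" "!!n. LP p M (V n)" "p > 1" "q = p / (p - 1)"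
  and C: "!!n. (LINT x|M. norm (V n x) powr p) <= C"
  and Zn: "(%n. LINT x|M. norm (Zn n x - Z x) powr q) ----> 0"
  and w: "(%n. LINT x|M. Z x \<bullet> V n x) ----> 0"
 shows "(%n. LINT x|M. Zn n x \<bullet> V n x) ----> 0"
proof (rule tendsto_zero_approxI)
 fix e :: real assume "e > 0"
 have q: "q > 0" "p > 0" using assms by auto
 have C0: "C >= 0" using C[of 0] by (smt (verit) lint_nonneg powr_ge_zero)
 define t where "t = (e / (C + 1)) powr (1 / p)"
 have t: "t > 0" "t powr p = e / (C + 1)" using \<open>e > 0\<close> C0 q by (auto simp: t_def powr_powr)
 have tC: "t powr p * C <= e" unfolding t(2) using C0 \<open>e > 0\<close> by (simp add: pos_divide_le_eq distrib_left)
 define b where "b n = \<bar>LINT x|M. Z x \<bullet> V n x\<bar> + t powr (- q) * (LINT x|M. norm (Zn n x - Z x) powr q)" for n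
 have "\<bar>LINT x|M. Zn n x \<bullet> V n x\<bar> <= b n + e" for n
 proof -
  have d: "LP q M (%x. Zn n x - Z x)" using assms q by (intro LP_diff) auto
  have "(LINT x|M. Zn n x \<bullet> V n x) = (LINT x|M. Z x \<bullet> V n x) + (LINT x|M. (Zn n x - Z x) \<bullet> V n x)"
   using LP_inner_integrable(1)[OF assms(1) assms(3)[of n] assms(4,5)]
    LP_inner_integrable(1)[OF d assms(3)[of n] assms(4,5)]
   by (subst Bochner_Integration.integral_add[symmetric]) (auto simp: algebra_simps)
  moreover have "\<bar>LINT x|M. (Zn n x - Z x) \<bullet> V n x\<bar> <= t powr (- q) * (LINT x|M. norm (Zn n x - Z x) powr q) + t powr p * C"
   using LP_inner_bound[OF d assms(3)[of n] assms(4,5) t(1)] C[of n]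
   by (smt (verit) mult_left_mono powr_ge_zero)
  ultimately show ?thesis using tC by (auto simp: b_def)
 qed
 moreover have "b ----> 0 + t powr (- q) * 0"
  unfolding b_def by (intro tendsto_intros tendsto_rabs_zero w Zn)
 ultimately show "\<exists>b. b ----> 0 \<and> (\<forall>\<^sub>F n in sequentially. \<bar>LINT x|M. Zn n x \<bullet> V n x\<bar> <= b n + e)"
  by (intro exI[of _ b]) auto
qed

lemma LP_dominated:
 fixes Z :: "'m => 'b::euclidean_space"
 assumes [measurable]: "Z \<in> BM M" "!!n. Zn n \<in> BM M"
  and Y: "integrable M Y" "AE x in M. \<forall>n. norm (Zn n x) powr q <= Y x" and q: "q > 0"
  and conv: "AE x in M. (%n. Zn n x) ----> Z x"
 shows "LP q M Z" "!!n. LP q M (Zn n)" "(%n. LINT x|M. norm (Zn n x - Z x) powr q) ----> 0"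
  "AE x in M. norm (Z x) powr q <= Y x"
proof -
 have bd: "AE x in M. norm (Z x) powr q <= Y x"
  using Y(2) conv
 proof eventually_elim
  case (elim x)
  have "(%n. norm (Zn n x) powr q) ----> norm (Z x) powr q"
   using elim q by (intro tendsto_powr' tendsto_norm) auto
  then show ?case using elim by (intro LIMSEQ_le_const2) auto
 qed
 then show "AE x in M. norm (Z x) powr q <= Y x" .
 show "LP q M Z" by (rule LP_boundI[OF _ Y(1) bd]) auto
 show "LP q M (Zn n)" for n by (rule LP_boundI[OF _ Y(1)]) (use Y(2) in auto)
 have "(%n. LINT x|M. norm (Zn n x - Z x) powr q) ----> (LINT x|M. 0)"
 proof (rule integral_dominated_convergence[where w="%x. 2 powr q * (Y x + Y x)"])
  show "AE x in M. (%n. norm (Zn n x - Z x) powr q) ----> 0"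
   using conv
  proof eventually_elim
   case (elim x)
   have "(%n. norm (Zn n x - Z x) powr q) ----> 0 powr q"
    using elim q by (intro tendsto_powr' tendsto_norm_zero) (auto simp: LIM_zero_iff)
   then show ?case using q by simp
  qed
  show "AE x in M. norm (norm (Zn n x - Z x) powr q) <= 2 powr q * (Y x + Y x)" for n
   using Y(2) bd
  proof eventually_elim
   case (elim x)
   have "norm (Zn n x - Z x) powr q <= 2 powr q * (norm (Zn n x) powr q + norm (Z x) powr q)"
    using q by (intro norm_diff_powr_le) auto
   also have "... <= 2 powr q * (Y x + Y x)" using elim by (intro mult_left_mono add_mono) auto
   finally show ?case by simp
  qed
 qed (use Y in auto)
 then show "(%n. LINT x|M. norm (Zn n x - Z x) powr q) ----> 0" by simp
qed

lemma fatou_real: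
 fixes f :: "nat => 'm => real"
 assumes "!!n. integrable M (f n)" "!!n. AE x in M. f n x >= 0" "!!n. (LINT x|M. f n x) <= C"
  and [measurable]: "F \<in> BM M" and "AE x in M. (%n. f n x) ----> F x"
 shows "integrable M F" "(LINT x|M. F x) <= C" "AE x in M. F x >= 0"
proof -
 have [measurable]: "f n \<in> BM M" for n using assms(1) by auto
 have nn: "AE x in M. \<forall>n. f n x >= 0" using assms(2) by (simp add: AE_all_countable)
 show F0: "AE x in M. F x >= 0" using nn assms(5)
  by eventually_elim (auto intro: LIMSEQ_le_const)
 have "(\<integral>\<^sup>+x. ennreal (F x) \<partial>M) = (\<integral>\<^sup>+x. liminf (%n. ennreal (f n x)) \<partial>M)"
  using assms(5)
 proof (intro nn_integral_cong_AE, eventually_elim)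
  case (elim x)
  then show ?case by (intro lim_imp_Liminf[symmetric] tendsto_ennrealI) auto
 qed
 also have "... <= liminf (%n. \<integral>\<^sup>+x. ennreal (f n x) \<partial>M)" by (intro nn_integral_liminf) auto
 also have "... = liminf (%n. ennreal (LINT x|M. f n x))"
  using assms(1,2) by (subst nn_integral_eq_integral) auto
 also have "... <= liminf (%n::nat. ennreal C)"
  by (intro Liminf_mono always_eventually) (auto intro: ennreal_leI assms)
 also have "... = ennreal C" by (simp add: Liminf_const)
 finally have *: "(\<integral>\<^sup>+x. ennreal (F x) \<partial>M) <= ennreal C" .
 then show "integrable M F"
  by (intro integrableI_nonneg F0) (auto simp: top.not_eq_extremum order_le_less_trans)
 have C0: "C >= 0" using integral_nonneg_AE[OF assms(2)[of 0]] assms(3)[of 0] by linarith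
 show "(LINT x|M. F x) <= C"
  using * C0 by (subst integral_eq_nn_integral[OF _ F0]) (auto intro!: enn2real_leI)
qed

text \<open>Vitali's theorem in the form used here: a bound in L^p with p > 1 makes the tails above
  a level R uniformly small, so that a.e. convergence improves to convergence in L^1.\<close>

lemma (in finite_measure) LP_fatou_vitali:
 fixes X :: "'a => 'b::euclidean_space"
 assumes "!!n. LP p M (Xn n)" "!!n. (LINT x|M. norm (Xn n x) powr p) <= C"
  and X[measurable]: "X \<in> BM M" and conv: "AE x in M. (%n. Xn n x) ----> X x" and p: "p > 1"
 shows "LP p M X" "(LINT x|M. norm (X x) powr p) <= C"
  "(%n. LINT x|M. norm (Xn n x - X x)) ----> 0"
proof -
 have [measurable]: "Xn n \<in> BM M" for n using assms(1) by (auto simp: LP_def)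
 have c': "AE x in M. (%n. norm (Xn n x) powr p) ----> norm (X x) powr p"
  using conv by eventually_elim (use p in \<open>intro tendsto_powr' tendsto_norm; auto\<close>)
 show XLP: "LP p M X"
  unfolding LP_def using fatou_real(1)[OF _ _ assms(2) _ c'] assms(1) by (auto simp: LP_def)
 show XC: "(LINT x|M. norm (X x) powr p) <= C"
  by (rule fatou_real(2)[OF _ _ assms(2) _ c']) (use assms(1) in \<open>auto simp: LP_def\<close>)
 have D: "LP p M (%x. Xn n x - X x)" for n using assms(1) XLP p by (intro LP_diff) auto
 define C2 where "C2 = 2 powr p * (C + C)"
 have DC: "(LINT x|M. norm (Xn n x - X x) powr p) <= C2" for n
 proof -
  have "(LINT x|M. norm (Xn n x - X x) powr p) <= (LINT x|M. 2 powr p * (norm (Xn n x) powr p + norm (X x) powr p))"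
   by (intro integral_mono norm_diff_powr_le) (use D assms(1) XLP p in \<open>auto simp: LP_def\<close>)
  also have "... = 2 powr p * ((LINT x|M. norm (Xn n x) powr p) + (LINT x|M. norm (X x) powr p))"
   using assms(1) XLP by (auto simp: LP_def)
  also have "... <= C2" unfolding C2_def using XC assms(2)[of n] by (intro mult_left_mono add_mono) auto
  finally show ?thesis .
 qed
 have C20: "C2 >= 0" using DC[of 0] by (smt (verit) lint_nonneg powr_ge_zero)
 show "(%n. LINT x|M. norm (Xn n x - X x)) ----> 0"
 proof (rule tendsto_zero_approxI)
  fix e :: real assume "e > 0"
  \<comment> \<open>Makes \<open>R powr (1 - p) * C2\<close> equal to
    \<open>C2 * e / (C2 + 1)\<close>, hence at most e.\<close>
  define R where "R = ((C2 + 1) / e) powr (1 / (p - 1))"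
  have R: "R > 0" "R powr (p - 1) = (C2 + 1) / e" using \<open>e > 0\<close> C20 p by (auto simp: R_def powr_powr)
  have split: "t <= min t R + R powr (1 - p) * t powr p" if "t >= 0" for t
  proof (cases "t <= R")
   case False
   then have "t = t powr (1 - p) * t powr p" using R by (simp add: powr_add[symmetric])
   also have "... <= R powr (1 - p) * t powr p" using False p R by (intro mult_right_mono powr_mono2') auto
   finally show ?thesis using False R by auto
  qed auto
  define b where "b n = (LINT x|M. min (norm (Xn n x - X x)) R)" for n
  have i1: "integrable M (%x. min (norm (Xn n x - X x)) R)" for n
   by (rule integrable_const_bound[of _ R]) (use R in auto)
  have "\<bar>LINT x|M. norm (Xn n x - X x)\<bar> <= b n + e" for n
  proof -
   have "(LINT x|M. norm (Xn n x - X x)) <= (LINT x|M. min (norm (Xn n x - X x)) R + R powr (1 - p) * norm (Xn n x - X x) powr p)"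
    by (intro integral_mono) (use LP_integrable[OF D] D p i1 split in \<open>auto simp: LP_def\<close>)
   also have "... = b n + R powr (1 - p) * (LINT x|M. norm (Xn n x - X x) powr p)"
    using i1 D by (auto simp: LP_def b_def)
   also have "R powr (1 - p) * (LINT x|M. norm (Xn n x - X x) powr p) <= R powr (1 - p) * C2"
    by (intro mult_left_mono DC) auto
   also have "R powr (1 - p) * C2 = C2 * e / (C2 + 1)" using R \<open>e > 0\<close> C20
    by (simp add: powr_diff powr_add field_simps)
   also have "... <= e" using C20 \<open>e > 0\<close> by (simp add: field_simps)
   finally show ?thesis by simp
  qed
  moreover have "b ----> (LINT x|M. 0)"
   unfolding b_def
  proof (rule integral_dominated_convergence[where w="%x. R"])
   show "AE x in M. (%n. min (norm (Xn n x - X x)) R) ----> 0"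
    using conv
   proof eventually_elim
    case (elim x)
    have "(%n. min (norm (Xn n x - X x)) R) ----> min 0 R"
     using elim by (intro tendsto_min tendsto_norm_zero tendsto_const) (auto simp: LIM_zero_iff)
    then show ?case using R by simp
   qed
  qed (use R in auto)
  ultimately show "\<exists>b. b ----> 0 \<and> (\<forall>\<^sub>F n in sequentially. \<bar>LINT x|M. norm (Xn n x - X x)\<bar> <= b n + e)"
   by (intro exI[of _ b]) auto
 qed
qed

lemma summable_integrals_AE:
 fixes f :: "nat => 'm => real"
 assumes "!!n. integrable M (f n)" "!!n x. f n x >= 0" "!!n. (LINT x|M. f n x) <= (1/2)^n"
 shows "AE x in M. summable (%n. f n x)" "integrable M (%x. \<Sum>n. f n x)"
proof -
 have [measurable]: "f n \<in> BM M" for n using assms(1) by auto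
 have s: "summable (%n. LINT x|M. f n x)"
  by (rule summable_comparison_test'[of "%n. (1/2)^n" 0])
    (use assms in \<open>auto intro!: lint_nonneg summable_geometric\<close>)
 have "(\<integral>\<^sup>+x. (\<Sum>n. ennreal (f n x)) \<partial>M) = (\<Sum>n. \<integral>\<^sup>+x. ennreal (f n x) \<partial>M)"
  by (rule nn_integral_suminf) auto
 also have "... = (\<Sum>n. ennreal (LINT x|M. f n x))" using assms by (subst nn_integral_eq_integral) auto
 also have "... = ennreal (\<Sum>n. LINT x|M. f n x)"
  by (rule suminf_ennreal2) (use s assms in \<open>auto intro!: lint_nonneg\<close>)
 finally have "(\<integral>\<^sup>+x. (\<Sum>n. ennreal (f n x)) \<partial>M) \<noteq> \<infinity>" by simp
 then have "AE x in M. (\<Sum>n. ennreal (f n x)) \<noteq> \<infinity>" by (intro nn_integral_PInf_AE) auto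
 then show 1: "AE x in M. summable (%n. f n x)"
  by eventually_elim (use assms(2) in \<open>auto intro!: summable_suminf_not_top\<close>)
 show "integrable M (%x. \<Sum>n. f n x)"
  by (rule integrable_suminf) (use 1 s assms in auto)
qed

text \<open>Geometric speed makes the sum of all errors integrable: its finiteness gives convergence
  a.e., and its value a majorant common to all n.\<close>

lemma LP_fast:
 fixes X :: "'m => 'b::euclidean_space"
 assumes "!!n. LP p M (Xn n)" "LP p M X" "!!n. (LINT x|M. norm (Xn n x - X x) powr p) <= (1/2)^n" "p > 0"
 shows "AE x in M. (%n. Xn n x) ----> X x"
  "\<exists>Y. integrable M Y \<and> (AE x in M. \<forall>n. norm (Xn n x) powr p <= Y x)"
proof -
 have D: "LP p M (%x. Xn n x - X x)" for n using assms by (intro LP_diff) auto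
 note S = summable_integrals_AE[of M "%n x. norm (Xn n x - X x) powr p", OF _ _ assms(3)]
 have S1: "AE x in M. summable (%n. norm (Xn n x - X x) powr p)" using S D by (auto simp: LP_def)
 have S2: "integrable M (%x. \<Sum>n. norm (Xn n x - X x) powr p)" using S D by (auto simp: LP_def)
 show "AE x in M. (%n. Xn n x) ----> X x" using S1
 proof eventually_elim
  case (elim x)
  have "(%n. (norm (Xn n x - X x) powr p) powr (1/p)) ----> 0 powr (1/p)"
   by (rule tendsto_powr'[OF summable_LIMSEQ_zero[OF elim] tendsto_const]) (use assms in auto)
  then have "(%n. norm (Xn n x - X x)) ----> 0" using assms by (simp add: powr_powr)
  then show ?case by (simp add: tendsto_norm_zero_iff LIM_zero_iff)
 qed
 define Y where "Y x = 2 powr p * ((\<Sum>n. norm (Xn n x - X x) powr p) + norm (X x) powr p)" for x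
 have "integrable M Y" unfolding Y_def using S2 assms by (auto simp: LP_def)
 moreover have "AE x in M. \<forall>n. norm (Xn n x) powr p <= Y x" using S1
 proof eventually_elim
  case (elim x)
  have "norm (Xn n x) powr p <= Y x" for n
  proof -
   have "norm ((Xn n x - X x) + X x) powr p <= 2 powr p * (norm (Xn n x - X x) powr p + norm (X x) powr p)"
    using assms by (intro norm_add_powr_le) auto
   also have "... <= Y x" unfolding Y_def
    using sum_le_suminf[OF elim, of "{n}"] by (intro mult_left_mono add_mono) auto
   finally show ?thesis by simp
  qed
  then show ?case by simp
 qed
 ultimately show "\<exists>Y. integrable M Y \<and> (AE x in M. \<forall>n. norm (Xn n x) powr p <= Y x)" by blast
qed

section \<open>Completeness of L^p\<close>

definition LPCauchy where
 "LPCauchy p M X \<longleftrightarrow> (\<forall>e>0. \<exists>N::nat. \<forall>m\<ge>N. \<forall>n\<ge>N. (LINT x|M. norm (X m x - X n x) powr p) < e)"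

lemma LP_complete:
 fixes X :: "nat => 'm => 'b::euclidean_space"
 assumes LP: "!!n. LP p M (X n)" and Cau: "LPCauchy p M X" and p: "p > 0"
 shows "\<exists>Y. LP p M Y \<and> (%n. LINT x|M. norm (X n x - Y x) powr p) ----> 0"
proof -
 have [measurable]: "X n \<in> BM M" for n using LP by (auto simp: LP_def)
 \<comment> \<open>The first factor is the p-th power of the admissible increment (1/2)^k, the
   second bounds the integral of the normalised increment \<open>f k\<close>. Summability of
   \<open>f k x\<close> then makes the increments at x eventually at most (1/2)^k.\<close>
 define w where "w k = ((1/2)^k) powr p * ((1/2)^k :: real)" for k :: nat
 have w0: "w k > 0" for k by (auto simp: w_def)
 define N where "N k = (SOME N. \<forall>m\<ge>N. \<forall>n\<ge>N. (LINT x|M. norm (X m x - X n x) powr p) < w k)" for k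
 have N: "(LINT x|M. norm (X m x - X n x) powr p) < w k" if "m >= N k" "n >= N k" for k m n
  using someI_ex[OF Cau[unfolded LPCauchy_def, rule_format, OF w0[of k]]] that unfolding N_def by blast
 define r where "r k = (MAX j\<in>{..k}. N j) + k" for k
 have rN: "r k >= N j" if "j <= k" for j k
 proof -
  have "N j <= (MAX j\<in>{..k}. N j)" using that by (intro Max_ge) auto
  then show ?thesis unfolding r_def by linarith
 qed
 define f where "f k x = norm (X (r (Suc k)) x - X (r k) x) powr p / ((1/2)^k) powr p" for k x
 have D: "LP p M (%x. X m x - X n x)" for m n using LP p by (intro LP_diff) auto
 have fi: "integrable M (f k)" for k unfolding f_def using D by (auto simp: LP_def)
 have f1: "(LINT x|M. f k x) <= (1/2)^k" for k
 proof -
  have "(LINT x|M. norm (X (r (Suc k)) x - X (r k) x) powr p) <= w k"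
   using N[of k "r (Suc k)" "r k"] rN by auto
  then show ?thesis by (simp add: f_def w_def field_simps)
 qed
 have "AE x in M. summable (%k. f k x)"
  by (rule summable_integrals_AE[OF fi _ f1]) (auto simp: f_def)
 then have ae: "AE x in M. convergent (%k. X (r k) x)"
 proof eventually_elim
  case (elim x)
  have "\<forall>\<^sub>F k in sequentially. f k x < 1"
   using summable_LIMSEQ_zero[OF elim] by (intro order_tendstoD) auto
  then have "\<forall>\<^sub>F k in sequentially. norm (X (r (Suc k)) x - X (r k) x) <= (1/2)^k"
  proof eventually_elim
   case (elim k)
   then have "norm (X (r (Suc k)) x - X (r k) x) powr p < ((1/2)^k) powr p" by (simp add: f_def)
   then show ?case using p by (smt (verit) powr_mono2 zero_le_power divide_nonneg_nonneg)
  qed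
  then have "summable (%k. X (r (Suc k)) x - X (r k) x)"
   by (rule summable_comparison_test_ev) (auto intro!: summable_geometric)
  then have "convergent (%n. \<Sum>k<n. X (r (Suc k)) x - X (r k) x)" by (simp add: summable_iff_convergent)
  then have "convergent (%n. X (r n) x - X (r 0) x)"       using sum_lessThan_telescope[of "%k. X (r k) x"] by simp
  from convergent_add[OF this convergent_const[of "X (r 0) x"]] show ?case by simp
 qed
 define Y where "Y x = lim (%k. X (r k) x)" for x
 have [measurable]: "Y \<in> BM M" unfolding Y_def by measurable
 have ae': "AE x in M. (%k. X (r k) x) ----> Y x"
  using ae by eventually_elim (simp add: Y_def convergent_LIMSEQ_iff)
 \<comment> \<open>Fatou's lemma in the second index of the Cauchy condition; shifting k by j keeps
   that index beyond \<open>N j\<close>.\<close>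
 have F: "LP p M (%x. X n x - Y x) \<and> (LINT x|M. norm (X n x - Y x) powr p) <= w j" if "n >= N j" for n j
 proof -
  have c: "AE x in M. (%k. norm (X n x - X (r (k + j)) x) powr p) ----> norm (X n x - Y x) powr p"
   using ae' by eventually_elim
    (use p in \<open>intro tendsto_powr' tendsto_norm tendsto_diff tendsto_const; auto intro: LIMSEQ_ignore_initial_segment\<close>)
  have le: "(LINT x|M. norm (X n x - X (r (k + j)) x) powr p) <= w j" for k
   using N[of j n "r (k + j)"] that rN[of j "k + j"] by auto
  show ?thesis unfolding LP_def
   using fatou_real(1,2)[OF _ _ le _ c] D by (auto simp: LP_def)
 qed
 have "LP p M (%x. X (N 0) x - (X (N 0) x - Y x))" by (rule LP_diff[OF LP]) (use F[of 0 "N 0"] p in auto)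
 then have "LP p M Y" by simp
 moreover have "(%n. LINT x|M. norm (X n x - Y x) powr p) ----> 0"
 proof (rule LIMSEQ_I)
  fix e :: real assume "e > 0"
  have "w ----> 0"
  proof (rule real_tendsto_sandwich[of "%k. 0" _ _ "%k. (1/2)^k"])
   show "\<forall>\<^sub>F k in sequentially. w k <= (1/2)^k"
    unfolding w_def using p by (auto intro!: always_eventually mult_left_le_one_le powr_le1 power_le_one)
  qed (use w0 in \<open>auto intro!: always_eventually LIMSEQ_realpow_zero less_imp_le\<close>)
  then obtain j where "w j < e" using \<open>e > 0\<close> by (metis order_tendstoD(2) eventually_happens sequentially_bot)
  then show "\<exists>no. \<forall>n\<ge>no. norm ((LINT x|M. norm (X n x - Y x) powr p) - 0) < e"
   using F by (intro exI[of _ "N j"]) (auto simp: lint_nonneg intro: order_le_less_trans)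
 qed
 ultimately show ?thesis by blast
qed

text \<open>For a simple function U the composition is glued from countably many sections;
  continuity in the second variable carries measurability over to limits of simple
  functions.\<close>

lemma Caratheodory_measurable:
 fixes F :: "'m => 'b::euclidean_space => 'c::euclidean_space"
 assumes "!!y. (%x. F x y) \<in> BM M" "!!x. continuous_on UNIV (F x)"
  and U: "U \<in> BM M"
 shows "(%x. F x (U x)) \<in> BM M"
proof -
 obtain s where s: "!!i. simple_function M (s i)" "!!x. x \<in> space M ==> (%i. s i x) ----> U x"
  using borel_measurable_implies_sequence_metric[OF U, of 0] by metis
 show ?thesis
 proof (rule borel_measurable_LIMSEQ_metric)
  show "(%x. F x (s i x)) \<in> BM M" for i
  proof (rule measurable_compose_countable'[where I="s i ` space M" and g="s i" and f="%y x. F x y"])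
   show "s i \<in> measurable M (count_space (s i ` space M))"
    using s(1)[of i] by (auto simp: simple_function_def measurable_count_space_eq2)
   show "countable (s i ` space M)" using s(1)[of i] by (auto simp: simple_function_def countable_finite)
  qed (use assms in auto)
  show "(%i. F x (s i x)) ----> F x (U x)" if "x \<in> space M" for x
   by (rule continuous_on_tendsto_compose[OF assms(2) s(2)[OF that]]) auto
 qed
qed

text \<open>The defect in the midpoint convexity of the p-th power of the norm. Integrated, it
  measures the uniform convexity of L^p.\<close>

definition cvx_gap :: "real => 'b::euclidean_space => 'b => real" where
 "cvx_gap p a b = (norm a powr p + norm b powr p) / 2 - norm ((a + b) /\<^sub>R 2) powr p"

text \<open>If the norms differ, strict convexity of t^p is enough; if they agree, the parallelogram
  law makes the midpoint strictly shorter.\<close>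

lemma cvx_gap_pos:
 assumes p: "p > 1" and "a \<noteq> b"
 shows "cvx_gap p a b > 0"
proof -
 define s t where "s = norm a" and "t = norm b"
 have st: "s >= 0" "t >= 0" by (auto simp: s_def t_def)
 have n: "norm ((a + b) /\<^sub>R 2) <= (s + t) / 2"
  using norm_triangle_ineq[of a b] by (simp add: s_def t_def)
 show ?thesis
 proof (cases "s = t")
  case False
  define c where "c = (s + t) / 2"
  have c: "c > 0" "s \<noteq> c" "t \<noteq> c" using False st by (auto simp: c_def)
  have "s powr p > c powr p + p * c powr (p - 1) * (s - c)" "t powr p > c powr p + p * c powr (p - 1) * (t - c)"
   using powr_strict_tangent[OF p c(1)] st c by auto
  moreover have "p * c powr (p - 1) * (s - c) + p * c powr (p - 1) * (t - c) = 0"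
   by (simp add: c_def field_simps)
  moreover have "norm ((a + b) /\<^sub>R 2) powr p <= c powr p" using n p by (intro powr_mono2) (auto simp: c_def)
  ultimately have "2 * norm ((a + b) /\<^sub>R 2) powr p < s powr p + t powr p" by linarith
  then show ?thesis unfolding cvx_gap_def s_def t_def by simp
 next
  case True
  have "norm (a + b) ^ 2 + norm (a - b) ^ 2 = 2 * norm a ^ 2 + 2 * norm b ^ 2"
   by (simp add: power2_norm_eq_inner inner_simps inner_commute)
  moreover have "norm (a - b) ^ 2 > 0" using \<open>a \<noteq> b\<close> by simp
  ultimately have "norm (a + b) ^ 2 < 2 * norm a ^ 2 + 2 * norm b ^ 2" by linarith
  then have "norm (a + b) ^ 2 < (2 * s)^2" using True by (simp add: s_def t_def power_mult_distrib)
  then have "norm (a + b) < 2 * s" using st by (intro power2_less_imp_less[of "norm (a + b)"]) auto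
  then have "norm ((a + b) /\<^sub>R 2) < s" by simp
  then have "norm ((a + b) /\<^sub>R 2) powr p < s powr p" using p by (intro powr_less_mono2) auto
  then show ?thesis unfolding cvx_gap_def s_def[symmetric] t_def[symmetric] using True by simp
 qed
qed

lemma cvx_gap_nonneg: "p > 1 ==> cvx_gap p a b >= 0"
 using cvx_gap_pos[of p a b] by (cases "a = b") (auto simp: cvx_gap_def scaleR_2[symmetric])

text \<open>Both sides are homogeneous of degree p, so the pairs for which the first term on the
  right does not suffice can be scaled into the compact set K. There the gap is continuous and
  positive, hence at least some m > 0.\<close>

lemma cvx_gap_uniform:
 fixes e :: real
 assumes p: "p > 1" and "e > 0"
 shows "\<exists>c>0. \<forall>a b::'b::euclidean_space.
   norm (a - b) powr p <= e * (norm a powr p + norm b powr p) + c * cvx_gap p a b"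
proof -
 let ?N = "%z::'b\<times>'b. norm (fst z) powr p + norm (snd z) powr p"
 let ?E = "%z::'b\<times>'b. cvx_gap p (fst z) (snd z)"
 define K where "K = {z::'b\<times>'b. ?N z = 1 \<and> norm (fst z - snd z) powr p >= e}"
 have cN: "continuous_on UNIV ?N" "continuous_on UNIV (%z::'b\<times>'b. norm (fst z - snd z) powr p)"
  "continuous_on UNIV ?E"
  unfolding cvx_gap_def using p by (auto intro!: continuous_intros continuous_on_powr')
 have "closed K" unfolding K_def Collect_conj_eq
  using cN by (intro closed_Int closed_Collect_eq closed_Collect_le continuous_on_const) auto
 moreover have "bounded K" unfolding bounded_iff
 proof (intro exI[of _ 2] ballI)
  fix z assume "z \<in> K"
  then have *: "norm (fst z) powr p <= 1" "norm (snd z) powr p <= 1" unfolding K_def by (auto, smt (verit) powr_ge_zero, smt (verit) powr_ge_zero)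
  have "t <= 1" if "t powr p <= 1" "t >= 0" for t :: real
  proof (rule ccontr)
   assume "\<not> t <= 1"
   then have "1 powr p < t powr p" using p by (intro powr_less_mono2) auto
   then show False using that by simp
  qed
  with * have "norm (fst z) <= 1" "norm (snd z) <= 1" by auto
  then show "norm z <= 2" using norm_Pair_le[of "fst z" "snd z"] by simp
 qed
 ultimately have K: "compact K" by (simp add: compact_eq_bounded_closed)
 have pos: "?E z > 0" if "z \<in> K" for z
  using that \<open>e > 0\<close> p by (intro cvx_gap_pos) (auto simp: K_def)
 obtain m where m: "m > 0" "!!z. z \<in> K ==> ?E z >= m"
 proof (cases "K = {}")
  case True then show ?thesis using that[of 1] by auto
 next
  case False
  then obtain z where "z \<in> K" "\<forall>y\<in>K. ?E z <= ?E y"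
   using continuous_attains_inf[OF K, of ?E] cN(3) continuous_on_subset by blast
  then show ?thesis using that[of "?E z"] pos by auto
 qed
 have hom: "cvx_gap p (s *\<^sub>R a) (s *\<^sub>R b) = s powr p * cvx_gap p a b" if "s > 0" for s and a b :: 'b
 proof -
  have "(s *\<^sub>R a + s *\<^sub>R b) /\<^sub>R 2 = s *\<^sub>R ((a + b) /\<^sub>R 2)" by (simp add: scaleR_add_right)
  then have "norm ((s *\<^sub>R a + s *\<^sub>R b) /\<^sub>R 2) = s * norm ((a + b) /\<^sub>R 2)" using that by simp
  then have "norm ((s *\<^sub>R a + s *\<^sub>R b) /\<^sub>R 2) powr p = s powr p * norm ((a + b) /\<^sub>R 2) powr p"
   using that by (simp only: powr_mult norm_ge_zero less_imp_le)
  moreover have "norm (s *\<^sub>R c) powr p = s powr p * norm c powr p" for c :: 'b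
   using that by (simp add: powr_mult)
  ultimately show ?thesis unfolding cvx_gap_def by (simp add: algebra_simps)
 qed
 \<comment> \<open>On K the left side is at most 2^p, so this multiple of the gap dominates
   it.\<close>
 define c where "c = 2 powr p / m"
 have "norm (a - b) powr p <= e * (norm a powr p + norm b powr p) + c * cvx_gap p a b" for a b :: 'b
 proof (cases "norm (a - b) powr p < e * (norm a powr p + norm b powr p)")
  case True
  moreover have "c * cvx_gap p a b >= 0"
   unfolding c_def using cvx_gap_nonneg[OF p] m by (intro mult_nonneg_nonneg) auto
  ultimately show ?thesis by linarith
 next
  case False
  define N where "N = norm a powr p + norm b powr p"
  show ?thesis
  proof (cases "N = 0")
   case True
   then have "norm a powr p = 0" "norm b powr p = 0" unfolding N_def by (smt (verit) powr_ge_zero)+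
   then show ?thesis using cvx_gap_nonneg[OF p, of a b] m by (auto simp: c_def)
  next
   case neq: False
   then have N: "N > 0" unfolding N_def by (smt (verit) powr_ge_zero)
   define s where "s = N powr (- 1/p)"
   have s: "s > 0" "s powr p = 1 / N" using N p by (auto simp: s_def powr_powr powr_divide powr_minus_divide)
   have "(s *\<^sub>R a, s *\<^sub>R b) \<in> K"
   proof -
    have "norm (s *\<^sub>R a) powr p + norm (s *\<^sub>R b) powr p = s powr p * N"
     using s(1) by (simp add: powr_mult N_def algebra_simps)
    moreover have "norm (s *\<^sub>R a - s *\<^sub>R b) powr p = s powr p * norm (a - b) powr p"
     using s(1) by (simp add: powr_mult scaleR_diff_right[symmetric])
    moreover have "1 / N * norm (a - b) powr p >= e"
     using N False unfolding N_def[symmetric] by (simp add: field_simps)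
    ultimately show ?thesis unfolding s(2) using N by (simp add: K_def)
   qed
   then have "m <= s powr p * cvx_gap p a b" using m(2) hom[OF s(1)] by fastforce
   then have "m * N <= cvx_gap p a b" using s(2) N by (simp add: field_simps)
   then have "2 powr p * N <= c * cvx_gap p a b" using m by (simp add: c_def field_simps)
   moreover have "norm (a - b) powr p <= 2 powr p * N" unfolding N_def using p by (intro norm_diff_powr_le) auto
   moreover have "e * N >= 0" using \<open>e > 0\<close> N by simp
   ultimately show ?thesis unfolding N_def by linarith
  qed
 qed
 moreover have "c > 0" using m by (simp add: c_def)
 ultimately show ?thesis by blast
qed

lemma cvx_gap_integrable:
 assumes "LP p M f" "LP p M g" "p > 1"
 shows "integrable M (%x. cvx_gap p (f x) (g x))"
proof -
 have "LP p M (%x. (1/2) *\<^sub>R (f x + g x))" using assms by (intro LP_scaleR LP_add) auto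
 then show ?thesis using assms unfolding cvx_gap_def by (auto simp: LP_def)
qed

text \<open>Small gaps force closeness in L^p. In \<open>mazur\<close> the members of a minimising
  sequence have small gaps.\<close>

lemma cvx_gap_Cauchy:
 fixes X :: "nat => 'm => 'b::euclidean_space"
 assumes LP: "!!n. LP p M (X n)" and p: "p > 1" and C: "!!n. (LINT x|M. norm (X n x) powr p) <= C"
  and g: "!!e. e > 0 ==> \<exists>N. \<forall>m\<ge>N. \<forall>n\<ge>N. (LINT x|M. cvx_gap p (X m x) (X n x)) < e"
 shows "LPCauchy p M X"
 unfolding LPCauchy_def
proof (intro allI impI)
 fix e :: real assume "e > 0"
 have C0: "C >= 0" using C[of 0] by (smt (verit) lint_nonneg powr_ge_zero)
 define d where "d = e / (4 * (C + 1))"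
 have "d > 0" using \<open>e > 0\<close> C0 by (simp add: d_def)
 then obtain c where c: "c > 0" "!!a b::'b. norm (a - b) powr p <= d * (norm a powr p + norm b powr p) + c * cvx_gap p a b"
  using cvx_gap_uniform[OF p \<open>d > 0\<close>, where 'b='b] by blast
 have "e / (2 * c) > 0" using \<open>e > 0\<close> c by simp
 from g[OF this] obtain N
  where N: "!!m n. m >= N ==> n >= N ==> (LINT x|M. cvx_gap p (X m x) (X n x)) < e / (2 * c)" by blast
 have "(LINT x|M. norm (X m x - X n x) powr p) < e" if "m >= N" "n >= N" for m n
 proof -
  have D: "LP p M (%x. X m x - X n x)" using LP p by (intro LP_diff) auto
  note G = cvx_gap_integrable[OF LP LP p, of m n]
  have "(LINT x|M. norm (X m x - X n x) powr p) <= (LINT x|M. d * (norm (X m x) powr p + norm (X n x) powr p) + c * cvx_gap p (X m x) (X n x))"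
   by (intro integral_mono) (use D LP G c in \<open>auto simp: LP_def\<close>)
  also have "... = d * ((LINT x|M. norm (X m x) powr p) + (LINT x|M. norm (X n x) powr p)) + c * (LINT x|M. cvx_gap p (X m x) (X n x))"
   using LP G by (auto simp: LP_def)
  also have "... < d * (C + C) + c * (e / (2 * c))"
   using N[OF that] c C \<open>d > 0\<close> by (intro add_le_less_mono mult_left_mono add_mono mult_strict_left_mono) auto
  also have "... <= e" using C0 \<open>e > 0\<close> c by (simp add: d_def field_simps)
  finally show ?thesis .
 qed
 then show "\<exists>N. \<forall>m\<ge>N. \<forall>n\<ge>N. (LINT x|M. norm (X m x - X n x) powr p) < e" by blast
qed

section \<open>Test functions\<close>

definition C1 :: "('a::euclidean_space => real) => bool" where
 "C1 \<phi> \<longleftrightarrow> (\<exists>D. continuous_on UNIV D \<and> (\<forall>x. (\<phi> has_derivative (%h. D x \<bullet> h)) (at x)))"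

text \<open>Packing a function and its gradient into one vector-valued map turns convergence in the
  Sobolev norm into L^p convergence of a single map.\<close>

definition jet :: "('a::euclidean_space => real) => 'a => real \<times> 'a" where
 "jet \<phi> x = (\<phi> x, grad \<phi> x)"

lemma fst_jet [simp]: "fst (jet \<phi> x) = \<phi> x" and snd_jet [simp]: "snd (jet \<phi> x) = grad \<phi> x"
 by (auto simp: jet_def)

lemma grad_unique:
 assumes "(\<phi> has_derivative (%h. D \<bullet> h)) (at x)"
 shows "grad \<phi> x = D"
proof -
 have "(\<phi> has_derivative (%h. grad \<phi> x \<bullet> h)) (at x)" unfolding grad_def by (rule someI[of _ D]) fact
 then have "(%h. grad \<phi> x \<bullet> h) = (%h. D \<bullet> h)" using assms has_derivative_unique by blast
 then show ?thesis by (metis vector_eq_rdot)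
qed

lemma C1I:
 assumes "continuous_on UNIV D" "!!x. (\<phi> has_derivative (%h. D x \<bullet> h)) (at x)"
 shows "C1 \<phi>" "grad \<phi> x = D x"
proof -
 show "C1 \<phi>" unfolding C1_def using assms by (intro exI[of _ D]) auto
 show "grad \<phi> x = D x" by (rule grad_unique[OF assms(2)])
qed

lemma C1D:
 assumes "C1 \<phi>"
 shows "(\<phi> has_derivative (%h. grad \<phi> x \<bullet> h)) (at x)" "continuous_on UNIV (grad \<phi>)" "continuous_on UNIV \<phi>"
  "continuous_on UNIV (jet \<phi>)"
proof -
 obtain D where D: "continuous_on UNIV D" "!!x. (\<phi> has_derivative (%h. D x \<bullet> h)) (at x)"
  using assms unfolding C1_def by blast
 then have g: "grad \<phi> = D" by (intro ext grad_unique)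
 then show "(\<phi> has_derivative (%h. grad \<phi> x \<bullet> h)) (at x)" and c: "continuous_on UNIV (grad \<phi>)" using D by auto
 show c': "continuous_on UNIV \<phi>"
  by (rule continuous_at_imp_continuous_on) (use D(2) has_derivative_continuous in metis)
 show "continuous_on UNIV (jet \<phi>)" unfolding jet_def using c c' by (intro continuous_intros)
qed

lemma C1_const: "C1 (%x. c)" "grad (%x. c) x = 0"
 by (rule C1I[of "%x. 0"]; auto)+

lemma C1_add:
 assumes "C1 \<phi>" "C1 \<psi>"
 shows "C1 (%x. \<phi> x + \<psi> x)" "grad (%x. \<phi> x + \<psi> x) x = grad \<phi> x + grad \<psi> x"
proof -
 have "((%x. \<phi> x + \<psi> x) has_derivative (%h. (grad \<phi> x + grad \<psi> x) \<bullet> h)) (at x)" for x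
  by (rule has_derivative_eq_rhs[OF has_derivative_add[OF C1D(1)[OF assms(1)] C1D(1)[OF assms(2)]]])
    (auto simp: inner_simps)
 from C1I[OF continuous_on_add[OF C1D(2)[OF assms(1)] C1D(2)[OF assms(2)]] this]
 show "C1 (%x. \<phi> x + \<psi> x)" "grad (%x. \<phi> x + \<psi> x) x = grad \<phi> x + grad \<psi> x" by auto
qed

lemma C1_mult:
 assumes "C1 \<phi>" "C1 \<psi>"
 shows "C1 (%x. \<phi> x * \<psi> x)" "grad (%x. \<phi> x * \<psi> x) x = \<phi> x *\<^sub>R grad \<psi> x + \<psi> x *\<^sub>R grad \<phi> x"
proof -
 have d: "((%x. \<phi> x * \<psi> x) has_derivative (%h. (\<phi> x *\<^sub>R grad \<psi> x + \<psi> x *\<^sub>R grad \<phi> x) \<bullet> h)) (at x)" for x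
  by (rule has_derivative_eq_rhs[OF has_derivative_mult[OF C1D(1)[OF assms(1)] C1D(1)[OF assms(2)]]])
    (auto simp: inner_simps)
 have c: "continuous_on UNIV (%x. \<phi> x *\<^sub>R grad \<psi> x + \<psi> x *\<^sub>R grad \<phi> x)"
  by (intro continuous_on_add continuous_on_scaleR C1D assms)
 show "C1 (%x. \<phi> x * \<psi> x)" "grad (%x. \<phi> x * \<psi> x) x = \<phi> x *\<^sub>R grad \<psi> x + \<psi> x *\<^sub>R grad \<phi> x"
  by (fact C1I(1)[OF c d], fact C1I(2)[OF c d])
qed

lemma C1_scale:
 assumes "C1 \<phi>" shows "C1 (%x. c * \<phi> x)" "grad (%x. c * \<phi> x) x = c *\<^sub>R grad \<phi> x"
 using C1_mult[OF C1_const(1) assms, of c] by (auto simp: C1_const(2))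

lemma C1_diff:
 assumes "C1 \<phi>" "C1 \<psi>"
 shows "C1 (%x. \<phi> x - \<psi> x)" "grad (%x. \<phi> x - \<psi> x) x = grad \<phi> x - grad \<psi> x"
 using C1_add[OF assms(1) C1_scale(1)[OF assms(2), of "-1"]] C1_scale(2)[OF assms(2), of "-1"] by auto

lemma C1_compose:
 assumes "C1 \<phi>" and T: "!!s. (T has_field_derivative T' s) (at s)" and T': "continuous_on UNIV T'"
 shows "C1 (%x. T (\<phi> x))" "grad (%x. T (\<phi> x)) x = T' (\<phi> x) *\<^sub>R grad \<phi> x"
proof -
 have d: "((%x. T (\<phi> x)) has_derivative (%h. (T' (\<phi> x) *\<^sub>R grad \<phi> x) \<bullet> h)) (at x)" for x
  by (rule has_derivative_eq_rhs[OF has_derivative_compose[OF C1D(1)[OF assms(1)] T[unfolded has_field_derivative_def]]])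
    auto
 have c: "continuous_on UNIV (%x. T' (\<phi> x) *\<^sub>R grad \<phi> x)"
  by (intro continuous_on_scaleR continuous_on_compose2[OF T'] C1D assms) auto
 show "C1 (%x. T (\<phi> x))" "grad (%x. T (\<phi> x)) x = T' (\<phi> x) *\<^sub>R grad \<phi> x"
  by (fact C1I(1)[OF c d], fact C1I(2)[OF c d])
qed

lemma C1c_iff: "C1c \<Omega> \<phi> \<longleftrightarrow> C1 \<phi> \<and> compact (closure {x. \<phi> x \<noteq> 0}) \<and> closure {x. \<phi> x \<noteq> 0} \<subseteq> \<Omega>"
 by (auto simp: C1c_def C1_def)

lemma C1c_C1: "C1c \<Omega> \<phi> ==> C1 \<phi>" by (simp add: C1c_iff)

lemma C1c_outside:
 assumes "C1c \<Omega> \<phi>" "x \<notin> closure {x. \<phi> x \<noteq> 0}"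
 shows "\<phi> x = 0" "grad \<phi> x = 0"
proof -
 let ?S = "- closure {x. \<phi> x \<noteq> 0}"
 have z: "\<phi> y = 0" if "y \<in> ?S" for y using that closure_subset[of "{x. \<phi> x \<noteq> 0}"] by blast
 have x: "x \<in> ?S" using assms(2) by simp
 then show "\<phi> x = 0" by (rule z)
 have "((%x. 0) has_derivative (%h. 0 \<bullet> h)) (at x)" by simp
 then have "(\<phi> has_derivative (%h. 0 \<bullet> h)) (at x)"
  by (rule has_derivative_transform_within_open[OF _ _ x]) (auto simp only: z open_Compl[OF closed_closure])
 then show "grad \<phi> x = 0" by (rule grad_unique)
qed

lemma C1c_jet_zero:
 assumes "C1c \<Omega> \<phi>" "x \<notin> \<Omega>" shows "jet \<phi> x = 0" "\<phi> x = 0" "grad \<phi> x = 0"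
 using C1c_outside[OF assms(1), of x] assms by (auto simp: C1c_iff jet_def zero_prod_def)

lemma compact_closure_subset:
 assumes "closure A \<subseteq> K" "compact K" shows "compact (closure A)"
 using compact_Int_closed[OF assms(2) closed_closure, of A] assms(1) by (simp add: Int_absorb1)

lemma C1c_dom:
 assumes "C1 \<psi>" "C1c \<Omega> \<phi>" "!!x. \<phi> x = 0 ==> \<psi> x = 0"
 shows "C1c \<Omega> \<psi>"
proof -
 have "closure {x. \<psi> x \<noteq> 0} \<subseteq> closure {x. \<phi> x \<noteq> 0}" using assms(3) by (intro closure_mono) auto
 then show ?thesis using assms compact_closure_subset[of "{x. \<psi> x \<noteq> 0}"] unfolding C1c_iff by blast
qed

lemma C1c_zero: "C1c \<Omega> (%x. 0)" by (simp add: C1c_iff C1_const)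

lemma C1c_add: assumes "C1c \<Omega> \<phi>" "C1c \<Omega> \<psi>" shows "C1c \<Omega> (%x. \<phi> x + \<psi> x)"
proof -
 have "closure {x. \<phi> x + \<psi> x \<noteq> 0} \<subseteq> closure ({x. \<phi> x \<noteq> 0} \<union> {x. \<psi> x \<noteq> 0})" by (intro closure_mono) auto
 then have *: "closure {x. \<phi> x + \<psi> x \<noteq> 0} \<subseteq> closure {x. \<phi> x \<noteq> 0} \<union> closure {x. \<psi> x \<noteq> 0}"
  by (simp add: closure_Un)
 have "compact (closure {x. \<phi> x \<noteq> 0} \<union> closure {x. \<psi> x \<noteq> 0})" using assms by (auto simp: C1c_iff)
 then have "compact (closure {x. \<phi> x + \<psi> x \<noteq> 0})"
  using * compact_closure_subset by blast
 then show ?thesis using assms C1_add(1) * unfolding C1c_iff by blast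
qed

lemma C1c_mult: "C1c \<Omega> \<phi> ==> C1 \<psi> ==> C1c \<Omega> (%x. \<phi> x * \<psi> x)"
 by (rule C1c_dom[OF C1_mult(1)]) (auto simp: C1c_C1)

lemma C1c_scale: "C1c \<Omega> \<phi> ==> C1c \<Omega> (%x. c * \<phi> x)"
 by (rule C1c_dom[OF C1_scale(1)]) (auto simp: C1c_C1)

lemma C1c_sum:
 assumes "!!i. i < (m::nat) ==> C1c \<Omega> (\<phi> i)"
 shows "C1c \<Omega> (%x. \<Sum>i<m. c i * \<phi> i x)" "grad (%x. \<Sum>i<m. c i * \<phi> i x) x = (\<Sum>i<m. c i *\<^sub>R grad (\<phi> i) x)"
 using assms
proof (induction m arbitrary: x)
 case (Suc m)
 { case 1 then show ?case using Suc.IH(1) by (auto intro!: C1c_add C1c_scale) }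
 { case 2
  have "C1 (%x. \<Sum>i<m. c i * \<phi> i x)" using Suc.IH(1) 2 by (auto intro: C1c_C1)
  then show ?case using Suc.IH(2) 2 C1c_C1[OF 2[of m]]
   by (simp add: C1_add(2)[OF _ C1_scale(1)] C1_scale(2)) }
qed (auto simp: C1c_zero C1_const)

lemma C1c_bounded:
 assumes "C1c \<Omega> \<phi>"
 shows "\<exists>B>0. \<forall>x. norm (jet \<phi> x) <= B \<and> \<bar>\<phi> x\<bar> <= B \<and> norm (grad \<phi> x) <= B"
proof -
 let ?K = "closure {x. \<phi> x \<noteq> 0}"
 have "bounded (jet \<phi> ` ?K)"
  using assms C1D(4) by (intro compact_imp_bounded compact_continuous_image) (auto simp: C1c_iff intro: continuous_on_subset)
 then obtain B where B: "B > 0" "!!x. x \<in> ?K ==> norm (jet \<phi> x) <= B" unfolding bounded_pos by auto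
 have b: "norm (jet \<phi> x) <= B" for x
  using B C1c_outside[OF assms, of x] by (cases "x \<in> ?K") (auto simp: jet_def zero_prod_def[symmetric])
 moreover have "\<bar>\<phi> x\<bar> <= B" "norm (grad \<phi> x) <= B" for x
  using b[of x] norm_fst_snd_le[of "jet \<phi> x"] by auto
 ultimately show ?thesis using B(1) by auto
qed

text \<open>The squared positive part is the C^1 brick from which the bumps, \<open>Q\<close> and
  \<open>cut\<close> are all built.\<close>

lemma DERIV_sq_pos: "((%t::real. (max 0 t)\<^sup>2) has_field_derivative 2 * max 0 t) (at t)"
proof -
 consider "t > 0" | "t < 0" | "t = 0" by linarith
 then show ?thesis
 proof cases
  case 1
  have "((%t::real. t\<^sup>2) has_field_derivative 2 * t) (at t)" by (auto intro!: derivative_eq_intros)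
  then have "((%t::real. (max 0 t)\<^sup>2) has_field_derivative 2 * t) (at t)"
   by (rule has_field_derivative_transform_within_open[of _ _ _ "{0<..}"]) (use 1 in auto)
  then show ?thesis using 1 by simp
 next
  case 2
  have "((%t::real. 0) has_field_derivative 0) (at t)" by auto
  then have "((%t::real. (max 0 t)\<^sup>2) has_field_derivative 0) (at t)"
   by (rule has_field_derivative_transform_within_open[of _ _ _ "{..<0}"]) (use 2 in auto)
  then show ?thesis using 2 by simp
 next
  case 3
  have "((%y::real. (max 0 y)\<^sup>2 / y) \<longlongrightarrow> 0) (at 0)"
  proof (rule Lim_null_comparison)
   show "\<forall>\<^sub>F y in at (0::real). norm ((max 0 y)\<^sup>2 / y) <= \<bar>y\<bar>"
    by (rule always_eventually) (auto simp: max_def power2_eq_square)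
  qed (auto intro!: tendsto_eq_intros)
  then show ?thesis using 3 by (simp add: has_field_derivative_iff)
 qed
qed

definition ball_bump :: "'a::euclidean_space => real => 'a => real" where
 "ball_bump c r x = (max 0 (r\<^sup>2 - (x - c) \<bullet> (x - c)))\<^sup>2"

lemma ball_bump_pos_iff: "r > 0 ==> ball_bump c r x > 0 \<longleftrightarrow> x \<in> ball c r"
proof -
 assume "r > 0"
 have "ball_bump c r x > 0 \<longleftrightarrow> (norm (x - c))\<^sup>2 < r\<^sup>2"
  by (auto simp: ball_bump_def power2_norm_eq_inner)
 also have "... \<longleftrightarrow> norm (x - c) < r" using \<open>r > 0\<close> by (auto intro: power_strict_mono dest: power2_less_imp_less)
 finally show ?thesis by (simp add: dist_norm norm_minus_commute)
qed

lemma ball_bump_nonneg: "ball_bump c r x >= 0"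
 by (simp add: ball_bump_def)

lemma C1c_ball_bump:
 assumes "r > 0" "cball c r \<subseteq> \<Omega>" shows "C1c \<Omega> (ball_bump c r)"
proof -
 have "C1 (%x. r\<^sup>2 - (x - c) \<bullet> (x - c))"
  by (rule C1I[of "%x. - 2 *\<^sub>R (x - c)"])
    (auto intro!: continuous_intros derivative_eq_intros simp: inner_simps inner_commute)
 from C1_compose(1)[OF this DERIV_sq_pos] have "C1 (ball_bump c r)"
  unfolding ball_bump_def[abs_def] by (simp add: continuous_intros)
 moreover have "{x. ball_bump c r x \<noteq> 0} \<subseteq> cball c r"
 proof safe
  fix x assume "ball_bump c r x \<noteq> 0"
  then have "ball_bump c r x > 0" using ball_bump_nonneg[of c r x] by linarith
  then show "x \<in> cball c r" using ball_bump_pos_iff[OF assms(1), of c x] by auto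
 qed
 then have *: "closure {x. ball_bump c r x \<noteq> 0} \<subseteq> cball c r" by (simp add: closure_minimal)
 then have "compact (closure {x. ball_bump c r x \<noteq> 0})"
  using compact_closure_subset compact_cball by blast
 ultimately show ?thesis using assms * by (auto simp: C1c_iff)
qed

text \<open>A finite sum of ball bumps is positive on K, hence bounded below there by compactness;
  dividing by the minimum gives values at least 1.\<close>

lemma C1c_bump:
 assumes "open \<Omega>" "compact K" "K \<subseteq> \<Omega>"
 obtains \<psi> where "C1c \<Omega> \<psi>" "!!x. \<psi> x >= 0" "!!x. x \<in> K ==> \<psi> x >= 1"
proof -
 have "\<forall>x\<in>K. \<exists>r>0. cball x r \<subseteq> \<Omega>" using assms by (meson open_contains_cball subsetD)
 then obtain r where r: "!!x. x \<in> K ==> r x > 0 \<and> cball x (r x) \<subseteq> \<Omega>" by metis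
 obtain F where F: "F \<subseteq> K" "finite F" "K \<subseteq> (\<Union>c\<in>F. ball c (r c))"
 proof (rule compactE_image[OF assms(2), of K "%c. ball c (r c)"])
  show "K \<subseteq> (\<Union>c\<in>K. ball c (r c))" using r by force
 qed (use that in auto)
 define \<psi> where "\<psi> x = (\<Sum>c\<in>F. ball_bump c (r c) x)" for x
 have C: "C1c \<Omega> \<psi>" unfolding \<psi>_def using F(2,1)
 proof (induction F rule: finite_induct)
  case (insert c F) then show ?case using r C1c_ball_bump[of "r c" c \<Omega>] by (auto intro!: C1c_add)
 qed (simp add: C1c_zero)
 have nn: "\<psi> x >= 0" for x unfolding \<psi>_def by (intro sum_nonneg ball_bump_nonneg)
 have pos: "\<psi> x > 0" if x: "x \<in> K" for x
 proof -
  obtain c where c: "c \<in> F" "x \<in> ball c (r c)" using F x by auto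
  then have "ball_bump c (r c) x > 0" using r F ball_bump_pos_iff by (metis subsetD)
  also have "ball_bump c (r c) x <= \<psi> x" unfolding \<psi>_def using c F by (intro member_le_sum ball_bump_nonneg) auto
  finally show ?thesis .
 qed
 show ?thesis
 proof (cases "K = {}")
  case True then show ?thesis using that[OF C1c_zero] by auto
 next
  case False
  then obtain z where z: "z \<in> K" "\<forall>y\<in>K. \<psi> z <= \<psi> y"
   using continuous_attains_inf[OF assms(2) False] C1D(3)[OF C1c_C1[OF C]] continuous_on_subset by blast
  show ?thesis
  proof (rule that[of "%x. 1 / \<psi> z * \<psi> x"])
   show "C1c \<Omega> (%x. 1 / \<psi> z * \<psi> x)" by (rule C1c_scale[OF C])
  qed (use nn pos z in \<open>auto simp: field_simps\<close>)
 qed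
qed

text \<open>The tangent line to t^p at c is integrated. Its slope is nonnegative, so c may be any
  lower bound for the mean of k; in the applications c is the absolute value of a mean and k the
  absolute value of the function.\<close>

lemma jensen_set:
 fixes k :: "'e::euclidean_space => real"
 assumes S: "compact S" and k: "continuous_on UNIV k" "!!y. k y >= 0" and p: "p > 1" and c: "c >= 0"
  and le: "c * measure lborel S <= (LINT y|lborel. indicator S y * k y)"
 shows "c powr p * measure lborel S <= (LINT y|lborel. indicator S y * k y powr p)"
proof -
 have i1: "integrable lborel (%y. indicator S y *\<^sub>R k y)"
  by (intro borel_integrable_compact S continuous_on_subset[OF k(1)]) auto
 have i2: "integrable lborel (%y. indicator S y *\<^sub>R k y powr p)"
  using k p by (intro borel_integrable_compact S continuous_on_powr' continuous_on_subset[OF k(1)] continuous_on_const) auto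
 have i3: "integrable lborel (%y. indicator S y *\<^sub>R (1::real))"
  by (intro borel_integrable_compact S continuous_on_const)
 have m: "(LINT y|lborel. indicator S y *\<^sub>R (1::real)) = measure lborel S" by simp
 let ?d = "p * c powr (p - 1)"
 have "c powr p * measure lborel S + ?d * (c * measure lborel S - c * measure lborel S)
   <= c powr p * measure lborel S + ?d * ((LINT y|lborel. indicator S y * k y) - c * measure lborel S)"
  using le p by (intro add_left_mono mult_left_mono) auto
 also have "... = (LINT y|lborel. c powr p * (indicator S y *\<^sub>R 1) + ?d * (indicator S y *\<^sub>R k y - c * (indicator S y *\<^sub>R 1)))"
  using i1 i3 m by (subst Bochner_Integration.integral_add) auto
 also have "... <= (LINT y|lborel. indicator S y *\<^sub>R k y powr p)"
 proof (rule integral_mono)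
  show "c powr p * (indicator S y *\<^sub>R 1) + ?d * (indicator S y *\<^sub>R k y - c * (indicator S y *\<^sub>R 1)) <= indicator S y *\<^sub>R k y powr p" for y
   using powr_tangent[OF p c k(2)[of y]] by (auto simp: indicator_def)
 qed (use i1 i2 i3 in auto)
 finally show ?thesis by simp
qed

section \<open>Translations of integrals and of functions\<close>

lemma nn_integral_shift:
 fixes f :: "'a::euclidean_space => ennreal"
 assumes [measurable]: "f \<in> borel_measurable borel"
 shows "(\<integral>\<^sup>+x. f (x + h) \<partial>lborel) = (\<integral>\<^sup>+x. f x \<partial>lborel)"
proof -
 have "(\<integral>\<^sup>+x. f x \<partial>lborel) = (\<integral>\<^sup>+x. f x \<partial>distr lborel borel ((+) h))" by (simp add: lborel_distr_plus)
 also have "... = (\<integral>\<^sup>+x. f (h + x) \<partial>lborel)" by (subst nn_integral_distr) auto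
 finally show ?thesis by (simp add: add.commute)
qed

lemma integral_shift:
 fixes f :: "'a::euclidean_space => real"
 assumes [measurable]: "f \<in> borel_measurable borel"
 shows "(LINT x|lborel. f (x + h)) = (LINT x|lborel. f x)"
  "integrable lborel f ==> integrable lborel (%x. f (x + h))"
proof -
 have "(LINT x|lborel. f x) = (LINT x|distr lborel borel ((+) h). f x)" by (simp add: lborel_distr_plus)
 also have "... = (LINT x|lborel. f (h + x))" by (subst integral_distr) auto
 finally show "(LINT x|lborel. f (x + h)) = (LINT x|lborel. f x)" by (simp add: add.commute)
 assume "integrable lborel f"
 then have "integrable (distr lborel borel ((+) h)) f" by (simp add: lborel_distr_plus)
 then have "integrable lborel (%x. f (h + x))" by (subst (asm) integrable_distr_eq) auto
 then show "integrable lborel (%x. f (x + h))" by (simp add: add.commute)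
qed

lemma nn_integral_swap:
 fixes F :: "'a::euclidean_space => 'c::euclidean_space => ennreal"
 assumes "(%(x,y). F x y) \<in> borel_measurable (borel \<Otimes>\<^sub>M borel)"
 shows "(\<integral>\<^sup>+x. \<integral>\<^sup>+y. F x y \<partial>lborel \<partial>lborel) = (\<integral>\<^sup>+y. \<integral>\<^sup>+x. F x y \<partial>lborel \<partial>lborel)"
proof -
 have ps: "pair_sigma_finite (lborel :: 'a measure) (lborel :: 'c measure)"
  by (simp add: pair_sigma_finite_def sigma_finite_lborel)
 have m: "(%(x,y). F x y) \<in> borel_measurable ((lborel :: 'a measure) \<Otimes>\<^sub>M (lborel :: 'c measure))"
  using assms by (simp add: measurable_cong_sets[OF sets_pair_measure_cong[OF sets_lborel sets_lborel] refl])
 show ?thesis using pair_sigma_finite.Fubini[OF ps m] by simp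
qed

text \<open>The difference is the integral of the directional derivative over the segment, and
  Jensen's inequality moves the power inside.\<close>

lemma C1_difference_powr_le:
 fixes \<phi> :: "'a::euclidean_space => real"
 assumes "C1 \<phi>" and p: "p > 1"
 shows "ennreal (\<bar>\<phi> (x + h) - \<phi> x\<bar> powr p)
  <= (\<integral>\<^sup>+t. ennreal (norm h powr p) * (indicator {0..1} t * ennreal (norm (grad \<phi> (x + t *\<^sub>R h)) powr p)) \<partial>lborel)"
proof -
 define k where "k t = grad \<phi> (x + t *\<^sub>R h) \<bullet> h" for t :: real
 have cg: "continuous_on UNIV (%t. grad \<phi> (x + t *\<^sub>R h))"
  by (intro continuous_on_compose2[OF C1D(2)[OF assms(1)]] continuous_intros) auto
 have ck: "continuous_on UNIV k" unfolding k_def by (intro continuous_intros cg)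
 have d: "((%t. \<phi> (x + t *\<^sub>R h)) has_vector_derivative k t) (at t within {0..1})" for t
 proof -
  have "((%t. x + t *\<^sub>R h) has_derivative (%s. s *\<^sub>R h)) (at t within {0..1})"
   by (auto intro!: derivative_eq_intros)
  from has_derivative_compose[OF this C1D(1)[OF assms(1)]]
  show ?thesis unfolding has_vector_derivative_def k_def by simp
 qed
 have "has_bochner_integral lborel (%t. indicator {0..1} t *\<^sub>R k t) (\<phi> (x + 1 *\<^sub>R h) - \<phi> (x + 0 *\<^sub>R h))"
  by (rule has_bochner_integral_FTC_Icc[OF _ d]) (auto intro: continuous_on_subset[OF ck])
 then have eq: "(LINT t|lborel. indicator {0..1} t *\<^sub>R k t) = \<phi> (x + h) - \<phi> x"
  by (auto simp: has_bochner_integral_iff)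
 have "\<bar>\<phi> (x + h) - \<phi> x\<bar> * measure lborel {0..1::real} <= (LINT t|lborel. \<bar>indicator {0..1} t *\<^sub>R k t\<bar>)"
  unfolding eq[symmetric] using integral_abs_bound by simp
 also have "... = (LINT t|lborel. indicator {0..1} t * \<bar>k t\<bar>)"
  by (intro Bochner_Integration.integral_cong) (auto simp: indicator_def)
 finally have "\<bar>\<phi> (x + h) - \<phi> x\<bar> powr p * measure lborel {0..1::real} <= (LINT t|lborel. indicator {0..1} t * \<bar>k t\<bar> powr p)"
  by (intro jensen_set p) (auto intro!: continuous_intros ck)
 then have "\<bar>\<phi> (x + h) - \<phi> x\<bar> powr p <= (LINT t|lborel. indicator {0..1} t * \<bar>k t\<bar> powr p)" by simp
 also have "... <= (LINT t|lborel. norm h powr p * (indicator {0..1} t *\<^sub>R norm (grad \<phi> (x + t *\<^sub>R h)) powr p))"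
 proof (rule integral_mono)
  have "integrable lborel (%t. indicator {0..1} t *\<^sub>R \<bar>k t\<bar> powr p)"
   using p by (intro borel_integrable_compact continuous_on_powr' continuous_intros continuous_on_subset[OF ck]) auto
  then show "integrable lborel (%t. indicator {0..1} t * \<bar>k t\<bar> powr p)" by simp
  show i: "integrable lborel (%t. norm h powr p * (indicator {0..1} t *\<^sub>R norm (grad \<phi> (x + t *\<^sub>R h)) powr p))"
   using p by (intro integrable_mult_right borel_integrable_compact continuous_on_powr' continuous_intros continuous_on_subset[OF cg]) auto
  show "indicator {0..1} t * \<bar>k t\<bar> powr p <= norm h powr p * (indicator {0..1} t *\<^sub>R norm (grad \<phi> (x + t *\<^sub>R h)) powr p)" for t
  proof -
   have "\<bar>k t\<bar> powr p <= (norm (grad \<phi> (x + t *\<^sub>R h)) * norm h) powr p"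
    unfolding k_def using p Cauchy_Schwarz_ineq2 by (intro powr_mono2) auto
   then show ?thesis by (auto simp: indicator_def powr_mult mult.commute)
  qed
 qed
 finally have "ennreal (\<bar>\<phi> (x + h) - \<phi> x\<bar> powr p) <= ennreal (LINT t|lborel. norm h powr p * (indicator {0..1} t *\<^sub>R norm (grad \<phi> (x + t *\<^sub>R h)) powr p))"
  by (rule ennreal_leI)
 also have "... = (\<integral>\<^sup>+t. ennreal (norm h powr p * (indicator {0..1} t *\<^sub>R norm (grad \<phi> (x + t *\<^sub>R h)) powr p)) \<partial>lborel)"
  using p by (intro nn_integral_eq_integral[symmetric] integrable_mult_right borel_integrable_compact continuous_on_powr' continuous_intros continuous_on_subset[OF cg]) auto
 also have "... = (\<integral>\<^sup>+t. ennreal (norm h powr p) * (indicator {0..1} t * ennreal (norm (grad \<phi> (x + t *\<^sub>R h)) powr p)) \<partial>lborel)"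
  by (intro nn_integral_cong) (auto simp: indicator_def ennreal_mult)
 finally show ?thesis .
qed

text \<open>After exchanging the integrals, every translate of the gradient has the same integral
  over x. A long shift gives Poincare's inequality, short shifts give Rellich compactness.\<close>

lemma translation_estimate:
 fixes \<phi> :: "'a::euclidean_space => real"
 assumes "C1 \<phi>" and p: "p > 1"
 shows "(\<integral>\<^sup>+x. ennreal (\<bar>\<phi> (x + h) - \<phi> x\<bar> powr p) \<partial>lborel)
  <= ennreal (norm h powr p) * (\<integral>\<^sup>+x. ennreal (norm (grad \<phi> x) powr p) \<partial>lborel)"
proof -
 have [measurable]: "grad \<phi> \<in> borel_measurable borel"
  by (intro borel_measurable_continuous_onI C1D assms)
 let ?g = "%x. ennreal (norm (grad \<phi> x) powr p)"
 have "(\<integral>\<^sup>+x. ennreal (\<bar>\<phi> (x + h) - \<phi> x\<bar> powr p) \<partial>lborel)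
  <= (\<integral>\<^sup>+x. \<integral>\<^sup>+t. ennreal (norm h powr p) * (indicator {0..1::real} t * ?g (x + t *\<^sub>R h)) \<partial>lborel \<partial>lborel)"
  by (intro nn_integral_mono C1_difference_powr_le assms)
 also have "... = (\<integral>\<^sup>+t. \<integral>\<^sup>+x. ennreal (norm h powr p) * (indicator {0..1::real} t * ?g (x + t *\<^sub>R h)) \<partial>lborel \<partial>lborel)"
  by (rule nn_integral_swap) measurable
 also have "... = (\<integral>\<^sup>+t. (ennreal (norm h powr p) * (\<integral>\<^sup>+x. ?g x \<partial>lborel)) * indicator {0..1::real} t \<partial>lborel)"
 proof (intro nn_integral_cong)
  fix t :: real
  have "(\<integral>\<^sup>+x. ennreal (norm h powr p) * (indicator {0..1::real} t * ?g (x + t *\<^sub>R h)) \<partial>lborel)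
   = ennreal (norm h powr p) * (indicator {0..1::real} t * (\<integral>\<^sup>+x. ?g (x + t *\<^sub>R h) \<partial>lborel))"
   by (simp add: nn_integral_cmult)
  also have "(\<integral>\<^sup>+x. ?g (x + t *\<^sub>R h) \<partial>lborel) = (\<integral>\<^sup>+x. ?g x \<partial>lborel)"
   by (rule nn_integral_shift) measurable
  finally show "(\<integral>\<^sup>+x. ennreal (norm h powr p) * (indicator {0..1::real} t * ?g (x + t *\<^sub>R h)) \<partial>lborel)
   = (ennreal (norm h powr p) * (\<integral>\<^sup>+x. ?g x \<partial>lborel)) * indicator {0..1::real} t" by (simp add: ac_simps)
 qed
 also have "... = ennreal (norm h powr p) * (\<integral>\<^sup>+x. ?g x \<partial>lborel)"
  by (subst nn_integral_cmult_indicator) auto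
 finally show ?thesis .
qed

section \<open>Test functions on a bounded open set: Poincare's inequality and integration by
  parts\<close>

locale dom =
 fixes \<Omega> :: "'a::euclidean_space set" and p :: real
 assumes open_dom: "open \<Omega>" and bounded_dom: "bounded \<Omega>" and p1: "p > 1"
begin

abbreviation "M \<equiv> lebesgue_on \<Omega>"

lemma dom_lmeasurable: "\<Omega> \<in> lmeasurable"
 using open_dom bounded_dom by (rule lmeasurable_open[rotated])

lemma dom_sets [simp]: "\<Omega> \<in> sets lebesgue" using dom_lmeasurable by auto

sublocale finite_measure M
 by (rule finite_measure_lebesgue_on[OF dom_lmeasurable])

lemma p0: "p > 0" "p >= 0" "p >= 1" using p1 by auto

lemma continuous_meas: "continuous_on UNIV f ==> f \<in> BM M" for f :: "'a => 'b::euclidean_space"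
 by (intro continuous_imp_measurable_on_sets_lebesgue) (auto intro: continuous_on_subset)

lemma nn_integral_dom:
 assumes "f \<in> borel_measurable borel" "!!x. x \<notin> \<Omega> ==> f x = 0"
 shows "(\<integral>\<^sup>+x. f x \<partial>M) = (\<integral>\<^sup>+x. f x \<partial>lborel)"
proof -
 have "(\<integral>\<^sup>+x. f x \<partial>M) = (\<integral>\<^sup>+x. f x * indicator \<Omega> x \<partial>lebesgue)" by (subst nn_integral_restrict_space) auto
 also have "... = (\<integral>\<^sup>+x. f x \<partial>lebesgue)" using assms(2) by (intro nn_integral_cong) (auto simp: indicator_def)
 also have "... = (\<integral>\<^sup>+x. f x \<partial>lborel)" using assms(1) by (subst nn_integral_completion) auto
 finally show ?thesis .
qed

lemma integral_dom:
 fixes f :: "'a => 'b::euclidean_space"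
 assumes "f \<in> borel_measurable borel" "!!x. x \<notin> \<Omega> ==> f x = 0"
 shows "(LINT x|M. f x) = (LINT x|lborel. f x)"
proof -
 have "(LINT x|M. f x) = (LINT x|lebesgue. indicator \<Omega> x *\<^sub>R f x)" by (subst integral_restrict_space) auto
 also have "... = (LINT x|lebesgue. f x)" using assms(2) by (intro Bochner_Integration.integral_cong) (auto simp: indicator_def)
 also have "... = (LINT x|lborel. f x)" using assms(1) by (subst integral_completion) auto
 finally show ?thesis .
qed

lemma C1c_LP:
 assumes "C1c \<Omega> \<phi>" and q: "q >= 0" shows "LP q M (jet \<phi>)" "LP q M \<phi>" "LP q M (grad \<phi>)"
proof -
 obtain B where B: "!!x. norm (jet \<phi> x) <= B" using C1c_bounded[OF assms(1)] by blast
 note C = C1D(2-4)[OF C1c_C1[OF assms(1)]]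
 show "LP q M (jet \<phi>)" "LP q M \<phi>" "LP q M (grad \<phi>)"
  using B norm_fst_snd_le[of "jet \<phi> x" for x]
  by (intro LP_bounded[of _ B] continuous_meas C q; fastforce intro: order_trans)+
qed

lemma C1c_energy:
 assumes "C1c \<Omega> \<phi>"
 shows "(\<integral>\<^sup>+x. ennreal (norm (grad \<phi> x) powr p) \<partial>lborel) = ennreal (LINT x|M. norm (grad \<phi> x) powr p)"
  "(\<integral>\<^sup>+x. ennreal (\<bar>\<phi> x\<bar> powr p) \<partial>lborel) = ennreal (LINT x|M. \<bar>\<phi> x\<bar> powr p)"
proof -
 have [measurable]: "\<phi> \<in> borel_measurable borel" "grad \<phi> \<in> borel_measurable borel"
  by (intro borel_measurable_continuous_onI C1D C1c_C1[OF assms])+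
 have "(\<integral>\<^sup>+x. ennreal (norm (grad \<phi> x) powr p) \<partial>lborel) = (\<integral>\<^sup>+x. ennreal (norm (grad \<phi> x) powr p) \<partial>M)"
  using C1c_jet_zero[OF assms] by (intro nn_integral_dom[symmetric]) auto
 also have "... = ennreal (LINT x|M. norm (grad \<phi> x) powr p)"
  using C1c_LP(3)[OF assms p0(2)] by (intro nn_integral_eq_integral) (auto simp: LP_def)
 finally show "(\<integral>\<^sup>+x. ennreal (norm (grad \<phi> x) powr p) \<partial>lborel) = ennreal (LINT x|M. norm (grad \<phi> x) powr p)" .
 have "(\<integral>\<^sup>+x. ennreal (\<bar>\<phi> x\<bar> powr p) \<partial>lborel) = (\<integral>\<^sup>+x. ennreal (\<bar>\<phi> x\<bar> powr p) \<partial>M)"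
  using C1c_jet_zero[OF assms] by (intro nn_integral_dom[symmetric]) auto
 also have "... = ennreal (LINT x|M. \<bar>\<phi> x\<bar> powr p)"
  using C1c_LP(2)[OF assms p0(2)] by (intro nn_integral_eq_integral) (auto simp: LP_def)
 finally show "(\<integral>\<^sup>+x. ennreal (\<bar>\<phi> x\<bar> powr p) \<partial>lborel) = ennreal (LINT x|M. \<bar>\<phi> x\<bar> powr p)" .
qed

lemma C1c_translation:
 assumes "C1c \<Omega> \<phi>"
 shows "(\<integral>\<^sup>+x. ennreal (\<bar>\<phi> (x + h) - \<phi> x\<bar> powr p) \<partial>lborel) <= ennreal (norm h powr p * (LINT x|M. norm (grad \<phi> x) powr p))"
 using translation_estimate[OF C1c_C1[OF assms] p1, of h] by (simp add: C1c_energy[OF assms] ennreal_mult)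

lemma poincare:
 "\<exists>C>0. \<forall>\<phi>. C1c \<Omega> \<phi> --> (LINT x|M. \<bar>\<phi> x\<bar> powr p) <= C * (LINT x|M. norm (grad \<phi> x) powr p)"
proof -
 obtain R where R: "R > 0" "!!x. x \<in> \<Omega> ==> norm x <= R" using bounded_dom unfolding bounded_pos by auto
 obtain b :: 'a where b: "b \<in> Basis" using SOME_Basis by blast
 \<comment> \<open>This shift is longer than the diameter of \<Omega>, so \<phi>(x + h) = 0 for x in
   \<Omega>, and the translation estimate bounds \<phi> itself.\<close>
 define h where "h = (2 * R + 1) *\<^sub>R b"
 have h: "norm h = 2 * R + 1" using R b by (simp add: h_def)
 have out: "x + h \<notin> \<Omega>" if "x \<in> \<Omega>" for x
  using R(2)[OF that] R(2)[of "x + h"] norm_diff_ineq[of h x] h R(1) by (auto simp: add.commute)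
 have "(LINT x|M. \<bar>\<phi> x\<bar> powr p) <= norm h powr p * (LINT x|M. norm (grad \<phi> x) powr p)" if \<phi>: "C1c \<Omega> \<phi>" for \<phi>
 proof -
  have "ennreal (LINT x|M. \<bar>\<phi> x\<bar> powr p) = (\<integral>\<^sup>+x. ennreal (\<bar>\<phi> x\<bar> powr p) \<partial>lborel)" by (simp add: C1c_energy[OF \<phi>])
  also have "... <= (\<integral>\<^sup>+x. ennreal (\<bar>\<phi> (x + h) - \<phi> x\<bar> powr p) \<partial>lborel)"
  proof (intro nn_integral_mono ennreal_leI)
   show "\<bar>\<phi> x\<bar> powr p <= \<bar>\<phi> (x + h) - \<phi> x\<bar> powr p" for x
    using C1c_jet_zero(2)[OF \<phi>] out[of x] by (cases "x \<in> \<Omega>") auto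
  qed
  also have "... <= ennreal (norm h powr p * (LINT x|M. norm (grad \<phi> x) powr p))" by (rule C1c_translation[OF \<phi>])
  finally show ?thesis by (subst (asm) ennreal_le_iff) (auto intro!: mult_nonneg_nonneg lint_nonneg)
 qed
 then show ?thesis using h R by (intro exI[of _ "norm h powr p"]) auto
qed

text \<open>Difference quotients have integral 0 by translation invariance, and they converge to the
  partial derivatives, dominated by a Lipschitz constant on a bounded set.\<close>

lemma integral_grad_zero:
 assumes "C1c \<Omega> \<phi>" shows "(LINT x|M. grad \<phi> x) = 0"
proof -
 have [measurable]: "\<phi> \<in> borel_measurable borel" "grad \<phi> \<in> borel_measurable borel"
  by (intro borel_measurable_continuous_onI C1D C1c_C1[OF assms])+
 obtain R where R: "R > 0" "!!x. x \<in> \<Omega> ==> norm x <= R" using bounded_dom unfolding bounded_pos by auto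
 obtain B where B: "B > 0" "!!x. norm (grad \<phi> x) <= B" "!!x. \<bar>\<phi> x\<bar> <= B" using C1c_bounded[OF assms] by blast
 have lip: "\<bar>\<phi> x - \<phi> y\<bar> <= B * norm (x - y)" for x y
 proof -
  have "norm (\<phi> x - \<phi> y) <= B * norm (x - y)"
  proof (rule differentiable_bound[of UNIV \<phi> "%x h. grad \<phi> x \<bullet> h"])
   show "onorm (%h. grad \<phi> x \<bullet> h) <= B" for x
   proof (rule onorm_le)
    fix h
    have "\<bar>grad \<phi> x \<bullet> h\<bar> <= norm (grad \<phi> x) * norm h" by (rule Cauchy_Schwarz_ineq2)
    also have "... <= B * norm h" using B by (intro mult_right_mono) auto
    finally show "norm (grad \<phi> x \<bullet> h) <= B * norm h" by simp
   qed
  qed (use C1D(1)[OF C1c_C1[OF assms]] in auto)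
  then show ?thesis by simp
 qed
 have ij: "integrable lborel \<phi>"
 proof -
  have "integrable lborel (%x. indicator (cball 0 R) x *\<^sub>R \<phi> x)"
   by (intro borel_integrable_compact continuous_on_subset[OF C1D(3)[OF C1c_C1[OF assms]]]) auto
  also have "(%x. indicator (cball 0 R) x *\<^sub>R \<phi> x) = \<phi>"
   using R C1c_jet_zero(2)[OF assms] by (auto simp: indicator_def fun_eq_iff)
  finally show ?thesis .
 qed
 have comp: "(LINT x|lborel. grad \<phi> x \<bullet> b) = 0" if b: "b \<in> Basis" for b
 proof -
  define s where "s n x = (\<phi> (x + (1 / real (Suc n)) *\<^sub>R b) - \<phi> x) / (1 / real (Suc n))" for n x
  have "(%n. LINT x|lborel. s n x) ----> (LINT x|lborel. grad \<phi> x \<bullet> b)"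
  \<comment> \<open>The increments have length at most 1, so all quotients vanish off the ball of
    radius R + 1.\<close>
  proof (rule integral_dominated_convergence[where w="%x. indicator (cball 0 (R + 1)) x *\<^sub>R B"])
   show "integrable lborel (%x::'a. indicator (cball 0 (R + 1)) x *\<^sub>R B)"
    by (intro borel_integrable_compact) auto
   show "AE x in lborel. (%n. s n x) ----> grad \<phi> x \<bullet> b"
   proof (intro AE_I2)
    fix x
    have "((%t. x + t *\<^sub>R b) has_derivative (%s. s *\<^sub>R b)) (at (0::real))"
     by (auto intro!: derivative_eq_intros)
    from has_derivative_compose[OF this C1D(1)[OF C1c_C1[OF assms]]]
    have "((%t. \<phi> (x + t *\<^sub>R b)) has_field_derivative (grad \<phi> x \<bullet> b)) (at 0)"
     unfolding has_field_derivative_def by (simp add: mult.commute[of _ "grad \<phi> x \<bullet> b"])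
    then have "((%h. (\<phi> (x + h *\<^sub>R b) - \<phi> x) / h) \<longlongrightarrow> grad \<phi> x \<bullet> b) (at 0)"
     by (auto dest: DERIV_D)
    moreover have "filterlim (%n. 1 / real (Suc n)) (at 0) sequentially"
     unfolding filterlim_at using LIMSEQ_Suc[OF lim_1_over_n] by auto
    ultimately show "(%n. s n x) ----> grad \<phi> x \<bullet> b"
     unfolding s_def by (rule filterlim_compose)
   qed
   show "AE x in lborel. norm (s n x) <= indicator (cball 0 (R + 1)) x *\<^sub>R B" for n
   proof (intro AE_I2)
    fix x
    have nb: "norm ((1 / real (Suc n)) *\<^sub>R b) = 1 / real (Suc n)" using b by simp
    have "\<bar>\<phi> (x + (1 / real (Suc n)) *\<^sub>R b) - \<phi> x\<bar> <= B * (1 / real (Suc n))"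
     using lip[of "x + (1 / real (Suc n)) *\<^sub>R b" x] nb by simp
    then have "\<bar>\<phi> (x + (1 / real (Suc n)) *\<^sub>R b) - \<phi> x\<bar> / (1 / real (Suc n)) <= B * (1 / real (Suc n)) / (1 / real (Suc n))"
     by (rule divide_right_mono) simp
    then have "\<bar>s n x\<bar> <= B" unfolding s_def abs_divide by simp
    moreover have "s n x = 0" if "x \<notin> cball 0 (R + 1)"
    proof -
     have "x \<notin> \<Omega>" using that R by force
     moreover have "x + (1 / real (Suc n)) *\<^sub>R b \<notin> \<Omega>"
     proof
      assume "x + (1 / real (Suc n)) *\<^sub>R b \<in> \<Omega>"
      then have "norm (x + (1 / real (Suc n)) *\<^sub>R b) <= R" by (rule R)
      moreover have "1 / real (Suc n) <= 1" by simp
      ultimately have "norm x <= R + 1" using norm_diff_ineq[of x "(1 / real (Suc n)) *\<^sub>R b"] nb by linarith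
      then show False using that by simp
     qed
     ultimately show ?thesis unfolding s_def using C1c_jet_zero(2)[OF assms] by simp
    qed
    ultimately show "norm (s n x) <= indicator (cball 0 (R + 1)) x *\<^sub>R B" by (auto simp: indicator_def)
   qed
   show "s n \<in> borel_measurable lborel" for n unfolding s_def by measurable
   show "(%x. grad \<phi> x \<bullet> b) \<in> borel_measurable lborel" by measurable
  qed
  moreover have "(LINT x|lborel. s n x) = 0" for n
  proof -
   have "(LINT x|lborel. s n x) = ((LINT x|lborel. \<phi> (x + (1 / real (Suc n)) *\<^sub>R b)) - (LINT x|lborel. \<phi> x)) / (1 / real (Suc n))"
    unfolding s_def using integral_shift(2)[OF _ ij] ij by simp
   then show ?thesis using integral_shift(1)[of \<phi> "(1 / real (Suc n)) *\<^sub>R b"] by simp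
  qed
  ultimately have "(%n. 0) ----> (LINT x|lborel. grad \<phi> x \<bullet> b)" by simp
  then show ?thesis using LIMSEQ_unique tendsto_const by metis
 qed
 have im: "integrable M (grad \<phi>)" using LP_integrable[OF C1c_LP(3)[OF assms p0(2)] p0(3)] .
 show ?thesis
 proof (rule euclidean_eqI)
  fix b :: 'a assume b: "b \<in> Basis"
  have "(LINT x|M. grad \<phi> x) \<bullet> b = (LINT x|M. grad \<phi> x \<bullet> b)" using im by simp
  also have "... = (LINT x|lborel. grad \<phi> x \<bullet> b)" using C1c_jet_zero(3)[OF assms] by (intro integral_dom) auto
  finally show "(LINT x|M. grad \<phi> x) \<bullet> b = 0 \<bullet> b" using comp[OF b] by simp
 qed
qed

lemma C1c_ibp:
 assumes "C1c \<Omega> \<phi>" "C1c \<Omega> \<psi>"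
 shows "(LINT x|M. \<phi> x *\<^sub>R grad \<psi> x) = - (LINT x|M. \<psi> x *\<^sub>R grad \<phi> x)"
proof -
 have i: "integrable M (%x. u x *\<^sub>R grad v x)" if uv: "C1c \<Omega> u" "C1c \<Omega> v" for u v :: "'a => real"
 proof -
  obtain B where B: "!!x. \<bar>u x\<bar> <= B" using C1c_bounded[OF uv(1)] by blast
  have "LP p M (%x. u x *\<^sub>R grad v x)"
   by (rule LP_mult_bounded[OF C1c_LP(3)[OF uv(2)] _ B])
     (use p0 C1D(3)[OF C1c_C1[OF uv(1)]] in \<open>auto intro: continuous_meas\<close>)
  then show ?thesis using LP_integrable p0 by blast
 qed
 have "0 = (LINT x|M. grad (%x. \<phi> x * \<psi> x) x)"
  using integral_grad_zero[OF C1c_mult[OF assms(1) C1c_C1[OF assms(2)]]] by simp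
 also have "... = (LINT x|M. \<phi> x *\<^sub>R grad \<psi> x + \<psi> x *\<^sub>R grad \<phi> x)"
  by (simp add: C1_mult(2)[OF C1c_C1[OF assms(1)] C1c_C1[OF assms(2)]])
 also have "... = (LINT x|M. \<phi> x *\<^sub>R grad \<psi> x) + (LINT x|M. \<psi> x *\<^sub>R grad \<phi> x)"
  using i assms by simp
 finally show ?thesis by (simp add: eq_neg_iff_add_eq_0)
qed

end

section \<open>Sobolev space\<close>

text \<open>Applied to the translates of a function, this average over a ball of radius e acts as a
  mollifier; the compactness argument uses the equicontinuity of the averages.\<close>

definition avg :: "real => ('a::euclidean_space => real) => real" where
 "avg e u = (LINT y|lborel. indicator (cball 0 e) y *\<^sub>R u y) / measure lborel (cball (0::'a) e)"

lemma measure_cball_pos': "e > 0 ==> measure lborel (cball (0::'a::euclidean_space) e) > 0"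
 by (rule content_cball_pos)

lemma avg_integrable:
 "continuous_on UNIV u ==> integrable lborel (%y. indicator (cball 0 e) y *\<^sub>R u y)"
 for u :: "'a::euclidean_space => real"
 by (intro borel_integrable_compact) (auto intro: continuous_on_subset)

lemma avg_diff:
 assumes "continuous_on UNIV u" "continuous_on UNIV v"
 shows "avg e (%y. u y - v y) = avg e u - avg e v"
proof -
 have "(LINT y|lborel. indicator (cball 0 e) y *\<^sub>R (u y - v y))
   = (LINT y|lborel. indicator (cball 0 e) y *\<^sub>R u y - indicator (cball 0 e) y *\<^sub>R v y)"
  by (simp add: algebra_simps)
 also have "... = (LINT y|lborel. indicator (cball 0 e) y *\<^sub>R u y) - (LINT y|lborel. indicator (cball 0 e) y *\<^sub>R v y)"
  using avg_integrable[OF assms(1)] avg_integrable[OF assms(2)] by (rule Bochner_Integration.integral_diff)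
 finally show ?thesis unfolding avg_def by (simp add: diff_divide_distrib)
qed

lemma avg_const: "e > 0 ==> avg e (%y::'a::euclidean_space. c) = c"
 using measure_cball_pos'[of e, where 'a='a] by (simp add: avg_def)

lemma avg_jensen:
 fixes u :: "'a::euclidean_space => real"
 assumes u: "continuous_on UNIV u" and p: "p > 1" and e: "e > 0"
 shows "ennreal (\<bar>avg e u\<bar> powr p * measure lborel (cball (0::'a) e))
   <= (\<integral>\<^sup>+y. indicator (cball 0 e) y * ennreal (\<bar>u y\<bar> powr p) \<partial>lborel)"
proof -
 let ?V = "measure lborel (cball (0::'a) e)"
 note V = measure_cball_pos'[OF e, where 'a='a]
 have "\<bar>avg e u\<bar> * ?V = \<bar>LINT y|lborel. indicator (cball 0 e) y *\<^sub>R u y\<bar>"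
  unfolding avg_def using V by (simp add: abs_divide)
 also have "... <= (LINT y|lborel. \<bar>indicator (cball 0 e) y *\<^sub>R u y\<bar>)" by (rule integral_abs_bound)
 also have "... = (LINT y|lborel. indicator (cball 0 e) y * \<bar>u y\<bar>)"
  by (intro Bochner_Integration.integral_cong) (auto simp: indicator_def)
 finally have "\<bar>avg e u\<bar> powr p * ?V <= (LINT y|lborel. indicator (cball 0 e) y * \<bar>u y\<bar> powr p)"
  by (intro jensen_set p) (auto intro!: continuous_intros u)
 then have "ennreal (\<bar>avg e u\<bar> powr p * ?V) <= ennreal (LINT y|lborel. indicator (cball 0 e) y * \<bar>u y\<bar> powr p)"
  by (rule ennreal_leI)
 also have "... = (\<integral>\<^sup>+y. ennreal (indicator (cball 0 e) y * \<bar>u y\<bar> powr p) \<partial>lborel)"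
 proof (rule nn_integral_eq_integral[symmetric])
  have "continuous_on UNIV (%y. \<bar>u y\<bar> powr p)" using p u by (intro continuous_on_powr' continuous_intros) auto
  from avg_integrable[OF this] show "integrable lborel (%y. indicator (cball 0 e) y * \<bar>u y\<bar> powr p)" by simp
 qed auto
 also have "... = (\<integral>\<^sup>+y. indicator (cball 0 e) y * ennreal (\<bar>u y\<bar> powr p) \<partial>lborel)"
  by (intro nn_integral_cong) (auto simp: indicator_def)
 finally show ?thesis .
qed

section \<open>Compactness by averaging\<close>

context dom
begin

lemma continuous_shift: "C1c \<Omega> \<phi> ==> continuous_on UNIV (%y. \<phi> (x + y))"
 by (rule continuous_on_compose2[OF C1D(3)[OF C1c_C1]]) (auto intro!: continuous_intros)

lemma C1c_borel: "C1c \<Omega> \<phi> ==> \<phi> \<in> borel_measurable borel" "C1c \<Omega> \<phi> ==> grad \<phi> \<in> borel_measurable borel"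
 by (intro borel_measurable_continuous_onI C1D C1c_C1; assumption)+

lemma indicator_le_nn: "(\<integral>\<^sup>+y. indicator A y * f y \<partial>N) <= (\<integral>\<^sup>+y. f y \<partial>N)"
 by (intro nn_integral_mono) (auto simp: indicator_def)

text \<open>The modulus depends on \<phi> only through its energy, which makes the averages of a
  family of bounded energy equicontinuous for each fixed radius.\<close>

lemma avg_lipschitz:
 assumes "C1c \<Omega> \<phi>" "e > 0"
 shows "\<bar>avg e (%y. \<phi> (x + y)) - avg e (%y. \<phi> (x' + y))\<bar> powr p * measure lborel (cball (0::'a) e)
   <= norm (x - x') powr p * (LINT x|M. norm (grad \<phi> x) powr p)"
proof -
 note [measurable] = C1c_borel[OF assms(1)]
 have "ennreal (\<bar>avg e (%y. \<phi> (x + y) - \<phi> (x' + y))\<bar> powr p * measure lborel (cball (0::'a) e))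
   <= (\<integral>\<^sup>+y. indicator (cball 0 e) y * ennreal (\<bar>\<phi> (x + y) - \<phi> (x' + y)\<bar> powr p) \<partial>lborel)"
  using assms by (intro avg_jensen p1 continuous_on_diff continuous_shift)
 also have "... <= (\<integral>\<^sup>+y. ennreal (\<bar>\<phi> (x + y) - \<phi> (x' + y)\<bar> powr p) \<partial>lborel)"
  by (rule indicator_le_nn)
 also have "... = (\<integral>\<^sup>+y. ennreal (\<bar>\<phi> ((y + x') + (x - x')) - \<phi> (y + x')\<bar> powr p) \<partial>lborel)"
  by (simp add: algebra_simps)
 also have "... = (\<integral>\<^sup>+y. ennreal (\<bar>\<phi> (y + (x - x')) - \<phi> y\<bar> powr p) \<partial>lborel)"
  by (rule nn_integral_shift[of "%y. ennreal (\<bar>\<phi> (y + (x - x')) - \<phi> y\<bar> powr p)" x']) measurable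
 also have "... <= ennreal (norm (x - x') powr p * (LINT x|M. norm (grad \<phi> x) powr p))"
  by (rule C1c_translation[OF assms(1)])
 finally show ?thesis
  using assms by (subst (asm) ennreal_le_iff)
   (auto simp: avg_diff continuous_shift intro!: mult_nonneg_nonneg lint_nonneg)
qed

lemma avg_bound:
 assumes "C1c \<Omega> \<phi>" "e > 0"
 shows "\<bar>avg e (%y. \<phi> (x + y))\<bar> powr p * measure lborel (cball (0::'a) e) <= (LINT x|M. \<bar>\<phi> x\<bar> powr p)"
proof -
 note [measurable] = C1c_borel[OF assms(1)]
 have "ennreal (\<bar>avg e (%y. \<phi> (x + y))\<bar> powr p * measure lborel (cball (0::'a) e))
   <= (\<integral>\<^sup>+y. indicator (cball 0 e) y * ennreal (\<bar>\<phi> (x + y)\<bar> powr p) \<partial>lborel)"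
  using assms by (intro avg_jensen p1 continuous_shift)
 also have "... <= (\<integral>\<^sup>+y. ennreal (\<bar>\<phi> (x + y)\<bar> powr p) \<partial>lborel)"
  by (rule indicator_le_nn)
 also have "... = (\<integral>\<^sup>+y. ennreal (\<bar>\<phi> (y + x)\<bar> powr p) \<partial>lborel)"
  by (simp add: algebra_simps)
 also have "... = (\<integral>\<^sup>+y. ennreal (\<bar>\<phi> y\<bar> powr p) \<partial>lborel)"
  by (rule nn_integral_shift) measurable
 also have "... = ennreal (LINT x|M. \<bar>\<phi> x\<bar> powr p)" by (rule C1c_energy(2)[OF assms(1)])
 finally show ?thesis by (subst (asm) ennreal_le_iff) (auto intro!: lint_nonneg)
qed

lemma avg_continuous:
 assumes "C1c \<Omega> \<phi>" "e > 0"
 shows "continuous_on UNIV (%x. avg e (%y. \<phi> (x + y)))"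
proof -
 let ?V = "measure lborel (cball (0::'a) e)" and ?E = "LINT x|M. norm (grad \<phi> x) powr p"
 let ?A = "%x. avg e (%y. \<phi> (x + y))"
 note V = measure_cball_pos'[OF assms(2), where 'a='a]
 have "isCont ?A x" for x
 proof -
  have "((%x'. \<bar>?A x' - ?A x\<bar> powr p) \<longlongrightarrow> 0) (at x)"
  proof (rule Lim_null_comparison)
   show "\<forall>\<^sub>F x' in at x. norm (\<bar>?A x' - ?A x\<bar> powr p) <= norm (x' - x) powr p * ?E / ?V"
    using avg_lipschitz[OF assms, of _ x] V by (auto simp: field_simps)
   have "((%x'. norm (x' - x) powr p) \<longlongrightarrow> 0 powr p) (at x)"
    using p0 by (intro tendsto_powr' tendsto_norm_zero tendsto_const LIM_zero tendsto_ident_at) auto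
   then show "((%x'. norm (x' - x) powr p * ?E / ?V) \<longlongrightarrow> 0) (at x)"
    using p0 V by (auto intro!: tendsto_eq_intros)
  qed
  then have "((%x'. (\<bar>?A x' - ?A x\<bar> powr p) powr (1/p)) \<longlongrightarrow> 0 powr (1/p)) (at x)"
   using p0 by (intro tendsto_powr' tendsto_const) auto
  then have "((%x'. \<bar>?A x' - ?A x\<bar>) \<longlongrightarrow> 0) (at x)" using p0 by (simp add: powr_powr)
  then show ?thesis by (simp add: isCont_def tendsto_rabs_zero_iff LIM_zero_iff)
 qed
 then show ?thesis by (simp add: continuous_at_imp_continuous_on)
qed

text \<open>By Jensen's inequality the error is an integral over shifts y with |y| <= e, and after
  Tonelli each shift is governed by the translation estimate. The bound is uniform over families of
  bounded energy.\<close>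

lemma avg_approx:
 assumes \<phi>: "C1c \<Omega> \<phi>" and e: "e > 0"
 shows "(LINT x|M. \<bar>avg e (%y. \<phi> (x + y)) - \<phi> x\<bar> powr p) <= e powr p * (LINT x|M. norm (grad \<phi> x) powr p)"
proof -
 let ?V = "measure lborel (cball (0::'a) e)" and ?E = "LINT x|M. norm (grad \<phi> x) powr p"
 let ?A = "%x. avg e (%y. \<phi> (x + y))"
 note V = measure_cball_pos'[OF e, where 'a='a]
 note [measurable] = C1c_borel[OF \<phi>]
 have E0: "?E >= 0" by (auto intro!: lint_nonneg)
 have cA: "continuous_on UNIV (%x. ?A x - \<phi> x)"
  by (intro continuous_on_diff avg_continuous assms C1D(3)[OF C1c_C1[OF \<phi>]])
 have [measurable]: "?A \<in> borel_measurable borel"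
  by (intro borel_measurable_continuous_onI avg_continuous assms)
 have pt: "ennreal (\<bar>?A x - \<phi> x\<bar> powr p * ?V) <= (\<integral>\<^sup>+y. indicator (cball 0 e) y * ennreal (\<bar>\<phi> (x + y) - \<phi> x\<bar> powr p) \<partial>lborel)" for x
  using avg_jensen[OF continuous_on_diff[OF continuous_shift[OF \<phi>, of x] continuous_on_const[of _ "\<phi> x"]] p1 e]
  by (simp add: avg_diff[OF continuous_shift[OF \<phi>] continuous_on_const] avg_const e)
 have "(\<integral>\<^sup>+x. ennreal (\<bar>?A x - \<phi> x\<bar> powr p * ?V) \<partial>M) = (\<integral>\<^sup>+x. ennreal (\<bar>?A x - \<phi> x\<bar> powr p * ?V) * indicator \<Omega> x \<partial>lebesgue)"
  by (subst nn_integral_restrict_space) auto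
 also have "... <= (\<integral>\<^sup>+x. ennreal (\<bar>?A x - \<phi> x\<bar> powr p * ?V) \<partial>lebesgue)"
  by (intro nn_integral_mono) (auto simp: indicator_def)
 also have "... = (\<integral>\<^sup>+x. ennreal (\<bar>?A x - \<phi> x\<bar> powr p * ?V) \<partial>lborel)" by (subst nn_integral_completion) auto
 also have "... <= (\<integral>\<^sup>+x. \<integral>\<^sup>+y. indicator (cball 0 e) y * ennreal (\<bar>\<phi> (x + y) - \<phi> x\<bar> powr p) \<partial>lborel \<partial>lborel)"
  by (intro nn_integral_mono pt)
 also have "... = (\<integral>\<^sup>+y. \<integral>\<^sup>+x. indicator (cball 0 e) y * ennreal (\<bar>\<phi> (x + y) - \<phi> x\<bar> powr p) \<partial>lborel \<partial>lborel)"
 proof (rule nn_integral_swap)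
  have "(%z. \<phi> (fst z + snd z)) \<in> borel_measurable (borel \<Otimes>\<^sub>M borel)"
   "(%z::'a\<times>'a. indicator (cball 0 e) (snd z) :: ennreal) \<in> borel_measurable (borel \<Otimes>\<^sub>M borel)"
   by (rule measurable_compose[OF _ C1c_borel(1)[OF \<phi>]], measurable)
     (rule measurable_compose[OF measurable_snd], simp)
  moreover have "(%z::'a\<times>'a. \<phi> (fst z)) \<in> borel_measurable (borel \<Otimes>\<^sub>M borel)"
   by (rule measurable_compose[OF measurable_fst C1c_borel(1)[OF \<phi>]])
  ultimately show "(%(x, y). indicator (cball 0 e) y * ennreal (\<bar>\<phi> (x + y) - \<phi> x\<bar> powr p)) \<in> borel_measurable (borel \<Otimes>\<^sub>M borel)"
   unfolding split_beta by (intro borel_measurable_times_ennreal) (auto intro!: measurable_compose[OF _ measurable_ennreal])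
 qed
 also have "... = (\<integral>\<^sup>+y. indicator (cball 0 e) y * (\<integral>\<^sup>+x. ennreal (\<bar>\<phi> (x + y) - \<phi> x\<bar> powr p) \<partial>lborel) \<partial>lborel)"
  by (simp add: nn_integral_cmult)
 also have "... <= (\<integral>\<^sup>+y. ennreal (e powr p * ?E) * indicator (cball (0::'a) e) y \<partial>lborel)"
 proof (rule nn_integral_mono)
  fix y :: 'a
  show "indicator (cball 0 e) y * (\<integral>\<^sup>+x. ennreal (\<bar>\<phi> (x + y) - \<phi> x\<bar> powr p) \<partial>lborel) <= ennreal (e powr p * ?E) * indicator (cball 0 e) y"
  proof (cases "y \<in> cball 0 e")
   case True
   have "(\<integral>\<^sup>+x. ennreal (\<bar>\<phi> (x + y) - \<phi> x\<bar> powr p) \<partial>lborel) <= ennreal (norm y powr p * ?E)"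
    by (rule C1c_translation[OF \<phi>])
   also have "... <= ennreal (e powr p * ?E)"
    using True p0 E0 by (intro ennreal_leI mult_right_mono powr_mono2) auto
   finally show ?thesis using True by simp
  qed auto
 qed
 also have "... = ennreal (e powr p * ?E) * emeasure lborel (cball (0::'a) e)"
  by (subst nn_integral_cmult_indicator) auto
 also have "emeasure lborel (cball (0::'a) e) = ennreal ?V"
  by (intro emeasure_eq_ennreal_measure) (use emeasure_bounded_finite[OF bounded_cball, of "0::'a" e] in auto)
 also have "ennreal (e powr p * ?E) * ennreal ?V = ennreal (e powr p * ?E * ?V)" using E0 by (simp add: ennreal_mult)
 finally have *: "(\<integral>\<^sup>+x. ennreal (\<bar>?A x - \<phi> x\<bar> powr p * ?V) \<partial>M) <= ennreal (e powr p * ?E * ?V)" .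
 have mM: "(%x. ?A x - \<phi> x) \<in> BM M" by (rule continuous_meas[OF cA])
 have i: "integrable M (%x. \<bar>?A x - \<phi> x\<bar> powr p * ?V)"
  by (rule integrableI_nonneg) (use mM * V in \<open>auto simp: top.not_eq_extremum intro: order_le_less_trans\<close>)
 have "ennreal (LINT x|M. \<bar>?A x - \<phi> x\<bar> powr p * ?V) <= ennreal (e powr p * ?E * ?V)"
  using * by (subst nn_integral_eq_integral[symmetric, OF i]) auto
 then have "(LINT x|M. \<bar>?A x - \<phi> x\<bar> powr p) * ?V <= e powr p * ?E * ?V"
  using E0 by (subst (asm) ennreal_le_iff) auto
 then show ?thesis using V by simp
qed

text \<open>For each radius the averages are bounded and equicontinuous. A diagonal sequence over
  radii and a countable dense set makes all of them converge pointwise, hence in L^p by domination,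
  and \<open>avg_approx\<close> transfers this to the \<phi> n.\<close>

theorem rellich:
 assumes \<phi>: "!!n. C1c \<Omega> (\<phi> n)" and C: "!!n. (LINT x|M. norm (grad (\<phi> n) x) powr p) <= C"
 obtains r :: "nat => nat" where "strict_mono r" "LPCauchy p M (%n. \<phi> (r n))"
proof -
 obtain PC where PC: "PC > 0" "!!\<phi>. C1c \<Omega> \<phi> ==> (LINT x|M. \<bar>\<phi> x\<bar> powr p) <= PC * (LINT x|M. norm (grad \<phi> x) powr p)"
  using poincare by blast
 have C0: "C >= 0" using C[of 0] by (smt (verit) lint_nonneg powr_ge_zero)
 have PCC: "(LINT x|M. \<bar>\<phi> n x\<bar> powr p) <= PC * C" for n
  using PC(2)[OF \<phi>[of n]] C[of n] PC(1) by (smt (verit) mult_left_mono)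
 define e where "e j = 1 / real (Suc j)" for j
 have e: "e j > 0" for j by (simp add: e_def)
 define V where "V j = measure lborel (cball (0::'a) (e j))" for j
 have V: "V j > 0" for j unfolding V_def by (rule measure_cball_pos'[OF e])
 define A where "A j n x = avg (e j) (%y. \<phi> n (x + y))" for j n x
 define B where "B j = (PC * C / V j) powr (1/p)" for j
 define L where "L j = (C / V j) powr (1/p)" for j
 have root: "t <= s powr (1/p)" if "t powr p <= s" "t >= 0" for s t :: real
 proof -
  have "(t powr p) powr (1/p) <= s powr (1/p)" using that p0 by (intro powr_mono2) auto
  then show ?thesis using that p0 by (simp add: powr_powr)
 qed
 have AB: "\<bar>A j n x\<bar> <= B j" for j n x
  unfolding B_def A_def using avg_bound[OF \<phi>[of n] e[of j], of x] PCC[of n] V[of j]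
  by (intro root) (auto simp: V_def field_simps intro: order_trans)
 have AL: "\<bar>A j n x - A j n x'\<bar> <= norm (x - x') * L j" for j n x x'
 proof -
  have "\<bar>A j n x - A j n x'\<bar> powr p * V j <= norm (x - x') powr p * C"
   using avg_lipschitz[OF \<phi>[of n] e[of j], of x x'] C[of n] unfolding A_def V_def
   by (smt (verit) mult_left_mono powr_ge_zero)
  then have "\<bar>A j n x - A j n x'\<bar> powr p <= norm (x - x') powr p * (C / V j)"
   using V[of j] by (simp add: field_simps)
  then have "\<bar>A j n x - A j n x'\<bar> <= (norm (x - x') powr p * (C / V j)) powr (1/p)"
   by (rule root) auto
  also have "... = (norm (x - x') powr p) powr (1/p) * (C / V j) powr (1/p)"
   by (rule powr_mult)
  also have "... = norm (x - x') * L j" using p1 by (simp add: powr_powr L_def)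
  finally show ?thesis .
 qed
 obtain D :: "'a set" where D: "countable D" "!!X. open X ==> X \<noteq> {} ==> \<exists>d\<in>D. d \<in> X"
  by (erule countable_dense_setE)
 have B0: "B j >= 0" for j by (simp add: B_def)
 obtain r where r: "strict_mono (r::nat=>nat)"
  "!!z. z \<in> (UNIV::nat set) \<times> D ==> \<exists>l. (%n. A (fst z) (r n) (snd z) / (B (fst z) + 1)) ----> l"
 \<comment> \<open>The quotient by \<open>B + 1\<close> gives every pair of radius and point the
   common bound 1.\<close>
 proof (rule function_convergent_subsequence[of "(UNIV::nat set) \<times> D" "%n z. A (fst z) n (snd z) / (B (fst z) + 1)" 1])
  show "norm (A (fst z) n (snd z) / (B (fst z) + 1)) <= 1" for n and z :: "nat \<times> 'a"
   using AB[of "fst z" n "snd z"] B0[of "fst z"] by (simp add: abs_divide)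
 qed (use D in auto)
 have convD: "Cauchy (%n. A j (r n) q)" if q: "q \<in> D" for j q
 proof -
  obtain l where "(%n. A j (r n) q / (B j + 1)) ----> l" using r(2)[of "(j, q)"] q by auto
  then have "(%n. A j (r n) q / (B j + 1) * (B j + 1)) ----> l * (B j + 1)" by (intro tendsto_intros)
  then have "(%n. A j (r n) q) ----> l * (B j + 1)" using B0[of j] by simp
  then show ?thesis by (rule LIMSEQ_imp_Cauchy)
 qed
 have conv: "convergent (%n. A j (r n) x)" for j x
 proof (rule Cauchy_convergent, rule metric_CauchyI)
  fix d :: real assume "d > 0"
  define s where "s = d / (3 * (L j + 1))"
  have L0: "L j >= 0" by (simp add: L_def)
  have s: "s > 0" using \<open>d > 0\<close> L0 by (simp add: s_def)
  obtain q where q: "q \<in> D" "q \<in> ball x s" using D(2)[of "ball x s"] s by auto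
  have "norm (x - q) * L j <= s * (L j + 1)" using q L0 s by (intro mult_mono) (auto simp: dist_norm)
  also have "... = d / 3" using L0 by (simp add: s_def field_simps)
  finally have near: "\<bar>A j n x - A j n q\<bar> <= d/3" for n using AL[of j n x q] by linarith
  obtain N where N: "!!m n. m >= N ==> n >= N ==> dist (A j (r m) q) (A j (r n) q) < d/3"
   using metric_CauchyD[OF convD[OF q(1), of j], of "d/3"] \<open>d > 0\<close> by auto
  have "dist (A j (r m) x) (A j (r n) x) < d" if "m >= N" "n >= N" for m n
   using N[OF that] near[of "r m"] near[of "r n"] unfolding dist_real_def by linarith
  then show "\<exists>N. \<forall>m\<ge>N. \<forall>n\<ge>N. dist (A j (r m) x) (A j (r n) x) < d" by blast
 qed
 define Lim where "Lim j x = lim (%n. A j (r n) x)" for j x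
 have lim: "(%n. A j (r n) x) ----> Lim j x" for j x
  using conv unfolding Lim_def by (simp add: convergent_LIMSEQ_iff)
 have mA: "A j n \<in> BM M" for j n
  unfolding A_def by (intro continuous_meas avg_continuous \<phi> e)
 have mL: "Lim j \<in> BM M" for j
  by (rule borel_measurable_LIMSEQ_real[OF lim mA])
 have dct: "LP p M (Lim j)" "LP p M (A j (r n))" "(%n. LINT x|M. norm (A j (r n) x - Lim j x) powr p) ----> 0" for j n
 proof -
  have bd: "AE x in M. \<forall>n. norm (A j (r n) x) powr p <= B j powr p"
   using AB p0 by (intro AE_I2 allI powr_mono2) auto
  note * = LP_dominated[OF mL[of j] mA[of j "r n" for n] _ bd p0(1)]
  show "LP p M (Lim j)" "LP p M (A j (r n))" "(%n. LINT x|M. norm (A j (r n) x - Lim j x) powr p) ----> 0"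
   by (rule *; use lim in simp)+
 qed
 have LP\<phi>: "LP p M (\<phi> n)" for n by (rule C1c_LP(2)[OF \<phi> p0(2)])
 have app: "(LINT x|M. norm (\<phi> n x - A j n x) powr p) <= e j powr p * C" for j n
 proof -
  have "(LINT x|M. norm (\<phi> n x - A j n x) powr p) <= e j powr p * (LINT x|M. norm (grad (\<phi> n) x) powr p)"
   using avg_approx[OF \<phi>[of n] e[of j]] unfolding A_def by (simp add: abs_minus_commute)
  also have "... <= e j powr p * C" using C[of n] by (intro mult_left_mono) auto
  finally show ?thesis .
 qed
 let ?K = "2 powr p :: real"
 have est: "(LINT x|M. norm (\<phi> (r n) x - Lim j x) powr p) <= ?K * (e j powr p * C + (LINT x|M. norm (A j (r n) x - Lim j x) powr p))" for j n
 proof -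
  have "(LINT x|M. norm (\<phi> (r n) x - Lim j x) powr p) <= (LINT x|M. ?K * (norm (\<phi> (r n) x - A j (r n) x) powr p + norm (A j (r n) x - Lim j x) powr p))"
  proof (rule integral_mono)
   show "norm (\<phi> (r n) x - Lim j x) powr p <= ?K * (norm (\<phi> (r n) x - A j (r n) x) powr p + norm (A j (r n) x - Lim j x) powr p)" for x
    using norm_add_powr_le[OF p0(2), of "\<phi> (r n) x - A j (r n) x" "A j (r n) x - Lim j x"] by simp
  qed (use LP_int[OF LP_diff[OF LP\<phi> dct(1) p0(2)]] LP_int[OF LP_diff[OF LP\<phi> dct(2) p0(2)]] LP_int[OF LP_diff[OF dct(2) dct(1) p0(2)]] in auto)
  also have "... = ?K * ((LINT x|M. norm (\<phi> (r n) x - A j (r n) x) powr p) + (LINT x|M. norm (A j (r n) x - Lim j x) powr p))"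
   using LP_int[OF LP_diff[OF LP\<phi> dct(2) p0(2)]] LP_int[OF LP_diff[OF dct(2) dct(1) p0(2)]] by simp
  also have "... <= ?K * (e j powr p * C + (LINT x|M. norm (A j (r n) x - Lim j x) powr p))"
   by (intro mult_left_mono add_mono app) auto
  finally show ?thesis .
 qed
 have "LPCauchy p M (%n. \<phi> (r n))"
  unfolding LPCauchy_def
 proof (intro allI impI)
  fix d :: real assume d: "d > 0"
  have K: "?K > 0" by simp
  \<comment> \<open>The inequality with constant \<open>2 powr p\<close> is applied twice below,
    which costs 4 times its square; 8 leaves room.\<close>
  define d' where "d' = d / (8 * ?K * ?K)"
  have d': "d' > 0" using d by (simp add: d'_def)
  have "(%j. e j powr p * C) ----> 0 powr p * C"
   unfolding e_def using p0 by (intro tendsto_intros tendsto_powr' LIMSEQ_Suc[OF lim_1_over_n]) auto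
  then have "\<forall>\<^sub>F j in sequentially. e j powr p * C < d'" using p0 d' by (intro order_tendstoD(2)[of _ 0]) auto
  from eventually_happens'[OF sequentially_bot this] obtain j where j: "e j powr p * C < d'" by blast
  obtain N where N: "!!n. n >= N ==> (LINT x|M. norm (A j (r n) x - Lim j x) powr p) < d'"
   using order_tendstoD(2)[OF dct(3)[of j] d'] by (auto simp: eventually_sequentially)
  have 1: "(LINT x|M. norm (\<phi> (r n) x - Lim j x) powr p) < ?K * (d' + d')" if "n >= N" for n
   using est[where j=j and n=n] j N[OF that] K by (smt (verit) mult_strict_left_mono)
  have "(LINT x|M. norm (\<phi> (r m) x - \<phi> (r n) x) powr p) < d" if "m >= N" "n >= N" for m n
  proof -
   have "(LINT x|M. norm (\<phi> (r m) x - \<phi> (r n) x) powr p) <= (LINT x|M. ?K * (norm (\<phi> (r m) x - Lim j x) powr p + norm (\<phi> (r n) x - Lim j x) powr p))"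
   proof (rule integral_mono)
    show "norm (\<phi> (r m) x - \<phi> (r n) x) powr p <= ?K * (norm (\<phi> (r m) x - Lim j x) powr p + norm (\<phi> (r n) x - Lim j x) powr p)" for x
     using norm_diff_powr_le[OF p0(2), of "\<phi> (r m) x - Lim j x" "\<phi> (r n) x - Lim j x"] by simp
   qed (use LP_int[OF LP_diff[OF LP\<phi> dct(1) p0(2)]] LP_int[OF LP_diff[OF LP\<phi> LP\<phi> p0(2)]] in auto)
   also have "... = ?K * ((LINT x|M. norm (\<phi> (r m) x - Lim j x) powr p) + (LINT x|M. norm (\<phi> (r n) x - Lim j x) powr p))"
    using LP_int[OF LP_diff[OF LP\<phi> dct(1) p0(2)]] by simp
   also have "... < ?K * (?K * (d' + d') + ?K * (d' + d'))"
    using 1[OF that(1)] 1[OF that(2)] K by (intro mult_strict_left_mono add_strict_mono) auto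
   also have "... <= d" using d K by (simp add: d'_def field_simps)
   finally show ?thesis .
  qed
  then show "\<exists>N. \<forall>m\<ge>N. \<forall>n\<ge>N. (LINT x|M. norm (\<phi> (r m) x - \<phi> (r n) x) powr p) < d" by blast
 qed
 then show ?thesis using that r(1) by blast
qed

end

text \<open>Iterated midpoints of the tail from n on take the place of convex combinations in
  Mazur's lemma: \<open>cvx_gap\<close> only sees midpoints, and bounds pass to them by rule
  induction.\<close>

inductive mid :: "(nat => 'm => 'b::euclidean_space) => nat => ('m => 'b) => bool" for X n where
 base: "k >= n ==> mid X n (X k)"
| step: "mid X n f ==> mid X n g ==> mid X n (%x. (f x + g x) /\<^sub>R 2)"

lemma mid_mono: "mid X m f ==> n <= m ==> mid X n f"
proof (induction rule: mid.induct)
 case (base k) then show ?case by (intro mid.base) simp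
next
 case (step f g) then show ?case by (intro mid.step)
qed

lemma mid_LP:
 assumes "!!n. LP p M (X n)" "p > 0" "mid X n f" shows "LP p M f"
 using assms(3)
proof (induction rule: mid.induct)
 case (step f g)
 then show ?case using assms by (intro LP_scaleR LP_add) auto
qed (use assms in auto)

lemma half_sum_powr_le:
 fixes a b :: "'b::euclidean_space"
 shows "p > 1 ==> norm ((a + b) /\<^sub>R 2) powr p <= (norm a powr p + norm b powr p) / 2"
 using cvx_gap_nonneg[of p a b] by (simp add: cvx_gap_def)

text \<open>The bound is stated for an affine image of the combination, since it is applied both to
  the combination itself and to the distance of one of its components to a fixed function.\<close>

lemma mid_norm_le:
 fixes X :: "nat => 'm => 'b::euclidean_space" and T :: "'b => 'c::euclidean_space"
 assumes "linear T" and X: "!!n. LP p M (X n)" and u: "LP p M u" and p: "p > 1"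
  and le: "!!k. k >= n ==> (LINT x|M. norm (T (X k x) - u x) powr p) <= C"
  and T: "!!f. LP p M f ==> LP p M (%x. T (f x))" and f: "mid X n f"
 shows "(LINT x|M. norm (T (f x) - u x) powr p) <= C"
 using f
proof (induction rule: mid.induct)
 case (step f g)
 interpret T: linear T by fact
 have fg: "LP p M f" "LP p M g" "LP p M (%x. (f x + g x) /\<^sub>R 2)"
  using mid_LP[OF X _ step.hyps(1)] mid_LP[OF X _ step.hyps(2)] mid_LP[OF X _ mid.step[OF step.hyps]] p by auto
 have i: "integrable M (%x. norm (T (h x) - u x) powr p)" if "LP p M h" for h
  using LP_int[OF LP_diff[OF T[OF that] u]] p by auto
 have "(LINT x|M. norm (T ((f x + g x) /\<^sub>R 2) - u x) powr p)
  <= (LINT x|M. (norm (T (f x) - u x) powr p + norm (T (g x) - u x) powr p) / 2)"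
 proof (rule integral_mono[OF i[OF fg(3)]])
  fix x
  have "T ((f x + g x) /\<^sub>R 2) - u x = ((T (f x) - u x) + (T (g x) - u x)) /\<^sub>R 2"
   by (simp add: T.scaleR T.add algebra_simps scaleR_2[symmetric])
  then show "norm (T ((f x + g x) /\<^sub>R 2) - u x) powr p <= (norm (T (f x) - u x) powr p + norm (T (g x) - u x) powr p) / 2"
   using half_sum_powr_le[OF p] by metis
 qed (use i[OF fg(1)] i[OF fg(2)] in auto)
 also have "... = ((LINT x|M. norm (T (f x) - u x) powr p) + (LINT x|M. norm (T (g x) - u x) powr p)) / 2"
  using i[OF fg(1)] i[OF fg(2)] by simp
 also have "... <= C" using step.IH by simp
 finally show ?case .
qed (use le in auto)

lemma LP_zero: "LP p M (%x. 0)" by (simp add: LP_def)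

lemma half_less: "a < c ==> b < c ==> (a + b) / 2 < (c::real)" by simp

text \<open>The infima of the energy J over the midpoint hulls of the tails increase and are bounded
  by C. Two near minimisers have a midpoint in an earlier hull, whose energy is at least the infimum
  there; so their convexity gap is small, and they form a Cauchy sequence.\<close>

lemma mazur:
 fixes X :: "nat => 'm => 'b::euclidean_space"
 assumes X: "!!n. LP p M (X n)" and C: "!!n. (LINT x|M. norm (X n x) powr p) <= C" and p: "p > 1"
 shows "\<exists>F Y. (\<forall>n. mid X n (F n)) \<and> LP p M Y \<and> (%n. LINT x|M. norm (F n x - Y x) powr p) ----> 0"
proof -
 define J where "J f = (LINT x|M. norm (f x) powr p)" for f :: "'m => 'b"
 have J0: "J f >= 0" for f unfolding J_def by (intro lint_nonneg) auto
 define I where "I n = Inf (J ` {f. mid X n f})" for n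
 have ne: "J ` {f. mid X n f} \<noteq> {}" for n using mid.base[of n n X] by auto
 have bdd: "bdd_below (J ` {f. mid X n f})" for n using J0 by (auto intro: bdd_belowI[of _ 0])
 have I_le: "I n <= J f" if "mid X n f" for n f
  unfolding I_def by (rule cInf_lower[OF _ bdd]) (use that in auto)
 have JC: "J f <= C" if "mid X n f" for n f
 proof -
  have "linear (%x::'b. x)" by (rule linear_id[unfolded id_def])
  from mid_norm_le[OF this X LP_zero p, where n=n and C=C and f=f] show ?thesis using C that by (simp add: J_def)
 qed
 have "incseq I"
 proof (rule incseq_SucI)
  show "I n <= I (Suc n)" for n
   unfolding I_def[of "Suc n"] by (rule cInf_greatest[OF ne]) (auto intro!: I_le mid_mono[of X "Suc n" _ n])
 qed
 moreover have IC: "I n <= C" for n using I_le[of n] JC[of n] mid.base[of n n X] by (meson order_trans order_refl)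
 ultimately obtain L where L: "I ----> L" "!!n. I n <= L"
  using incseq_convergent[of I C] by auto
 have "\<exists>f. mid X n f \<and> J f < I n + 1 / real (Suc n)" for n
  using cInf_lessD[OF ne, of n "I n + 1 / real (Suc n)"] unfolding I_def by auto
 then obtain F where F: "!!n. mid X n (F n)" "!!n. J (F n) < I n + 1 / real (Suc n)" by metis
 have FLP: "LP p M (F n)" for n using mid_LP[OF X _ F(1)] p by auto
 have "LPCauchy p M F"
 proof (rule cvx_gap_Cauchy[OF FLP p])
  show "(LINT x|M. norm (F n x) powr p) <= C" for n using JC[OF F(1)] unfolding J_def .
  fix e :: real assume "e > 0"
  have "(%n. L - I n + 1 / real (Suc n)) ----> L - L + 0"
   by (intro tendsto_intros L LIMSEQ_Suc[OF lim_1_over_n])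
  then have "\<forall>\<^sub>F n in sequentially. L - I n + 1 / real (Suc n) < e" using \<open>e > 0\<close> by (intro order_tendstoD) auto
  from eventually_happens'[OF sequentially_bot this] obtain N where N: "L - I N + 1 / real (Suc N) < e" by blast
  have "(LINT x|M. cvx_gap p (F m x) (F n x)) < e" if "m >= N" "n >= N" for m n
  proof -
   have m: "mid X N (F m)" "mid X N (F n)" using F(1) mid_mono that by metis+
   have mLP: "LP p M (%x. (F m x + F n x) /\<^sub>R 2)" using mid_LP[OF X _ mid.step[OF m]] p by auto
   have "(LINT x|M. cvx_gap p (F m x) (F n x)) = (J (F m) + J (F n)) / 2 - J (%x. (F m x + F n x) /\<^sub>R 2)"
    unfolding cvx_gap_def J_def using LP_int[OF FLP] LP_int[OF mLP] by simp
   moreover have "I N <= J (%x. (F m x + F n x) /\<^sub>R 2)" by (rule I_le[OF mid.step[OF m]])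
   ultimately have 1: "(LINT x|M. cvx_gap p (F m x) (F n x)) <= (J (F m) + J (F n)) / 2 - I N" by simp
   have le: "J (F k) < L + 1 / real (Suc N)" if "k >= N" for k
   proof -
    have "1 / real (Suc k) <= 1 / real (Suc N)" using that by (simp add: field_simps)
    then show ?thesis using F(2)[of k] L(2)[of k] by linarith
   qed
   have "(J (F m) + J (F n)) / 2 < L + 1 / real (Suc N)"         by (rule half_less) (use le[OF that(1)] le[OF that(2)] in auto)
   then show ?thesis using 1 N by linarith
  qed
  then show "\<exists>N. \<forall>m\<ge>N. \<forall>n\<ge>N. (LINT x|M. cvx_gap p (F m x) (F n x)) < e" by blast
 qed
 from LP_complete[OF FLP this] p obtain Y where "LP p M Y" "(%n. LINT x|M. norm (F n x - Y x) powr p) ----> 0" by auto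
 then show ?thesis using F(1) by blast
qed

lemma fast_subseq:
 fixes a :: "nat => real"
 assumes "a ----> 0" obtains s :: "nat => nat" where "strict_mono s" "!!n. a (s n) <= (1/2)^n"
proof -
 have "\<exists>N. \<forall>n\<ge>N. a n < (1/2)^k" for k :: nat
  using order_tendstoD(2)[OF assms, of "(1/2)^k"] by (auto simp: eventually_sequentially)
 then obtain N where N: "!!k n. n >= N k ==> a n < (1/2)^k" by metis
 define s where "s k = (\<Sum>j\<le>k. N j) + k" for k
 have "strict_mono s" by (rule strict_monoI_Suc) (simp add: s_def)
 moreover have "a (s n) <= (1/2)^n" for n
 proof -
  have "N n <= (\<Sum>j\<le>n. N j)" by (rule member_le_sum) auto
  then have "N n <= s n" unfolding s_def by linarith
  then show ?thesis using N[of n "s n"] by linarith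
 qed
 ultimately show ?thesis using that by blast
qed

section \<open>The space W of jets\<close>

context dom
begin

text \<open>The p-th power of the L^p distance, without the root; hence the constant
  \<open>2 powr p\<close> in \<open>dst_triangle\<close>.\<close>

definition dst :: "('a => 'b::euclidean_space) => ('a => 'b) => real" where
 "dst X Y = (LINT x|M. norm (X x - Y x) powr p)"

lemma dst_nonneg: "dst X Y >= 0"
 unfolding dst_def by (intro lint_nonneg) auto

lemma dst_commute: "dst X Y = dst Y X"
 unfolding dst_def by (simp add: norm_minus_commute)

lemma dst_triangle:
 assumes "LP p M X" "LP p M Y" "LP p M Z"
 shows "dst X Z <= 2 powr p * (dst X Y + dst Y Z)"
proof -
 note i = LP_int[OF LP_diff[OF assms(1) assms(2) p0(2)]] LP_int[OF LP_diff[OF assms(2) assms(3) p0(2)]]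
  LP_int[OF LP_diff[OF assms(1) assms(3) p0(2)]]
 have "dst X Z <= (LINT x|M. 2 powr p * (norm (X x - Y x) powr p + norm (Y x - Z x) powr p))"
  unfolding dst_def
 proof (rule integral_mono[OF i(3)])
  show "norm (X x - Z x) powr p <= 2 powr p * (norm (X x - Y x) powr p + norm (Y x - Z x) powr p)" for x
   using norm_add_powr_le[OF p0(2), of "X x - Y x" "Y x - Z x"] by simp
 qed (use i in auto)
 also have "... = 2 powr p * (dst X Y + dst Y Z)" unfolding dst_def using i by simp
 finally show ?thesis .
qed

lemma dst_fst_snd_le:
 assumes "LP p M X" "LP p M Y"
 shows "dst (%x. fst (X x)) (%x. fst (Y x)) <= dst X Y" "dst (%x. snd (X x)) (%x. snd (Y x)) <= dst X Y"
proof -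
 note i = LP_int[OF LP_diff[OF assms p0(2)]]
  LP_int[OF LP_diff[OF LP_fst[OF assms(1) p0(2)] LP_fst[OF assms(2) p0(2)] p0(2)]]
  LP_int[OF LP_diff[OF LP_snd[OF assms(1) p0(2)] LP_snd[OF assms(2) p0(2)] p0(2)]]
 show "dst (%x. fst (X x)) (%x. fst (Y x)) <= dst X Y" unfolding dst_def
  by (intro integral_mono i powr_mono2) (use norm_fst_snd_le(1)[of "X x - Y x" for x] p0 in auto)
 show "dst (%x. snd (X x)) (%x. snd (Y x)) <= dst X Y" unfolding dst_def
  by (intro integral_mono i powr_mono2) (use norm_fst_snd_le(2)[of "X x - Y x" for x] p0 in auto)
qed

lemma dst_zero_AE: assumes "LP p M X" "LP p M Y" "dst X Y = 0" shows "AE x in M. X x = Y x"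
proof -
 have "AE x in M. norm (X x - Y x) powr p = 0"
  using integral_nonneg_eq_0_iff_AE[OF LP_int[OF LP_diff[OF assms(1,2) p0(2)]]] assms(3) by (auto simp: dst_def)
 then show ?thesis by eventually_elim simp
qed

text \<open>An element carries its gradient as second component. That the gradient is determined by
  the function is a theorem, \<open>W_unique\<close>.\<close>

definition W :: "('a => real \<times> 'a) set" where
 "W = {X. LP p M X \<and> (\<forall>e>0. \<exists>\<phi>. C1c \<Omega> \<phi> \<and> dst (jet \<phi>) X < e)}"

lemma W_LP: "X \<in> W ==> LP p M X" by (simp add: W_def)

lemma jet_LP: "C1c \<Omega> \<phi> ==> LP p M (jet \<phi>)" by (rule C1c_LP(1)[OF _ p0(2)])

lemma jet_W: "C1c \<Omega> \<phi> ==> jet \<phi> \<in> W"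
 using p0 by (auto simp: W_def jet_LP dst_def intro!: exI[of _ \<phi>])

lemma W_closed:
 assumes "!!n. Xs n \<in> W" "LP p M X" "(%n. dst (Xs n) X) ----> 0" shows "X \<in> W"
 unfolding W_def
proof (intro CollectI conjI allI impI assms(2))
 fix e :: real assume "e > 0"
 define d where "d = e / (2 * 2 powr p)"
 have "d > 0" using \<open>e > 0\<close> by (simp add: d_def)
 from eventually_happens'[OF sequentially_bot order_tendstoD(2)[OF assms(3) this]]
 obtain n where n: "dst (Xs n) X < d" by blast
 obtain \<phi> where \<phi>: "C1c \<Omega> \<phi>" "dst (jet \<phi>) (Xs n) < d" using assms(1)[of n] \<open>d > 0\<close> unfolding W_def by blast
 have "dst (jet \<phi>) X <= 2 powr p * (dst (jet \<phi>) (Xs n) + dst (Xs n) X)"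
  by (rule dst_triangle[OF jet_LP[OF \<phi>(1)] W_LP[OF assms(1)] assms(2)])
 also have "... < 2 powr p * (d + d)" using n \<phi> by (intro mult_strict_left_mono) auto
 also have "... = e" by (simp add: d_def)
 finally show "\<exists>\<phi>. C1c \<Omega> \<phi> \<and> dst (jet \<phi>) X < e" using \<phi> by blast
qed

text \<open>Dominated convergence of jets is the working criterion for membership in W.\<close>

lemma W_dominated:
 assumes "!!n. C1c \<Omega> (\<phi> n)" "Y \<in> BM M" "integrable M g"
  "AE x in M. \<forall>n. norm (jet (\<phi> n) x) powr p <= g x" "AE x in M. (%n. jet (\<phi> n) x) ----> Y x"
 shows "Y \<in> W" "(%n. dst (jet (\<phi> n)) Y) ----> 0"
proof -
 have m: "jet (\<phi> n) \<in> BM M" for n using LP_meas[OF jet_LP[OF assms(1)]] .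
 note * = LP_dominated[OF assms(2) m assms(3,4) p0(1) assms(5)]
 show 1: "(%n. dst (jet (\<phi> n)) Y) ----> 0" unfolding dst_def by (rule *(3))
 show "Y \<in> W" by (rule W_closed[OF jet_W[OF assms(1)] *(1) 1])
qed

text \<open>Closure properties of W are proved by applying the operation to such test functions:
  geometric speed supplies the a.e. limit and the majorant that \<open>W_dominated\<close> asks
  for.\<close>

lemma W_fast:
 assumes "X \<in> W"
 shows "\<exists>\<phi> Y. (\<forall>n. C1c \<Omega> (\<phi> n)) \<and> (\<forall>n. dst (jet (\<phi> n)) X <= (1/2)^n) \<and> (AE x in M. (%n. jet (\<phi> n) x) ----> X x)
   \<and> integrable M Y \<and> (AE x in M. \<forall>n. norm (jet (\<phi> n) x) powr p <= Y x)"
proof -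
 have "\<exists>\<phi>. C1c \<Omega> \<phi> \<and> dst (jet \<phi>) X < (1/2)^n" for n :: nat using assms unfolding W_def by simp
 then obtain \<phi> where \<phi>: "!!n. C1c \<Omega> (\<phi> n)" "!!n. dst (jet (\<phi> n)) X < (1/2)^n" by metis
 then have le: "!!n. dst (jet (\<phi> n)) X <= (1/2)^n" by (simp add: less_imp_le)
 note F = LP_fast[OF jet_LP[OF \<phi>(1)] W_LP[OF assms] le[unfolded dst_def] p0(1)]
 show ?thesis using \<phi>(1) le F by blast
qed

lemma W_mid:
 assumes "X \<in> W" "Y \<in> W" shows "(%x. (X x + Y x) /\<^sub>R 2) \<in> W"
proof -
 obtain \<phi> g where "\<forall>n. C1c \<Omega> (\<phi> n)" "AE x in M. (%n. jet (\<phi> n) x) ----> X x" "integrable M g"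
  "AE x in M. \<forall>n. norm (jet (\<phi> n) x) powr p <= g x" using W_fast[OF assms(1)] by blast
  note \<phi> = this[rule_format]
 obtain \<psi> h where "\<forall>n. C1c \<Omega> (\<psi> n)" "AE x in M. (%n. jet (\<psi> n) x) ----> Y x" "integrable M h"
  "AE x in M. \<forall>n. norm (jet (\<psi> n) x) powr p <= h x" using W_fast[OF assms(2)] by blast
  note \<psi> = this[rule_format]
 define \<zeta> where "\<zeta> n = (%x. 1/2 * \<phi> n x + 1/2 * \<psi> n x)" for n
 have c: "C1c \<Omega> (\<zeta> n)" for n unfolding \<zeta>_def by (intro C1c_add C1c_scale \<phi> \<psi>)
 have j: "jet (\<zeta> n) x = (jet (\<phi> n) x + jet (\<psi> n) x) /\<^sub>R 2" for n x
  using C1_add(2)[OF C1_scale(1)[OF C1c_C1[OF \<phi>(1)[of n]], of "1/2"] C1_scale(1)[OF C1c_C1[OF \<psi>(1)[of n]], of "1/2"]]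
   C1_scale(2)[OF C1c_C1[OF \<phi>(1)[of n]], of "1/2"] C1_scale(2)[OF C1c_C1[OF \<psi>(1)[of n]], of "1/2"]
  by (simp add: \<zeta>_def jet_def algebra_simps)
 show ?thesis
 proof (rule W_dominated(1)[OF c])
  show "(%x. (X x + Y x) /\<^sub>R 2) \<in> BM M"
   using LP_meas[OF W_LP[OF assms(1)]] LP_meas[OF W_LP[OF assms(2)]] by auto
  show "integrable M (%x. (g x + h x) / 2)" using \<phi> \<psi> by auto
  show "AE x in M. \<forall>n. norm (jet (\<zeta> n) x) powr p <= (g x + h x) / 2" using \<phi>(4) \<psi>(4)
  proof eventually_elim
   case (elim x)
   show ?case
   proof
    fix n
    have "norm (jet (\<zeta> n) x) powr p <= (norm (jet (\<phi> n) x) powr p + norm (jet (\<psi> n) x) powr p) / 2"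
     unfolding j by (rule half_sum_powr_le[OF p1])
    also have "... <= (g x + h x) / 2" using elim by (intro divide_right_mono add_mono) auto
    finally show "norm (jet (\<zeta> n) x) powr p <= (g x + h x) / 2" .
   qed
  qed
  show "AE x in M. (%n. jet (\<zeta> n) x) ----> (X x + Y x) /\<^sub>R 2" using \<phi>(2) \<psi>(2)
   unfolding j by eventually_elim (intro tendsto_intros)
 qed
qed

lemma mid_W: assumes "!!n. X n \<in> W" "mid X n f" shows "f \<in> W"
 using assms(2)
proof (induction rule: mid.induct)
 case (step f g) then show ?case by (intro W_mid)
qed (rule assms)

lemma jet_bounded_C1c: "C1c \<Omega> \<psi> ==> \<exists>B>0. \<forall>x. \<bar>\<psi> x\<bar> <= B \<and> norm (grad \<psi> x) <= B"
 using C1c_bounded by blast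

lemma W_weak:
 assumes "X \<in> W" "C1c \<Omega> \<psi>"
 shows "(LINT x|M. fst (X x) *\<^sub>R grad \<psi> x) = - (LINT x|M. \<psi> x *\<^sub>R snd (X x))"
proof -
 obtain \<phi> g where "\<forall>n. C1c \<Omega> (\<phi> n)" "AE x in M. (%n. jet (\<phi> n) x) ----> X x" "integrable M g"
  "AE x in M. \<forall>n. norm (jet (\<phi> n) x) powr p <= g x" using W_fast[OF assms(1)] by blast
  note \<phi> = this[rule_format]
 obtain B where B: "B > 0" "!!x. \<bar>\<psi> x\<bar> <= B" "!!x. norm (grad \<psi> x) <= B" using jet_bounded_C1c[OF assms(2)] by metis
 have [measurable]: "\<psi> \<in> BM M" "grad \<psi> \<in> BM M"
  using C1c_LP[OF assms(2) p0(2)] by (auto simp: LP_def)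
 have [measurable]: "\<phi> n \<in> BM M" "grad (\<phi> n) \<in> BM M" for n
  using C1c_LP[OF \<phi>(1) p0(2)] by (auto simp: LP_def)
 have [measurable]: "(%x. fst (X x)) \<in> BM M" "(%x. snd (X x)) \<in> BM M"
  using borel_measurable_fst_snd[OF LP_meas[OF W_LP[OF assms(1)]]] by auto
 have bd: "AE x in M. \<forall>n. norm (jet (\<phi> n) x) <= 1 + g x" using \<phi>(4)
 proof eventually_elim
  case (elim x)
  show ?case
  proof
   fix n
   show "norm (jet (\<phi> n) x) <= 1 + g x"
    using le_one_plus_powr[OF p0(3) norm_ge_zero, of "jet (\<phi> n) x"] elim[rule_format, of n] by linarith
  qed
 qed
 have wi: "integrable M (%x. B * (1 + g x))" using \<phi>(3) by auto
 have 1: "(%n. LINT x|M. \<phi> n x *\<^sub>R grad \<psi> x) ----> (LINT x|M. fst (X x) *\<^sub>R grad \<psi> x)"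
 proof (rule integral_dominated_convergence[OF _ _ wi])
  show "AE x in M. (%n. \<phi> n x *\<^sub>R grad \<psi> x) ----> fst (X x) *\<^sub>R grad \<psi> x"
   using \<phi>(2)
  proof eventually_elim
   case (elim x) show ?case using tendsto_scaleR[OF tendsto_fst[OF elim] tendsto_const, of "grad \<psi> x"] by simp
  qed
  show "AE x in M. norm (\<phi> n x *\<^sub>R grad \<psi> x) <= B * (1 + g x)" for n using bd
  proof eventually_elim
   case (elim x)
   have "\<bar>\<phi> n x\<bar> <= 1 + g x" using elim[rule_format, of n] norm_fst_snd_le(1)[of "jet (\<phi> n) x"] by auto
   then have "norm (grad \<psi> x) * \<bar>\<phi> n x\<bar> <= B * (1 + g x)" using B by (intro mult_mono) (auto intro: less_imp_le)
   then show ?case by (simp add: mult.commute)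
  qed
 qed measurable
 have 2: "(%n. LINT x|M. \<psi> x *\<^sub>R grad (\<phi> n) x) ----> (LINT x|M. \<psi> x *\<^sub>R snd (X x))"
 proof (rule integral_dominated_convergence[OF _ _ wi])
  show "AE x in M. (%n. \<psi> x *\<^sub>R grad (\<phi> n) x) ----> \<psi> x *\<^sub>R snd (X x)"
   using \<phi>(2)
  proof eventually_elim
   case (elim x) show ?case using tendsto_scaleR[OF tendsto_const tendsto_snd[OF elim], of "\<psi> x"] by simp
  qed
  show "AE x in M. norm (\<psi> x *\<^sub>R grad (\<phi> n) x) <= B * (1 + g x)" for n using bd
  proof eventually_elim
   case (elim x)
   have "norm (grad (\<phi> n) x) <= 1 + g x" using elim[rule_format, of n] norm_fst_snd_le(2)[of "jet (\<phi> n) x"] by auto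
   then have "\<bar>\<psi> x\<bar> * norm (grad (\<phi> n) x) <= B * (1 + g x)" using B by (intro mult_mono) (auto intro: less_imp_le)
   then show ?case by simp
  qed
 qed measurable
 have "(%n. LINT x|M. \<phi> n x *\<^sub>R grad \<psi> x) ----> - (LINT x|M. \<psi> x *\<^sub>R snd (X x))"
  using tendsto_minus[OF 2] C1c_ibp[OF \<phi>(1) assms(2)] by simp
 then show ?thesis using LIMSEQ_unique[OF 1] by blast
qed

lemma W_poincare:
 "\<exists>C>0. \<forall>X\<in>W. (LINT x|M. \<bar>fst (X x)\<bar> powr p) <= C * (LINT x|M. norm (snd (X x)) powr p)"
proof -
 obtain C where C: "C > 0" "!!\<phi>. C1c \<Omega> \<phi> ==> (LINT x|M. \<bar>\<phi> x\<bar> powr p) <= C * (LINT x|M. norm (grad \<phi> x) powr p)"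
  using poincare by blast
 have "(LINT x|M. \<bar>fst (X x)\<bar> powr p) <= C * (LINT x|M. norm (snd (X x)) powr p)" if "X \<in> W" for X
 proof -
  obtain \<phi> g where "\<forall>n. C1c \<Omega> (\<phi> n)" "AE x in M. (%n. jet (\<phi> n) x) ----> X x" "integrable M g"
   "AE x in M. \<forall>n. norm (jet (\<phi> n) x) powr p <= g x" using W_fast[OF \<open>X \<in> W\<close>] by blast
  note \<phi> = this[rule_format]
  \<comment> \<open>Any continuous T that does not increase norms is allowed, so that both
    projections are covered at once.\<close>
  have T: "(%n. LINT x|M. norm (T (jet (\<phi> n) x)) powr p) ----> (LINT x|M. norm (T (X x)) powr p)"
   if T: "continuous_on UNIV T" "!!z. norm (T z) <= norm z" for T :: "real \<times> 'a => 'c::euclidean_space"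
  proof (rule integral_dominated_convergence[OF _ _ \<phi>(3)])
   show "AE x in M. (%n. norm (T (jet (\<phi> n) x)) powr p) ----> norm (T (X x)) powr p" using \<phi>(2)
   proof eventually_elim
    case (elim x)
    have "(%n. T (jet (\<phi> n) x)) ----> T (X x)" by (rule continuous_on_tendsto_compose[OF T(1) elim]) auto
    then show ?case using p0 by (intro tendsto_powr' tendsto_norm) auto
   qed
   show "AE x in M. norm (norm (T (jet (\<phi> n) x)) powr p) <= g x" for n using \<phi>(4)
   proof eventually_elim
    case (elim x)
    have "norm (T (jet (\<phi> n) x)) powr p <= norm (jet (\<phi> n) x) powr p"
     by (rule powr_mono2[OF p0(2) norm_ge_zero T(2)])
    also have "... <= g x" using elim by blast
    finally show ?case by simp
   qed
   show "(%x. norm (T (X x)) powr p) \<in> BM M"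
    using borel_measurable_continuous_on[OF T(1) LP_meas[OF W_LP[OF \<open>X \<in> W\<close>]]] by measurable
   show "(%x. norm (T (jet (\<phi> n) x)) powr p) \<in> BM M" for n
    using borel_measurable_continuous_on[OF T(1) LP_meas[OF jet_LP[OF \<phi>(1)[of n]]]] by measurable
  qed
  have "(%n. LINT x|M. \<bar>\<phi> n x\<bar> powr p) ----> (LINT x|M. \<bar>fst (X x)\<bar> powr p)"
   using T[OF continuous_on_fst[OF continuous_on_id] norm_fst_snd_le(1)] by simp
  moreover have "(%n. C * (LINT x|M. norm (grad (\<phi> n) x) powr p)) ----> C * (LINT x|M. norm (snd (X x)) powr p)"
   using tendsto_mult_left[OF T[OF continuous_on_snd[OF continuous_on_id] norm_fst_snd_le(2)]] by simp
  ultimately show ?thesis by (rule LIMSEQ_le) (use C(2)[OF \<phi>(1)] in auto)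
 qed
 then show ?thesis using C(1) by blast
qed

text \<open>U is a countable union of balls. Sums of their bumps, composed with the saturation
  \<open>T k\<close>, converge boundedly to the indicator of U.\<close>

lemma integral_open_zero:
 assumes G: "integrable M G" and z: "!!\<psi>. C1c \<Omega> \<psi> ==> (LINT x|M. \<psi> x * G x) = 0"
  and U: "open U" "U \<subseteq> \<Omega>"
 shows "(LINT x|M. indicator U x * G x) = 0"
proof (cases "U = {}")
 case False
 define F where "F = {(c, r). r > 0 \<and> cball c r \<subseteq> U}"
 have UF: "U = (\<Union>z\<in>F. ball (fst z) (snd z))"
 proof
  show "U \<subseteq> (\<Union>z\<in>F. ball (fst z) (snd z))"
  proof
   fix x assume "x \<in> U"
   then obtain e where "e > 0" "cball x e \<subseteq> U" using U(1) open_contains_cball by blast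
   then show "x \<in> (\<Union>z\<in>F. ball (fst z) (snd z))" unfolding F_def by (intro UN_I[of "(x, e)"]) auto
  qed
  show "(\<Union>z\<in>F. ball (fst z) (snd z)) \<subseteq> U" unfolding F_def using ball_subset_cball by fastforce
 qed
 obtain F' where F': "F' \<subseteq> (%z. ball (fst z) (snd z)) ` F" "countable F'" "\<Union>F' = U"
  using Lindelof[of "(%z. ball (fst z) (snd z)) ` F"] UF by auto
 have "F' \<noteq> {}" using F' False by auto
 define b where "b n = from_nat_into F' n" for n
 have bF: "b n \<in> F'" for n unfolding b_def by (rule from_nat_into[OF \<open>F' \<noteq> {}\<close>])
 then have "\<exists>z. z \<in> F \<and> b n = ball (fst z) (snd z)" for n using F'(1) by blast
 then obtain z where z': "!!n. z n \<in> F" "!!n. b n = ball (fst (z n)) (snd (z n))" by metis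
 have zr: "snd (z n) > 0" "cball (fst (z n)) (snd (z n)) \<subseteq> \<Omega>" for n using z'(1)[of n] U(2) unfolding F_def by auto
 have Ub: "x \<in> U \<longleftrightarrow> (\<exists>n. x \<in> b n)" for x
 proof
  assume "x \<in> U"
  then obtain S where "S \<in> F'" "x \<in> S" using F' by auto
  then show "\<exists>n. x \<in> b n" unfolding b_def using from_nat_into_surj[OF F'(2)] by metis
 qed (use F'(3) bF in auto)
 define \<beta> where "\<beta> n = ball_bump (fst (z n)) (snd (z n))" for n
 define \<psi> where "\<psi> k x = (\<Sum>n<k. 1 * \<beta> n x)" for k :: nat and x
 have C\<psi>: "C1c \<Omega> (\<psi> k)" for k unfolding \<psi>_def \<beta>_def by (intro C1c_sum(1) C1c_ball_bump zr)
 \<comment> \<open>\<open>T k\<close> is C^1, vanishes at 0 and takes values in [0, 1]; as k grows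
   it tends to 1 wherever its argument stays away from 0.\<close>
 define T where "T k s = real k * s\<^sup>2 / (1 + real k * s\<^sup>2)" for k :: nat and s
 define T' where "T' k s = 2 * real k * s / (1 + real k * s\<^sup>2)\<^sup>2" for k :: nat and s
 have pos: "1 + real k * s\<^sup>2 > 0" for k s by (simp add: add_pos_nonneg)
 have dT: "(T k has_field_derivative T' k s) (at s)" for k s
  unfolding T_def T'_def using pos[of k s]
  by (auto intro!: derivative_eq_intros simp: field_simps power2_eq_square)
 have cT: "continuous_on UNIV (T' k)" for k
  unfolding T'_def using pos by (intro continuous_intros) (auto simp: less_imp_neq[symmetric])
 define \<eta> where "\<eta> k x = T k (\<psi> k x)" for k x
 have C\<eta>: "C1c \<Omega> (\<eta> k)" for k
  unfolding \<eta>_def by (rule C1c_dom[OF C1_compose(1)[OF C1c_C1[OF C\<psi>[of k]] dT cT] C\<psi>[of k]]) (simp add: T_def)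
 have [measurable]: "\<eta> k \<in> BM M" for k using C1c_LP(2)[OF C\<eta> p0(2)] by (auto simp: LP_def)
 have [measurable]: "G \<in> BM M" using G by auto
 have [measurable]: "(%x. indicator U x * G x) \<in> BM M"
  by (intro borel_measurable_times borel_measurable_indicator) (use U open_dom in \<open>auto simp: sets_restrict_space_iff\<close>)
 have T01: "0 <= T k s" "T k s <= 1" for k s using pos[of k s] by (auto simp: T_def)
 have conv: "(%k. \<eta> k x) ----> indicator U x" for x
 proof (cases "x \<in> U")
  case True
  then obtain m where m: "x \<in> b m" using Ub by auto
  then have c: "\<beta> m x > 0" using ball_bump_pos_iff[OF zr(1)[of m], of "fst (z m)" x] z'(2) by (simp add: \<beta>_def)
  define c where "c = (\<beta> m x)\<^sup>2"
  have "c > 0" using c by (simp add: c_def)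
  have ge: "(\<psi> k x)\<^sup>2 >= c" if "k > m" for k
  proof -
   have "\<beta> m x <= \<psi> k x" unfolding \<psi>_def using that member_le_sum[of m "{..<k}" "%n. \<beta> n x"]
    by (auto simp: \<beta>_def ball_bump_nonneg)
   then show ?thesis unfolding c_def using c by (intro power_mono) auto
  qed
  have "(%k. 1 - 1 / (1 + real k * c)) ----> 1 - 0"
  proof (intro tendsto_intros tendsto_divide_0[OF tendsto_const] filterlim_at_top_imp_at_infinity)
   show "filterlim (%k. 1 + real k * c) at_top sequentially"
    by (intro filterlim_tendsto_add_at_top[OF tendsto_const] filterlim_at_top_mult_tendsto_pos[OF tendsto_const \<open>c > 0\<close>] filterlim_real_sequentially)
  qed
  then have l: "(%k. 1 - 1 / (1 + real k * c)) ----> 1" by simp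
  have "(%k. \<eta> k x) ----> 1"
  proof (rule real_tendsto_sandwich[OF _ _ l tendsto_const])
   show "\<forall>\<^sub>F k in sequentially. 1 - 1 / (1 + real k * c) <= \<eta> k x"
    using eventually_gt_at_top[of m]
   proof eventually_elim
    case (elim k)
    have "T k (\<psi> k x) = 1 - 1 / (1 + real k * (\<psi> k x)\<^sup>2)" using pos[of k "\<psi> k x"] by (simp add: T_def field_simps)
    moreover have "1 / (1 + real k * (\<psi> k x)\<^sup>2) <= 1 / (1 + real k * c)"
     using ge[OF elim] \<open>c > 0\<close> by (intro divide_left_mono add_left_mono mult_left_mono mult_pos_pos add_pos_nonneg) auto
    ultimately show ?case by (simp add: \<eta>_def)
   qed
   show "\<forall>\<^sub>F k in sequentially. \<eta> k x <= 1" using T01 by (simp add: \<eta>_def)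
  qed
  then show ?thesis using True by simp
 next
  case False
  then have "\<beta> n x = 0" for n using Ub z'(2) ball_bump_pos_iff[OF zr(1)] ball_bump_nonneg \<beta>_def by (metis order_less_le)
  then show ?thesis using False by (simp add: \<eta>_def \<psi>_def T_def)
 qed
 have "(%k. LINT x|M. \<eta> k x * G x) ----> (LINT x|M. indicator U x * G x)"
 proof (rule integral_dominated_convergence[where w="%x. \<bar>G x\<bar>"])
  show "AE x in M. norm (\<eta> k x * G x) <= \<bar>G x\<bar>" for k
   using T01 by (intro AE_I2) (auto simp: \<eta>_def abs_mult intro: mult_left_le_one_le)
  show "AE x in M. (%k. \<eta> k x * G x) ----> indicator U x * G x"
   by (intro AE_I2 tendsto_intros conv)
 qed (use G in auto)
 then have "(%k. 0) ----> (LINT x|M. indicator U x * G x)" using z[OF C\<eta>] by simp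
 then show ?thesis using LIMSEQ_unique tendsto_const by metis
qed auto

text \<open>By outer regularity S is, up to a null set, the decreasing limit of the open sets
  \<open>U n\<close>, to which the previous lemma applies.\<close>

lemma integral_measurable_zero:
 assumes G: "integrable M G" and z: "!!\<psi>. C1c \<Omega> \<psi> ==> (LINT x|M. \<psi> x * G x) = 0"
  and S: "S \<in> sets lebesgue" "S \<subseteq> \<Omega>"
 shows "(LINT x|M. indicator S x * G x) = 0"
proof -
 have "\<exists>T. open T \<and> S \<subseteq> T \<and> T - S \<in> lmeasurable \<and> emeasure lebesgue (T - S) < ennreal ((1/2)^n)" for n :: nat
  using sets_lebesgue_outer_open[OF S(1), of "(1/2)^n"] by (metis half_gt_zero_iff zero_less_one zero_less_power)
 then obtain T where T: "!!n. open (T n)" "!!n. S \<subseteq> T n" "!!n. emeasure lebesgue (T n - S) < ennreal ((1/2)^n)" by metis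
 define U where "U n = \<Omega> \<inter> (\<Inter>i\<le>n. T i)" for n :: nat
 define C where "C = \<Omega> \<inter> (\<Inter>i. T i)"
 have oU: "open (U n)" for n unfolding U_def using T(1) open_dom by (intro open_Int open_INT) auto
 have Ts: "T n \<in> sets lebesgue" for n using T(1) by auto
 have Cs: "C \<in> sets lebesgue" unfolding C_def using Ts by (intro sets.Int) auto
 have [measurable]: "G \<in> BM M" using G by auto
 have m: "(%x. indicator A x * G x) \<in> BM M" if "A \<in> sets lebesgue" "A \<subseteq> \<Omega>" for A
  using that by (intro borel_measurable_times borel_measurable_indicator) (auto simp: sets_restrict_space_iff)
 have "(%n. LINT x|M. indicator (U n) x * G x) ----> (LINT x|M. indicator C x * G x)"
 proof (rule integral_dominated_convergence[where w="%x. \<bar>G x\<bar>"])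
  have "(%n. indicator (U n) x :: real) ----> indicator C x" for x
  proof (cases "x \<in> C")
   case True
   then have "x \<in> U n" for n by (auto simp: C_def U_def)
   then show ?thesis using True by simp
  next
   case False
   show ?thesis
   proof (rule tendsto_eventually)
    show "\<forall>\<^sub>F n in sequentially. indicator (U n) x = (indicator C x :: real)"
    proof (cases "x \<in> \<Omega>")
     case True
     then obtain i where i: "x \<notin> T i" using False by (auto simp: C_def)
     show ?thesis using eventually_ge_at_top[of i]
      by eventually_elim (use i False in \<open>auto simp: U_def indicator_def\<close>)
    qed (auto simp: U_def C_def)
   qed
  qed
  then show "AE x in M. (%n. indicator (U n) x * G x) ----> indicator C x * G x"
   by (intro AE_I2 tendsto_intros)
  show "(%x. indicator C x * G x) \<in> BM M" using Cs by (intro m) (auto simp: C_def)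
  show "(%x. indicator (U n) x * G x) \<in> BM M" for n
   using oU by (intro m) (auto simp: U_def)
  show "AE x in M. norm (indicator (U n) x * G x) <= \<bar>G x\<bar>" for n
   by (intro AE_I2) (auto simp: indicator_def)
 qed (use G in auto)
 moreover have "(LINT x|M. indicator (U n) x * G x) = 0" for n
  by (rule integral_open_zero[OF G z oU]) (auto simp: U_def)
 ultimately have "(%n. 0) ----> (LINT x|M. indicator C x * G x)" by simp
 then have C0: "(LINT x|M. indicator C x * G x) = 0" using LIMSEQ_unique tendsto_const by metis
 have SC: "S \<subseteq> C" using S T(2) by (auto simp: C_def)
 have "emeasure lebesgue (C - S) <= ennreal ((1/2)^n)" for n
 proof -
  have "emeasure lebesgue (C - S) <= emeasure lebesgue (T n - S)"
   using Ts S by (intro emeasure_mono) (auto simp: C_def)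
  then show ?thesis using T(3)[of n] by order
 qed
 moreover have "(%n. ennreal ((1/2)^n)) ----> ennreal 0"
  by (intro tendsto_ennrealI LIMSEQ_realpow_zero) auto
 ultimately have "emeasure lebesgue (C - S) <= 0"
  by (intro LIMSEQ_le_const[of "%n. ennreal ((1/2)^n)"]) auto
 then have null: "C - S \<in> null_sets lebesgue" using Cs S by (auto simp: null_sets_def)
 have "AE x in lebesgue. x \<notin> C - S" by (rule AE_not_in[OF null])
 then have "AE x in M. x \<notin> C - S" by (subst AE_restrict_space_iff) auto
 then have "AE x in M. indicator S x * G x = indicator C x * G x"
  by eventually_elim (use SC in \<open>auto simp: indicator_def\<close>)
 then have "(LINT x|M. indicator S x * G x) = (LINT x|M. indicator C x * G x)"
  using m[OF S] m[OF Cs] by (intro integral_cong_AE) (auto simp: C_def)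
 then show ?thesis using C0 by simp
qed

text \<open>Integrating over the set where G is positive gives G <= 0 a.e.; the same applies to
  -G.\<close>

lemma du_Bois_Reymond:
 assumes G: "integrable M G" and z: "!!\<psi>. C1c \<Omega> \<psi> ==> (LINT x|M. \<psi> x * G x) = 0"
 shows "AE x in M. G x = (0::real)"
proof -
 have pos: "AE x in M. G x <= 0" if G: "integrable M G" and z: "!!\<psi>. C1c \<Omega> \<psi> ==> (LINT x|M. \<psi> x * G x) = 0" for G :: "'a => real"
 proof -
  define S where "S = {x \<in> space M. G x > 0}"
  have "S \<in> sets M" unfolding S_def using G by measurable
  then have S: "S \<in> sets lebesgue" "S \<subseteq> \<Omega>" "S \<in> sets M" by (auto simp: sets_restrict_space_iff)
  have i: "integrable M (%x. indicator S x * G x)"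
   using integrable_real_mult_indicator[OF S(3) G] by (simp add: mult.commute)
  have "(LINT x|M. indicator S x * G x) = 0" by (rule integral_measurable_zero[OF G z S(1,2)])
  then have "AE x in M. indicator S x * G x = 0"
   by (subst (asm) integral_nonneg_eq_0_iff_AE[OF i]) (auto simp: S_def indicator_def)
  then show ?thesis
  proof (rule AE_mp, intro AE_I2 impI)
   fix x assume "x \<in> space M" "indicator S x * G x = 0"
   then show "G x <= 0" by (cases "x \<in> S") (auto simp: S_def)
  qed
 qed
 have "AE x in M. G x <= 0" by (rule pos[OF G z])
 moreover have "AE x in M. - G x <= 0" by (rule pos) (use G z in auto)
 ultimately show ?thesis by eventually_elim auto
qed

text \<open>Both second components are weak gradients of the same function, so the fundamental lemma
  of the calculus of variations applies in every direction. This identifies weak limits and yields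
  \<open>gradient_zero_on_level\<close>.\<close>

lemma W_unique:
 assumes "X \<in> W" "Y \<in> W" "AE x in M. fst (X x) = fst (Y x)"
 shows "AE x in M. snd (X x) = snd (Y x)"
proof -
 have LX: "LP p M (%x. snd (X x))" "LP p M (%x. snd (Y x))" "LP p M (%x. fst (X x))" "LP p M (%x. fst (Y x))"
  using LP_snd LP_fst W_LP assms p0 by blast+
 have iX: "integrable M (%x. snd (X x))" "integrable M (%x. snd (Y x))" using LX LP_integrable p0 by blast+
 have "AE x in M. (snd (X x) - snd (Y x)) \<bullet> b = 0" for b
 proof (rule du_Bois_Reymond)
  show "integrable M (%x. (snd (X x) - snd (Y x)) \<bullet> b)" using iX by auto
  fix \<psi> assume \<psi>: "C1c \<Omega> \<psi>"
  obtain B where B: "B > 0" "!!x. \<bar>\<psi> x\<bar> <= B" using jet_bounded_C1c[OF \<psi>] by metis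
  have m\<psi>: "\<psi> \<in> BM M" using C1c_LP(2)[OF \<psi> p0(2)] by (auto simp: LP_def)
  have i: "integrable M (%x. \<psi> x *\<^sub>R snd (X x))" "integrable M (%x. \<psi> x *\<^sub>R snd (Y x))"
   using LP_integrable[OF LP_mult_bounded[OF LX(1) m\<psi> B(2) p0(2)] p0(3)]
    LP_integrable[OF LP_mult_bounded[OF LX(2) m\<psi> B(2) p0(2)] p0(3)] by auto
  have "(LINT x|M. fst (X x) *\<^sub>R grad \<psi> x) = (LINT x|M. fst (Y x) *\<^sub>R grad \<psi> x)"
   using assms(3) LX C1c_LP(3)[OF \<psi> p0(2)] by (intro integral_cong_AE) (auto simp: LP_def)
  then have "(LINT x|M. \<psi> x *\<^sub>R snd (X x)) = (LINT x|M. \<psi> x *\<^sub>R snd (Y x))"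
   using W_weak[OF assms(1) \<psi>] W_weak[OF assms(2) \<psi>] by simp
  then have "(LINT x|M. \<psi> x *\<^sub>R snd (X x) - \<psi> x *\<^sub>R snd (Y x)) = 0" using i by simp
  then have "(LINT x|M. (\<psi> x *\<^sub>R snd (X x) - \<psi> x *\<^sub>R snd (Y x)) \<bullet> b) = 0" using i by (subst integral_inner_left) auto
  then show "(LINT x|M. \<psi> x * ((snd (X x) - snd (Y x)) \<bullet> b)) = 0" by (simp add: algebra_simps)
 qed
 then have "AE x in M. \<forall>b\<in>Basis. (snd (X x) - snd (Y x)) \<bullet> b = 0" by (intro AE_finite_allI) auto
 then show ?thesis
 proof eventually_elim
  case (elim x)
  show ?case by (rule euclidean_eqI) (use elim in \<open>simp add: inner_diff_left\<close>)
 qed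
qed

end

section \<open>Weak convergence of gradients and compactness in W\<close>

context dom
begin

definition q where "q = p / (p - 1)"

lemma q1: "q = p / (p - 1)" "q > 1" "q > 0" "q >= 0" "q >= 1"
 using p1 by (auto simp: q_def field_simps)

lemma inner_int: "LP q M Z ==> LP p M V ==> integrable M (%x. Z x \<bullet> V x)"
 using LP_inner_integrable(1)[OF _ _ p1 q1(1)] .

lemma inner_dst_limit:
 assumes "LP q M Z" "!!n. LP p M (F n)" "LP p M Y" "(%n. dst (F n) Y) ----> 0"
 shows "(%n. LINT x|M. Z x \<bullet> F n x) ----> (LINT x|M. Z x \<bullet> Y x)"
proof -
 have D: "LP p M (%x. F n x - Y x)" for n using assms p0 by (intro LP_diff) auto
 have "(%n. LINT x|M. Z x \<bullet> (F n x - Y x)) ----> 0"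
 proof (rule tendsto_zero_approxI)
  fix e :: real assume "e > 0"
  define C where "C = (LINT x|M. norm (Z x) powr q)"
  have C0: "C >= 0" unfolding C_def by (intro lint_nonneg) auto
  define t where "t = (e / (C + 1)) powr (- 1 / q)"
  have t: "t > 0" "t powr (- q) = e / (C + 1)" using \<open>e > 0\<close> C0 q1(3) by (auto simp: t_def powr_powr)
  have tC: "t powr (- q) * C <= e" unfolding t(2) using C0 \<open>e > 0\<close> by (simp add: pos_divide_le_eq distrib_left)
  have "\<bar>LINT x|M. Z x \<bullet> (F n x - Y x)\<bar> <= t powr p * dst (F n) Y + e" for n
   using LP_inner_bound[OF assms(1) D p1 q1(1) t(1), of n] tC unfolding dst_def C_def by linarith
  moreover have "(%n. t powr p * dst (F n) Y) ----> t powr p * 0" by (intro tendsto_intros assms)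
  ultimately show "\<exists>b. b ----> 0 \<and> (\<forall>\<^sub>F n in sequentially. \<bar>LINT x|M. Z x \<bullet> (F n x - Y x)\<bar> <= b n + e)"
   by (intro exI[of _ "%n. t powr p * dst (F n) Y"]) auto
 qed
 moreover have "(LINT x|M. Z x \<bullet> (F n x - Y x)) = (LINT x|M. Z x \<bullet> F n x) - (LINT x|M. Z x \<bullet> Y x)" for n
  using inner_int[OF assms(1) assms(2)[of n]] inner_int[OF assms(1) assms(3)] by (simp add: inner_diff_right)
 ultimately show ?thesis by (simp add: LIM_zero_iff)
qed

lemma mid_inner_ge:
 assumes X: "!!n. X n \<in> W" and Z: "LP q M Z" and "!!k. k >= n ==> (LINT x|M. Z x \<bullet> snd (X k x)) >= c" and "mid X n f"
 shows "(LINT x|M. Z x \<bullet> snd (f x)) >= c"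
 using assms(4)
proof (induction rule: mid.induct)
 case (step f g)
 have fg: "LP p M (%x. snd (f x))" "LP p M (%x. snd (g x))"
  using W_LP[OF mid_W[OF X step.hyps(1)]] W_LP[OF mid_W[OF X step.hyps(2)]] LP_snd p0 by blast+
 have "(LINT x|M. Z x \<bullet> snd ((f x + g x) /\<^sub>R 2)) = (LINT x|M. (Z x \<bullet> snd (f x) + Z x \<bullet> snd (g x)) / 2)"
  by (intro Bochner_Integration.integral_cong) (auto simp: inner_add_right field_simps)
 also have "... = ((LINT x|M. Z x \<bullet> snd (f x)) + (LINT x|M. Z x \<bullet> snd (g x))) / 2"
  using inner_int[OF Z fg(1)] inner_int[OF Z fg(2)] by simp
 finally show ?case using step.IH by simp
qed (use assms(3) in auto)

text \<open>The midpoints supplied by \<open>mazur\<close> converge strongly, so their limit stays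
  in W. Their first components stay as close to u as those of the tail, which identifies the first
  component of the limit.\<close>

lemma weak_limit_exists:
 assumes X: "!!n. X n \<in> W" and C: "!!n. (LINT x|M. norm (X n x) powr p) <= C"
  and u: "LP p M u" and conv: "(%n. dst (%x. fst (X n x)) u) ----> 0"
 shows "\<exists>F Y. (\<forall>n. mid X n (F n)) \<and> Y \<in> W \<and> (%n. dst (F n) Y) ----> 0 \<and> (AE x in M. fst (Y x) = u x)"
proof -
 obtain F Y where F': "\<forall>n. mid X n (F n)" and Y: "LP p M Y" "(%n. dst (F n) Y) ----> 0"
  using mazur[of p M X, OF W_LP[OF X] C p1] unfolding dst_def by blast
 note F = F'[rule_format]
 have FW: "F n \<in> W" for n by (rule mid_W[OF X F])
 have YW: "Y \<in> W" by (rule W_closed[OF FW Y])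
 have "dst (%x. fst (Y x)) u <= 0"
 proof (rule LIMSEQ_le_const)
  have "(%n. dst (%x. fst (F n x)) u) ----> 0"
  proof (rule LIMSEQ_I)
   fix e :: real assume "e > 0"
   then obtain N where N: "!!n. n >= N ==> dst (%x. fst (X n x)) u < e/2"
    using order_tendstoD(2)[OF conv, of "e/2"] by (auto simp: eventually_sequentially)
   have le: "dst (%x. fst (F n x)) u <= e/2" if "n >= N" for n
    unfolding dst_def
   proof (rule mid_norm_le[where T=fst and X=X and n=n and p=p])
    show "linear fst" by (rule linear_fst)
    show "(LINT x|M. norm (fst (X k x) - u x) powr p) <= e/2" if "k >= n" for k
     using N[of k] \<open>k >= n\<close> \<open>n >= N\<close> by (simp add: dst_def less_imp_le)
   qed (use W_LP[OF X] u p1 F LP_fst[OF _ p0(2)] in auto)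
   show "\<exists>no. \<forall>n\<ge>no. norm (dst (%x. fst (F n x)) u - 0) < e"
   proof (intro exI[of _ N] allI impI)
    fix n assume "n >= N"
    from le[OF this] show "norm (dst (%x. fst (F n x)) u - 0) < e"
     using \<open>e > 0\<close> dst_nonneg[of "%x. fst (F n x)" u] unfolding real_norm_def by linarith
   qed
  qed
  then have "(%n. 2 powr p * (dst (F n) Y + dst (%x. fst (F n x)) u)) ----> 2 powr p * (0 + 0)"
   by (intro tendsto_intros Y)
  then show "(%n. 2 powr p * (dst (F n) Y + dst (%x. fst (F n x)) u)) ----> 0" by simp
  have "dst (%x. fst (Y x)) u <= 2 powr p * (dst (F n) Y + dst (%x. fst (F n x)) u)" for n
  proof -
   have "dst (%x. fst (Y x)) u <= 2 powr p * (dst (%x. fst (Y x)) (%x. fst (F n x)) + dst (%x. fst (F n x)) u)"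
    by (intro dst_triangle LP_fst Y u W_LP[OF FW] p0)
   also have "dst (%x. fst (Y x)) (%x. fst (F n x)) <= dst (F n) Y"
    using dst_fst_snd_le(1)[OF W_LP[OF FW] Y(1)] by (simp add: dst_commute)
   finally show ?thesis by simp
  qed
  then show "\<exists>N. \<forall>n\<ge>N. dst (%x. fst (Y x)) u <= 2 powr p * (dst (F n) Y + dst (%x. fst (F n x)) u)" by blast
 qed
 then have "dst (%x. fst (Y x)) u = 0" using dst_nonneg[of "%x. fst (Y x)" u] by linarith
 then have "AE x in M. fst (Y x) = u x" by (intro dst_zero_AE LP_fst Y u p0)
 then show ?thesis using F YW Y(2) by blast
qed

text \<open>If the pairings exceeded the limit by e infinitely often, so would those of all
  midpoints along that subsequence. But suitable midpoints converge strongly to an element of W with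
  the same function, hence, by \<open>W_unique\<close>, with the same gradient.\<close>

lemma weak_conv_aux:
 assumes X: "!!n. X n \<in> W" and C: "!!n. (LINT x|M. norm (X n x) powr p) <= C"
  and Y: "Y \<in> W" and conv: "(%n. dst (%x. fst (X n x)) (%x. fst (Y x))) ----> 0" and Z: "LP q M Z" and e: "e > 0"
 shows "finite {n. (LINT x|M. Z x \<bullet> snd (X n x)) >= (LINT x|M. Z x \<bullet> snd (Y x)) + e}"
proof (rule ccontr)
 assume "infinite {n. (LINT x|M. Z x \<bullet> snd (X n x)) >= (LINT x|M. Z x \<bullet> snd (Y x)) + e}"
 from infinite_enumerate[OF this] obtain r :: "nat => nat" where r': "strict_mono r"
  "\<forall>n. r n \<in> {n. (LINT x|M. Z x \<bullet> snd (X n x)) >= (LINT x|M. Z x \<bullet> snd (Y x)) + e}" by blast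
 have r: "strict_mono r" "!!n. (LINT x|M. Z x \<bullet> snd (X (r n) x)) >= (LINT x|M. Z x \<bullet> snd (Y x)) + e"
  using r' by auto
 have c: "(%n. dst (%x. fst (X (r n) x)) (%x. fst (Y x))) ----> 0"
  using LIMSEQ_subseq_LIMSEQ[OF conv r(1)] by (simp add: o_def)
 obtain F Y' where F: "\<forall>n. mid (%n. X (r n)) n (F n)" "Y' \<in> W" "(%n. dst (F n) Y') ----> 0"
  "AE x in M. fst (Y' x) = fst (Y x)"
  using weak_limit_exists[OF X C LP_fst[OF W_LP[OF Y] p0(2)] c] by blast
 have FW: "F n \<in> W" for n using mid_W[OF X] F(1) by blast
 have "(%n. dst (%x. snd (F n x)) (%x. snd (Y' x))) ----> 0"
 proof (rule real_tendsto_sandwich[OF _ _ tendsto_const F(3)])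
  show "\<forall>\<^sub>F n in sequentially. 0 <= dst (%x. snd (F n x)) (%x. snd (Y' x))" by (simp add: dst_nonneg)
  show "\<forall>\<^sub>F n in sequentially. dst (%x. snd (F n x)) (%x. snd (Y' x)) <= dst (F n) Y'"
   by (simp add: dst_fst_snd_le(2)[OF W_LP[OF FW] W_LP[OF F(2)]])
 qed
 then have "(%n. LINT x|M. Z x \<bullet> snd (F n x)) ----> (LINT x|M. Z x \<bullet> snd (Y' x))"
  by (intro inner_dst_limit Z LP_snd W_LP FW F p0)
 moreover have "(LINT x|M. Z x \<bullet> snd (F n x)) >= (LINT x|M. Z x \<bullet> snd (Y x)) + e" for n
  by (rule mid_inner_ge[of "%n. X (r n)", OF X Z r(2)]) (use F in blast)
 ultimately have "(LINT x|M. Z x \<bullet> snd (Y' x)) >= (LINT x|M. Z x \<bullet> snd (Y x)) + e"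
  by (intro LIMSEQ_le_const[of _ _ "(LINT x|M. Z x \<bullet> snd (Y x)) + e"]) auto
 moreover have "(LINT x|M. Z x \<bullet> snd (Y' x)) = (LINT x|M. Z x \<bullet> snd (Y x))"
 proof (rule integral_cong_AE)
  show "AE x in M. Z x \<bullet> snd (Y' x) = Z x \<bullet> snd (Y x)" using W_unique[OF F(2) Y F(4)]
   by eventually_elim simp
 qed (use LP_meas[OF Z] LP_meas[OF LP_snd[OF W_LP[OF Y] p0(2)]] LP_meas[OF LP_snd[OF W_LP[OF F(2)] p0(2)]] in auto)
 ultimately show False using e by simp
qed

lemma weak_conv:
 assumes X: "!!n. X n \<in> W" and C: "!!n. (LINT x|M. norm (X n x) powr p) <= C"
  and Y: "Y \<in> W" and conv: "(%n. dst (%x. fst (X n x)) (%x. fst (Y x))) ----> 0" and Z: "LP q M Z"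
 shows "(%n. LINT x|M. Z x \<bullet> (snd (X n x) - snd (Y x))) ----> 0"
proof (rule LIMSEQ_I)
 fix e :: real assume e: "e > 0"
 let ?L = "LINT x|M. Z x \<bullet> snd (Y x)" and ?l = "%n. LINT x|M. Z x \<bullet> snd (X n x)"
 have Z': "LP q M (%x. - Z x)" using Z by (simp add: LP_def)
 have f1: "finite {n. ?l n >= ?L + e}" by (rule weak_conv_aux[OF X C Y conv Z e])
 have f2: "finite {n. - ?l n >= - ?L + e}" using weak_conv_aux[OF X C Y conv Z' e] by simp
 have "\<forall>\<^sub>F n in sequentially. n \<notin> {n. ?l n >= ?L + e}" "\<forall>\<^sub>F n in sequentially. n \<notin> {n. - ?l n >= - ?L + e}"
  using f1 f2 by (auto simp: cofinite_eq_sequentially[symmetric] eventually_cofinite)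
 then have "\<forall>\<^sub>F n in sequentially. norm ((LINT x|M. Z x \<bullet> (snd (X n x) - snd (Y x))) - 0) < e"
 proof eventually_elim
  case (elim n)
  have "(LINT x|M. Z x \<bullet> (snd (X n x) - snd (Y x))) = ?l n - ?L"
   using inner_int[OF Z LP_snd[OF W_LP[OF X] p0(2), of n]] inner_int[OF Z LP_snd[OF W_LP[OF Y] p0(2)]]
   by (simp add: inner_diff_right)
  then show ?case using elim by auto
 qed
 then show "\<exists>no. \<forall>n\<ge>no. norm ((LINT x|M. Z x \<bullet> (snd (X n x) - snd (Y x))) - 0) < e"
  by (simp add: eventually_sequentially)
qed

lemma W_norm_bound:
 "\<exists>K>0. \<forall>X\<in>W. (LINT x|M. norm (X x) powr p) <= K * (LINT x|M. norm (snd (X x)) powr p)"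
proof -
 obtain C where C: "C > 0" "!!X. X \<in> W ==> (LINT x|M. \<bar>fst (X x)\<bar> powr p) <= C * (LINT x|M. norm (snd (X x)) powr p)"
  using W_poincare by blast
 have "(LINT x|M. norm (X x) powr p) <= 2 powr p * (C + 1) * (LINT x|M. norm (snd (X x)) powr p)" if X: "X \<in> W" for X
 proof -
  note i = LP_int[OF W_LP[OF X]] LP_int[OF LP_fst[OF W_LP[OF X] p0(2)]] LP_int[OF LP_snd[OF W_LP[OF X] p0(2)]]
  have "(LINT x|M. norm (X x) powr p) <= (LINT x|M. 2 powr p * (norm (fst (X x)) powr p + norm (snd (X x)) powr p))"
  proof (rule integral_mono[OF i(1)])
   show "norm (X x) powr p <= 2 powr p * (norm (fst (X x)) powr p + norm (snd (X x)) powr p)" for x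
    using norm_Pair_powr_le[OF p0(2), of "fst (X x)" "snd (X x)"] by simp
  qed (use i in auto)
  also have "... = 2 powr p * ((LINT x|M. norm (fst (X x)) powr p) + (LINT x|M. norm (snd (X x)) powr p))"
   using i by simp
  also have "... <= 2 powr p * (C * (LINT x|M. norm (snd (X x)) powr p) + (LINT x|M. norm (snd (X x)) powr p))"
   using C(2)[OF X] by (intro mult_left_mono add_right_mono) auto
  finally show ?thesis by (simp add: algebra_simps)
 qed
 moreover have "2 powr p * (C + 1) > 0" using C by simp
 ultimately show ?thesis by blast
qed

text \<open>Besides Rellich compactness this packages the consequences that are used in the two limit
  passages: the functions converge almost everywhere with an integrable majorant and the gradients
  converge weakly.\<close>

theorem W_compact:
 assumes X: "!!n. X n \<in> W" and C: "!!n. (LINT x|M. norm (snd (X n x)) powr p) <= C"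
 obtains r Y g where "strict_mono (r::nat=>nat)" "Y \<in> W" "integrable M g"
   "AE x in M. (%n. fst (X (r n) x)) ----> fst (Y x)"
   "AE x in M. \<forall>n. \<bar>fst (X (r n) x)\<bar> powr p <= g x"
   "\<forall>Z. LP q M Z --> (%n. LINT x|M. Z x \<bullet> (snd (X (r n) x) - snd (Y x))) ----> 0"
proof -
 obtain K where K: "K > 0" "!!X. X \<in> W ==> (LINT x|M. norm (X x) powr p) <= K * (LINT x|M. norm (snd (X x)) powr p)"
  using W_norm_bound by blast
 have XC: "(LINT x|M. norm (X n x) powr p) <= K * C" for n
  using order_trans[OF K(2)[OF X[of n]] mult_left_mono[OF C[of n]]] K(1) by simp
 \<comment> \<open>\<open>rellich\<close> speaks of test functions, so X n is replaced by one at
   distance below (1/2)^n, an error that vanishes in the limit.\<close>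
 have "\<exists>\<phi>. C1c \<Omega> \<phi> \<and> dst (jet \<phi>) (X n) < (1/2)^n" for n using X[of n] unfolding W_def by simp
 then obtain \<phi> where \<phi>: "!!n. C1c \<Omega> (\<phi> n)" "!!n. dst (jet (\<phi> n)) (X n) < (1/2)^n" by metis
 have E: "(LINT x|M. norm (grad (\<phi> n) x) powr p) <= 2 powr p * (1 + C)" for n
 proof -
  have "dst (%x. grad (\<phi> n) x) (%x. 0) <= 2 powr p * (dst (%x. grad (\<phi> n) x) (%x. snd (X n x)) + dst (%x. snd (X n x)) (%x. 0))"
   by (intro dst_triangle LP_zero LP_snd W_LP X p0 C1c_LP(3) \<phi>)
  also have "dst (%x. grad (\<phi> n) x) (%x. snd (X n x)) <= (1/2)^n"
   using dst_fst_snd_le(2)[OF jet_LP[OF \<phi>(1)] W_LP[OF X], of n n] \<phi>(2)[of n] by simp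
  also have "(1/2)^n <= (1::real)" by (simp add: power_le_one)
  finally have "dst (%x. grad (\<phi> n) x) (%x. 0) <= 2 powr p * (1 + dst (%x. snd (X n x)) (%x. 0))" by simp
  also have "dst (%x. snd (X n x)) (%x. 0) <= C" using C[of n] by (simp add: dst_def)
  finally show ?thesis by (simp add: dst_def)
 qed
 obtain r where r: "strict_mono (r::nat=>nat)" "LPCauchy p M (%n. \<phi> (r n))"
  by (rule rellich[OF \<phi>(1) E])
 have L\<phi>: "LP p M (\<phi> n)" for n by (rule C1c_LP(2)[OF \<phi>(1) p0(2)])
 obtain u where u: "LP p M u" "(%n. dst (\<phi> (r n)) u) ----> 0"
  using LP_complete[OF L\<phi> r(2) p0(1)] unfolding dst_def by blast
 have LX: "LP p M (%x. fst (X n x))" for n by (intro LP_fst W_LP X p0)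
 have c1: "(%n. dst (%x. fst (X (r n) x)) u) ----> 0"
 proof (rule real_tendsto_sandwich[of "%n. 0" _ _ "%n. 2 powr p * ((1/2)^(r n) + dst (\<phi> (r n)) u)"])
  show "\<forall>\<^sub>F n in sequentially. dst (%x. fst (X (r n) x)) u <= 2 powr p * ((1/2)^(r n) + dst (\<phi> (r n)) u)"
  proof (intro always_eventually allI)
   fix n
   have "dst (%x. fst (X (r n) x)) (\<phi> (r n)) <= (1/2)^(r n)"
    using dst_fst_snd_le(1)[OF jet_LP[OF \<phi>(1)] W_LP[OF X], of "r n" "r n"] \<phi>(2)[of "r n"] by (simp add: dst_commute)
   then show "dst (%x. fst (X (r n) x)) u <= 2 powr p * ((1/2)^(r n) + dst (\<phi> (r n)) u)"
    using dst_triangle[OF LX L\<phi> u(1), of "r n" "r n"] by (smt (verit) mult_left_mono powr_ge_zero)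
  qed
  have "(%n. (1/2::real)^(r n)) ----> 0"
   using LIMSEQ_subseq_LIMSEQ[OF LIMSEQ_realpow_zero[of "1/2"] r(1)] by (simp add: o_def)
  then show "(%n. 2 powr p * ((1/2)^(r n) + dst (\<phi> (r n)) u)) ----> 0"
   using tendsto_mult[OF tendsto_const tendsto_add[OF _ u(2)], of "%n. (1/2)^(r n)" 0 "2 powr p"] by simp
 qed (simp_all add: dst_nonneg)
 obtain s where s: "strict_mono s" "!!n. dst (%x. fst (X (r (s n)) x)) u <= (1/2)^n"
  using fast_subseq[OF c1] by metis
 have rs: "strict_mono (%n. r (s n))" using strict_mono_o[OF r(1) s(1)] by (simp add: o_def)
 have c2: "(%n. dst (%x. fst (X (r (s n)) x)) u) ----> 0"
  using LIMSEQ_subseq_LIMSEQ[OF c1 s(1)] by (simp add: o_def)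
 obtain F Y where Y: "Y \<in> W" "AE x in M. fst (Y x) = u x"
  using weak_limit_exists[OF X XC u(1) c2] by blast
 have LY: "LP p M (%x. fst (Y x))" by (intro LP_fst W_LP Y p0)
 have du: "dst (%x. fst (X n x)) u = dst (%x. fst (X n x)) (%x. fst (Y x))" for n
  unfolding dst_def
 proof (rule integral_cong_AE)
  show "AE x in M. norm (fst (X n x) - u x) powr p = norm (fst (X n x) - fst (Y x)) powr p"
   using Y(2) by eventually_elim simp
 qed (use LP_meas[OF LX] LP_meas[OF u(1)] LP_meas[OF LY] in auto)
 have c3: "(%n. dst (%x. fst (X (r (s n)) x)) (%x. fst (Y x))) ----> 0" using c2 unfolding du .
 have s2: "(LINT x|M. norm (fst (X (r (s n)) x) - fst (Y x)) powr p) <= (1/2)^n" for n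
  using s(2)[of n] unfolding du unfolding dst_def .
 note fast = LP_fast[of p M "%n x. fst (X (r (s n)) x)", OF LX LY s2 p0(1)]
 obtain g where g: "integrable M g" "AE x in M. \<forall>n. norm (fst (X (r (s n)) x)) powr p <= g x" using fast(2) by blast
 have wk: "(%n. LINT x|M. Z x \<bullet> (snd (X (r (s n)) x) - snd (Y x))) ----> 0" if "LP q M Z" for Z
  by (rule weak_conv[OF X XC Y(1) c3 that])
 show ?thesis
  by (rule that[of "%n. r (s n)" Y g]) (use rs Y(1) g fast(1) wk in simp_all)
qed

end

section \<open>Leray-Lions operators\<close>

text \<open>By monotonicity along the segment from \<open>\<zeta>\<close> to \<open>\<xi>\<close> it suffices to bound the increment from
  below at distance exactly \<open>\<epsilon>\<close>, which is a compact situation; no growth condition is needed.\<close>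

lemma monotone_gradient_converges:
 fixes A :: "real \<times> 'a::euclidean_space => 'a"
 assumes cont: "continuous_on UNIV A"
  and mono: "!!s \<xi> \<xi>'. \<xi> \<noteq> \<xi>' ==> (A (s, \<xi>) - A (s, \<xi>')) \<bullet> (\<xi> - \<xi>') > 0"
  and s: "sn ----> s" and z: "\<zeta>n ----> \<zeta>"
  and D: "(%n. (A (sn n, \<xi>n n) - A (sn n, \<zeta>n n)) \<bullet> (\<xi>n n - \<zeta>n n)) ----> (0::real)"
 shows "\<xi>n ----> \<zeta>"
proof -
 let ?f = "%z. (A (fst z, snd (snd z)) - A (fst z, fst (snd z))) \<bullet> (snd (snd z) - fst (snd z))"
 have cA: "continuous_on UNIV (%z::real\<times>'a\<times>'a. A (fst z, g z))" if "continuous_on UNIV g" for g :: "real\<times>'a\<times>'a => 'a"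
  by (rule continuous_on_compose2[OF cont]) (use that in \<open>auto intro!: continuous_on_Pair continuous_on_fst continuous_on_id\<close>)
 have cf: "continuous_on UNIV ?f"
  by (intro continuous_on_inner continuous_on_diff cA continuous_on_fst continuous_on_snd continuous_on_id)
 have "(%n. \<xi>n n - \<zeta>n n) ----> 0"
 proof (rule LIMSEQ_I)
  fix e :: real assume e: "e > 0"
  define K where "K = cball s 1 \<times> {w. norm (fst w - \<zeta>) <= 1 \<and> norm (snd w - fst w) = e}"
  have "closed {w::'a\<times>'a. norm (fst w - \<zeta>) <= 1 \<and> norm (snd w - fst w) = e}"
   unfolding Collect_conj_eq
   by (intro closed_Int closed_Collect_le closed_Collect_eq continuous_on_norm continuous_on_diff
     continuous_on_fst continuous_on_snd continuous_on_id continuous_on_const)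
  moreover have "bounded {w::'a\<times>'a. norm (fst w - \<zeta>) <= 1 \<and> norm (snd w - fst w) = e}"
   unfolding bounded_iff
  proof (intro exI[of _ "2 * (norm \<zeta> + 1) + e"] ballI)
   fix w :: "'a \<times> 'a" assume "w \<in> {w. norm (fst w - \<zeta>) <= 1 \<and> norm (snd w - fst w) = e}"
   then have "norm (fst w) <= norm \<zeta> + 1" "norm (snd w) <= norm \<zeta> + 1 + e"
    using norm_triangle_sub[of "fst w" \<zeta>] norm_triangle_sub[of "snd w" "fst w"] by auto
   then show "norm w <= 2 * (norm \<zeta> + 1) + e" using norm_Pair_le[of "fst w" "snd w"] by simp
  qed
  ultimately have K: "compact K" unfolding K_def by (intro compact_Times) (auto simp: compact_eq_bounded_closed)
  have pos: "?f w > 0" if "w \<in> K" for w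
   using that e by (intro mono) (auto simp: K_def)
  obtain m where m: "m > 0" "!!w. w \<in> K ==> ?f w >= m"
  proof (cases "K = {}")
   case True then show ?thesis using that[of 1] by auto
  next
   case False
   obtain z where "z \<in> K" "\<forall>y\<in>K. ?f z <= ?f y"
    using continuous_attains_inf[OF K False continuous_on_subset[OF cf]] by blast
   then show ?thesis using that[of "?f z"] pos by auto
  qed
  have ev: "\<forall>\<^sub>F n in sequentially. dist (sn n) s < 1" "\<forall>\<^sub>F n in sequentially. dist (\<zeta>n n) \<zeta> < 1"
   "\<forall>\<^sub>F n in sequentially. (A (sn n, \<xi>n n) - A (sn n, \<zeta>n n)) \<bullet> (\<xi>n n - \<zeta>n n) < m"
   using tendstoD[OF s, of 1] tendstoD[OF z, of 1] order_tendstoD(2)[OF D m(1)] by auto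
  then have "\<forall>\<^sub>F n in sequentially. norm (\<xi>n n - \<zeta>n n - 0) < e"
  proof eventually_elim
   case (elim n)
   show ?case
   proof (rule ccontr)
    assume "\<not> norm (\<xi>n n - \<zeta>n n - 0) < e"
    then have L: "norm (\<xi>n n - \<zeta>n n) >= e" by simp
    define t where "t = e / norm (\<xi>n n - \<zeta>n n)"
    define \<eta> where "\<eta> = \<zeta>n n + t *\<^sub>R (\<xi>n n - \<zeta>n n)"
    have ne: "norm (\<xi>n n - \<zeta>n n) > 0" using L e by linarith
    have t: "0 < t" "t <= 1" unfolding t_def using L e ne by (auto intro: divide_pos_pos)
    have "(sn n, \<zeta>n n, \<eta>) \<in> K" using elim(1,2) ne e
     by (auto simp: K_def \<eta>_def t_def dist_norm norm_minus_commute)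
    then have "m <= (A (sn n, \<eta>) - A (sn n, \<zeta>n n)) \<bullet> (t *\<^sub>R (\<xi>n n - \<zeta>n n))" using m(2) by (fastforce simp: \<eta>_def)
    also have "... <= t * ((A (sn n, \<xi>n n) - A (sn n, \<zeta>n n)) \<bullet> (\<xi>n n - \<zeta>n n))"
    proof -
     have "(A (sn n, \<xi>n n) - A (sn n, \<eta>)) \<bullet> (\<xi>n n - \<zeta>n n) >= 0"
     proof (cases "t = 1")
      case True then show ?thesis by (simp add: \<eta>_def)
     next
      case False
      have eq: "\<xi>n n - \<eta> = (1 - t) *\<^sub>R (\<xi>n n - \<zeta>n n)" by (simp add: \<eta>_def algebra_simps)
      then have "\<xi>n n \<noteq> \<eta>" using False ne by auto
      then have "(A (sn n, \<xi>n n) - A (sn n, \<eta>)) \<bullet> ((1 - t) *\<^sub>R (\<xi>n n - \<zeta>n n)) > 0" using mono eq by metis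
      then show ?thesis using t False by (simp add: zero_less_mult_iff)
     qed
     then have "(A (sn n, \<eta>) - A (sn n, \<zeta>n n)) \<bullet> (\<xi>n n - \<zeta>n n) <= (A (sn n, \<xi>n n) - A (sn n, \<zeta>n n)) \<bullet> (\<xi>n n - \<zeta>n n)"
      by (simp add: inner_diff_left)
     then show ?thesis using t by (simp add: mult_left_mono)
    qed
    finally have mm: "m <= t * ((A (sn n, \<xi>n n) - A (sn n, \<zeta>n n)) \<bullet> (\<xi>n n - \<zeta>n n))" .
    then have "(A (sn n, \<xi>n n) - A (sn n, \<zeta>n n)) \<bullet> (\<xi>n n - \<zeta>n n) > 0" using m t by (smt (verit) mult_nonneg_nonpos)
    then have "t * ((A (sn n, \<xi>n n) - A (sn n, \<zeta>n n)) \<bullet> (\<xi>n n - \<zeta>n n)) <= (A (sn n, \<xi>n n) - A (sn n, \<zeta>n n)) \<bullet> (\<xi>n n - \<zeta>n n)"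
     using t by (simp add: mult_left_le_one_le)
    then show False using mm elim(3) by linarith
   qed
  qed
  then show "\<exists>no. \<forall>n\<ge>no. norm (\<xi>n n - \<zeta>n n - 0) < e" by (simp add: eventually_sequentially)
 qed
 from tendsto_add[OF this z] show ?thesis by simp
qed

text \<open>On grids of [-R, R]^m Kuhn's combinatorial lemma finds a cell which, for each i, has
  vertices where F i is nonpositive and nonnegative. Along a subsequence the cells shrink to a
  point, which is a common zero. Points are functions on all naturals, of which the first m values
  are the coordinates.\<close>

lemma poincare_miranda:
 fixes F :: "nat => (nat => real) => real"
 assumes R: "R > 0"
  and cont: "!!i c ck. i < m ==> (!!j. j < m ==> (%k. ck k j) ----> c j) ==> (!!k j. j < m ==> \<bar>ck k j\<bar> <= R) ==>
    (%k. F i (ck k)) ----> F i c"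
  and low: "!!i c. i < m ==> (!!j. j < m ==> \<bar>c j\<bar> <= R) ==> c i = - R ==> F i c <= 0"
  and high: "!!i c. i < m ==> (!!j. j < m ==> \<bar>c j\<bar> <= R) ==> c i = R ==> F i c >= 0"
 shows "\<exists>c. (\<forall>j<m. \<bar>c j\<bar> <= R) \<and> (\<forall>i<m. F i c = 0)"
proof -
 define pt where "pt N x j = - R + 2 * R * real (x j) / real (Suc N)" for N :: nat and x :: "nat => nat" and j
 have ptR: "\<bar>pt N x j\<bar> <= R" if "x j <= Suc N" for N x j
 proof -
  have "0 <= real (x j) / real (Suc N)" "real (x j) / real (Suc N) <= 1" using that by auto
  then have "0 <= 2 * R * (real (x j) / real (Suc N))" "2 * R * (real (x j) / real (Suc N)) <= 2 * R * 1"
   by (intro mult_nonneg_nonneg mult_left_mono; use R in linarith)+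
  then show ?thesis unfolding pt_def by (simp add: abs_le_iff)
 qed
 have key: "\<exists>q. (\<forall>j<m. q j <= Suc N) \<and> (\<forall>i<m. \<exists>r s. (\<forall>j<m. q j <= r j \<and> r j <= q j + 1 \<and> r j <= Suc N) \<and>
   (\<forall>j<m. q j <= s j \<and> s j <= q j + 1 \<and> s j <= Suc N) \<and> F i (pt N r) <= 0 \<and> F i (pt N s) >= 0)" for N
 proof -
  \<comment> \<open>Kuhn's lemma prescribes label 0 on the lower faces and 1 on the upper ones; the
    conditions on F at the faces make this consistent with the sign of F i, which decides
    elsewhere.\<close>
  define label where "label x i = (if x i = 0 then 0 else if x i = Suc N then 1 else if F i (pt N x) <= 0 then 0 else (1::nat))" for x i
  have l0: "F i (pt N x) <= 0" if "i < m" "\<forall>j<m. x j <= Suc N" "label x i = 0" for x i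
   using that low[of i "pt N x"] ptR[of x _ N] by (auto simp: label_def pt_def split: if_splits)
  have l1: "F i (pt N x) >= 0" if "i < m" "\<forall>j<m. x j <= Suc N" "label x i = 1" for x i
   using that high[of i "pt N x"] ptR[of x _ N] by (auto simp: label_def pt_def split: if_splits)
  have l01: "label x i = 0 \<or> label x i = 1" for x i by (auto simp: label_def)
  obtain q where q: "\<forall>i<m. q i < Suc N"
   "\<forall>i<m. \<exists>r s. (\<forall>j<m. q j <= r j \<and> r j <= q j + 1) \<and> (\<forall>j<m. q j <= s j \<and> s j <= q j + 1) \<and> label r i \<noteq> label s i"
   by (rule kuhn_lemma[of "Suc N" m label]) (auto simp: label_def)
  show ?thesis
  proof (rule exI[of _ q], intro conjI allI impI)
   fix i assume i: "i < m"
   obtain r s where rs: "\<forall>j<m. q j <= r j \<and> r j <= q j + 1" "\<forall>j<m. q j <= s j \<and> s j <= q j + 1" "label r i \<noteq> label s i"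
    using q(2) i by blast
   have "r j <= Suc N" "s j <= Suc N" if j: "j < m" for j
    using rs(1)[rule_format, OF j] rs(2)[rule_format, OF j] q(1)[rule_format, OF j] by linarith+
   then have rs': "\<forall>j<m. r j <= Suc N" "\<forall>j<m. s j <= Suc N" by blast+
   consider "label r i = 0 \<and> label s i = 1" | "label s i = 0 \<and> label r i = 1" using l01 rs(3) by metis
   then show "\<exists>r s. (\<forall>j<m. q j <= r j \<and> r j <= q j + 1 \<and> r j <= Suc N) \<and>
   (\<forall>j<m. q j <= s j \<and> s j <= q j + 1 \<and> s j <= Suc N) \<and> F i (pt N r) <= 0 \<and> F i (pt N s) >= 0"
   proof cases
    case 1 then show ?thesis using l0[OF i rs'(1)] l1[OF i rs'(2)] rs rs' by (intro exI[of _ r] exI[of _ s]) auto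
   next
    case 2 then show ?thesis using l0[OF i rs'(2)] l1[OF i rs'(1)] rs rs' by (intro exI[of _ s] exI[of _ r]) auto
   qed
  qed (use q(1) in auto)
 qed
 from choice[OF allI[OF key]] obtain Q where Q: "\<forall>N. (\<forall>j<m. Q N j <= Suc N) \<and> (\<forall>i<m. \<exists>r s. (\<forall>j<m. Q N j <= r j \<and> r j <= Q N j + 1 \<and> r j <= Suc N) \<and>
   (\<forall>j<m. Q N j <= s j \<and> s j <= Q N j + 1 \<and> s j <= Suc N) \<and> F i (pt N r) <= 0 \<and> F i (pt N s) >= 0)" ..
 obtain k where k: "strict_mono (k::nat=>nat)" "!!j. j \<in> {..<m} ==> \<exists>l. (%n. pt (k n) (Q (k n)) j) ----> l"
  by (rule function_convergent_subsequence[of "{..<m}" "%N j. pt N (Q N) j" R]) (use Q ptR in auto)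
 from k(2) obtain c where c: "!!j. j < m ==> (%n. pt (k n) (Q (k n)) j) ----> c j"
  using bchoice[of "{..<m}" "%j l. (%n. pt (k n) (Q (k n)) j) ----> l"] by auto
 have cR: "\<bar>c j\<bar> <= R" if "j < m" for j
  by (rule LIMSEQ_le_const2[OF tendsto_rabs[OF c[OF that]]]) (use Q ptR that in blast)
 have near: "(%n. pt (k n) (r n) j) ----> c j"
  if j: "j < m" and r: "!!n. Q (k n) j <= r n j \<and> r n j <= Q (k n) j + 1" for r j
 proof -
  have "(%n. pt (k n) (r n) j - pt (k n) (Q (k n)) j) ----> 0"
  proof (rule Lim_null_comparison)
   show "\<forall>\<^sub>F n in sequentially. norm (pt (k n) (r n) j - pt (k n) (Q (k n)) j) <= 2 * R * (1 / real (Suc (k n)))"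
   proof (intro always_eventually allI)
    fix n
    have "pt (k n) (r n) j - pt (k n) (Q (k n)) j = 2 * R * ((real (r n j) - real (Q (k n) j)) / real (Suc (k n)))"
     unfolding pt_def by (simp add: diff_divide_distrib right_diff_distrib)
    also have "\<bar>...\<bar> = 2 * R * (\<bar>real (r n j) - real (Q (k n) j)\<bar> / real (Suc (k n)))"
     using R by (simp add: abs_mult)
    also have "... <= 2 * R * (1 / real (Suc (k n)))"
     using R r[of n] by (intro mult_left_mono divide_right_mono) auto
    finally show "norm (pt (k n) (r n) j - pt (k n) (Q (k n)) j) <= 2 * R * (1 / real (Suc (k n)))" by simp
   qed
   have "(%n. 1 / real (Suc (k n))) ----> 0"
    using LIMSEQ_subseq_LIMSEQ[OF LIMSEQ_Suc[OF lim_1_over_n] k(1)] by (simp add: o_def)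
   then show "(%n. 2 * R * (1 / real (Suc (k n)))) ----> 0" by (rule tendsto_mult_right_zero)
  qed
  from tendsto_add[OF this c[OF j]] show ?thesis by simp
 qed
 have "F i c = 0" if i: "i < m" for i
 proof -
  from Q i have "\<forall>n. \<exists>r s. (\<forall>j<m. Q (k n) j <= r j \<and> r j <= Q (k n) j + 1 \<and> r j <= Suc (k n)) \<and>
   (\<forall>j<m. Q (k n) j <= s j \<and> s j <= Q (k n) j + 1 \<and> s j <= Suc (k n)) \<and> F i (pt (k n) r) <= 0 \<and> F i (pt (k n) s) >= 0" by blast
  from choice[OF this] obtain r where "\<forall>n. \<exists>s. (\<forall>j<m. Q (k n) j <= r n j \<and> r n j <= Q (k n) j + 1 \<and> r n j <= Suc (k n)) \<and>
   (\<forall>j<m. Q (k n) j <= s j \<and> s j <= Q (k n) j + 1 \<and> s j <= Suc (k n)) \<and> F i (pt (k n) (r n)) <= 0 \<and> F i (pt (k n) s) >= 0" ..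
  from choice[OF this] obtain s where rs: "\<forall>n. (\<forall>j<m. Q (k n) j <= r n j \<and> r n j <= Q (k n) j + 1 \<and> r n j <= Suc (k n)) \<and>
   (\<forall>j<m. Q (k n) j <= s n j \<and> s n j <= Q (k n) j + 1 \<and> s n j <= Suc (k n)) \<and> F i (pt (k n) (r n)) <= 0 \<and> F i (pt (k n) (s n)) >= 0" ..
  have "(%n. F i (pt (k n) (r n))) ----> F i c"
   by (rule cont[OF i]) (use rs near[of _ r] ptR in auto)
  then have "F i c <= 0" by (rule LIMSEQ_le_const2) (use rs in blast)
  moreover have "(%n. F i (pt (k n) (s n))) ----> F i c"
   by (rule cont[OF i]) (use rs near[of _ s] ptR in auto)
  then have "F i c >= 0" by (rule LIMSEQ_le_const) (use rs in blast)
  ultimately show ?thesis by simp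
 qed
 then show ?thesis using cR by blast
qed

text \<open>F compares c with the projection of c - f c onto the cube, so its sign on the faces is
  automatic. At a zero of F, each \<open>f i c\<close> vanishes or c lies on an i-th face with
  \<open>f i c * c i <= 0\<close>; coercivity excludes the latter alternative.\<close>

lemma coercive_zero:
 fixes f :: "nat => (nat => real) => real"
 assumes R: "R > 0"
  and cont: "!!i c ck. i < m ==> (!!j. j < m ==> (%k. ck k j) ----> c j) ==> (!!k j. j < m ==> \<bar>ck k j\<bar> <= R) ==>
    (%k. f i (ck k)) ----> f i c"
  and coer: "!!c i. i < m ==> \<bar>c i\<bar> = R ==> (!!j. j < m ==> \<bar>c j\<bar> <= R) ==> (\<Sum>j<m. f j c * c j) > 0"
 shows "\<exists>c. \<forall>i<m. f i c = 0"
proof -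
 define F where "F i c = c i - max (- R) (min R (c i - f i c))" for i c
 have "\<exists>c. (\<forall>j<m. \<bar>c j\<bar> <= R) \<and> (\<forall>i<m. F i c = 0)"
 proof (rule poincare_miranda[OF R])
  show "(%k. F i (ck k)) ----> F i c"
   if "i < m" "!!j. j < m ==> (%k. ck k j) ----> c j" "!!k j. j < m ==> \<bar>ck k j\<bar> <= R" for i c ck
   unfolding F_def using that cont[OF that] by (intro tendsto_diff tendsto_max tendsto_min tendsto_const) auto
 qed (use R in \<open>auto simp: F_def\<close>)
 then obtain c where c: "\<forall>j<m. \<bar>c j\<bar> <= R" "\<forall>i<m. F i c = 0" by blast
 have sg: "f i c = 0 \<or> \<bar>c i\<bar> = R \<and> f i c * c i <= 0" if "i < m" for i
 proof -
  have *: "c i = max (- R) (min R (c i - f i c))" using c(2) that by (auto simp: F_def)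
  have "\<bar>c i\<bar> <= R" using c(1) that by blast
  then consider "\<bar>c i\<bar> < R" | "c i = R" | "c i = - R" by linarith
  then show ?thesis
  proof cases
   case 1 then show ?thesis using * by (auto simp: max_def min_def split: if_splits)
  next
   case 2
   then have "f i c <= 0" using * R by (auto simp: max_def min_def split: if_splits)
   then show ?thesis using 2 R by (auto simp: mult_nonpos_nonneg)
  next
   case 3
   then have "f i c >= 0" using * R by (auto simp: max_def min_def split: if_splits)
   then show ?thesis using 3 R by (auto simp: mult_nonneg_nonpos)
  qed
 qed
 have "f i c = 0" if i: "i < m" for i
 proof (rule ccontr)
  assume "f i c \<noteq> 0"
  then have "\<bar>c i\<bar> = R" using sg[OF i] by auto
  then have "(\<Sum>j<m. f j c * c j) > 0" using coer[OF i] c(1) by blast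
  moreover have "(\<Sum>j<m. f j c * c j) <= 0" by (rule sum_nonpos) (use sg in fastforce)
  ultimately show False by simp
 qed
 then show ?thesis by blast
qed

context dom
begin

text \<open>A jet is determined up to a small error by a modulus of continuity and rounded values on a
  finite net, hence by one of countably many codes.\<close>

lemma W_separable:
 "\<exists>\<phi>::nat => 'a => real. (\<forall>i. C1c \<Omega> (\<phi> i)) \<and> (\<forall>X\<in>W. \<forall>e>0. \<exists>i. dst (jet (\<phi> i)) X < e)"
proof -
 obtain R where R: "!!x. x \<in> \<Omega> ==> norm x <= R" using bounded_dom unfolding bounded_iff by blast
 let ?B = "cball (0::'a) R"
 have "\<exists>l::'a list. set l \<subseteq> ?B \<and> ?B \<subseteq> (\<Union>x\<in>set l. ball x (1 / real (Suc j)))" for j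
 proof -
  obtain k where k: "finite k" "k \<subseteq> ?B" "?B \<subseteq> (\<Union>x\<in>k. ball x (1 / real (Suc j)))"
   using seq_compact_imp_totally_bounded[OF compact_imp_seq_compact[OF compact_cball[of 0 R]]]
   by (metis of_nat_0_less_iff zero_less_Suc zero_less_divide_1_iff)
  then show ?thesis using finite_list by metis
 qed
 then have "\<forall>j. \<exists>l::'a list. set l \<subseteq> ?B \<and> ?B \<subseteq> (\<Union>x\<in>set l. ball x (1 / real (Suc j)))" by blast
 from choice[OF this] obtain net where net: "\<forall>j. set (net j) \<subseteq> ?B \<and> ?B \<subseteq> (\<Union>x\<in>set (net j). ball x (1 / real (Suc j)))" ..
 obtain D :: "(real \<times> 'a) set" where D: "countable D" "!!X. open X ==> X \<noteq> {} ==> \<exists>d\<in>D. d \<in> X"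
  by (erule countable_dense_setE)
 \<comment> \<open>A code lists a precision index k, the index j of a modulus for that precision,
   and values from the dense set on the j-th net. Two functions with the same code have jets within
   4/(k+1) of each other, by four errors of size 1/(k+1).\<close>
 define match where "match z \<phi> \<longleftrightarrow> (case z of (k, j, ds) => C1c \<Omega> \<phi> \<and>
   (\<forall>x\<in>?B. \<forall>y\<in>?B. dist x y < 1 / real (Suc j) --> dist (jet \<phi> x) (jet \<phi> y) < 1 / real (Suc k)) \<and>
   list_all2 (%x d. dist (jet \<phi> x) d < 1 / real (Suc k)) (net j) ds)"
  for z :: "nat \<times> nat \<times> (real \<times> 'a) list" and \<phi>
 define Codes where "Codes = (UNIV :: nat set) \<times> (UNIV :: nat set) \<times> lists D"
 have cc: "countable Codes" unfolding Codes_def by (intro countable_SIGMA countableI_type countable_lists D)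
 define pick where "pick z = (if \<exists>\<phi>. match z \<phi> then SOME \<phi>. match z \<phi> else (%x. 0))" for z
 have pick: "match z (pick z)" if "match z \<phi>" for z \<phi>
  unfolding pick_def using that someI_ex[of "match z"] by auto
 have pickC: "C1c \<Omega> (pick z)" for z
 proof (cases "\<exists>\<phi>. match z \<phi>")
  case True
  then have "match z (pick z)" using pick by blast
  then show ?thesis by (auto simp: match_def split: prod.splits)
 qed (simp add: pick_def C1c_zero)
 have ne: "Codes \<noteq> {}" unfolding Codes_def by (auto intro: lists.Nil)
 define \<phi> where "\<phi> i = pick (from_nat_into Codes i)" for i
 have ex: "\<exists>z\<in>Codes. fst z = k \<and> match z \<psi>" if \<psi>: "C1c \<Omega> \<psi>" for k \<psi>
 proof -
  have "uniformly_continuous_on ?B (jet \<psi>)"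
   by (intro compact_uniformly_continuous continuous_on_subset[OF C1D(4)[OF C1c_C1[OF \<psi>]]]) auto
  then obtain d where d: "d > 0" "!!x y. x \<in> ?B ==> y \<in> ?B ==> dist y x < d ==> dist (jet \<psi> y) (jet \<psi> x) < 1 / real (Suc k)"
   unfolding uniformly_continuous_on_def by (metis of_nat_0_less_iff zero_less_Suc zero_less_divide_1_iff)
  obtain j where j: "1 / real (Suc j) < d" using nat_approx_posE[OF d(1)] by blast
  have "\<forall>x. \<exists>e\<in>D. dist (jet \<psi> x) e < 1 / real (Suc k)"
   using D(2)[of "ball (jet \<psi> x) (1 / real (Suc k))" for x] by auto
  then obtain e where e: "!!x. e x \<in> D" "!!x. dist (jet \<psi> x) (e x) < 1 / real (Suc k)" by metis
  have "match (k, j, map e (net j)) \<psi>"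
   unfolding match_def using \<psi> d(2) j e(2) by (auto simp: list_all2_map2 intro!: list.rel_refl)
  moreover have "(k, j, map e (net j)) \<in> Codes" unfolding Codes_def using e(1) by auto
  ultimately show ?thesis by force
 qed
 have close: "norm (jet \<psi> x - jet \<psi>' x) <= 4 / real (Suc k)" if m: "match z \<psi>" "match z \<psi>'" "fst z = k" and x: "x \<in> \<Omega>" for \<psi> \<psi>' z k x
 proof -
  obtain j ds where z: "z = (k, j, ds)" using m(3) by (cases z) auto
  have xB: "x \<in> ?B" using R[OF x] by simp
  then have "x \<in> (\<Union>x\<in>set (net j). ball x (1 / real (Suc j)))" using net by blast
  then obtain y where y0: "y \<in> set (net j)" "x \<in> ball y (1 / real (Suc j))" by blast
  have "y \<in> ?B" using y0(1) net by blast
  then have y: "y \<in> set (net j)" "dist x y < 1 / real (Suc j)" "y \<in> ?B"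
   using y0 by (auto simp: dist_commute)
  obtain i where i: "i < length (net j)" "y = net j ! i" using y(1) by (metis in_set_conv_nth)
  have 1: "dist (jet \<psi> y) (ds ! i) < 1 / real (Suc k)" "dist (jet \<psi>' y) (ds ! i) < 1 / real (Suc k)"
   using m(1,2) i by (auto simp: match_def z list_all2_conv_all_nth)
  have 2: "dist (jet \<psi> x) (jet \<psi> y) < 1 / real (Suc k)" "dist (jet \<psi>' x) (jet \<psi>' y) < 1 / real (Suc k)"
   using m(1,2) xB y by (auto simp: match_def z)
  have "dist (jet \<psi> x) (jet \<psi>' x) <= dist (jet \<psi> x) (jet \<psi> y) + dist (jet \<psi> y) (ds ! i) + dist (jet \<psi>' y) (ds ! i) + dist (jet \<psi>' x) (jet \<psi>' y)"
   by metric
  moreover have "4 / real (Suc k) = 4 * (1 / real (Suc k))" by simp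
  ultimately show ?thesis using 1 2 unfolding dist_norm by linarith
 qed
 have "\<exists>i. dst (jet (\<phi> i)) X < e" if X: "X \<in> W" and e: "e > 0" for X e
 proof -
  define e' where "e' = e / (2 * 2 powr p)"
  have e': "e' > 0" using e by (simp add: e'_def)
  obtain \<psi> where \<psi>: "C1c \<Omega> \<psi>" "dst (jet \<psi>) X < e'" using X e' unfolding W_def by blast
  have "(%k. (4 * (1 / real (Suc k))) powr p * measure M (space M)) ----> (4 * 0) powr p * measure M (space M)"
   using p0 by (intro tendsto_mult tendsto_powr' tendsto_const LIMSEQ_Suc[OF lim_1_over_n]) auto
  then have "\<forall>\<^sub>F k in sequentially. (4 * (1 / real (Suc k))) powr p * measure M (space M) < e'"
   using e' p0 by (intro order_tendstoD(2)[of _ 0]) auto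
  from eventually_happens'[OF sequentially_bot this] obtain k where k: "(4 / real (Suc k)) powr p * measure M (space M) < e'" by auto
  obtain z where z: "z \<in> Codes" "fst z = k" "match z \<psi>" using ex[OF \<psi>(1)] by blast
  obtain i where i: "from_nat_into Codes i = z" using from_nat_into_surj[OF cc z(1)] by blast
  have C: "C1c \<Omega> (\<phi> i)" unfolding \<phi>_def by (rule pickC)
  have "match z (\<phi> i)" unfolding \<phi>_def i using pick z(3) by blast
  then have cl: "norm (jet (\<phi> i) x - jet \<psi> x) <= 4 / real (Suc k)" if "x \<in> \<Omega>" for x
   using close[OF _ z(3) z(2) that] by blast
  have "dst (jet (\<phi> i)) (jet \<psi>) <= (LINT x|M. (4 / real (Suc k)) powr p)"
   unfolding dst_def
  proof (rule integral_mono[OF LP_int[OF LP_diff[OF jet_LP[OF C] jet_LP[OF \<psi>(1)] p0(2)]]])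
   show "norm (jet (\<phi> i) x - jet \<psi> x) powr p <= (4 / real (Suc k)) powr p" if "x \<in> space M" for x
    using that cl p0 by (intro powr_mono2) (auto simp: space_restrict_space)
  qed auto
  also have "... < e'" using k by (simp add: mult.commute)
  finally have "dst (jet (\<phi> i)) (jet \<psi>) < e'" .
  then have "2 powr p * (dst (jet (\<phi> i)) (jet \<psi>) + dst (jet \<psi>) X) < 2 powr p * (e' + e')"
   using \<psi>(2) by (intro mult_strict_left_mono) auto
  also have "... = e" by (simp add: e'_def)
  finally have "dst (jet (\<phi> i)) X < e"
   using dst_triangle[OF jet_LP[OF C] jet_LP[OF \<psi>(1)] W_LP[OF X]] by linarith
  then show ?thesis by blast
 qed
 then show ?thesis using pickC unfolding \<phi>_def by blast
qed

end

text \<open>Continuity is imposed at every x, which makes compositions measurable, while the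
  inequalities hold a.e. \<open>Hp_singular\<close> arranges this by setting the coefficient to 0 on
  a null set and lets b absorb the factor of (A2).\<close>

locale leray = dom \<Omega> p for \<Omega> :: "'a::euclidean_space set" and p :: real +
 fixes A :: "'a => real \<times> 'a => 'a" and \<alpha> \<beta> :: real and b :: "'a => real"
 assumes A_meas: "!!z. (%x. A x z) \<in> BM M"
  and A_cont: "!!x. continuous_on UNIV (A x)"
  and \<alpha>0: "\<alpha> > 0" and \<beta>0: "\<beta> >= 0"
  and b_LP: "LP q M b"
  and A_coer: "AE x in M. \<forall>z. A x z \<bullet> snd z >= \<alpha> * norm (snd z) powr p"
  and A_grow: "AE x in M. \<forall>z. norm (A x z) <= b x + \<beta> * (\<bar>fst z\<bar> powr (p - 1) + norm (snd z) powr (p - 1))"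
  and A_mono: "AE x in M. \<forall>s \<xi> \<xi>'. \<xi> \<noteq> \<xi>' --> (A x (s, \<xi>) - A x (s, \<xi>')) \<bullet> (\<xi> - \<xi>') > 0"
begin

lemma Ameas: "X \<in> BM M ==> (%x. A x (X x)) \<in> BM M"
 by (rule Caratheodory_measurable[OF A_meas A_cont])

definition GA :: "'a => real" where "GA x = 2 powr q * norm (b x) powr q"
definition KA :: real where "KA = 2 powr q * \<beta> powr q * 2 powr q"

lemma KA0: "KA >= 0" by (simp add: KA_def)

lemma GA_int: "integrable M GA" unfolding GA_def using LP_int[OF b_LP] by simp

text \<open>Because (p - 1) q = p, the q-th power of the growth condition is of order p in the jet;
  thus A maps L^p jets to L^q fields.\<close>

lemma A_grow_powr:
 "AE x in M. \<forall>z. norm (A x z) powr q <= GA x + KA * (\<bar>fst z\<bar> powr p + norm (snd z) powr p)"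
 using A_grow
proof eventually_elim
 case (elim x)
 show ?case
 proof
  fix z :: "real \<times> 'a"
  have pq: "(p - 1) * q = p" using p1 by (simp add: q1(1))
  let ?u = "\<bar>fst z\<bar> powr (p - 1)" and ?v = "norm (snd z) powr (p - 1)"
  have "norm (A x z) <= norm (b x) + \<beta> * (?u + ?v)" using elim[rule_format, of z] by auto
  then have "norm (A x z) powr q <= (norm (b x) + \<beta> * (?u + ?v)) powr q" using q1(3) by (intro powr_mono2) auto
  also have "... <= 2 powr q * (norm (b x) powr q + (\<beta> * (?u + ?v)) powr q)"
   using q1(3) \<beta>0 by (intro powr_add_le) auto
  also have "... <= 2 powr q * (norm (b x) powr q + \<beta> powr q * (2 powr q * (\<bar>fst z\<bar> powr p + norm (snd z) powr p)))"
  proof (intro mult_left_mono add_left_mono)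
   have "(\<beta> * (?u + ?v)) powr q = \<beta> powr q * (?u + ?v) powr q" using \<beta>0 by (simp add: powr_mult)
   also have "... <= \<beta> powr q * (2 powr q * (?u powr q + ?v powr q))"
    using q1(3) by (intro mult_left_mono powr_add_le) auto
   also have "?u powr q = \<bar>fst z\<bar> powr p" by (simp add: powr_powr pq)
   also have "?v powr q = norm (snd z) powr p" by (simp add: powr_powr pq)
   finally show "(\<beta> * (?u + ?v)) powr q <= \<beta> powr q * (2 powr q * (\<bar>fst z\<bar> powr p + norm (snd z) powr p))" .
  qed auto
  finally show "norm (A x z) powr q <= GA x + KA * (\<bar>fst z\<bar> powr p + norm (snd z) powr p)"
   by (simp add: GA_def KA_def algebra_simps)
 qed
qed

lemma A_LP:
 assumes "LP p M X" shows "LP q M (%x. A x (X x))"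
  "(LINT x|M. norm (A x (X x)) powr q) <= (LINT x|M. GA x) + 2 * KA * (LINT x|M. norm (X x) powr p)"
proof -
 let ?g = "%x. GA x + KA * (norm (X x) powr p + norm (X x) powr p)"
 have i: "integrable M ?g" using GA_int LP_int[OF assms] by auto
 have le: "AE x in M. norm (A x (X x)) powr q <= ?g x"
  using A_grow_powr
 proof eventually_elim
  case (elim x)
  have "\<bar>fst (X x)\<bar> powr p <= norm (X x) powr p" "norm (snd (X x)) powr p <= norm (X x) powr p"
   using norm_fst_snd_le[of "X x"] p0 by (auto intro!: powr_mono2)
  then have "KA * (\<bar>fst (X x)\<bar> powr p + norm (snd (X x)) powr p) <= KA * (norm (X x) powr p + norm (X x) powr p)"
   using KA0 by (intro mult_left_mono) auto
  then show ?case using elim[rule_format, of "X x"] by linarith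
 qed
 show L: "LP q M (%x. A x (X x))" by (rule LP_boundI[OF Ameas[OF LP_meas[OF assms]] i le])
 have "(LINT x|M. norm (A x (X x)) powr q) <= (LINT x|M. ?g x)"
  by (rule integral_mono_AE[OF LP_int[OF L] i le])
 also have "... = (LINT x|M. GA x) + 2 * KA * (LINT x|M. norm (X x) powr p)"
  using GA_int LP_int[OF assms] by simp
 finally show "(LINT x|M. norm (A x (X x)) powr q) <= (LINT x|M. GA x) + 2 * KA * (LINT x|M. norm (X x) powr p)" .
qed

lemma A_mono_nonneg: "AE x in M. \<forall>s \<xi> \<xi>'. (A x (s, \<xi>) - A x (s, \<xi>')) \<bullet> (\<xi> - \<xi>') >= 0"
 using A_mono
proof eventually_elim
 case (elim x)
 show ?case
 proof (intro allI)
  fix s \<xi> \<xi>' show "(A x (s, \<xi>) - A x (s, \<xi>')) \<bullet> (\<xi> - \<xi>') >= 0"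
   using elim[rule_format, of \<xi> \<xi>' s] by (cases "\<xi> = \<xi>'") (auto intro: less_imp_le)
 qed
qed

text \<open>The jets come with an L^p bound instead of a majorant; the resulting L^q bound on A,
  with q > 1, feeds Vitali's theorem.\<close>

lemma A_conv_L1:
 assumes X: "!!n. LP p M (X n)" "!!n. (LINT x|M. norm (X n x) powr p) <= C" and Y: "LP p M Y"
  and c: "AE x in M. (%n. X n x) ----> Y x"
 shows "(%n. LINT x|M. norm (A x (X n x) - A x (Y x))) ----> 0"
proof (rule LP_fatou_vitali(3)[where p=q and C="(LINT x|M. GA x) + 2 * KA * C"])
 show "(LINT x|M. norm (A x (X n x)) powr q) <= (LINT x|M. GA x) + 2 * KA * C" for n
  using A_LP(2)[OF X(1), of n] mult_left_mono[OF X(2)[of n], of "2 * KA"] KA0 by linarith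
 show "AE x in M. (%n. A x (X n x)) ----> A x (Y x)" using c
  by eventually_elim (rule continuous_on_tendsto_compose[OF A_cont], auto)
qed (use A_LP(1)[OF X(1)] Ameas[OF LP_meas[OF Y]] q1 in auto)

text \<open>The almost everywhere convergence that turns weak convergence of the gradients into strong
  information: the Minty type quantity tends to 0.\<close>

lemma gradient_AE:
 assumes u: "AE x in M. (%n. fst (U n x)) ----> fst (Y x)" and w: "AE x in M. (%n. V n x) ----> snd (Y x)"
  and D: "AE x in M. x \<in> S --> (%n. (A x (U n x) - A x (fst (U n x), V n x)) \<bullet> (snd (U n x) - V n x)) ----> 0"
 shows "AE x in M. x \<in> S --> (%n. snd (U n x)) ----> snd (Y x)"
 using u w D A_mono
proof eventually_elim
 case (elim x)
 show ?case
 proof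
  assume "x \<in> S"
  then have "(%n. (A x (fst (U n x), snd (U n x)) - A x (fst (U n x), V n x)) \<bullet> (snd (U n x) - V n x)) ----> 0"
   using elim(3) by simp
  from monotone_gradient_converges[OF A_cont _ elim(1,2) this]
  show "(%n. snd (U n x)) ----> snd (Y x)" using elim(4) by blast
 qed
qed

text \<open>Here the coefficient is evaluated at the new function but at the gradient of a strong
  approximation \<open>w\<close> of the limit, so it converges strongly while the increments converge weakly.\<close>

lemma frozen_term_limit:
 assumes U: "!!n. U n \<in> W" "!!n. (LINT x|M. norm (U n x) powr p) <= C" and Y: "Y \<in> W" and w: "!!n. w n \<in> W"
  and g: "integrable M g" and u: "AE x in M. (%n. fst (U n x)) ----> fst (Y x)"
  and ug: "AE x in M. \<forall>n. \<bar>fst (U n x)\<bar> powr p <= g x"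
  and k: "integrable M k" and wc: "AE x in M. (%n. w n x) ----> Y x" "AE x in M. \<forall>n. norm (w n x) powr p <= k x"
  and wd: "(%n. dst (w n) Y) ----> 0"
  and weak: "!!Z. LP q M Z ==> (%n. LINT x|M. Z x \<bullet> (snd (U n x) - snd (Y x))) ----> 0"
  and c: "!!n. c n \<in> BM M" "c' \<in> BM M" "!!n x. \<bar>c n x\<bar> <= B" "AE x in M. (%n. c n x) ----> c' x"
 shows "(%n. LINT x|M. (c n x *\<^sub>R A x (fst (U n x), snd (w n x))) \<bullet> (snd (U n x) - snd (w n x))) ----> 0"
proof -
 let ?Zn = "%n x. c n x *\<^sub>R A x (fst (U n x), snd (w n x))" and ?Z = "%x. c' x *\<^sub>R A x (Y x)"
 have B0: "B >= 0" using c(3) abs_ge_zero order_trans by blast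
 have m1: "(%x. (fst (U n x), snd (w n x))) \<in> BM M" for n
  using borel_measurable_fst_snd[OF LP_meas[OF W_LP[OF U(1)]], of n] borel_measurable_fst_snd[OF LP_meas[OF W_LP[OF w]], of n]
  by (intro borel_measurable_Pair) auto
 have mZn: "?Zn n \<in> BM M" for n using Ameas[OF m1] c(1) by auto
 have mZ: "?Z \<in> BM M" using Ameas[OF LP_meas[OF W_LP[OF Y]]] c(2) by auto
 \<comment> \<open>The coefficient involves only \<open>fst (U n x)\<close> and
   \<open>snd (w n x)\<close>, both dominated; the gradients of U n enter through the weakly
   convergent factor alone.\<close>
 define G where "G x = B powr q * (GA x + KA * (g x + k x))" for x
 have Gi: "integrable M G" unfolding G_def using GA_int g k by auto
 have Gb: "AE x in M. \<forall>n. norm (?Zn n x) powr q <= G x"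
  using A_grow_powr ug wc(2)
 proof eventually_elim
  case (elim x)
  show ?case
  proof
   fix n
   have "norm (?Zn n x) powr q = \<bar>c n x\<bar> powr q * norm (A x (fst (U n x), snd (w n x))) powr q"
    by (simp add: powr_mult)
   also have "... <= B powr q * (GA x + KA * (\<bar>fst (U n x)\<bar> powr p + norm (snd (w n x)) powr p))"
    using elim(1)[rule_format, of "(fst (U n x), snd (w n x))"] c(3)[of n x] q1(4) B0
    by (intro mult_mono powr_mono2) auto
   also have "... <= G x"
   proof -
    have "norm (snd (w n x)) powr p <= norm (w n x) powr p" using norm_fst_snd_le(2)[of "w n x"] p0 by (intro powr_mono2) auto
    then have "norm (snd (w n x)) powr p <= k x" using elim(3)[rule_format, of n] by linarith
    then show ?thesis unfolding G_def using elim(2)[rule_format, of n] KA0 by (intro mult_left_mono add_left_mono add_mono) auto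
   qed
   finally show "norm (?Zn n x) powr q <= G x" .
  qed
 qed
 have Zc: "AE x in M. (%n. ?Zn n x) ----> ?Z x"
  using u wc(1) c(4)
 proof eventually_elim
  case (elim x)
  have "(%n. (fst (U n x), snd (w n x))) ----> (fst (Y x), snd (Y x))"
   using elim tendsto_snd[OF elim(2)] by (intro tendsto_Pair) auto
  then have "(%n. A x (fst (U n x), snd (w n x))) ----> A x (Y x)"
   by (intro continuous_on_tendsto_compose[OF A_cont]) auto
  then show ?case using elim(3) by (intro tendsto_scaleR)
 qed
 note Z = LP_dominated[OF mZ mZn Gi Gb q1(3) Zc]
 have LU: "LP p M (%x. snd (U n x))" for n using LP_snd W_LP U p0 by blast
 have LY: "LP p M (%x. snd (Y x))" using LP_snd W_LP Y p0 by blast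
 have Lw: "LP p M (%x. snd (w n x))" for n using LP_snd W_LP w p0 by blast
 have LV: "LP p M (%x. snd (U n x) - snd (w n x))" for n using LU Lw p0 by (intro LP_diff) auto
 define C' where "C' = 2 powr p * (C + (LINT x|M. k x))"
 show ?thesis
 proof (rule inner_limit_zero[OF Z(1) Z(2) LV p1 q1(1), where C=C'])
  fix n
  have "(LINT x|M. norm (snd (U n x) - snd (w n x)) powr p) <= (LINT x|M. 2 powr p * (norm (U n x) powr p + norm (w n x) powr p))"
  proof (rule integral_mono[OF LP_int[OF LV]])
   fix x
   have "norm (snd (U n x) - snd (w n x)) powr p <= 2 powr p * (norm (snd (U n x)) powr p + norm (snd (w n x)) powr p)"
    using p0 by (intro norm_diff_powr_le) auto
   also have "... <= 2 powr p * (norm (U n x) powr p + norm (w n x) powr p)"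
    using p0 by (intro mult_left_mono add_mono powr_mono2 norm_fst_snd_le) auto
   finally show "norm (snd (U n x) - snd (w n x)) powr p <= 2 powr p * (norm (U n x) powr p + norm (w n x) powr p)" .
  qed (use LP_int[OF W_LP[OF U(1)]] LP_int[OF W_LP[OF w]] in auto)
  also have "... = 2 powr p * ((LINT x|M. norm (U n x) powr p) + (LINT x|M. norm (w n x) powr p))"
   using LP_int[OF W_LP[OF U(1)], of n] LP_int[OF W_LP[OF w], of n] by simp
  also have "(LINT x|M. norm (w n x) powr p) <= (LINT x|M. k x)"
   using wc(2) by (intro integral_mono_AE LP_int[OF W_LP[OF w]] k) auto
  finally show "(LINT x|M. norm (snd (U n x) - snd (w n x)) powr p) <= C'"
   unfolding C'_def using U(2)[of n] by (auto intro: order_trans mult_left_mono)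
 next
  show "(%n. LINT x|M. norm (?Zn n x - ?Z x) powr q) ----> 0" by (rule Z(3))
  have ds: "(%n. dst (%x. snd (w n x)) (%x. snd (Y x))) ----> 0"
   by (rule real_tendsto_sandwich[of "%n. 0" _ _ "%n. dst (w n) Y"])
    (simp_all add: dst_nonneg dst_fst_snd_le(2)[OF W_LP[OF w] W_LP[OF Y]] wd)
  have "(%n. (LINT x|M. ?Z x \<bullet> (snd (U n x) - snd (Y x))) + ((LINT x|M. ?Z x \<bullet> snd (Y x)) - (LINT x|M. ?Z x \<bullet> snd (w n x))))
    ----> 0 + ((LINT x|M. ?Z x \<bullet> snd (Y x)) - (LINT x|M. ?Z x \<bullet> snd (Y x)))"
   by (intro tendsto_add tendsto_diff tendsto_const weak Z(1) inner_dst_limit[OF Z(1) Lw LY ds])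
  moreover have "(LINT x|M. ?Z x \<bullet> (snd (U n x) - snd (Y x))) + ((LINT x|M. ?Z x \<bullet> snd (Y x)) - (LINT x|M. ?Z x \<bullet> snd (w n x)))
    = (LINT x|M. ?Z x \<bullet> (snd (U n x) - snd (w n x)))" for n
   using inner_int[OF Z(1) LU[of n]] inner_int[OF Z(1) LY] inner_int[OF Z(1) Lw[of n]] by (simp add: inner_diff_right)
  ultimately show "(%n. LINT x|M. ?Z x \<bullet> (snd (U n x) - snd (w n x))) ----> 0" by simp
 qed
qed

end

text \<open>F is bounded but may depend on the gradient, so that even this problem calls for a.e.
  convergence of the gradients.\<close>

locale leray_bounded = leray +
 fixes F :: "'a => real \<times> 'a => real" and CF :: real
 assumes F_meas: "!!z. (%x. F x z) \<in> BM M"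
  and F_cont: "!!x. continuous_on UNIV (F x)"
  and F_bound: "!!x z. \<bar>F x z\<bar> <= CF"
begin

lemma Fmeas: "X \<in> BM M ==> (%x. F x (X x)) \<in> BM M"
 by (rule Caratheodory_measurable[OF F_meas F_cont])

lemma CF0: "CF >= 0" using F_bound[of undefined undefined] by linarith

lemma F_LP: "X \<in> BM M ==> LP r M (%x. F x (X x))" if "r >= 0"
 using F_bound that by (intro LP_bounded[of _ CF] Fmeas) auto

definition comb :: "(nat => 'a => real) => nat => (nat => real) => 'a => real" where
 "comb \<phi> m c x = (\<Sum>i<m. c i * \<phi> i x)"

lemma comb_C1c: "(!!i. C1c \<Omega> (\<phi> i)) ==> C1c \<Omega> (comb \<phi> m c)"
 unfolding comb_def by (rule C1c_sum(1))

lemma comb_jet: "(!!i. C1c \<Omega> (\<phi> i)) ==> jet (comb \<phi> m c) x = (\<Sum>i<m. c i *\<^sub>R jet (\<phi> i) x)"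
proof -
 assume \<phi>: "!!i. C1c \<Omega> (\<phi> i)"
 have "grad (comb \<phi> m c) x = (\<Sum>i<m. c i *\<^sub>R grad (\<phi> i) x)"
  unfolding comb_def[abs_def] by (rule C1c_sum(2)[OF \<phi>])
 then show ?thesis by (simp add: jet_def comb_def sum_prod prod_eq_iff fst_sum snd_sum)
qed

lemma FL_int: "C1c \<Omega> \<phi> ==> X \<in> BM M ==> integrable M (%x. F x (X x) * \<phi> x)"
 using inner_int[OF F_LP[OF q1(4)] C1c_LP(2)[OF _ p0(2)]] by simp

lemma AL_int: "C1c \<Omega> \<phi> ==> LP p M X ==> integrable M (%x. A x (X x) \<bullet> grad \<phi> x)"
 by (rule inner_int[OF A_LP(1) C1c_LP(3)[OF _ p0(2)]])

lemma energy_lower: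
 "\<exists>C0\<ge>0. \<forall>u. C1c \<Omega> u -->
   (LINT x|M. A x (jet u x) \<bullet> grad u x) - (LINT x|M. F x (jet u x) * u x) \<ge>
   \<alpha> / 2 * (LINT x|M. norm (grad u x) powr p) - C0"
proof -
 obtain PC where PC: "PC > 0" "!!\<phi>. C1c \<Omega> \<phi> ==> (LINT x|M. \<bar>\<phi> x\<bar> powr p) <= PC * (LINT x|M. norm (grad \<phi> x) powr p)"
  using poincare by blast
 \<comment> \<open>Chosen so that \<open>(CF + 1) * (t powr p * PC)\<close> is \<alpha>/2: after
   Poincare's inequality half of the coercive term absorbs the lower-order one.\<close>
 define t where "t = (\<alpha> / (2 * (CF + 1) * PC)) powr (1/p)"
 have t: "t > 0" "t powr p = \<alpha> / (2 * (CF + 1) * PC)" using CF0 PC \<alpha>0 p1 by (auto simp: t_def powr_powr)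
 define C0 where "C0 = CF * (t powr (- q) * measure M (space M))"
 have C0: "C0 >= 0" unfolding C0_def using CF0 by simp
 have "(LINT x|M. A x (jet u x) \<bullet> grad u x) - (LINT x|M. F x (jet u x) * u x) \<ge>
   \<alpha> / 2 * (LINT x|M. norm (grad u x) powr p) - C0" if u: "C1c \<Omega> u" for u
 proof -
  note Lu = C1c_LP[OF u p0(2)]
  let ?E = "LINT x|M. norm (grad u x) powr p"
  have "\<alpha> * ?E = (LINT x|M. \<alpha> * norm (grad u x) powr p)" by simp
  also have "... <= (LINT x|M. A x (jet u x) \<bullet> grad u x)"
  proof (rule integral_mono_AE)
   show "AE x in M. \<alpha> * norm (grad u x) powr p <= A x (jet u x) \<bullet> grad u x"
    using A_coer by eventually_elim (metis snd_jet)
  qed (use LP_int[OF Lu(3)] AL_int[OF u Lu(1)] in auto)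
  finally have 1: "\<alpha> * ?E <= (LINT x|M. A x (jet u x) \<bullet> grad u x)" .
  have "(LINT x|M. F x (jet u x) * u x) <= (LINT x|M. CF * (t powr (- q) + t powr p * \<bar>u x\<bar> powr p))"
  proof (rule integral_mono[OF FL_int[OF u LP_meas[OF Lu(1)]]])
   show "integrable M (%x. CF * (t powr (- q) + t powr p * \<bar>u x\<bar> powr p))" using LP_int[OF Lu(2)] by simp
   fix x
   have "F x (jet u x) * u x <= \<bar>F x (jet u x)\<bar> * \<bar>u x\<bar>" by (metis abs_ge_self abs_mult)
   also have "... <= CF * \<bar>u x\<bar>" using F_bound by (intro mult_right_mono) auto
   also have "\<bar>u x\<bar> <= t powr (- q) + t powr p * \<bar>u x\<bar> powr p"
    using young_scaled[OF p1 q1(1) _ _ t(1), of 1 "\<bar>u x\<bar>"] by simp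
   finally show "F x (jet u x) * u x <= CF * (t powr (- q) + t powr p * \<bar>u x\<bar> powr p)"
    using CF0 by (simp add: mult_left_mono)
  qed
  also have "... = C0 + CF * (t powr p * (LINT x|M. \<bar>u x\<bar> powr p))"
   using LP_int[OF Lu(2)] by (simp add: C0_def algebra_simps)
  also have "... <= C0 + (CF + 1) * (t powr p * (PC * ?E))"
   using PC(2)[OF u] CF0 by (intro add_left_mono mult_mono mult_nonneg_nonneg) (auto intro!: lint_nonneg)
  also have "(CF + 1) * (t powr p * (PC * ?E)) = \<alpha> / 2 * ?E"
  proof -
   have gen: "K * (a / (2 * K * P) * (P * E)) = a / 2 * E" if "K > 0" "P > 0" for K a P E :: real
    using that by (simp add: field_simps)
   show ?thesis unfolding t(2) by (rule gen) (use CF0 PC(1) in auto)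
  qed
  finally have 2: "(LINT x|M. F x (jet u x) * u x) <= C0 + \<alpha> / 2 * ?E" .
  show ?thesis using 1 2 by (simp add: algebra_simps)
 qed
 then show ?thesis using C0 by blast
qed

text \<open>Bounded coefficients keep the jets of the combinations uniformly bounded, which
  dominates both integrands.\<close>

lemma comb_continuous:
 assumes \<phi>: "!!i. C1c \<Omega> (\<phi> i)" and c: "!!j. j < m ==> (%k. ck k j) ----> c j" and R: "!!k j. j < m ==> \<bar>ck k j\<bar> <= R"
 shows "(%k. LINT x|M. A x (jet (comb \<phi> m (ck k)) x) \<bullet> grad (\<phi> i) x) ----> (LINT x|M. A x (jet (comb \<phi> m c) x) \<bullet> grad (\<phi> i) x)"
  "(%k. LINT x|M. F x (jet (comb \<phi> m (ck k)) x) * \<phi> i x) ----> (LINT x|M. F x (jet (comb \<phi> m c) x) * \<phi> i x)"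
proof -
 have "\<forall>i. \<exists>B>0. \<forall>x. norm (jet (\<phi> i) x) <= B \<and> \<bar>\<phi> i x\<bar> <= B \<and> norm (grad (\<phi> i) x) <= B" using C1c_bounded[OF \<phi>] by blast
 from choice[OF this] obtain B where B: "\<forall>i. B i > 0 \<and> (\<forall>x. norm (jet (\<phi> i) x) <= B i \<and> \<bar>\<phi> i x\<bar> <= B i \<and> norm (grad (\<phi> i) x) <= B i)" ..
 define S where "S = (\<Sum>i<m. R * B i)"
 have bd: "norm (jet (comb \<phi> m (ck k)) x) <= S" for k x
  unfolding comb_jet[OF \<phi>] S_def
  by (rule order_trans[OF norm_sum]) (use R B in \<open>auto intro!: sum_mono mult_mono order_trans[OF abs_ge_zero R]\<close>)
 have cv: "(%k. jet (comb \<phi> m (ck k)) x) ----> jet (comb \<phi> m c) x" for x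
  unfolding comb_jet[OF \<phi>] by (intro tendsto_sum tendsto_scaleR tendsto_const c) auto
 have mk: "jet (comb \<phi> m d) \<in> BM M" for d by (rule LP_meas[OF jet_LP[OF comb_C1c[OF \<phi>]]])
 note m\<phi> = LP_meas[OF C1c_LP(2)[OF \<phi> p0(2)]] LP_meas[OF C1c_LP(3)[OF \<phi> p0(2)]]
 show "(%k. LINT x|M. F x (jet (comb \<phi> m (ck k)) x) * \<phi> i x) ----> (LINT x|M. F x (jet (comb \<phi> m c) x) * \<phi> i x)"
 proof (rule integral_dominated_convergence[where w="%x. CF * B i"])
  show "AE x in M. (%k. F x (jet (comb \<phi> m (ck k)) x) * \<phi> i x) ----> F x (jet (comb \<phi> m c) x) * \<phi> i x"
   by (intro AE_I2 tendsto_mult tendsto_const continuous_on_tendsto_compose[OF F_cont cv]) auto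
  show "AE x in M. norm (F x (jet (comb \<phi> m (ck k)) x) * \<phi> i x) <= CF * B i" for k
   using B CF0 by (intro AE_I2) (auto simp: abs_mult intro!: mult_mono F_bound)
 qed (use Fmeas[OF mk] m\<phi> in auto)
 show "(%k. LINT x|M. A x (jet (comb \<phi> m (ck k)) x) \<bullet> grad (\<phi> i) x) ----> (LINT x|M. A x (jet (comb \<phi> m c) x) \<bullet> grad (\<phi> i) x)"
 proof (rule integral_dominated_convergence[where w="%x. (\<bar>b x\<bar> + \<beta> * (S powr (p - 1) + S powr (p - 1))) * B i"])
  show "AE x in M. (%k. A x (jet (comb \<phi> m (ck k)) x) \<bullet> grad (\<phi> i) x) ----> A x (jet (comb \<phi> m c) x) \<bullet> grad (\<phi> i) x"
   by (intro AE_I2 tendsto_inner tendsto_const continuous_on_tendsto_compose[OF A_cont cv]) auto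
  show "integrable M (%x. (\<bar>b x\<bar> + \<beta> * (S powr (p - 1) + S powr (p - 1))) * B i)"
   using LP_integrable[OF b_LP q1(5)] by simp
  show "AE x in M. norm (A x (jet (comb \<phi> m (ck k)) x) \<bullet> grad (\<phi> i) x) <= (\<bar>b x\<bar> + \<beta> * (S powr (p - 1) + S powr (p - 1))) * B i" for k
   using A_grow
  proof eventually_elim
   case (elim x)
   let ?z = "jet (comb \<phi> m (ck k)) x"
   have "\<bar>fst ?z\<bar> powr (p - 1) <= S powr (p - 1)" "norm (snd ?z) powr (p - 1) <= S powr (p - 1)"
    using order_trans[OF norm_fst_snd_le(1) bd[of k x]] order_trans[OF norm_fst_snd_le(2) bd[of k x]] p1
    by (auto intro!: powr_mono2)
   then have "\<beta> * (\<bar>fst ?z\<bar> powr (p - 1) + norm (snd ?z) powr (p - 1)) <= \<beta> * (S powr (p - 1) + S powr (p - 1))"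
    using \<beta>0 by (intro mult_left_mono) auto
   then have a: "norm (A x ?z) <= \<bar>b x\<bar> + \<beta> * (S powr (p - 1) + S powr (p - 1))"
    using elim[rule_format, of ?z] by linarith
   have "norm (A x ?z \<bullet> grad (\<phi> i) x) <= norm (A x ?z) * norm (grad (\<phi> i) x)"
    using Cauchy_Schwarz_ineq2 by simp
   also have "... <= (\<bar>b x\<bar> + \<beta> * (S powr (p - 1) + S powr (p - 1))) * B i"
    using a B \<beta>0 by (intro mult_mono) auto
   finally show ?case .
  qed
 qed (use Ameas[OF mk] m\<phi> in auto)
qed

text \<open>The regularisation \<open>\<epsilon> c\<close> makes the finite-dimensional problem coercive in the coefficients
  although the \<open>\<phi> i\<close> need not be linearly independent.\<close>

lemma galerkin:
 assumes \<phi>: "!!i. C1c \<Omega> (\<phi> i)"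
 shows "\<exists>C. \<forall>m. \<exists>u. C1c \<Omega> u \<and> (LINT x|M. norm (grad u x) powr p) <= C \<and>
   (LINT x|M. A x (jet u x) \<bullet> grad u x) <= (LINT x|M. F x (jet u x) * u x) \<and>
   (\<forall>i<m. \<bar>(LINT x|M. A x (jet u x) \<bullet> grad (\<phi> i) x) - (LINT x|M. F x (jet u x) * \<phi> i x)\<bar> <= 1 / real (Suc m))"
proof -
 obtain C0 where C0: "C0 >= 0" "!!u. C1c \<Omega> u ==>
   (LINT x|M. A x (jet u x) \<bullet> grad u x) - (LINT x|M. F x (jet u x) * u x) \<ge>
   \<alpha> / 2 * (LINT x|M. norm (grad u x) powr p) - C0" using energy_lower by blast
 have "\<exists>u. C1c \<Omega> u \<and> (LINT x|M. norm (grad u x) powr p) <= 2 * C0 / \<alpha> \<and>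
   (LINT x|M. A x (jet u x) \<bullet> grad u x) <= (LINT x|M. F x (jet u x) * u x) \<and>
   (\<forall>i<m. \<bar>(LINT x|M. A x (jet u x) \<bullet> grad (\<phi> i) x) - (LINT x|M. F x (jet u x) * \<phi> i x)\<bar> <= 1 / real (Suc m))" for m
 proof -
  \<comment> \<open>The energy estimate gives \<open>e * (c i)\<^sup>2 <= C0 + 1\<close>, so this e
    makes the residual \<open>e * c i\<close> at most 1/(m + 1) in absolute value.\<close>
  define e where "e = 1 / ((C0 + 1) * (real (Suc m))\<^sup>2)"
  have e: "e > 0" using C0 by (simp add: e_def)
  \<comment> \<open>On the faces of this cube the regularisation contributes at least C0 + 1, which
    beats the loss C0 in the energy estimate.\<close>
  define R where "R = sqrt ((C0 + 1) / e)"
  have R: "R > 0" "e * R\<^sup>2 = C0 + 1" using e C0 by (auto simp: R_def)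
  define r where "r i c = (LINT x|M. A x (jet (comb \<phi> m c) x) \<bullet> grad (\<phi> i) x) - (LINT x|M. F x (jet (comb \<phi> m c) x) * \<phi> i x)" for i c
  define f where "f i c = r i c + e * c i" for i c
  have sumr: "(\<Sum>j<m. r j c * c j) = (LINT x|M. A x (jet (comb \<phi> m c) x) \<bullet> grad (comb \<phi> m c) x) - (LINT x|M. F x (jet (comb \<phi> m c) x) * comb \<phi> m c x)" for c
  proof -
   note Lc = jet_LP[OF comb_C1c[where \<phi>=\<phi> and m=m and c=c, OF \<phi>]]
   have "(\<Sum>j<m. r j c * c j) = (\<Sum>j<m. (LINT x|M. c j * (A x (jet (comb \<phi> m c) x) \<bullet> grad (\<phi> j) x)) - (LINT x|M. c j * (F x (jet (comb \<phi> m c) x) * \<phi> j x)))"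
    unfolding r_def by (intro sum.cong) (auto simp: algebra_simps)
   also have "... = (\<Sum>j<m. (LINT x|M. c j * (A x (jet (comb \<phi> m c) x) \<bullet> grad (\<phi> j) x))) - (\<Sum>j<m. (LINT x|M. c j * (F x (jet (comb \<phi> m c) x) * \<phi> j x)))"
    by (rule sum_subtractf)
   also have "(\<Sum>j<m. (LINT x|M. c j * (A x (jet (comb \<phi> m c) x) \<bullet> grad (\<phi> j) x))) = (LINT x|M. (\<Sum>j<m. c j * (A x (jet (comb \<phi> m c) x) \<bullet> grad (\<phi> j) x)))"
    using AL_int[OF \<phi> Lc] by (intro Bochner_Integration.integral_sum[symmetric]) auto
   also have "(\<Sum>j<m. (LINT x|M. c j * (F x (jet (comb \<phi> m c) x) * \<phi> j x))) = (LINT x|M. (\<Sum>j<m. c j * (F x (jet (comb \<phi> m c) x) * \<phi> j x)))"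
    using FL_int[OF \<phi> LP_meas[OF Lc]] by (intro Bochner_Integration.integral_sum[symmetric]) auto
   also have "(%x. \<Sum>j<m. c j * (A x (jet (comb \<phi> m c) x) \<bullet> grad (\<phi> j) x)) = (%x. A x (jet (comb \<phi> m c) x) \<bullet> grad (comb \<phi> m c) x)"
   proof
    fix x
    have "grad (comb \<phi> m c) x = (\<Sum>j<m. c j *\<^sub>R grad (\<phi> j) x)"
     unfolding comb_def[abs_def] by (rule C1c_sum(2)[OF \<phi>])
    then show "(\<Sum>j<m. c j * (A x (jet (comb \<phi> m c) x) \<bullet> grad (\<phi> j) x)) = A x (jet (comb \<phi> m c) x) \<bullet> grad (comb \<phi> m c) x"
     by (simp add: inner_sum_right)
   qed
   also have "(%x. \<Sum>j<m. c j * (F x (jet (comb \<phi> m c) x) * \<phi> j x)) = (%x. F x (jet (comb \<phi> m c) x) * comb \<phi> m c x)"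
    by (auto simp: comb_def sum_distrib_left intro!: sum.cong)
   finally show ?thesis .
  qed
  have sumf: "(\<Sum>j<m. f j c * c j) >= \<alpha> / 2 * (LINT x|M. norm (grad (comb \<phi> m c) x) powr p) - C0 + e * (\<Sum>j<m. (c j)\<^sup>2)" for c
  proof -
   have "(\<Sum>j<m. f j c * c j) = (\<Sum>j<m. r j c * c j) + e * (\<Sum>j<m. (c j)\<^sup>2)"
    by (simp add: f_def sum_distrib_left sum.distrib[symmetric] algebra_simps power2_eq_square)
   then show ?thesis using C0(2)[OF comb_C1c[where \<phi>=\<phi> and m=m and c=c, OF \<phi>]] sumr[of c] by linarith
  qed
  have En: "(LINT x|M. norm (grad (comb \<phi> m c) x) powr p) >= 0" for c
   by (intro lint_nonneg) auto
  have sq: "(c i)\<^sup>2 <= (\<Sum>j<m. (c j)\<^sup>2)" if "i < m" for c :: "nat => real" and i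
   using that by (intro member_le_sum) auto
  have "\<exists>c. \<forall>i<m. f i c = 0"
  proof (rule coercive_zero[OF R(1)])
   show "(%k. f i (ck k)) ----> f i c"
    if "i < m" "!!j. j < m ==> (%k. ck k j) ----> c j" "!!k j. j < m ==> \<bar>ck k j\<bar> <= R" for i c ck
    unfolding f_def r_def using that(1)
    by (intro tendsto_add tendsto_diff tendsto_mult tendsto_const that(2) comb_continuous[OF \<phi> that(2,3)])
   show "(\<Sum>j<m. f j c * c j) > 0" if "i < m" "\<bar>c i\<bar> = R" "!!j. j < m ==> \<bar>c j\<bar> <= R" for c i
   proof -
    have "R\<^sup>2 <= (\<Sum>j<m. (c j)\<^sup>2)" using sq[OF that(1), of c] that(2) by (metis power2_abs)
    then have "e * R\<^sup>2 <= e * (\<Sum>j<m. (c j)\<^sup>2)" using e by (intro mult_left_mono) auto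
    moreover have "\<alpha> / 2 * (LINT x|M. norm (grad (comb \<phi> m c) x) powr p) >= 0" using En \<alpha>0 by simp
    ultimately show ?thesis using sumf[of c] R(2) by linarith
   qed
  qed
  then obtain c where c: "\<forall>i<m. f i c = 0" by blast
  then have "(\<Sum>j<m. f j c * c j) = 0" by (intro sum.neutral) auto
  then have le: "\<alpha> / 2 * (LINT x|M. norm (grad (comb \<phi> m c) x) powr p) + e * (\<Sum>j<m. (c j)\<^sup>2) <= C0" using sumf[of c] by linarith
  have s0: "e * (\<Sum>j<m. (c j)\<^sup>2) >= 0" using e by (intro mult_nonneg_nonneg sum_nonneg) auto
  have e1: "(LINT x|M. norm (grad (comb \<phi> m c) x) powr p) <= 2 * C0 / \<alpha>"
  proof -
   have "\<alpha> / 2 * (LINT x|M. norm (grad (comb \<phi> m c) x) powr p) <= C0" using le s0 by linarith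
   then show ?thesis using \<alpha>0 by (simp add: field_simps)
  qed
  have rc: "r i c = - e * c i" if "i < m" for i using c that by (auto simp: f_def add_eq_0_iff)
  have "(\<Sum>j<m. r j c * c j) = - (e * (\<Sum>j<m. (c j)\<^sup>2))"
   unfolding sum_distrib_left sum_negf[symmetric] by (intro sum.cong) (auto simp: rc power2_eq_square)
  then have e2: "(LINT x|M. A x (jet (comb \<phi> m c) x) \<bullet> grad (comb \<phi> m c) x) <= (LINT x|M. F x (jet (comb \<phi> m c) x) * comb \<phi> m c x)"
   using sumr[of c] s0 by linarith
  have e3: "\<bar>r i c\<bar> <= 1 / real (Suc m)" if "i < m" for i
  proof -
   have "\<alpha> / 2 * (LINT x|M. norm (grad (comb \<phi> m c) x) powr p) >= 0" using En \<alpha>0 by simp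
   then have "e * (\<Sum>j<m. (c j)\<^sup>2) <= C0 + 1" using le by linarith
   then have "e * (c i)\<^sup>2 <= C0 + 1" using sq[OF that, of c] e by (smt (verit) mult_left_mono)
   then have "e * (e * (c i)\<^sup>2) <= e * (C0 + 1)" using e by (intro mult_left_mono) auto
   also have "e * (C0 + 1) = (1 / real (Suc m))\<^sup>2" using C0(1) by (simp add: e_def power_divide)
   finally have "(r i c)\<^sup>2 <= (1 / real (Suc m))\<^sup>2" by (simp add: rc[OF that] power2_eq_square algebra_simps)
   then have "\<bar>r i c\<bar> <= \<bar>1 / real (Suc m)\<bar>" by (simp only: abs_le_square_iff)
   then show ?thesis by simp
  qed
  show ?thesis
   by (intro exI[of _ "comb \<phi> m c"] conjI comb_C1c \<phi> e1 e2) (use e3 in \<open>auto simp: r_def\<close>)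
 qed
 then show ?thesis by blast
qed

text \<open>The Galerkin solutions U j are compared with test functions w j converging to their weak
  limit. The energy inequality, the approximate equation and \<open>frozen_term_limit\<close> make
  the monotone increments D j vanish in L^1; then the gradients converge a.e. along a subsequence
  and both sides pass to the limit.\<close>

theorem leray_existence:
 "\<exists>Y\<in>W. \<forall>V\<in>W. (LINT x|M. A x (Y x) \<bullet> snd (V x)) = (LINT x|M. F x (Y x) * fst (V x))"
proof -
 from W_separable obtain \<phi> :: "nat => 'a => real" where sep: "(\<forall>i. C1c \<Omega> (\<phi> i)) \<and> (\<forall>X\<in>W. \<forall>e>0. \<exists>i. dst (jet (\<phi> i)) X < e)"
  ..
 note \<phi> = sep[THEN conjunct1, rule_format] and dense = sep[THEN conjunct2]
 obtain C where C: "\<forall>m. \<exists>u. C1c \<Omega> u \<and> (LINT x|M. norm (grad u x) powr p) <= C \<and>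
   (LINT x|M. A x (jet u x) \<bullet> grad u x) <= (LINT x|M. F x (jet u x) * u x) \<and>
   (\<forall>i<m. \<bar>(LINT x|M. A x (jet u x) \<bullet> grad (\<phi> i) x) - (LINT x|M. F x (jet u x) * \<phi> i x)\<bar> <= 1 / real (Suc m))"
  using galerkin[of \<phi>, OF \<phi>] ..
 from choice[OF C] obtain v where v: "\<forall>m. C1c \<Omega> (v m) \<and> (LINT x|M. norm (grad (v m) x) powr p) <= C \<and>
   (LINT x|M. A x (jet (v m) x) \<bullet> grad (v m) x) <= (LINT x|M. F x (jet (v m) x) * v m x) \<and>
   (\<forall>i<m. \<bar>(LINT x|M. A x (jet (v m) x) \<bullet> grad (\<phi> i) x) - (LINT x|M. F x (jet (v m) x) * \<phi> i x)\<bar> <= 1 / real (Suc m))" ..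
 have XW: "jet (v m) \<in> W" for m using v by (intro jet_W) blast
 have XC: "(LINT x|M. norm (snd (jet (v m) x)) powr p) <= C" for m using v by simp
 obtain r Y g where r: "strict_mono (r::nat=>nat)" and Y: "Y \<in> W" and g: "integrable M g"
   and u: "AE x in M. (%n. fst (jet (v (r n)) x)) ----> fst (Y x)"
   and ug: "AE x in M. \<forall>n. \<bar>fst (jet (v (r n)) x)\<bar> powr p <= g x"
   and weak: "\<forall>Z. LP q M Z --> (%n. LINT x|M. Z x \<bullet> (snd (jet (v (r n)) x) - snd (Y x))) ----> 0"
  by (rule W_compact[of "%m. jet (v m)" C, OF XW XC])
 have "\<forall>j. \<exists>i. dst (jet (\<phi> i)) Y < (1/2)^j" using dense Y by simp
 from choice[OF this] obtain I where I: "\<forall>j. dst (jet (\<phi> (I j))) Y < (1/2)^j" ..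
 \<comment> \<open>An index large enough for \<open>\<phi> (I j)\<close> to be among the functions
   tested in the Galerkin problem that U j solves.\<close>
 define n where "n j = max j (Suc (I j))" for j
 have nlim: "filterlim n at_top sequentially"
  by (rule filterlim_at_top_mono[OF filterlim_ident]) (auto simp: n_def)
 define U where "U j = jet (v (r (n j)))" for j
 define w where "w j = jet (\<phi> (I j))" for j
 have UW: "U j \<in> W" and wW: "w j \<in> W" for j unfolding U_def w_def by (intro XW jet_W \<phi>)+
 have Is: "I j < r (n j)" "j <= r (n j)" for j using seq_suble[OF r, of "n j"] by (auto simp: n_def)
 have uU: "AE x in M. (%j. fst (U j x)) ----> fst (Y x)" using u unfolding U_def
  by eventually_elim (rule filterlim_compose[OF _ nlim])
 have ugU: "AE x in M. \<forall>j. \<bar>fst (U j x)\<bar> powr p <= g x" using ug unfolding U_def by eventually_elim blast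
 have weakU: "(%j. LINT x|M. Z x \<bullet> (snd (U j x) - snd (Y x))) ----> 0" if "LP q M Z" for Z
  using filterlim_compose[OF weak[rule_format, OF that] nlim] unfolding U_def .
 have Ile: "dst (w j) Y <= (1/2)^j" for j using I unfolding w_def by (simp add: less_imp_le)
 note wf = LP_fast[OF W_LP[OF wW] W_LP[OF Y] Ile[unfolded dst_def] p0(1)]
 obtain k where k: "integrable M k" "AE x in M. \<forall>j. norm (w j x) powr p <= k x" using wf(2) by blast
 have wd: "(%j. dst (w j) Y) ----> 0"
  by (rule real_tendsto_sandwich[of "%n. 0" _ _ "%j. (1/2)^j"])
    (auto simp: dst_nonneg Ile intro!: LIMSEQ_realpow_zero)
 obtain K where K: "K > 0" "\<forall>X\<in>W. (LINT x|M. norm (X x) powr p) <= K * (LINT x|M. norm (snd (X x)) powr p)"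
  using W_norm_bound by blast
 have UC: "(LINT x|M. norm (U j x) powr p) <= K * C" for j
 proof -
  have "(LINT x|M. norm (U j x) powr p) <= K * (LINT x|M. norm (snd (U j x)) powr p)" using K(2) UW by blast
  also have "... <= K * C" unfolding U_def using K(1) XC by (intro mult_left_mono) auto
  finally show ?thesis .
 qed
 have frozen: "(%j. LINT x|M. (1 *\<^sub>R A x (fst (U j x), snd (w j x))) \<bullet> (snd (U j x) - snd (w j x))) ----> 0"
  by (rule frozen_term_limit[OF UW UC Y wW g uU ugU k(1) wf(1) k(2) wd weakU, where B=1]) auto
 have LU: "LP p M (U j)" and Lw: "LP p M (w j)" for j by (intro W_LP UW wW)+
 have LUs: "LP p M (%x. snd (U j x))" "LP p M (%x. snd (w j x))" "LP p M (%x. fst (U j x))" "LP p M (%x. fst (w j x))" for j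
  using LP_snd LP_fst LU Lw p0 by blast+
 have LV: "LP p M (%x. snd (U j x) - snd (w j x))" for j by (intro LP_diff LUs p0)
 have Lp: "LP p M (%x. (fst (U j x), snd (w j x)))" for j by (intro LP_Pair LUs p0)
 have Fi: "integrable M (%x. F x (U j x) * fst (U j x))" "integrable M (%x. F x (U j x) * fst (w j x))" for j
  using inner_int[OF F_LP[OF q1(4) LP_meas[OF LU]] LUs(3)] inner_int[OF F_LP[OF q1(4) LP_meas[OF LU]] LUs(4)] by auto
 have Ft: "(%j. LINT x|M. F x (U j x) * (fst (U j x) - fst (w j x))) ----> (LINT x|M. 0)"
 proof (rule integral_dominated_convergence[where w="%x. CF * ((1 + g x) + (1 + k x))"])
  show "AE x in M. norm (F x (U j x) * (fst (U j x) - fst (w j x))) <= CF * ((1 + g x) + (1 + k x))" for j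
   using ugU k(2)
  proof eventually_elim
   case (elim x)
   have "\<bar>fst (U j x)\<bar> <= 1 + g x"
    using le_one_plus_powr[OF p0(3), of "\<bar>fst (U j x)\<bar>"] elim(1)[rule_format, of j] by simp
   moreover have "norm (w j x) <= 1 + k x"
    using le_one_plus_powr[OF p0(3), of "norm (w j x)"] elim(2)[rule_format, of j] by simp
   ultimately have "\<bar>fst (U j x) - fst (w j x)\<bar> <= (1 + g x) + (1 + k x)"
    using norm_fst_snd_le(1)[of "w j x"] by simp
   then show ?case unfolding norm_mult using F_bound CF0 by (intro mult_mono) (auto simp del: split_paired_All)
  qed
  show "AE x in M. (%j. F x (U j x) * (fst (U j x) - fst (w j x))) ----> 0" using uU wf(1)
  proof eventually_elim
   case (elim x)
   have d: "(%j. fst (U j x) - fst (w j x)) ----> 0"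
    using tendsto_diff[OF elim(1) tendsto_fst[OF elim(2)]] by simp
   show ?case
   proof (rule Lim_null_comparison)
    show "\<forall>\<^sub>F j in sequentially. norm (F x (U j x) * (fst (U j x) - fst (w j x))) <= CF * \<bar>fst (U j x) - fst (w j x)\<bar>"
     unfolding real_norm_def abs_mult by (intro always_eventually allI mult_right_mono F_bound) auto
    show "(%j. CF * \<bar>fst (U j x) - fst (w j x)\<bar>) ----> 0"
     using tendsto_mult_right_zero[OF tendsto_rabs_zero[OF d]] .
   qed
  qed
  show "integrable M (%x. CF * ((1 + g x) + (1 + k x)))" using g k by simp
 qed (use Fmeas[OF LP_meas[OF LU]] LP_meas[OF LUs(3)] LP_meas[OF LUs(4)] in auto)
 define D where "D j x = (A x (U j x) - A x (fst (U j x), snd (w j x))) \<bullet> (snd (U j x) - snd (w j x))" for j x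
 have Di: "integrable M (D j)" for j
  unfolding D_def by (rule inner_int[OF LP_diff[OF A_LP(1)[OF LU] A_LP(1)[OF Lp] q1(4)] LV])
 have D0: "AE x in M. D j x >= 0" for j
  using A_mono_nonneg
 proof eventually_elim
  case (elim x)
  then show ?case using elim[rule_format, of "fst (U j x)" "snd (U j x)" "snd (w j x)"] by (simp add: D_def)
 qed
 have Dle: "(LINT x|M. D j x) <= (LINT x|M. F x (U j x) * (fst (U j x) - fst (w j x))) + 1 / real (Suc j)
   - (LINT x|M. (1 *\<^sub>R A x (fst (U j x), snd (w j x))) \<bullet> (snd (U j x) - snd (w j x)))" for j
 proof -
  have "(LINT x|M. D j x) = (LINT x|M. A x (U j x) \<bullet> snd (U j x)) - (LINT x|M. A x (U j x) \<bullet> snd (w j x))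
   - (LINT x|M. A x (fst (U j x), snd (w j x)) \<bullet> (snd (U j x) - snd (w j x)))"
   using inner_int[OF A_LP(1)[OF LU] LUs(1), of j j] inner_int[OF A_LP(1)[OF LU] LUs(2), of j j]
    inner_int[OF A_LP(1)[OF Lp] LV, of j j]
   by (simp add: D_def inner_diff_left inner_diff_right[of "A x (U j x)" for x])
  moreover have "(LINT x|M. A x (U j x) \<bullet> snd (U j x)) <= (LINT x|M. F x (U j x) * fst (U j x))"
   using v by (simp add: U_def)
  moreover have "\<bar>(LINT x|M. A x (U j x) \<bullet> snd (w j x)) - (LINT x|M. F x (U j x) * fst (w j x))\<bar> <= 1 / real (Suc (r (n j)))"
   using v Is(1)[of j] by (simp add: U_def w_def)
  moreover have "1 / real (Suc (r (n j))) <= 1 / real (Suc j)" using Is(2)[of j] by (intro divide_left_mono) auto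
  moreover have "(LINT x|M. F x (U j x) * (fst (U j x) - fst (w j x))) = (LINT x|M. F x (U j x) * fst (U j x)) - (LINT x|M. F x (U j x) * fst (w j x))"
   using Fi by (simp add: right_diff_distrib)
  ultimately show ?thesis by simp
 qed
 have Dlim: "(%j. LINT x|M. norm (D j x)) ----> 0"
 proof (rule real_tendsto_sandwich[of "%n. 0"])
  have eq: "(LINT x|M. norm (D j x)) = (LINT x|M. D j x)" for j
   using D0[of j] Di[of j] by (intro integral_cong_AE) auto
  show "\<forall>\<^sub>F j in sequentially. (LINT x|M. norm (D j x)) <= (LINT x|M. F x (U j x) * (fst (U j x) - fst (w j x))) + 1 / real (Suc j)
   - (LINT x|M. (1 *\<^sub>R A x (fst (U j x), snd (w j x))) \<bullet> (snd (U j x) - snd (w j x)))"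
   unfolding eq by (intro always_eventually allI Dle)
  show "(%j. (LINT x|M. F x (U j x) * (fst (U j x) - fst (w j x))) + 1 / real (Suc j)
   - (LINT x|M. (1 *\<^sub>R A x (fst (U j x), snd (w j x))) \<bullet> (snd (U j x) - snd (w j x)))) ----> 0"
   using tendsto_diff[OF tendsto_add[OF Ft LIMSEQ_Suc[OF lim_1_over_n]] frozen] by simp
 qed (auto intro!: always_eventually lint_nonneg)
 obtain t where t: "strict_mono t" "AE x in M. (%j. D (t j) x) ----> 0"
  using tendsto_L1_AE_subseq[OF Di Dlim] by blast
 have ut: "AE x in M. (%j. fst (U (t j) x)) ----> fst (Y x)" using uU
  by eventually_elim (rule filterlim_compose[OF _ filterlim_subseq[OF t(1)]])
 have wt: "AE x in M. (%j. snd (w (t j) x)) ----> snd (Y x)" using wf(1)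
  by eventually_elim (rule filterlim_compose[OF tendsto_snd filterlim_subseq[OF t(1)]])
 have "AE x in M. x \<in> UNIV --> (%j. snd (U (t j) x)) ----> snd (Y x)"
 proof (rule gradient_AE[OF ut wt])
  show "AE x in M. x \<in> UNIV --> (%j. (A x (U (t j) x) - A x (fst (U (t j) x), snd (w (t j) x))) \<bullet> (snd (U (t j) x) - snd (w (t j) x))) ----> 0"
   using t(2) unfolding D_def by eventually_elim simp
 qed
 with ut have Ut: "AE x in M. (%j. U (t j) x) ----> Y x"
 proof eventually_elim
  case (elim x)
  have "(%j. (fst (U (t j) x), snd (U (t j) x))) ----> (fst (Y x), snd (Y x))" using elim by (intro tendsto_Pair) auto
  then show ?case by simp
 qed
 have AL: "(%j. LINT x|M. norm (A x (U (t j) x) - A x (Y x))) ----> 0"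
  by (rule A_conv_L1[OF LU UC W_LP[OF Y] Ut])
 have LAY: "LP q M (%x. A x (Y x))" and LFY: "LP q M (%x. F x (Y x))"
  using A_LP(1)[OF W_LP[OF Y]] F_LP[OF q1(4) LP_meas[OF W_LP[OF Y]]] by auto
 have eq\<phi>: "(LINT x|M. A x (Y x) \<bullet> grad (\<phi> i) x) = (LINT x|M. F x (Y x) * \<phi> i x)" for i
 proof -
  obtain B where B: "B > 0" "\<forall>x. \<bar>\<phi> i x\<bar> <= B \<and> norm (grad (\<phi> i) x) <= B" using jet_bounded_C1c[OF \<phi>[of i]] by blast
  have l1: "(%j. (LINT x|M. A x (U (t j) x) \<bullet> grad (\<phi> i) x) - (LINT x|M. A x (Y x) \<bullet> grad (\<phi> i) x)) ----> 0"
  proof (rule Lim_null_comparison)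
   show "(%j. B * (LINT x|M. norm (A x (U (t j) x) - A x (Y x)))) ----> 0" by (rule tendsto_mult_right_zero[OF AL])
   show "\<forall>\<^sub>F j in sequentially. norm ((LINT x|M. A x (U (t j) x) \<bullet> grad (\<phi> i) x) - (LINT x|M. A x (Y x) \<bullet> grad (\<phi> i) x)) <= B * (LINT x|M. norm (A x (U (t j) x) - A x (Y x)))"
   proof (intro always_eventually allI)
    fix j
    have LD: "LP q M (%x. A x (U (t j) x) - A x (Y x))" using A_LP(1)[OF LU] LAY q1 by (intro LP_diff) auto
    have "(LINT x|M. A x (U (t j) x) \<bullet> grad (\<phi> i) x) - (LINT x|M. A x (Y x) \<bullet> grad (\<phi> i) x) = (LINT x|M. (A x (U (t j) x) - A x (Y x)) \<bullet> grad (\<phi> i) x)"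
     using AL_int[OF \<phi>[of i] LU[of "t j"]] AL_int[OF \<phi>[of i] W_LP[OF Y]] by (simp add: inner_diff_left)
    also have "norm ... <= (LINT x|M. norm ((A x (U (t j) x) - A x (Y x)) \<bullet> grad (\<phi> i) x))" by (rule integral_norm_bound)
    also have "... <= (LINT x|M. B * norm (A x (U (t j) x) - A x (Y x)))"
    proof (rule integral_mono)
     show "integrable M (%x. norm ((A x (U (t j) x) - A x (Y x)) \<bullet> grad (\<phi> i) x))"
      using inner_int[OF LD C1c_LP(3)[OF \<phi> p0(2)]] by auto
     show "integrable M (%x. B * norm (A x (U (t j) x) - A x (Y x)))" using LP_integrable[OF LD q1(5)] by auto
     fix x
     have "norm ((A x (U (t j) x) - A x (Y x)) \<bullet> grad (\<phi> i) x) <= norm (A x (U (t j) x) - A x (Y x)) * norm (grad (\<phi> i) x)"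
      using Cauchy_Schwarz_ineq2 by simp
     also have "... <= norm (A x (U (t j) x) - A x (Y x)) * B" using B by (intro mult_left_mono) auto
     finally show "norm ((A x (U (t j) x) - A x (Y x)) \<bullet> grad (\<phi> i) x) <= B * norm (A x (U (t j) x) - A x (Y x))"
      by (simp add: mult.commute)
    qed
    finally show "norm ((LINT x|M. A x (U (t j) x) \<bullet> grad (\<phi> i) x) - (LINT x|M. A x (Y x) \<bullet> grad (\<phi> i) x)) <= B * (LINT x|M. norm (A x (U (t j) x) - A x (Y x)))"
     by simp
   qed
  qed
  have l2: "(%j. LINT x|M. F x (U (t j) x) * \<phi> i x) ----> (LINT x|M. F x (Y x) * \<phi> i x)"
  proof (rule integral_dominated_convergence[where w="%x. CF * B"])
   show "AE x in M. (%j. F x (U (t j) x) * \<phi> i x) ----> F x (Y x) * \<phi> i x" using Ut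
    by eventually_elim (intro tendsto_mult tendsto_const continuous_on_tendsto_compose[OF F_cont]; simp)
   show "AE x in M. norm (F x (U (t j) x) * \<phi> i x) <= CF * B" for j
    unfolding real_norm_def abs_mult using B CF0 by (intro AE_I2 mult_mono F_bound) auto
  qed (use Fmeas[OF LP_meas[OF LU]] Fmeas[OF LP_meas[OF W_LP[OF Y]]] LP_meas[OF C1c_LP(2)[OF \<phi> p0(2)]] in auto)
  have l3: "(%j. (LINT x|M. A x (U (t j) x) \<bullet> grad (\<phi> i) x) - (LINT x|M. F x (U (t j) x) * \<phi> i x)) ----> 0"
  proof (rule Lim_null_comparison)
   show "(%j. 1 / real (Suc j)) ----> 0" by (rule LIMSEQ_Suc[OF lim_1_over_n])
   show "\<forall>\<^sub>F j in sequentially. norm ((LINT x|M. A x (U (t j) x) \<bullet> grad (\<phi> i) x) - (LINT x|M. F x (U (t j) x) * \<phi> i x)) <= 1 / real (Suc j)"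
    using eventually_gt_at_top[of i]
   proof eventually_elim
    case (elim j)
    have j: "j <= r (n (t j))" using Is(2)[of "t j"] seq_suble[OF t(1), of j] by simp
    then have "i < r (n (t j))" using elim by simp
    then have "\<bar>(LINT x|M. A x (U (t j) x) \<bullet> grad (\<phi> i) x) - (LINT x|M. F x (U (t j) x) * \<phi> i x)\<bar> <= 1 / real (Suc (r (n (t j))))"
     using v by (simp add: U_def)
    also have "... <= 1 / real (Suc j)" using j by (intro divide_left_mono) auto
    finally show ?case by simp
   qed
  qed
  show ?thesis using tendsto_add[OF tendsto_diff[OF l3 l1] l2] by (simp add: LIMSEQ_const_iff)
 qed
 have "(LINT x|M. A x (Y x) \<bullet> snd (V x)) = (LINT x|M. F x (Y x) * fst (V x))" if V: "V \<in> W" for V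
 proof -
  have "\<forall>j. \<exists>i. dst (jet (\<phi> i)) V < (1/2)^j" using dense V by simp
  from choice[OF this] obtain I where I: "\<forall>j. dst (jet (\<phi> (I j))) V < (1/2)^j" ..
  have z: "(%j. dst (jet (\<phi> (I j))) V) ----> 0"
   by (rule real_tendsto_sandwich[of "%n. 0" _ _ "%j. (1/2)^j"])
     (auto simp: dst_nonneg I less_imp_le intro!: LIMSEQ_realpow_zero)
  have L: "LP p M (jet (\<phi> (I j)))" for j by (rule jet_LP[OF \<phi>])
  have d: "(%j. dst (%x. snd (jet (\<phi> (I j)) x)) (%x. snd (V x))) ----> 0" "(%j. dst (%x. fst (jet (\<phi> (I j)) x)) (%x. fst (V x))) ----> 0"
   by (rule real_tendsto_sandwich[OF _ _ tendsto_const z], simp_all only: dst_nonneg dst_fst_snd_le[OF L W_LP[OF V]] eventually_True)+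
  have l1: "(%j. LINT x|M. A x (Y x) \<bullet> snd (jet (\<phi> (I j)) x)) ----> (LINT x|M. A x (Y x) \<bullet> snd (V x))"
   by (rule inner_dst_limit[OF LAY _ _ d(1)]) (intro LP_snd L W_LP V p0)+
  have "(%j. LINT x|M. F x (Y x) \<bullet> fst (jet (\<phi> (I j)) x)) ----> (LINT x|M. F x (Y x) \<bullet> fst (V x))"
   by (rule inner_dst_limit[OF LFY _ _ d(2)]) (intro LP_fst L W_LP V p0)+
  then have l2: "(%j. LINT x|M. A x (Y x) \<bullet> snd (jet (\<phi> (I j)) x)) ----> (LINT x|M. F x (Y x) * fst (V x))"
   by (simp add: eq\<phi>)
  show ?thesis by (rule LIMSEQ_unique[OF l1 l2])
 qed
 then show ?thesis using Y by blast
qed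

end

section \<open>Composition with truncations\<close>

context dom
begin

lemma lipschitz_of_deriv:
 fixes T T' :: "real => real"
 assumes "!!s. (T has_field_derivative T' s) (at s)" "!!s. \<bar>T' s\<bar> <= B"
 shows "\<bar>T s - T t\<bar> <= B * \<bar>s - t\<bar>"
proof -
 have "norm (T s - T t) <= B * norm (s - t)"
  by (rule field_differentiable_bound[of UNIV T T']) (use assms in auto)
 then show ?thesis by simp
qed

text \<open>T 0 = 0 keeps the supports of the composed test functions compact, and the bound on T'
  provides the majorant.\<close>

lemma W_compose:
 assumes X: "X \<in> W" and T: "!!s. (T has_field_derivative T' s) (at s)" "continuous_on UNIV T'" "!!s. \<bar>T' s\<bar> <= B" "T 0 = 0"
 shows "(%x. (T (fst (X x)), T' (fst (X x)) *\<^sub>R snd (X x))) \<in> W"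
proof -
 obtain \<phi> g where F: "\<forall>n. C1c \<Omega> (\<phi> n)" "AE x in M. (%n. jet (\<phi> n) x) ----> X x" "integrable M g"
  "AE x in M. \<forall>n. norm (jet (\<phi> n) x) powr p <= g x" using W_fast[OF X] by blast
 have cT: "continuous_on UNIV T" by (rule DERIV_continuous_on) (use T(1) in \<open>auto intro: has_field_derivative_at_within\<close>)
 have B0: "B >= 0" using T(3) abs_ge_zero order_trans by blast
 have C: "C1c \<Omega> (%x. T (\<phi> n x))" for n
  by (rule C1c_dom[OF C1_compose(1)[OF C1c_C1[OF F(1)[rule_format, of n]] T(1,2)] F(1)[rule_format, of n]]) (simp add: T(4))
 have j: "jet (%x. T (\<phi> n x)) x = (T (\<phi> n x), T' (\<phi> n x) *\<^sub>R grad (\<phi> n) x)" for n x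
  using C1_compose(2)[OF C1c_C1 T(1,2), of \<Omega> "\<phi> n"] F(1) by (simp add: jet_def)
 show ?thesis
 proof (rule W_dominated(1)[OF C])
  show "(%x. (T (fst (X x)), T' (fst (X x)) *\<^sub>R snd (X x))) \<in> BM M"
   using borel_measurable_fst_snd[OF LP_meas[OF W_LP[OF X]]] borel_measurable_continuous_on[OF cT] borel_measurable_continuous_on[OF T(2)]
   by (intro borel_measurable_Pair borel_measurable_scaleR) auto
  show "integrable M (%x. (2 * B) powr p * g x)" using F by auto
  show "AE x in M. \<forall>n. norm (jet (%x. T (\<phi> n x)) x) powr p <= (2 * B) powr p * g x" using F(4)
  proof eventually_elim
   case (elim x)
   show ?case
   proof
    fix n
    have "norm (jet (%x. T (\<phi> n x)) x) <= \<bar>T (\<phi> n x)\<bar> + norm (T' (\<phi> n x) *\<^sub>R grad (\<phi> n) x)"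
     unfolding j using norm_Pair_le[of "T (\<phi> n x)" "T' (\<phi> n x) *\<^sub>R grad (\<phi> n) x"] by simp
    also have "\<bar>T (\<phi> n x)\<bar> <= B * \<bar>\<phi> n x\<bar>" using lipschitz_of_deriv[OF T(1,3), of "\<phi> n x" 0] T(4) by simp
    also have "norm (T' (\<phi> n x) *\<^sub>R grad (\<phi> n) x) <= B * norm (grad (\<phi> n) x)" using T(3) by (simp add: mult_right_mono)
    also have "B * \<bar>\<phi> n x\<bar> <= B * norm (jet (\<phi> n) x)" using norm_fst_snd_le(1)[of "jet (\<phi> n) x"] B0 by (intro mult_left_mono) auto
    also have "B * norm (grad (\<phi> n) x) <= B * norm (jet (\<phi> n) x)" using norm_fst_snd_le(2)[of "jet (\<phi> n) x"] B0 by (intro mult_left_mono) auto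
    finally have "norm (jet (%x. T (\<phi> n x)) x) <= 2 * B * norm (jet (\<phi> n) x)" by simp
    then have "norm (jet (%x. T (\<phi> n x)) x) powr p <= (2 * B * norm (jet (\<phi> n) x)) powr p" using p0 by (intro powr_mono2) auto
    also have "... = (2 * B) powr p * norm (jet (\<phi> n) x) powr p" by (rule powr_mult)
    also have "... <= (2 * B) powr p * g x" using elim by (intro mult_left_mono) auto
    finally show "norm (jet (%x. T (\<phi> n x)) x) powr p <= (2 * B) powr p * g x" .
   qed
  qed
  show "AE x in M. (%n. jet (%x. T (\<phi> n x)) x) ----> (T (fst (X x)), T' (fst (X x)) *\<^sub>R snd (X x))" using F(2)
  proof eventually_elim
   case (elim x)
   have 1: "(%n. \<phi> n x) ----> fst (X x)" "(%n. grad (\<phi> n) x) ----> snd (X x)"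
    using tendsto_fst[OF elim] tendsto_snd[OF elim] by auto
   show ?case unfolding j
    by (intro tendsto_Pair tendsto_scaleR 1 continuous_on_tendsto_compose[OF cT 1(1)] continuous_on_tendsto_compose[OF T(2) 1(1)]) auto
  qed
 qed
qed

text \<open>Here \<psi> provides the compact support, so T(0) is arbitrary; in return T itself is
  bounded, since it multiplies the gradient of \<psi>.\<close>

lemma W_test:
 assumes X: "X \<in> W" and \<psi>: "C1c \<Omega> \<psi>" and w: "C1c \<Omega> w"
  and T: "!!s. (T has_field_derivative T' s) (at s)" "continuous_on UNIV T'" "!!s. \<bar>T' s\<bar> <= B" "!!s. \<bar>T s\<bar> <= B"
 shows "(%x. (\<psi> x * T (fst (X x) - w x), T (fst (X x) - w x) *\<^sub>R grad \<psi> x + (\<psi> x * T' (fst (X x) - w x)) *\<^sub>R (snd (X x) - grad w x))) \<in> W"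
proof -
 obtain \<phi> g where F: "\<forall>n. C1c \<Omega> (\<phi> n)" "AE x in M. (%n. jet (\<phi> n) x) ----> X x" "integrable M g"
  "AE x in M. \<forall>n. norm (jet (\<phi> n) x) powr p <= g x" using W_fast[OF X] by blast
 have cT: "continuous_on UNIV T" by (rule DERIV_continuous_on) (use T(1) in \<open>auto intro: has_field_derivative_at_within\<close>)
 have B0: "B >= 0" using T(3) abs_ge_zero order_trans by blast
 obtain L where L: "L > 0" "\<forall>x. \<bar>\<psi> x\<bar> <= L \<and> norm (grad \<psi> x) <= L" using jet_bounded_C1c[OF \<psi>] by blast
 obtain L' where L': "L' > 0" "\<forall>x. \<bar>w x\<bar> <= L' \<and> norm (grad w x) <= L'" using jet_bounded_C1c[OF w] by blast
 define v where "v n x = \<psi> x * T (\<phi> n x - w x)" for n x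
 have C1d: "C1 (%x. \<phi> n x - w x)" "grad (%x. \<phi> n x - w x) x = grad (\<phi> n) x - grad w x" for n x
  using C1_diff[OF C1c_C1 C1c_C1[OF w], of \<Omega> "\<phi> n"] F(1) by auto
 have C1T: "C1 (%x. T (\<phi> n x - w x))" "grad (%x. T (\<phi> n x - w x)) x = T' (\<phi> n x - w x) *\<^sub>R (grad (\<phi> n) x - grad w x)" for n x
  using C1_compose[OF C1d(1)[of n] T(1,2)] C1d(2) by auto
 have C: "C1c \<Omega> (v n)" for n unfolding v_def by (rule C1c_mult[OF \<psi> C1T(1)])
 have j: "jet (v n) x = (\<psi> x * T (\<phi> n x - w x), T (\<phi> n x - w x) *\<^sub>R grad \<psi> x + (\<psi> x * T' (\<phi> n x - w x)) *\<^sub>R (grad (\<phi> n) x - grad w x))" for n x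
  using C1_mult(2)[OF C1c_C1[OF \<psi>] C1T(1)[of n]] C1T(2)[of n] by (simp add: jet_def v_def[abs_def] add.commute)
 define K where "K = 2 * L * B + L * B * L' + L * B"
 have K0: "K >= 0" using L(1) L'(1) B0 by (simp add: K_def)
 have bd: "norm (jet (v n) x) <= K * (1 + norm (jet (\<phi> n) x))" for n x
 proof -
  have "norm (jet (v n) x) <= \<bar>\<psi> x * T (\<phi> n x - w x)\<bar> + norm (T (\<phi> n x - w x) *\<^sub>R grad \<psi> x + (\<psi> x * T' (\<phi> n x - w x)) *\<^sub>R (grad (\<phi> n) x - grad w x))"
   unfolding j by (rule order_trans[OF norm_Pair_le]) simp
  also have "... <= \<bar>\<psi> x\<bar> * \<bar>T (\<phi> n x - w x)\<bar> + (\<bar>T (\<phi> n x - w x)\<bar> * norm (grad \<psi> x) + \<bar>\<psi> x\<bar> * \<bar>T' (\<phi> n x - w x)\<bar> * (norm (grad (\<phi> n) x) + norm (grad w x)))"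
   unfolding abs_mult
   by (intro add_left_mono order_trans[OF norm_triangle_ineq] add_mono) (auto simp: abs_mult intro!: mult_left_mono norm_triangle_ineq4)
  also have "... <= L * B + (B * L + L * B * (norm (jet (\<phi> n) x) + L'))"
   using L L' T(3)[of "\<phi> n x - w x"] T(4)[of "\<phi> n x - w x"] B0 norm_fst_snd_le(2)[of "jet (\<phi> n) x"]
   by (intro add_mono mult_mono) auto
  also have "... = 2 * L * B + L * B * L' + L * B * norm (jet (\<phi> n) x)" by (simp add: algebra_simps)
  also have "... <= K + K * norm (jet (\<phi> n) x)"
   using L(1) L'(1) B0 by (intro add_mono mult_right_mono) (auto simp: K_def)
  finally show ?thesis by (simp add: distrib_left)
 qed
 show ?thesis
 proof (rule W_dominated(1)[OF C])
  have "(%x. fst (X x) - w x) \<in> BM M" "\<psi> \<in> BM M" "grad \<psi> \<in> BM M" "grad w \<in> BM M"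
   "(%x. snd (X x)) \<in> BM M"
   using borel_measurable_fst_snd[OF LP_meas[OF W_LP[OF X]]] LP_meas[OF C1c_LP(2)[OF \<psi> p0(2)]] LP_meas[OF C1c_LP(3)[OF \<psi> p0(2)]]
    LP_meas[OF C1c_LP(2)[OF w p0(2)]] LP_meas[OF C1c_LP(3)[OF w p0(2)]] by auto
  then show "(%x. (\<psi> x * T (fst (X x) - w x), T (fst (X x) - w x) *\<^sub>R grad \<psi> x + (\<psi> x * T' (fst (X x) - w x)) *\<^sub>R (snd (X x) - grad w x))) \<in> BM M"
   using borel_measurable_continuous_on[OF cT] borel_measurable_continuous_on[OF T(2)]
   by (intro borel_measurable_Pair borel_measurable_times borel_measurable_add borel_measurable_scaleR borel_measurable_diff) auto
  show "integrable M (%x. K powr p * (2 powr p * (1 + g x)))" using F by auto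
  show "AE x in M. \<forall>n. norm (jet (v n) x) powr p <= K powr p * (2 powr p * (1 + g x))" using F(4)
  proof eventually_elim
   case (elim x)
   show ?case
   proof
    fix n
    have "norm (jet (v n) x) powr p <= (K * (1 + norm (jet (\<phi> n) x))) powr p" using bd p0 by (intro powr_mono2) auto
    also have "... = K powr p * (1 + norm (jet (\<phi> n) x)) powr p" by (rule powr_mult)
    also have "(1 + norm (jet (\<phi> n) x)) powr p <= 2 powr p * (1 + norm (jet (\<phi> n) x) powr p)"
     using powr_add_le[of 1 "norm (jet (\<phi> n) x)" p] p0 by simp
    also have "... <= 2 powr p * (1 + g x)" using elim by (intro mult_left_mono add_left_mono) auto
    finally show "norm (jet (v n) x) powr p <= K powr p * (2 powr p * (1 + g x))" by (simp add: mult_left_mono)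
   qed
  qed
  show "AE x in M. (%n. jet (v n) x) ----> (\<psi> x * T (fst (X x) - w x), T (fst (X x) - w x) *\<^sub>R grad \<psi> x + (\<psi> x * T' (fst (X x) - w x)) *\<^sub>R (snd (X x) - grad w x))" using F(2)
  proof eventually_elim
   case (elim x)
   have 1: "(%n. \<phi> n x) ----> fst (X x)" "(%n. grad (\<phi> n) x) ----> snd (X x)"
    using tendsto_fst[OF elim] tendsto_snd[OF elim] by auto
   have 2: "(%n. \<phi> n x - w x) ----> fst (X x) - w x" by (intro tendsto_diff 1 tendsto_const)
   have 3: "(%n. T (\<phi> n x - w x)) ----> T (fst (X x) - w x)" "(%n. T' (\<phi> n x - w x)) ----> T' (fst (X x) - w x)"
    by (intro continuous_on_tendsto_compose[OF cT 2] continuous_on_tendsto_compose[OF T(2) 2]; simp)+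
   show ?case unfolding j by (intro tendsto_Pair tendsto_scaleR tendsto_add tendsto_diff tendsto_mult 1 3 tendsto_const)
  qed
 qed
qed

text \<open>The gradient of a function in \<open>W\<close> vanishes where the function does: truncate at height \<open>\<delta>\<close>
 with slope \<open>\<approx> 1\<close> at the zero level and let \<open>\<delta> \<rightarrow> 0\<close>.\<close>

lemma gradient_zero_on_level:
 assumes X: "X \<in> W" shows "AE x in M. fst (X x) = 0 --> snd (X x) = 0"
proof -
 \<comment> \<open>T n tends to 0 while its slope stays 1 at 0 and tends to 0 elsewhere. The limit
   jet is 0 paired with grad u restricted to {u = 0}, and \<open>W_unique\<close> compares it with
   the zero jet.\<close>
 define T where "T n s = s / (1 + (real (Suc n) * s)\<^sup>2)" for n s
 define T' where "T' n s = (1 - (real (Suc n) * s)\<^sup>2) / (1 + (real (Suc n) * s)\<^sup>2)\<^sup>2" for n s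
 have pos: "1 + (real (Suc n) * s)\<^sup>2 > 0" for n s by (simp add: add_pos_nonneg)
 have dT: "(T n has_field_derivative T' n s) (at s)" for n s
 proof -
  have "(T n has_field_derivative (1 * (1 + (real (Suc n) * s)\<^sup>2) - s * (2 * (real (Suc n) * s) * real (Suc n))) / ((1 + (real (Suc n) * s)\<^sup>2) * (1 + (real (Suc n) * s)\<^sup>2))) (at s)"
   unfolding T_def using pos[of n s] by (intro DERIV_divide) (auto intro!: derivative_eq_intros)
  then show ?thesis unfolding T'_def by (simp add: power2_eq_square algebra_simps)
 qed
 have cT': "continuous_on UNIV (T' n)" for n
  unfolding T'_def using pos by (intro continuous_intros) (auto simp: less_imp_neq[symmetric] simp del: of_nat_Suc)
 have bT': "\<bar>T' n s\<bar> <= 1" for n s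
 proof -
  define t where "t = (real (Suc n) * s)\<^sup>2"
  have t: "t >= 0" by (simp add: t_def)
  have "\<bar>1 - t\<bar> <= 1 + t" using t by linarith
  also have "1 + t <= (1 + t)\<^sup>2" using t by (simp add: power2_eq_square algebra_simps)
  finally have "\<bar>1 - t\<bar> <= (1 + t)\<^sup>2" .
  then show ?thesis unfolding T'_def t_def[symmetric] using t by (simp add: abs_divide divide_le_eq)
 qed
 have T0: "T n 0 = 0" "T' n 0 = 1" for n by (auto simp: T_def T'_def)
 have Tle: "\<bar>T n s\<bar> <= \<bar>s\<bar>" for n s using lipschitz_of_deriv[OF dT bT', of n s 0] T0 by simp
 have lim: "(%n. T n s) ----> 0" "(%n. T' n s) ----> (if s = 0 then 1 else 0)" for s
 proof -
  have "(%n. T n s) ----> 0 \<and> (%n. T' n s) ----> 0" if s: "s \<noteq> 0"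
  proof -
   have "filterlim (%n. real (Suc n) * \<bar>s\<bar>) at_top sequentially"
    using s by (intro filterlim_at_top_mult_tendsto_pos[OF tendsto_const _ filterlim_compose[OF filterlim_real_sequentially filterlim_Suc]]) simp
   then have l1: "filterlim (%n. (real (Suc n) * \<bar>s\<bar>)\<^sup>2) at_top sequentially"
    by (rule filterlim_pow_at_top[rotated]) simp
   then have l: "filterlim (%n. 1 + (real (Suc n) * s)\<^sup>2) at_top sequentially"
    by (intro filterlim_tendsto_add_at_top[OF tendsto_const]) (simp add: power_mult_distrib)
   have i: "(%n. 1 / (1 + (real (Suc n) * s)\<^sup>2)) ----> 0"
    by (rule tendsto_divide_0[OF tendsto_const filterlim_at_top_imp_at_infinity[OF l]])
   have a: "(%n. T n s) ----> 0" using tendsto_mult_right_zero[OF i, of s] by (simp add: T_def)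
   have "(%n. T' n s) ----> 0"
   proof (rule Lim_null_comparison[OF _ i], intro always_eventually allI)
    fix n
    define t where "t = (real (Suc n) * s)\<^sup>2"
    have t: "t >= 0" by (simp add: t_def)
    have "\<bar>1 - t\<bar> / (1 + t)\<^sup>2 <= (1 + t) / (1 + t)\<^sup>2" using t by (intro divide_right_mono) auto
    also have "... = 1 / (1 + t)" using t by (simp add: power2_eq_square)
    finally show "norm (T' n s) <= 1 / (1 + (real (Suc n) * s)\<^sup>2)"
     unfolding T'_def t_def[symmetric] using t by (simp add: abs_divide)
   qed
   with a show ?thesis by blast
  qed
  then show "(%n. T n s) ----> 0" "(%n. T' n s) ----> (if s = 0 then 1 else 0)"
   using T0 by (cases "s = 0"; simp)+
 qed
 define Z where "Z n x = (T n (fst (X x)), T' n (fst (X x)) *\<^sub>R snd (X x))" for n x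
 define Z0 where "Z0 x = (0::real, (if fst (X x) = 0 then 1 else 0::real) *\<^sub>R snd (X x))" for x
 have ZW: "Z n \<in> W" for n unfolding Z_def by (rule W_compose[OF X dT cT' bT' T0(1)])
 have [measurable]: "(%x. fst (X x)) \<in> BM M" "(%x. snd (X x)) \<in> BM M"
  using borel_measurable_fst_snd[OF LP_meas[OF W_LP[OF X]]] by auto
 have mZ0: "Z0 \<in> BM M" unfolding Z0_def by (intro borel_measurable_Pair) measurable
 have "AE x in M. \<forall>n. norm (Z n x) powr p <= 2 powr p * norm (X x) powr p"
 proof (intro AE_I2 allI)
  fix x n
  have "norm (Z n x) <= \<bar>T n (fst (X x))\<bar> + \<bar>T' n (fst (X x))\<bar> * norm (snd (X x))"
   unfolding Z_def by (rule order_trans[OF norm_Pair_le]) simp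
  also have "... <= norm (X x) + 1 * norm (X x)"
   using Tle[of n "fst (X x)"] bT'[of n "fst (X x)"] norm_fst_snd_le[of "X x"] by (intro add_mono mult_mono) auto
  finally have "norm (Z n x) powr p <= (2 * norm (X x)) powr p" using p0 by (intro powr_mono2) auto
  then show "norm (Z n x) powr p <= 2 powr p * norm (X x) powr p" by (simp add: powr_mult)
 qed
 moreover have "AE x in M. (%n. Z n x) ----> Z0 x" unfolding Z_def Z0_def
  by (intro AE_I2 tendsto_Pair tendsto_scaleR lim tendsto_const)
 ultimately have d: "LP p M Z0" "(%n. dst (Z n) Z0) ----> 0"
  using LP_dominated(1,3)[OF mZ0 LP_meas[OF W_LP[OF ZW]], where Y="%x. 2 powr p * norm (X x) powr p" and q=p] LP_int[OF W_LP[OF X]] p0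
  by (auto simp: dst_def)
 have "Z0 \<in> W" by (rule W_closed[OF ZW d])
 moreover have "(%x. 0) \<in> W" using jet_W[OF C1c_zero] by (simp add: jet_def[abs_def] C1_const(2) zero_prod_def)
 ultimately have "AE x in M. snd (Z0 x) = snd (0 :: real \<times> 'a)" by (rule W_unique) (simp add: Z0_def)
 then show ?thesis by eventually_elim (auto simp: Z0_def split: if_splits)
qed

end

section \<open>Approximate problems\<close>

text \<open>The constants are what the estimates consume. s0 and c0 express that g has a positive
  lower limit at infinity, and \<open>h_sing\<close> encodes \<gamma> \<le> 1: arctan s compensates
  s^(-\<gamma>) near 0. The datum f is nonnegative everywhere, being the positive part of the
  original one.\<close>

locale singular = leray \<Omega> p a \<alpha> \<beta> b
 for \<Omega> :: "'a::euclidean_space set" and p :: real and a :: "'a => real \<times> 'a => 'a" and \<alpha> \<beta> :: real and b :: "'a => real" +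
 fixes g :: "real => real" and h :: "real => ennreal" and f :: "'a => real" and s0 c0 Ch :: real
 assumes g_cont: "continuous_on {0..} g" and g_nn: "!!s. s >= 0 ==> g s >= 0"
  and s0: "s0 >= 1" and c0: "c0 > 0" and g_ge: "!!s. s >= s0 ==> g s >= c0"
  and h_cont: "continuous_on {0..} h" and h_fin: "!!s. s > 0 ==> h s < \<infinity>"
  and Ch0: "Ch >= 0" and h_sing: "!!s. s > 0 ==> h s * ennreal (arctan s) <= ennreal Ch"
  and h_bd: "!!\<delta>. \<delta> > 0 ==> \<exists>B. \<forall>s\<ge>\<delta>. h s <= ennreal B"
  and f_int: "integrable M f" and f_nn: "!!x. f x >= 0"
begin

definition \<kappa> :: "nat => real" where "\<kappa> n = real (Suc n)"
text \<open>\<open>KE n >= 1 + (\<kappa> n)^2\<close> outweighs the derivative 1/(1 + u^2) of arctan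
  for 0 \<le> u \<le> \<kappa> n, and \<open>KE n / RE n = 1 / (1 + \<kappa> n)\<close> makes the
  flux \<open>E n\<close> negligible in L^1.\<close>

definition KE :: "nat => real" where "KE n = (1 + \<kappa> n)^2"
definition RE :: "nat => real" where "RE n = (1 + \<kappa> n)^3"
text \<open>Normalised so that \<open>E n \<xi> \<bullet> \<xi>\<close> is KE n times the excess of
  |\<xi>|^p over the threshold at which \<open>G n\<close> cuts it off. The maximum in the
  denominator avoids division by 0 and equals r wherever the numerator is positive.\<close>

definition er :: "nat => real => real" where
 "er n r = KE n * max 0 (r powr p - RE n powr p) / (max r (RE n))^2"
definition E :: "nat => 'a => 'a" where "E n \<xi> = er n (norm \<xi>) *\<^sub>R \<xi>"
text \<open>The first factor makes the term vanish at nonpositive values, which leads to nonnegative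
  solutions, and tends to 1 where the limit is positive. Where the limit is 0, so is its gradient,
  and nothing is lost.\<close>

definition G :: "nat => real \<times> 'a => real" where
 "G n z = min 1 (\<kappa> n * max 0 (fst z)) * g (min (max 0 (fst z)) (\<kappa> n)) * min (norm (snd z) powr p) (RE n powr p)"
definition hn :: "nat => real => real" where "hn n s = enn2real (min (h (max 0 s)) (ennreal (\<kappa> n)))"
text \<open>The last factor switches the source off above \<kappa> n, so that solutions stay in the
  range where \<open>E n\<close> is strong enough.\<close>

definition H :: "nat => 'a => real => real" where
 "H n x s = hn n s * min (f x) (\<kappa> n) * max 0 (min 1 (\<kappa> n - s))"

lemma \<kappa>1: "\<kappa> n >= 1" by (simp add: \<kappa>_def)
lemma KE1: "KE n >= 1" "KE n >= 1 + (\<kappa> n)^2"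
proof -
 show "KE n >= 1 + (\<kappa> n)^2" using \<kappa>1[of n] by (simp add: KE_def power2_eq_square algebra_simps)
 then show "KE n >= 1" by (smt (verit) zero_le_power2)
qed
lemma RE1: "RE n >= 1" "RE n > 0" "RE n >= real n" "KE n / RE n = 1 / (1 + \<kappa> n)"
proof -
 have k: "1 + \<kappa> n >= 1" using \<kappa>1[of n] by simp
 have "(1 + \<kappa> n)^1 <= (1 + \<kappa> n)^3" by (rule power_increasing[OF _ k]) simp
 then have "1 + \<kappa> n <= RE n" by (simp add: RE_def)
 then show "RE n >= 1" "RE n > 0" "RE n >= real n" using \<kappa>1[of n] by (auto simp: \<kappa>_def)
 show "KE n / RE n = 1 / (1 + \<kappa> n)" using k by (simp add: KE_def RE_def power3_eq_cube power2_eq_square)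
qed

lemma er_nonneg: "er n r >= 0"
 unfolding er_def using KE1(1)[of n] by (intro divide_nonneg_nonneg mult_nonneg_nonneg) auto

lemma er_zero: "0 <= r ==> r <= RE n ==> er n r = 0"
proof -
 assume "0 <= r" "r <= RE n"
 then have "r powr p <= RE n powr p" using p0 by (intro powr_mono2) auto
 then show ?thesis by (simp add: er_def)
qed

lemma er_large: "r > RE n ==> er n r = KE n * (r powr p - RE n powr p) / r^2"
proof -
 assume r: "r > RE n"
 then have "RE n powr p <= r powr p" using p0 RE1(2)[of n] by (intro powr_mono2) auto
 then show ?thesis using r by (simp add: er_def)
qed

lemma E_inner: "E n \<xi> \<bullet> \<xi> = KE n * max 0 (norm \<xi> powr p - RE n powr p)"
proof (cases "norm \<xi> <= RE n")
 case True
 then have "norm \<xi> powr p <= RE n powr p" using p0 by (intro powr_mono2) auto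
 then show ?thesis using er_zero[OF norm_ge_zero True] by (simp add: E_def)
next
 case False
 then have l: "norm \<xi> > RE n" by simp
 then have "RE n powr p <= norm \<xi> powr p" using p0 RE1(2)[of n] by (intro powr_mono2) auto
 moreover have "norm \<xi> > 0" using l RE1(2)[of n] by linarith
 ultimately show ?thesis using er_large[OF l] by (simp add: E_def dot_square_norm)
qed

lemma E_inner_nonneg: "E n \<xi> \<bullet> \<xi> >= 0"
 unfolding E_inner using KE1(1)[of n] by simp

lemma E_zero: "norm \<xi> <= RE n ==> E n \<xi> = 0"
 using er_zero[of "norm \<xi>" n] by (simp add: E_def)

text \<open>The first bound is the growth condition of a Leray-Lions operator. The second uses that
  E vanishes up to RE n, and yields smallness in L^1.\<close>

lemma E_norm: "norm (E n \<xi>) <= KE n * norm \<xi> powr (p - 1)" "norm (E n \<xi>) <= 1 / (1 + \<kappa> n) * norm \<xi> powr p"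
proof -
 have "norm (E n \<xi>) <= KE n * norm \<xi> powr (p - 1) \<and> norm (E n \<xi>) <= KE n / RE n * norm \<xi> powr p"
 proof (cases "norm \<xi> <= RE n")
  case True
  then show ?thesis using E_zero[OF True] KE1(1)[of n] RE1(2)[of n] by (auto intro!: mult_nonneg_nonneg divide_nonneg_nonneg)
 next
  case False
  define r where "r = norm \<xi>"
  have r: "r > RE n" "r > 0" using False RE1(2)[of n] by (auto simp: r_def)
  have "norm (E n \<xi>) = er n r * r" using er_nonneg[of n r] by (simp add: E_def r_def)
  also have "... = KE n * (r powr p - RE n powr p) / r"
   using er_large[OF r(1)] r(2) by (simp add: power2_eq_square)
  also have "... <= KE n * r powr p / r" using r KE1(1)[of n] by (intro divide_right_mono mult_left_mono) auto
  finally have 1: "norm (E n \<xi>) <= KE n * r powr p / r" .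
  have "r powr p / r = r powr (p - 1)" using r by (simp add: powr_diff)
  from this[symmetric] have 2: "norm (E n \<xi>) <= KE n * r powr (p - 1)" using 1 by simp
  have "KE n * r powr p / r <= KE n * r powr p / RE n"
   using r RE1(2)[of n] KE1(1)[of n] by (intro divide_left_mono mult_nonneg_nonneg) auto
  then show ?thesis using 1 2 by (simp add: r_def)
 qed
 then show "norm (E n \<xi>) <= KE n * norm \<xi> powr (p - 1)" "norm (E n \<xi>) <= 1 / (1 + \<kappa> n) * norm \<xi> powr p"
  by (auto simp: RE1(4))
qed

lemma E_cont: "continuous_on UNIV (E n)"
proof -
 have "max (norm \<xi>) (RE n) \<noteq> 0" for \<xi> :: 'a using RE1(2)[of n] by linarith
 then show ?thesis unfolding E_def er_def using p0
  by (intro continuous_intros continuous_on_powr' continuous_on_max) auto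
qed

text \<open>E is radial with the nondecreasing profile \<open>er n r * r\<close>; Cauchy-Schwarz
  reduces monotonicity to that of the profile.\<close>

lemma E_mono: "(E n \<xi> - E n \<zeta>) \<bullet> (\<xi> - \<zeta>) >= 0"
proof -
 have mon: "er n r * r <= er n s * s" if "0 <= r" "r <= s" for r s
 proof (cases "r <= RE n")
  case True
  then show ?thesis using er_zero[OF that(1) True] er_nonneg[of n s] that by simp
 next
  case False
  then have rs: "r > RE n" "s > RE n" "r > 0" "s > 0" using that RE1(2)[of n] by auto
  have eq: "er n t * t = KE n * (t powr (p - 1) - RE n powr p / t)" if "t > RE n" "t > 0" for t
   using er_large[OF that(1)] that(2) by (simp add: power2_eq_square powr_diff field_simps)
  have "r powr (p - 1) <= s powr (p - 1)" using that p1 by (intro powr_mono2) auto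
  moreover have "RE n powr p / s <= RE n powr p / r" using that rs by (intro divide_left_mono) auto
  ultimately show ?thesis unfolding eq[OF rs(1,3)] eq[OF rs(2,4)] using KE1(1)[of n] by (intro mult_left_mono) auto
 qed
 define r s where "r = norm \<xi>" and "s = norm \<zeta>"
 have rs: "r >= 0" "s >= 0" by (auto simp: r_def s_def)
 have "(er n r * r - er n s * s) * (r - s) >= 0"
  using mon[of r s] mon[of s r] rs by (cases "r <= s") (auto intro: mult_nonpos_nonpos mult_nonneg_nonneg)
 moreover have "(er n r + er n s) * (\<xi> \<bullet> \<zeta>) <= (er n r + er n s) * (r * s)"
  using er_nonneg[of n] norm_cauchy_schwarz[of \<xi> \<zeta>] by (intro mult_left_mono) (auto simp: r_def s_def)
 moreover have "(E n \<xi> - E n \<zeta>) \<bullet> (\<xi> - \<zeta>) = er n r * r^2 + er n s * s^2 - (er n r + er n s) * (\<xi> \<bullet> \<zeta>)"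
  by (simp add: E_def r_def s_def power2_norm_eq_inner inner_simps inner_commute algebra_simps)
 ultimately show ?thesis by (simp add: power2_eq_square algebra_simps)
qed

lemma g_cut_cont: "continuous_on UNIV (%s. g (min (max 0 s) c))" if "c >= 0"
 by (rule continuous_on_compose2[OF g_cont]) (use that in \<open>auto intro!: continuous_intros\<close>)

lemma g_bound: "c >= 0 ==> \<exists>B\<ge>0. \<forall>s. 0 <= s \<and> s <= c --> g s <= B"
proof -
 assume "c >= 0"
 have "bounded (g ` {0..c})"
  by (intro compact_imp_bounded compact_continuous_image continuous_on_subset[OF g_cont]) auto
 then obtain B where "B > 0" "\<forall>x\<in>{0..c}. norm (g x) <= B" unfolding bounded_pos by blast
 then show ?thesis by (intro exI[of _ B]) (force simp: abs_le_iff)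
qed

lemma G_nonneg: "G n z >= 0"
 unfolding G_def using \<kappa>1[of n] by (intro mult_nonneg_nonneg g_nn) auto

lemma G_bound: "\<exists>B\<ge>0. \<forall>z. G n z <= B"
proof -
 obtain B where B: "B >= 0" "\<forall>s. 0 <= s \<and> s <= \<kappa> n --> g s <= B" using g_bound[of "\<kappa> n"] \<kappa>1[of n] by auto
 have "G n z <= 1 * B * RE n powr p" for z
  unfolding G_def using B \<kappa>1[of n] by (intro mult_mono mult_nonneg_nonneg g_nn) auto
 then show ?thesis using B(1) by (intro exI[of _ "1 * B * RE n powr p"]) auto
qed

lemma G_cont: "continuous_on UNIV (G n)"
proof -
 have c: "continuous_on UNIV (%z::real\<times>'a. g (min (max 0 (fst z)) (\<kappa> n)))"
  by (rule continuous_on_compose2[OF g_cut_cont[of "\<kappa> n"]]) (use \<kappa>1[of n] in \<open>auto intro!: continuous_intros\<close>)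
 show ?thesis unfolding G_def using p0
  by (intro continuous_on_mult c continuous_on_min continuous_on_max continuous_on_powr' continuous_intros) auto
qed

lemma hn_nonneg: "hn n s >= 0" by (simp add: hn_def)

lemma hn_le: "hn n s <= \<kappa> n"
 unfolding hn_def using \<kappa>1[of n] by (intro enn2real_leI) auto

lemma ennreal_hn: "ennreal (hn n s) = min (h (max 0 s)) (ennreal (\<kappa> n))"
 unfolding hn_def by (rule ennreal_enn2real) (auto simp: min_less_iff_disj)

lemma h_cont': "continuous_on UNIV (%s. h (max 0 s))"
 by (rule continuous_on_compose2[OF h_cont]) (auto intro!: continuous_intros)

lemma hn_cont: "continuous_on UNIV (hn n)"
proof -
 have c: "continuous_on UNIV (%s. min (h (max 0 s)) (ennreal (\<kappa> n)))"
  by (intro continuous_on_min h_cont' continuous_on_const)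
 have "isCont (hn n) s" for s
 proof -
  have "((%s. min (h (max 0 s)) (ennreal (\<kappa> n))) \<longlongrightarrow> min (h (max 0 s)) (ennreal (\<kappa> n))) (at s)"
   using c by (simp add: continuous_on_eq_continuous_at isCont_def)
  then have "((%s. min (h (max 0 s)) (ennreal (\<kappa> n))) \<longlongrightarrow> ennreal (hn n s)) (at s)" by (simp add: ennreal_hn)
  from tendsto_enn2real[OF this hn_nonneg] show ?thesis unfolding isCont_def hn_def[abs_def] by simp
 qed
 then show ?thesis by (simp add: continuous_at_imp_continuous_on)
qed

lemma H_nonneg: "H n x s >= 0"
 unfolding H_def using \<kappa>1[of n] hn_nonneg f_nn by (intro mult_nonneg_nonneg) auto

lemma H_le: "H n x s <= hn n s * f x"
proof -
 have "H n x s <= hn n s * f x * 1"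
  unfolding H_def using \<kappa>1[of n] hn_nonneg f_nn by (intro mult_mono mult_nonneg_nonneg) auto
 then show ?thesis by simp
qed

lemma H_bound: "H n x s <= \<kappa> n * \<kappa> n"
proof -
 have "H n x s <= \<kappa> n * \<kappa> n * 1"
  unfolding H_def using \<kappa>1[of n] hn_nonneg hn_le f_nn by (intro mult_mono mult_nonneg_nonneg) auto
 then show ?thesis by simp
qed

lemma H_cont: "continuous_on UNIV (%z::real\<times>'a. H n x (fst z))"
 unfolding H_def
 by (intro continuous_on_mult continuous_on_compose2[OF hn_cont] continuous_on_max continuous_on_min continuous_intros) auto

definition sol :: "nat => ('a => real \<times> 'a) => bool" where
 "sol n U \<longleftrightarrow> U \<in> W \<and> (\<forall>V\<in>W. (LINT x|M. (a x (U x) + E n (snd (U x))) \<bullet> snd (V x)) =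
   (LINT x|M. (H n x (fst (U x)) - G n (U x)) * fst (V x)))"

text \<open>Adding \<open>E n\<close> keeps the Leray-Lions structure: it is monotone, has growth of
  order p - 1 and a nonnegative product with \<xi>, so strict monotonicity and coercivity are
  inherited from a.\<close>

lemma approx_solution: "\<exists>U. sol n U"
proof -
 obtain B where B: "B >= 0" "\<forall>z. G n z <= B" using G_bound[of n] by blast
 have fm: "f \<in> BM M" using f_int by auto
 interpret L: leray_bounded \<Omega> p "%x z. a x z + E n (snd z)" \<alpha> "\<beta> + KE n" b "%x z. H n x (fst z) - G n z" "\<kappa> n * \<kappa> n + B"
 proof unfold_locales
  show "(%x. a x z + E n (snd z)) \<in> BM M" for z using A_meas[of z] by auto
  show "continuous_on UNIV (%z. a x z + E n (snd z))" for x
   by (intro continuous_on_add A_cont continuous_on_compose2[OF E_cont] continuous_intros) auto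
  show "0 < \<alpha>" by (rule \<alpha>0)
  show "0 <= \<beta> + KE n" using \<beta>0 KE1(1)[of n] by simp
  show "LP q M b" by (rule b_LP)
  show "AE x in M. \<forall>z. \<alpha> * norm (snd z) powr p <= (a x z + E n (snd z)) \<bullet> snd z"
   using A_coer by eventually_elim (auto simp: inner_add_left intro: add_increasing2 E_inner_nonneg simp del: split_paired_All)
  show "AE x in M. \<forall>z. norm (a x z + E n (snd z)) <= b x + (\<beta> + KE n) * (\<bar>fst z\<bar> powr (p - 1) + norm (snd z) powr (p - 1))"
   using A_grow
  proof eventually_elim
   case (elim x)
   show ?case
   proof
    fix z :: "real \<times> 'a"
    have "norm (a x z + E n (snd z)) <= norm (a x z) + norm (E n (snd z))" by (rule norm_triangle_ineq)
    moreover have "0 <= KE n * \<bar>fst z\<bar> powr (p - 1)" using KE1(1)[of n] by simp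
    ultimately show "norm (a x z + E n (snd z)) <= b x + (\<beta> + KE n) * (\<bar>fst z\<bar> powr (p - 1) + norm (snd z) powr (p - 1))"
     using elim[rule_format, of z] E_norm(1)[of n "snd z"] by (simp add: distrib_left distrib_right)
   qed
  qed
  show "AE x in M. \<forall>s \<xi> \<xi>'. \<xi> \<noteq> \<xi>' --> 0 < (a x (s, \<xi>) + E n (snd (s, \<xi>)) - (a x (s, \<xi>') + E n (snd (s, \<xi>')))) \<bullet> (\<xi> - \<xi>')"
   using A_mono
  proof eventually_elim
   case (elim x)
   show ?case
   proof (intro allI impI)
    fix s :: real and \<xi> \<xi>' :: 'a assume "\<xi> \<noteq> \<xi>'"
    then have "0 < (a x (s, \<xi>) - a x (s, \<xi>')) \<bullet> (\<xi> - \<xi>') + (E n \<xi> - E n \<xi>') \<bullet> (\<xi> - \<xi>')"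
     using elim E_mono[of n \<xi> \<xi>'] by (simp add: add_pos_nonneg)
    then show "0 < (a x (s, \<xi>) + E n (snd (s, \<xi>)) - (a x (s, \<xi>') + E n (snd (s, \<xi>')))) \<bullet> (\<xi> - \<xi>')"
     by (simp add: inner_simps algebra_simps)
   qed
  qed
  show "(%x. H n x (fst z) - G n z) \<in> BM M" for z unfolding H_def using fm by measurable
  show "continuous_on UNIV (%z. H n x (fst z) - G n z)" for x by (intro continuous_on_diff H_cont G_cont)
  show "\<bar>H n x (fst z) - G n z\<bar> <= \<kappa> n * \<kappa> n + B" for x z
   using H_nonneg[of n x "fst z"] H_bound[of n x "fst z"] G_nonneg[of n z] B(1) B(2)[rule_format, of z]
    mult_nonneg_nonneg[of "\<kappa> n" "\<kappa> n"] \<kappa>1[of n]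
   unfolding abs_le_iff by linarith
 qed
 show ?thesis using L.leray_existence unfolding sol_def by blast
qed

lemma E_LP: "LP p M X ==> LP q M (%x. E n (snd (X x)))"
proof (rule LP_boundI[where g="%x. KE n powr q * norm (X x) powr p"])
 assume X: "LP p M X"
 show "(%x. E n (snd (X x))) \<in> BM M"
  by (rule borel_measurable_continuous_on[OF E_cont borel_measurable_fst_snd(2)[OF LP_meas[OF X]]])
 show "integrable M (%x. KE n powr q * norm (X x) powr p)" using LP_int[OF X] by simp
 show "AE x in M. norm (E n (snd (X x))) powr q <= KE n powr q * norm (X x) powr p"
 proof (rule AE_I2)
  fix x
  have pq: "(p - 1) * q = p" using p1 by (simp add: q1(1))
  have "norm (E n (snd (X x))) powr q <= (KE n * norm (snd (X x)) powr (p - 1)) powr q"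
   using E_norm(1) q1(4) by (intro powr_mono2) auto
  also have "... = KE n powr q * norm (snd (X x)) powr p" using KE1(1)[of n] by (simp add: powr_mult powr_powr pq)
  also have "... <= KE n powr q * norm (X x) powr p" using norm_fst_snd_le(2)[of "X x"] p0 by (intro mult_left_mono powr_mono2) auto
  finally show "norm (E n (snd (X x))) powr q <= KE n powr q * norm (X x) powr p" .
 qed
qed

lemma G_meas: "X \<in> BM M ==> (%x. G n (X x)) \<in> BM M"
 by (rule borel_measurable_continuous_on[OF G_cont])

lemma H_meas:
 assumes [measurable]: "u \<in> BM M" shows "(%x. H n x (u x)) \<in> BM M"
proof -
 have [measurable]: "f \<in> BM M" "(%x. hn n (u x)) \<in> BM M"
  using f_int borel_measurable_continuous_on[OF hn_cont assms] by auto
 show ?thesis unfolding H_def by measurable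
qed

lemma GH_LP: assumes "X \<in> BM M" shows "LP q M (%x. G n (X x))" "LP q M (%x. H n x (fst (X x)))"
proof -
 obtain B where B: "B >= 0" "\<forall>z. G n z <= B" using G_bound[of n] by blast
 show "LP q M (%x. G n (X x))"
  by (rule LP_bounded[of _ B]) (use G_meas[OF assms] B G_nonneg q1(4) in \<open>auto simp del: split_paired_All\<close>)
 show "LP q M (%x. H n x (fst (X x)))"
  by (rule LP_bounded[of _ "\<kappa> n * \<kappa> n"]) (use H_meas[OF borel_measurable_fst_snd(1)[OF assms]] H_bound H_nonneg q1 in auto)
qed

lemma sol_ints:
 assumes U: "U \<in> W" and V: "V \<in> W"
 shows "integrable M (%x. a x (U x) \<bullet> snd (V x))" "integrable M (%x. E n (snd (U x)) \<bullet> snd (V x))"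
  "integrable M (%x. G n (U x) * fst (V x))" "integrable M (%x. H n x (fst (U x)) * fst (V x))"
proof -
 have L: "LP p M U" "LP p M (%x. snd (V x))" "LP p M (%x. fst (V x))"
  using W_LP[OF U] LP_snd[OF W_LP[OF V] p0(2)] LP_fst[OF W_LP[OF V] p0(2)] by auto
 show "integrable M (%x. a x (U x) \<bullet> snd (V x))" "integrable M (%x. E n (snd (U x)) \<bullet> snd (V x))"
  by (rule inner_int[OF A_LP(1)[OF L(1)] L(2)], rule inner_int[OF E_LP[OF L(1)] L(2)])
 show "integrable M (%x. G n (U x) * fst (V x))" "integrable M (%x. H n x (fst (U x)) * fst (V x))"
  using inner_int[OF GH_LP(1)[OF LP_meas[OF L(1)], of n] L(3)] inner_int[OF GH_LP(2)[OF LP_meas[OF L(1)], of n] L(3)] by auto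
qed

lemma sol_eq:
 assumes "sol n U" "V \<in> W"
 shows "(LINT x|M. a x (U x) \<bullet> snd (V x)) + (LINT x|M. E n (snd (U x)) \<bullet> snd (V x)) + (LINT x|M. G n (U x) * fst (V x))
   = (LINT x|M. H n x (fst (U x)) * fst (V x))"
proof -
 have U: "U \<in> W" using assms by (simp add: sol_def)
 note i = sol_ints[OF U assms(2)]
 have "(LINT x|M. (a x (U x) + E n (snd (U x))) \<bullet> snd (V x)) = (LINT x|M. (H n x (fst (U x)) - G n (U x)) * fst (V x))"
  using assms by (simp add: sol_def)
 then show ?thesis using i by (simp add: inner_add_left left_diff_distrib)
qed

text \<open>After testing with T(u) the flux terms are nonnegative and the right-hand side is
  nonpositive, so T'(u) |grad u|^p = 0 a.e. Thus T(u) has zero gradient, and Poincare's inequality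
  makes it 0.\<close>

lemma sign_test:
 assumes U: "sol n U" and T: "!!s. (T has_field_derivative T' s) (at s)" "continuous_on UNIV T'" "!!s. 0 <= T' s" "!!s. T' s <= 1" "T 0 = 0"
  and sg: "!!x s \<xi>. (H n x s - G n (s, \<xi>)) * T s <= 0"
 shows "AE x in M. T (fst (U x)) = 0"
proof -
 have UW: "U \<in> W" using U by (simp add: sol_def)
 define V where "V x = (T (fst (U x)), T' (fst (U x)) *\<^sub>R snd (U x))" for x
 have VW: "V \<in> W" unfolding V_def by (rule W_compose[OF UW T(1,2) _ T(5), of 1]) (use T(3,4) in auto)
 note i = sol_ints[OF UW VW]
 have "(LINT x|M. a x (U x) \<bullet> snd (V x)) <= 0"
 proof -
  have "(LINT x|M. E n (snd (U x)) \<bullet> snd (V x)) >= 0"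
   by (intro lint_nonneg) (auto simp: V_def intro: mult_nonneg_nonneg T(3) E_inner_nonneg)
  moreover have "(LINT x|M. H n x (fst (U x)) * fst (V x) - G n (U x) * fst (V x)) <= (LINT x|M. 0)"
  proof (rule integral_mono)
   show "H n x (fst (U x)) * fst (V x) - G n (U x) * fst (V x) <= 0" for x
    using sg[of x "fst (U x)" "snd (U x)"] by (simp add: V_def left_diff_distrib)
  qed (use i in auto)
  ultimately show ?thesis using sol_eq[OF U VW] i by simp
 qed
 have pos: "AE x in M. a x (U x) \<bullet> snd (V x) >= T' (fst (U x)) * (\<alpha> * norm (snd (U x)) powr p)"
  using A_coer
 proof eventually_elim
  case (elim x)
  then show ?case using elim[rule_format, of "U x"] T(3) by (simp add: V_def mult_left_mono)
 qed
 have pos0: "AE x in M. a x (U x) \<bullet> snd (V x) >= 0"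
  using pos
 proof eventually_elim
  case (elim x)
  have "T' (fst (U x)) * (\<alpha> * norm (snd (U x)) powr p) >= 0" using T(3) \<alpha>0 by (intro mult_nonneg_nonneg) auto
  then show ?case using elim by linarith
 qed
 have "(LINT x|M. a x (U x) \<bullet> snd (V x)) = 0"
  using \<open>(LINT x|M. a x (U x) \<bullet> snd (V x)) <= 0\<close> integral_nonneg_AE[OF pos0] by linarith
 then have "AE x in M. a x (U x) \<bullet> snd (V x) = 0" using integral_nonneg_eq_0_iff_AE[OF i(1) pos0] by simp
 with pos have V0: "AE x in M. snd (V x) = 0"
 proof eventually_elim
  case (elim x)
  then have "T' (fst (U x)) * (\<alpha> * norm (snd (U x)) powr p) <= 0" by simp
  moreover have "T' (fst (U x)) * (\<alpha> * norm (snd (U x)) powr p) >= 0" using T(3) \<alpha>0 by (intro mult_nonneg_nonneg) auto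
  ultimately have "T' (fst (U x)) * (\<alpha> * norm (snd (U x)) powr p) = 0" by linarith
  then show ?case using \<alpha>0 by (auto simp: V_def)
 qed
 obtain C where C: "C > 0" "\<forall>X\<in>W. (LINT x|M. \<bar>fst (X x)\<bar> powr p) <= C * (LINT x|M. norm (snd (X x)) powr p)"
  using W_poincare by blast
 have "(LINT x|M. norm (snd (V x)) powr p) = (LINT x|M. 0)"
  using V0 LP_meas[OF LP_snd[OF W_LP[OF VW] p0(2)]] by (intro integral_cong_AE) auto
 then have "(LINT x|M. \<bar>fst (V x)\<bar> powr p) <= 0" using C VW by fastforce
 moreover have "(LINT x|M. \<bar>fst (V x)\<bar> powr p) >= 0" by (intro lint_nonneg) auto
 ultimately have "(LINT x|M. \<bar>fst (V x)\<bar> powr p) = 0" by linarith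
 then have "AE x in M. \<bar>fst (V x)\<bar> powr p = 0"
  using integral_nonneg_eq_0_iff_AE[of M "%x. \<bar>fst (V x)\<bar> powr p"] LP_int[OF LP_fst[OF W_LP[OF VW] p0(2)]] by simp
 then show ?thesis by eventually_elim (simp add: V_def)
qed

text \<open>A C^1 version of the positive part: zero exactly on the nonpositive half-line and with
  slope in [0, 1], hence fit for \<open>sign_test\<close>.\<close>

definition Q :: "real => real" where "Q t = sqrt (1 + (max 0 t)^2) - 1"
definition Q' :: "real => real" where "Q' t = max 0 t / sqrt (1 + (max 0 t)^2)"

lemma Q_deriv: "(Q has_field_derivative Q' t) (at t)"
proof -
 have pos: "1 + (max 0 t)^2 > 0" by (simp add: add_pos_nonneg)
 have "((%t. sqrt (1 + (max 0 t)^2) - 1) has_field_derivative (inverse (sqrt (1 + (max 0 t)^2)) / 2 * (0 + 2 * max 0 t) - 0)) (at t)"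
  by (intro DERIV_diff DERIV_const DERIV_chain2[where f=sqrt and g="%t. 1 + (max 0 t)^2" and x=t, OF DERIV_real_sqrt[OF pos]] DERIV_add DERIV_sq_pos)
 moreover have "inverse (sqrt (1 + (max 0 t)^2)) / 2 * (0 + 2 * max 0 t) - 0 = Q' t"
  unfolding Q'_def divide_inverse by simp
 ultimately show ?thesis unfolding Q_def[abs_def] by (simp only:)
qed

lemma Q_props: "continuous_on UNIV Q'" "0 <= Q' t" "Q' t <= 1" "t <= 0 ==> Q t = 0" "Q t = 0 ==> t <= 0" "Q t >= 0"
proof -
 have pos: "1 + (max 0 t)^2 > 0" for t :: real by (simp add: add_pos_nonneg)
 show "continuous_on UNIV Q'" unfolding Q'_def
 proof (intro continuous_on_divide continuous_intros continuous_on_max ballI)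
  show "sqrt (1 + (max 0 t)^2) \<noteq> 0" for t :: real using real_sqrt_gt_zero[OF pos[of t]] by linarith
 qed
 show "0 <= Q' t" by (simp add: Q'_def)
 have "max 0 t <= sqrt (1 + (max 0 t)^2)" by (rule real_le_rsqrt) simp
 then show "Q' t <= 1" unfolding Q'_def using pos[of t] by (simp add: divide_le_eq)
 show "t <= 0 ==> Q t = 0" by (simp add: Q_def)
 show "Q t = 0 ==> t <= 0" by (simp add: Q_def)
 show "Q t >= 0" by (simp add: Q_def)
qed

text \<open>Below 0 the gradient term vanishes and the source is nonnegative; above \<kappa> n the
  source vanishes and the gradient term is nonnegative. Each half is one application of
  \<open>sign_test\<close>.\<close>

lemma sol_range:
 assumes U: "sol n U" shows "AE x in M. 0 <= fst (U x) \<and> fst (U x) <= \<kappa> n"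
proof -
 have "AE x in M. - Q (- fst (U x)) = 0"
 proof (rule sign_test[OF U, of "%s. - Q (- s)" "%s. Q' (- s)"])
  show "((%s. - Q (- s)) has_field_derivative Q' (- s)) (at s)" for s
   using DERIV_minus[OF DERIV_chain2[where f=Q and g="%s. - s" and x=s, OF Q_deriv DERIV_minus[OF DERIV_ident]]] by simp
  show "continuous_on UNIV (%s. Q' (- s))" by (rule continuous_on_compose2[OF Q_props(1)]) (auto intro!: continuous_intros)
  show "(H n x s - G n (s, \<xi>)) * - Q (- s) <= 0" for x s \<xi>
  proof (cases "s >= 0")
   case False
   then have "G n (s, \<xi>) = 0" by (simp add: G_def max_def)
   then show ?thesis using Q_props(6)[of "- s"] H_nonneg[of n x s] by (simp add: mult_nonneg_nonneg)
  qed (simp add: Q_props(4))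
 qed (simp_all add: Q_props(2,3) Q_def)
 moreover have "AE x in M. Q (fst (U x) - \<kappa> n) = 0"
 proof (rule sign_test[OF U, of "%s. Q (s - \<kappa> n)" "%s. Q' (s - \<kappa> n)"])
  show "((%s. Q (s - \<kappa> n)) has_field_derivative Q' (s - \<kappa> n)) (at s)" for s
   using DERIV_chain2[where f=Q and g="%s. s - \<kappa> n" and x=s, OF Q_deriv DERIV_diff[OF DERIV_ident DERIV_const]] by simp
  show "continuous_on UNIV (%s. Q' (s - \<kappa> n))" by (rule continuous_on_compose2[OF Q_props(1)]) (auto intro!: continuous_intros)
  show "(H n x s - G n (s, \<xi>)) * Q (s - \<kappa> n) <= 0" for x s \<xi>
  proof (cases "s <= \<kappa> n")
   case False
   then have "H n x s = 0" by (simp add: H_def max_def min_def)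
   then show ?thesis using Q_props(6)[of "s - \<kappa> n"] G_nonneg[of n "(s, \<xi>)"] by (simp add: mult_nonneg_nonneg)
  qed (simp add: Q_props(4))
  show "Q (0 - \<kappa> n) = 0" using \<kappa>1[of n] by (intro Q_props(4)) simp
 qed (simp_all add: Q_props(2,3) Q_def)
 ultimately show ?thesis
 proof eventually_elim
  case (elim x)
  then show ?case using Q_props(5)[of "- fst (U x)"] Q_props(5)[of "fst (U x) - \<kappa> n"] by auto
 qed
qed

end

lemma arctan_ge_half: "s >= 1 ==> arctan s >= 1/2"
proof -
 assume "s >= 1"
 then have "arctan 1 <= arctan s" by (simp only: arctan_monotone')
 then show ?thesis using arctan_one pi_gt3 by simp
qed

lemma arctan_abs_le_2: "\<bar>arctan s\<bar> <= 2"
 using arctan_lbound[of s] arctan_ubound[of s] pi_less_4 by linarith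

section \<open>Estimates independent of n\<close>

context singular
begin

lemma H_arctan: "s >= 0 ==> H n x s * arctan s <= Ch * f x"
proof (cases "s = 0")
 case False
 assume "s >= 0"
 then have s: "s > 0" using False by simp
 then have a: "arctan s >= 0" by simp
 have "ennreal (hn n s * arctan s) = ennreal (hn n s) * ennreal (arctan s)"
  by (rule ennreal_mult[OF hn_nonneg a])
 also have "... <= h s * ennreal (arctan s)" unfolding ennreal_hn using s by (intro mult_right_mono) auto
 also have "... <= ennreal Ch" by (rule h_sing[OF s])
 finally have "hn n s * arctan s <= Ch" using Ch0 by (simp add: ennreal_le_iff)
 then have "(hn n s * arctan s) * f x <= Ch * f x" by (rule mult_right_mono[OF _ f_nn])
 moreover have "H n x s * arctan s <= (hn n s * f x) * arctan s" by (rule mult_right_mono[OF H_le a])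
 ultimately show ?thesis by (simp add: algebra_simps)
qed (use Ch0 f_nn in simp)

lemma sol_W: "sol n U ==> U \<in> W" by (simp add: sol_def)

lemma G_int: "sol n U ==> integrable M (%x. G n (U x))"
 by (rule LP_integrable[OF GH_LP(1)[OF LP_meas[OF W_LP[OF sol_W]]] q1(5)])

text \<open>Tested with arctan u, the source is bounded by a multiple of f, as h(u) arctan u is
  bounded. The coercive part controls the gradient where u \<le> s0; for larger u its weight
  degenerates, and the G-term together with the E-term takes over.\<close>

lemma sol_energy:
 "\<exists>C\<ge>0. \<forall>n U. sol n U --> (LINT x|M. norm (snd (U x)) powr p) <= C \<and> (LINT x|M. G n (U x)) <= C"
proof -
 \<comment> \<open>One summand for each source of control: the coercive part where u \<le> s0, the
   E-term, and the G-term where u > s0, with arctan u >= 1/2 and g >= c0.\<close>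
 define Cc where "Cc = (1 + s0^2) / \<alpha> + 1 + 2 / c0"
 have cc: "(1 + s0^2) / \<alpha> >= 0" "2 / c0 >= 0" using \<alpha>0 c0 by (auto intro!: divide_nonneg_pos)
 obtain G1 where G1: "G1 >= 0" "\<forall>s. 0 <= s \<and> s <= 1 --> g s <= G1" using g_bound[of 1] by auto
 define F0 where "F0 = Ch * (LINT x|M. f x)"
 have F0: "F0 >= 0" unfolding F0_def using Ch0 f_nn by (intro mult_nonneg_nonneg lint_nonneg) auto
 have main: "(LINT x|M. norm (snd (U x)) powr p) <= Cc * F0 \<and> (LINT x|M. G n (U x)) <= G1 * (Cc * F0) + 2 * F0" if sol: "sol n U" for n U
 proof -
  have UW: "U \<in> W" by (rule sol_W[OF sol])
  define V where "V x = (arctan (fst (U x)), inverse (1 + (fst (U x))^2) *\<^sub>R snd (U x))" for x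
  have VW: "V \<in> W" unfolding V_def
  proof (rule W_compose[OF UW, of arctan "%s. inverse (1 + s^2)" 1])
   show "continuous_on UNIV (%s::real. inverse (1 + s^2))"
    by (intro continuous_intros) (auto simp: add_nonneg_eq_0_iff)
   show "\<bar>inverse (1 + s^2)\<bar> <= 1" for s :: real by (simp add: inverse_le_1_iff)
  qed (auto intro: DERIV_arctan)
  note i = sol_ints[OF UW VW]
  define I where "I x = a x (U x) \<bullet> snd (V x) + E n (snd (U x)) \<bullet> snd (V x) + G n (U x) * fst (V x)" for x
  have iI: "integrable M I" unfolding I_def using i by auto
  have "(LINT x|M. I x) = (LINT x|M. H n x (fst (U x)) * fst (V x))"
   unfolding I_def using sol_eq[OF sol VW] i by simp
  also have "... <= (LINT x|M. Ch * f x)"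
  proof (rule integral_mono_AE)
   show "AE x in M. H n x (fst (U x)) * fst (V x) <= Ch * f x"
    using sol_range[OF sol] by eventually_elim (simp add: V_def H_arctan)
  qed (use i f_int in auto)
  finally have IF: "(LINT x|M. I x) <= F0" by (simp add: F0_def)
  have pt: "AE x in M. norm (snd (U x)) powr p <= Cc * I x \<and> G n (U x) <= G1 * norm (snd (U x)) powr p + 2 * I x"
   using sol_range[OF sol] A_coer
  proof eventually_elim
   case (elim x)
   define u \<xi> where "u = fst (U x)" and "\<xi> = snd (U x)"
   have u: "0 <= u" "u <= \<kappa> n" using elim by (auto simp: u_def)
   have inv: "inverse (1 + u^2) > 0" by (simp add: add_pos_nonneg)
   define t1 t2 t3 where "t1 = a x (U x) \<bullet> snd (V x)" and "t2 = E n \<xi> \<bullet> snd (V x)" and "t3 = G n (U x) * arctan u"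
   have I: "I x = t1 + t2 + t3" by (simp add: I_def t1_def t2_def t3_def V_def u_def \<xi>_def)
   have "inverse (1 + u^2) * (\<alpha> * norm \<xi> powr p) <= inverse (1 + u^2) * (a x (U x) \<bullet> \<xi>)"
    using elim(2)[rule_format, of "U x"] inv by (intro mult_left_mono) (auto simp: \<xi>_def)
   then have t1: "inverse (1 + u^2) * (\<alpha> * norm \<xi> powr p) <= t1" by (simp add: t1_def V_def u_def \<xi>_def)
   have t10: "t1 >= 0" using t1 inv \<alpha>0 by (smt (verit) mult_nonneg_nonneg powr_ge_zero)
   let ?m = "max 0 (norm \<xi> powr p - RE n powr p)" and ?n = "min (norm \<xi> powr p) (RE n powr p)"
   have t2e: "t2 = inverse (1 + u^2) * (KE n * ?m)" by (simp add: t2_def V_def u_def \<xi>_def E_inner)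
   \<comment> \<open>This is where u \<le> \<kappa> n enters: the factor KE n cancels the weight
     1/(1 + u^2).\<close>
   have "1 + u^2 <= KE n" using KE1(2)[of n] u power_mono[OF u(2,1), of 2] by linarith
   then have "1 <= inverse (1 + u^2) * KE n" using inv by (simp add: field_simps add_pos_nonneg)
   then have "1 * ?m <= (inverse (1 + u^2) * KE n) * ?m" by (rule mult_right_mono) simp
   then have t2: "?m <= t2" by (simp add: t2e mult.assoc)
   have t20: "t2 >= 0" using t2 by linarith
   have t30: "t3 >= 0" using u G_nonneg by (simp add: t3_def)
   \<comment> \<open>The part below the threshold is seen by G, the excess by E.\<close>
   have dec: "norm \<xi> powr p = ?n + ?m" by auto
   have Glarge: "G n (U x) = g u * ?n" if "u >= 1"
   proof -
    have "1 * 1 <= \<kappa> n * u" using that \<kappa>1[of n] by (intro mult_mono) auto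
    then show ?thesis using u by (simp add: G_def u_def[symmetric] \<xi>_def[symmetric])
   qed
   have n0: "?n >= 0" by simp
   have le1: "norm \<xi> powr p <= Cc * I x"
   proof (cases "u <= s0")
    case True
    have gen: "X = K / l * (inverse K * (l * X))" if "K > 0" "l > 0" for X K l :: real
     using that by simp
    have "norm \<xi> powr p = (1 + u^2) / \<alpha> * (inverse (1 + u^2) * (\<alpha> * norm \<xi> powr p))"
     by (rule gen[OF _ \<alpha>0]) (use inv in simp)
    also have "... <= (1 + s0^2) / \<alpha> * t1"
     using True u \<alpha>0 t1 inv by (intro mult_mono divide_right_mono add_left_mono power_mono) auto
    also have "... <= Cc * I x" unfolding I Cc_def using cc t10 t20 t30 by (intro mult_mono) auto
    finally show ?thesis .
   next
    case False
    then have u1: "u >= 1" "u >= s0" using s0 by auto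
    have "c0 * ?n * (1/2) <= g u * ?n * arctan u"
     using g_ge[OF u1(2)] c0 n0 arctan_ge_half[OF u1(1)] g_nn[OF u(1)] by (intro mult_mono mult_nonneg_nonneg) auto
    then have "?n <= 2 / c0 * t3" using c0 Glarge[OF u1(1)] by (simp add: t3_def field_simps)
    then have "norm \<xi> powr p <= 2 / c0 * t3 + 1 * t2" using dec t2 by linarith
    also have "... <= Cc * t3 + Cc * t2"
     unfolding Cc_def using cc t20 t30 by (intro add_mono mult_right_mono) auto
    also have "... <= Cc * I x" unfolding I using cc t10 by (simp add: Cc_def distrib_left)
    finally show ?thesis .
   qed
   have le2: "G n (U x) <= G1 * norm \<xi> powr p + 2 * I x"
   proof (cases "u <= 1")
    case True
    have mu: "min (max 0 u) (\<kappa> n) = u" using u by simp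
    have "G n (U x) <= 1 * G1 * norm \<xi> powr p"
     unfolding G_def u_def[symmetric] \<xi>_def[symmetric] mu
     using G1 u True g_nn[OF u(1)] \<kappa>1[of n] by (intro mult_mono mult_nonneg_nonneg) auto
    then show ?thesis using t10 t20 t30 by (simp add: I)
   next
    case False
    then have "G n (U x) * (1/2) <= t3" unfolding t3_def
     using G_nonneg[of n "U x"] arctan_ge_half[of u] by (intro mult_left_mono) auto
    moreover have "G1 * norm \<xi> powr p >= 0" using G1 by simp
    ultimately show ?thesis using t10 t20 by (simp add: I)
   qed
   show ?case using le1 le2 by (simp add: \<xi>_def)
  qed
  have i2: "integrable M (%x. norm (snd (U x)) powr p)" by (rule LP_int[OF LP_snd[OF W_LP[OF UW] p0(2)]])
  have e1: "(LINT x|M. norm (snd (U x)) powr p) <= (LINT x|M. Cc * I x)"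
   using pt i2 iI by (intro integral_mono_AE) auto
  have Cc0: "Cc >= 0" using cc by (simp add: Cc_def)
  have e2: "(LINT x|M. norm (snd (U x)) powr p) <= Cc * F0"
   using e1 mult_left_mono[OF IF Cc0] by simp
  have "(LINT x|M. G n (U x)) <= (LINT x|M. G1 * norm (snd (U x)) powr p + 2 * I x)"
   using pt i2 iI G_int[OF sol] by (intro integral_mono_AE) auto
  also have "... = G1 * (LINT x|M. norm (snd (U x)) powr p) + 2 * (LINT x|M. I x)" using i2 iI by simp
  also have "... <= G1 * (Cc * F0) + 2 * F0" using e2 IF G1(1) by (intro add_mono mult_left_mono) auto
  finally show ?thesis using e2 by simp
 qed
 define C where "C = max (Cc * F0) (G1 * (Cc * F0) + 2 * F0)"
 have "C >= 0" unfolding C_def using F0 cc by (simp add: Cc_def le_max_iff_disj)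
 moreover have "\<forall>n U. sol n U --> (LINT x|M. norm (snd (U x)) powr p) <= C \<and> (LINT x|M. G n (U x)) <= C"
  using main unfolding C_def by (fastforce simp: le_max_iff_disj)
 ultimately show ?thesis by blast
qed

text \<open>The factor 1/(1 + \<kappa> n) in the last bound is what removes the flux E in the
  limit.\<close>

lemma sol_bounds:
 "\<exists>C\<ge>0. \<forall>n U. sol n U --> (LINT x|M. norm (snd (U x)) powr p) <= C \<and> (LINT x|M. G n (U x)) <= C \<and>
   (LINT x|M. norm (U x) powr p) <= C \<and> (LINT x|M. norm (a x (U x))) <= C \<and>
   (LINT x|M. norm (E n (snd (U x)))) <= C * (1 / (1 + \<kappa> n))"
proof -
 obtain C where C: "C >= 0" "\<forall>n U. sol n U --> (LINT x|M. norm (snd (U x)) powr p) <= C \<and> (LINT x|M. G n (U x)) <= C"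
  using sol_energy by blast
 obtain K where K: "K > 0" "\<forall>X\<in>W. (LINT x|M. norm (X x) powr p) <= K * (LINT x|M. norm (snd (X x)) powr p)"
  using W_norm_bound by blast
 define CA where "CA = measure M (space M) + ((LINT x|M. GA x) + 2 * KA * (K * C))"
 define D where "D = max C (max (K * C) CA)"
 have "(LINT x|M. norm (snd (U x)) powr p) <= D \<and> (LINT x|M. G n (U x)) <= D \<and>
   (LINT x|M. norm (U x) powr p) <= D \<and> (LINT x|M. norm (a x (U x))) <= D \<and>
   (LINT x|M. norm (E n (snd (U x)))) <= D * (1 / (1 + \<kappa> n))" if sol: "sol n U" for n U
 proof -
  have UW: "U \<in> W" by (rule sol_W[OF sol])
  have 1: "(LINT x|M. norm (snd (U x)) powr p) <= C" "(LINT x|M. G n (U x)) <= C" using C(2) sol by blast+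
  have "(LINT x|M. norm (U x) powr p) <= K * (LINT x|M. norm (snd (U x)) powr p)" using K(2) UW by blast
  also have "... <= K * C" using K(1) 1(1) by (intro mult_left_mono) auto
  finally have 2: "(LINT x|M. norm (U x) powr p) <= K * C" .
  note LA = A_LP[OF W_LP[OF UW]]
  have "(LINT x|M. norm (a x (U x))) <= (LINT x|M. 1 + norm (a x (U x)) powr q)"
   using LP_integrable[OF LA(1) q1(5)] LP_int[OF LA(1)] le_one_plus_powr[OF q1(5)] by (intro integral_mono) auto
  also have "... = measure M (space M) + (LINT x|M. norm (a x (U x)) powr q)" using LP_int[OF LA(1)] by simp
  also have "... <= CA" unfolding CA_def using LA(2) mult_left_mono[OF 2, of "2 * KA"] KA0 by simp
  finally have 3: "(LINT x|M. norm (a x (U x))) <= CA" .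
  have i2: "integrable M (%x. norm (snd (U x)) powr p)" by (rule LP_int[OF LP_snd[OF W_LP[OF UW] p0(2)]])
  have "(LINT x|M. norm (E n (snd (U x)))) <= (LINT x|M. 1 / (1 + \<kappa> n) * norm (snd (U x)) powr p)"
   using LP_integrable[OF E_LP[OF W_LP[OF UW]] q1(5)] i2 by (intro integral_mono E_norm(2)) auto
  also have "... = 1 / (1 + \<kappa> n) * (LINT x|M. norm (snd (U x)) powr p)" by simp
  also have "... <= 1 / (1 + \<kappa> n) * D" using 1 \<kappa>1[of n] by (intro mult_left_mono) (auto simp: D_def)
  finally have 4: "(LINT x|M. norm (E n (snd (U x)))) <= D * (1 / (1 + \<kappa> n))" by (simp add: mult.commute)
  have "C <= D" "K * C <= D" "CA <= D" by (auto simp: D_def)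
  then show ?thesis using 1 2 3 4 by (intro conjI; linarith)
 qed
 moreover have "D >= 0" using C(1) by (simp add: D_def)
 ultimately show ?thesis by blast
qed

text \<open>The integral of the source against \<phi> is read off from the equation itself, whose
  other terms are bounded in L^1; a direct estimate fails where u is small.\<close>

lemma sol_rhs:
 assumes \<phi>: "C1c \<Omega> \<phi>" "!!x. \<phi> x >= 0"
 shows "\<exists>C\<ge>0. \<forall>n U. sol n U --> (LINT x|M. H n x (fst (U x)) * \<phi> x) <= C"
proof -
 obtain C where C: "C >= 0" "\<forall>n U. sol n U --> (LINT x|M. norm (snd (U x)) powr p) <= C \<and> (LINT x|M. G n (U x)) <= C \<and>
   (LINT x|M. norm (U x) powr p) <= C \<and> (LINT x|M. norm (a x (U x))) <= C \<and>
   (LINT x|M. norm (E n (snd (U x)))) <= C * (1 / (1 + \<kappa> n))" using sol_bounds by blast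
 obtain B where B: "B > 0" "\<forall>x. \<bar>\<phi> x\<bar> <= B \<and> norm (grad \<phi> x) <= B" using jet_bounded_C1c[OF \<phi>(1)] by blast
 have "(LINT x|M. H n x (fst (U x)) * \<phi> x) <= B * C + B * C + B * C" if sol: "sol n U" for n U
 proof -
  have UW: "U \<in> W" by (rule sol_W[OF sol])
  note i = sol_ints[OF UW jet_W[OF \<phi>(1)]]
  have bd: "(LINT x|M. Z x \<bullet> grad \<phi> x) <= B * (LINT x|M. norm (Z x))" if Z: "LP q M Z" for Z
  proof -
   have "(LINT x|M. Z x \<bullet> grad \<phi> x) <= (LINT x|M. B * norm (Z x))"
   proof (rule integral_mono[OF inner_int[OF Z C1c_LP(3)[OF \<phi>(1) p0(2)]]])
    show "integrable M (%x. B * norm (Z x))" using LP_integrable[OF Z q1(5)] by auto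
    show "Z x \<bullet> grad \<phi> x <= B * norm (Z x)" for x
     using norm_cauchy_schwarz[of "Z x" "grad \<phi> x"] mult_left_mono[of "norm (grad \<phi> x)" B "norm (Z x)"] B(2)
     by (smt (verit) mult.commute norm_ge_zero)
   qed
   then show ?thesis by simp
  qed
  have s: "(LINT x|M. norm (a x (U x))) <= C" "(LINT x|M. G n (U x)) <= C" "(LINT x|M. norm (E n (snd (U x)))) <= C * (1 / (1 + \<kappa> n))"
   using C(2) sol by blast+
  have "C * (1 / (1 + \<kappa> n)) <= C * 1" using C(1) \<kappa>1[of n] by (intro mult_left_mono) auto
  then have s3: "(LINT x|M. norm (E n (snd (U x)))) <= C" using s(3) by simp
  have "(LINT x|M. a x (U x) \<bullet> grad \<phi> x) <= B * C"
   using bd[OF A_LP(1)[OF W_LP[OF UW]]] mult_left_mono[OF s(1), of B] B(1) by linarith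
  moreover have "(LINT x|M. E n (snd (U x)) \<bullet> grad \<phi> x) <= B * C"
   using bd[OF E_LP[OF W_LP[OF UW], of n]] mult_left_mono[OF s3, of B] B(1) by linarith
  moreover have "(LINT x|M. G n (U x) * \<phi> x) <= B * C"
  proof -
   have "(LINT x|M. G n (U x) * \<phi> x) <= (LINT x|M. B * G n (U x))"
   proof (rule integral_mono)
    show "integrable M (%x. G n (U x) * \<phi> x)" using i(3)[of n] by simp
    show "integrable M (%x. B * G n (U x))" using G_int[OF sol] by simp
    show "G n (U x) * \<phi> x <= B * G n (U x)" for x
     using mult_left_mono[of "\<phi> x" B "G n (U x)"] B(2) G_nonneg[of n "U x"] by (simp add: mult.commute abs_le_iff)
   qed
   also have "... <= B * C" using s(2) B(1) by simp
   finally show ?thesis .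
  qed
  ultimately show ?thesis using sol_eq[OF sol jet_W[OF \<phi>(1)]] by simp
 qed
 moreover have "B * C + B * C + B * C >= 0" using B C by simp
 ultimately show ?thesis by blast
qed

end

text \<open>Collects what compactness provides, together with smooth w j converging to Y. The bound
  on \<open>grad (w j)\<close> makes \<open>E (N j)\<close> vanish there, so that the monotonicity
  of E yields a sign.\<close>

locale singular_limit = singular \<Omega> p a \<alpha> \<beta> b g h f s0 c0 Ch
 for \<Omega> :: "'a::euclidean_space set" and p :: real and a :: "'a => real \<times> 'a => 'a" and \<alpha> \<beta> :: real and b :: "'a => real"
  and g :: "real => real" and h :: "real => ennreal" and f :: "'a => real" and s0 c0 Ch :: real +
 fixes U :: "nat => 'a => real \<times> 'a" and N :: "nat => nat" and Y :: "'a => real \<times> 'a"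
  and gd kd :: "'a => real" and w :: "nat => 'a => real"
 assumes U: "!!j. sol (N j) (U j)" and Nlim: "filterlim N at_top sequentially"
  and Y: "Y \<in> W" and gd: "integrable M gd" and kd: "integrable M kd"
  and uU: "AE x in M. (%j. fst (U j x)) ----> fst (Y x)" and ug: "AE x in M. \<forall>j. \<bar>fst (U j x)\<bar> powr p <= gd x"
  and weak: "!!Z. LP q M Z ==> (%j. LINT x|M. Z x \<bullet> (snd (U j x) - snd (Y x))) ----> 0"
  and w: "!!j. C1c \<Omega> (w j)" "!!j x. norm (grad (w j) x) <= RE (N j)"
  and wc: "AE x in M. (%j. jet (w j) x) ----> Y x" and wk: "AE x in M. \<forall>j. norm (jet (w j) x) powr p <= kd x"
  and wd: "(%j. dst (jet (w j)) Y) ----> 0"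

context singular
begin

lemma singular_limit_exists: "\<exists>U N Y gd kd w. singular_limit \<Omega> p a \<alpha> \<beta> b g h f s0 c0 Ch U N Y gd kd w"
proof -
 from choice[OF allI[OF approx_solution]] obtain X where X: "\<forall>n. sol n (X n)" ..
 obtain C where C: "C >= 0" "\<forall>n U. sol n U --> (LINT x|M. norm (snd (U x)) powr p) <= C \<and> (LINT x|M. G n (U x)) <= C"
  using sol_energy by blast
 have XW: "X n \<in> W" and XC: "(LINT x|M. norm (snd (X n x)) powr p) <= C" for n using X sol_W C(2) by blast+
 obtain r Y gd where r: "strict_mono (r::nat=>nat)" and Y: "Y \<in> W" and g: "integrable M gd"
   and u: "AE x in M. (%n. fst (X (r n) x)) ----> fst (Y x)"
   and ug: "AE x in M. \<forall>n. \<bar>fst (X (r n) x)\<bar> powr p <= gd x"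
   and weak: "\<forall>Z. LP q M Z --> (%n. LINT x|M. Z x \<bullet> (snd (X (r n) x) - snd (Y x))) ----> 0"
  by (rule W_compact[of X C, OF XW XC])
 obtain w :: "nat => 'a => real" and kd where w: "\<forall>n. C1c \<Omega> (w n)" "\<forall>n. dst (jet (w n)) Y <= (1/2)^n" "AE x in M. (%n. jet (w n) x) ----> Y x"
   "integrable M kd" "AE x in M. \<forall>n. norm (jet (w n) x) powr p <= kd x"
  using W_fast[OF Y] by blast
 have "\<forall>j. \<exists>B. B > 0 \<and> (\<forall>x. \<bar>w j x\<bar> <= B \<and> norm (grad (w j) x) <= B)" using jet_bounded_C1c w(1) by blast
 from choice[OF this] obtain B :: "nat => real" where B: "\<forall>j. B j > 0 \<and> (\<forall>x. \<bar>w j x\<bar> <= B j \<and> norm (grad (w j) x) <= B j)" ..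
 \<comment> \<open>The solution index is delayed until RE is at least the gradient bound of w
   j.\<close>
 define n where "n j = max j (nat \<lceil>B j\<rceil>)" for j
 have nlim: "filterlim n at_top sequentially"
  by (rule filterlim_at_top_mono[OF filterlim_ident]) (auto simp: n_def)
 have rn: "r (n j) >= n j" for j using seq_suble[OF r] by blast
 show ?thesis
 proof (intro exI, unfold_locales)
  show "sol (r (n j)) (X (r (n j)))" for j using X by blast
  show "filterlim (%j. r (n j)) at_top sequentially"
   by (rule filterlim_at_top_mono[OF nlim]) (auto simp: rn)
  show "Y \<in> W" "integrable M gd" "integrable M kd" by (fact Y, fact g, fact w(4))
  show "AE x in M. (%j. fst (X (r (n j)) x)) ----> fst (Y x)" using u
   by eventually_elim (rule filterlim_compose[OF _ nlim])
  show "AE x in M. \<forall>j. \<bar>fst (X (r (n j)) x)\<bar> powr p <= gd x" using ug by eventually_elim blast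
  show "(%j. LINT x|M. Z x \<bullet> (snd (X (r (n j)) x) - snd (Y x))) ----> 0" if "LP q M Z" for Z
   using filterlim_compose[OF weak[rule_format, OF that] nlim] .
  show "C1c \<Omega> (w j)" for j using w(1) by blast
  show "norm (grad (w j) x) <= RE (r (n j))" for j x
  proof -
   have "norm (grad (w j) x) <= B j" using B by blast
   also have "B j <= real (n j)" unfolding n_def by linarith
   also have "... <= real (r (n j))" using rn[of j] by simp
   also have "... <= RE (r (n j))" by (rule RE1(3))
   finally show ?thesis .
  qed
  show "AE x in M. (%j. jet (w j) x) ----> Y x" "AE x in M. \<forall>j. norm (jet (w j) x) powr p <= kd x" by (fact w(3), fact w(5))
  show "(%j. dst (jet (w j)) Y) ----> 0"
   by (rule real_tendsto_sandwich[of "%n. 0" _ _ "%j. (1/2)^j"])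
     (use w(2) in \<open>auto simp: dst_nonneg intro!: LIMSEQ_realpow_zero\<close>)
 qed
qed

end

section \<open>Convergence of the gradients on compact sets\<close>

context singular_limit
begin

lemma UW: "U j \<in> W" by (rule sol_W[OF U])

lemma UC: "\<exists>C\<ge>0. \<forall>j. (LINT x|M. norm (U j x) powr p) <= C"
 using sol_bounds U by blast

lemma Y_nonneg: "AE x in M. fst (Y x) >= 0"
proof -
 have "AE x in M. \<forall>j. 0 <= fst (U j x) \<and> fst (U j x) <= \<kappa> (N j)"
  by (subst AE_all_countable) (intro allI sol_range U)
 with uU show ?thesis by eventually_elim (auto intro: LIMSEQ_le_const)
qed

text \<open>Only L^1 bounds are available for the lower-order terms, so the function T in the test
  function has to be uniformly small. With T(s) = d arctan(s/d) these terms are O(d), while the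
  slope of T stays at least 1/2 where |s| \<le> d.\<close>

lemma gradient_subsequence:
 assumes K: "compact K" "K \<subseteq> \<Omega>"
 shows "\<exists>t. strict_mono (t::nat=>nat) \<and> (AE x in M. x \<in> K --> (%j. snd (U (t j) x)) ----> snd (Y x))"
proof -
 obtain \<phi> where \<phi>: "C1c \<Omega> \<phi>" "!!x. \<phi> x >= 0" "!!x. x \<in> K ==> \<phi> x >= 1" by (rule C1c_bump[OF open_dom K]) (erule that, auto)
 obtain L where L: "L > 0" "\<forall>x. \<bar>\<phi> x\<bar> <= L \<and> norm (grad \<phi> x) <= L" using jet_bounded_C1c[OF \<phi>(1)] by blast
 obtain C where C: "C >= 0" "\<forall>n U. sol n U --> (LINT x|M. norm (snd (U x)) powr p) <= C \<and> (LINT x|M. G n (U x)) <= C \<and>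
   (LINT x|M. norm (U x) powr p) <= C \<and> (LINT x|M. norm (a x (U x))) <= C \<and>
   (LINT x|M. norm (E n (snd (U x)))) <= C * (1 / (1 + \<kappa> n))" using sol_bounds by blast
 obtain C\<phi> where C\<phi>: "C\<phi> >= 0" "\<forall>n U. sol n U --> (LINT x|M. H n x (fst (U x)) * \<phi> x) <= C\<phi>" using sol_rhs[OF \<phi>(1,2)] by blast
 have wW: "jet (w j) \<in> W" for j by (rule jet_W[OF w(1)])
 have LU: "LP p M (U j)" for j by (rule W_LP[OF UW])
 have LUs: "LP p M (%x. snd (U j x))" "LP p M (%x. fst (U j x))" for j using LP_snd LP_fst LU p0 by blast+
 have Lw: "LP p M (w j)" "LP p M (grad (w j))" for j using C1c_LP[OF w(1) p0(2)] by blast+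
 have LV: "LP p M (%x. snd (U j x) - grad (w j) x)" for j by (intro LP_diff LUs Lw p0)
 have Lp: "LP p M (%x. (fst (U j x), grad (w j) x))" for j by (intro LP_Pair LUs Lw p0)
 have [measurable]: "\<phi> \<in> BM M" "grad \<phi> \<in> BM M" "w j \<in> BM M" "(%x. fst (U j x)) \<in> BM M"
   "(%x. fst (Y x)) \<in> BM M" for j
  using C1c_LP[OF \<phi>(1) p0(2)] Lw LUs borel_measurable_fst_snd(1)[OF LP_meas[OF W_LP[OF Y]]] by (auto simp: LP_def)
 define D where "D j x = (a x (U j x) - a x (fst (U j x), grad (w j) x)) \<bullet> (snd (U j x) - grad (w j) x)" for j x
 have Di: "integrable M (D j)" for j
  unfolding D_def by (rule inner_int[OF LP_diff[OF A_LP(1)[OF LU] A_LP(1)[OF Lp] q1(4)] LV])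
 have D0: "AE x in M. D j x >= 0" for j
  using A_mono_nonneg
 proof eventually_elim
  case (elim x)
  then show ?case using elim[rule_format, of "fst (U j x)" "snd (U j x)" "grad (w j) x"] by (simp add: D_def)
 qed
 \<comment> \<open>Truncation at 1 turns the aim into convergence in measure, since the increments
   are controlled only where u_j and w_j are close.\<close>
 define R where "R j = (LINT x|M. min 1 (\<phi> x * D j x))" for j
 have iR: "integrable M (%x. min 1 (\<phi> x * D j x))" for j
 proof (rule lint_bound)
  show "integrable M (%x. L * \<bar>D j x\<bar>)" using Di by auto
  show "(%x. min 1 (\<phi> x * D j x)) \<in> BM M" using borel_measurable_integrable[OF Di] by measurable
  show "AE x in M. norm (min 1 (\<phi> x * D j x)) <= norm (L * \<bar>D j x\<bar>)"
  proof (rule AE_I2)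
   fix x
   have "\<bar>\<phi> x * D j x\<bar> <= L * \<bar>D j x\<bar>" using L by (simp add: abs_mult mult_right_mono)
   moreover have "\<bar>min 1 (\<phi> x * D j x)\<bar> <= \<bar>\<phi> x * D j x\<bar>" by auto
   ultimately have "\<bar>min 1 (\<phi> x * D j x)\<bar> <= L * \<bar>D j x\<bar>" by linarith
   then show "norm (min 1 (\<phi> x * D j x)) <= norm (L * \<bar>D j x\<bar>)" using L(1) by simp
  qed
 qed
 have duw: "(%j. LINT x|M. \<bar>fst (U j x) - w j x\<bar> powr p) ----> (LINT x|M. 0)"
 proof (rule integral_dominated_convergence[where w="%x. 2 powr p * (gd x + kd x)"])
  show "integrable M (%x. 2 powr p * (gd x + kd x))" using gd kd by auto
  show "AE x in M. norm (\<bar>fst (U j x) - w j x\<bar> powr p) <= 2 powr p * (gd x + kd x)" for j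
   using ug wk
  proof eventually_elim
   case (elim x)
   have "\<bar>w j x\<bar> powr p <= norm (jet (w j) x) powr p" using norm_fst_snd_le(1)[of "jet (w j) x"] p0 by (intro powr_mono2) auto
   then have "\<bar>w j x\<bar> powr p <= kd x" using elim(2)[rule_format, of j] by linarith
   moreover have "norm (fst (U j x) - w j x) powr p <= 2 powr p * (norm (fst (U j x)) powr p + norm (w j x) powr p)"
    by (rule norm_diff_powr_le[OF p0(2)])
   ultimately show ?case using elim(1)[rule_format, of j]
    by (auto intro: order_trans[OF _ mult_left_mono])
  qed
  show "AE x in M. (%j. \<bar>fst (U j x) - w j x\<bar> powr p) ----> 0" using uU wc
  proof eventually_elim
   case (elim x)
   have "(%j. fst (U j x) - w j x) ----> 0" using tendsto_diff[OF elim(1) tendsto_fst[OF elim(2)]] by simp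
   then have "(%j. \<bar>fst (U j x) - w j x\<bar> powr p) ----> 0 powr p"
    using p0 by (intro tendsto_powr' tendsto_rabs_zero tendsto_const) auto
   then show ?case by simp
  qed
 qed auto
 have "R ----> 0"
 proof (rule tendsto_zero_approxI)
  fix e :: real assume e: "e > 0"
  \<comment> \<open>The sup norm of T is at most 2 d. It multiplies the bound of the source against
    \<phi> and the three L^1 bounds of a, E and G, with L bounding \<phi> and its gradient.\<close>
  define C' where "C' = 2 * (C\<phi> + 3 * L * C)"
  have C'0: "C' >= 0" unfolding C'_def using C\<phi> C L by simp
  \<comment> \<open>The factor 2 in the target \<open>2 * (d * C') <= e\<close> is the inverse of
    the minimal slope 1/2.\<close>
  define d where "d = e / (2 * C' + 1)"
  have d: "d > 0" "2 * (d * C') <= e" using e C'0 by (auto simp: d_def field_simps)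
  define T where "T s = d * arctan (s / d)" for s
  define T' where "T' s = inverse (1 + (s / d)^2)" for s
  have dT: "(T has_field_derivative T' s) (at s)" for s
  proof -
   have "(T has_field_derivative d * (inverse (1 + (s / d)^2) * (1 / d))) (at s)"
    unfolding T_def
    by (intro DERIV_cmult DERIV_chain2[where f=arctan and g="%s. s / d" and x=s, OF DERIV_arctan DERIV_cdivide[OF DERIV_ident]])
   moreover have "d * (inverse (1 + (s / d)^2) * (1 / d)) = T' s" unfolding T'_def using d(1) by simp
   ultimately show ?thesis by (simp only:)
  qed
  have pos: "1 + (s / d)^2 > 0" for s by (simp add: add_pos_nonneg)
  have cT': "continuous_on UNIV T'" unfolding T'_def
   using pos d(1) by (intro continuous_intros) (auto simp: less_imp_neq[symmetric])
  have T'01: "0 <= T' s" "T' s <= 1" for s unfolding T'_def using pos[of s] by (auto simp: inverse_le_1_iff)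
  have Tb: "\<bar>T s\<bar> <= 2 * d" for s unfolding T_def using arctan_abs_le_2[of "s / d"] d(1) by (simp add: abs_mult mult.commute)
  define c where "c j x = \<phi> x * T' (fst (U j x) - w j x)" for j x
  have c0L: "0 <= c j x" "c j x <= L" for j x
   using \<phi>(2)[of x] L T'01[of "fst (U j x) - w j x"] mult_mono[of "\<phi> x" L "T' (fst (U j x) - w j x)" 1]
   by (auto simp: c_def abs_le_iff)
  have [measurable]: "(%x. T (fst (U j x) - w j x)) \<in> BM M" "(%x. T' (fst (U j x) - w j x)) \<in> BM M" for j
  proof -
   have cT: "continuous_on UNIV T" by (rule DERIV_continuous_on) (use dT in \<open>auto intro: has_field_derivative_at_within\<close>)
   show "(%x. T (fst (U j x) - w j x)) \<in> BM M" "(%x. T' (fst (U j x) - w j x)) \<in> BM M"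
    by (rule borel_measurable_continuous_on[OF cT], measurable) (rule borel_measurable_continuous_on[OF cT'], measurable)
  qed
  have cm: "c j \<in> BM M" for j unfolding c_def by measurable
  define Fz where "Fz j = (LINT x|M. (c j x *\<^sub>R a x (fst (U j x), snd (jet (w j) x))) \<bullet> (snd (U j x) - snd (jet (w j) x)))" for j
  obtain C1 where C1: "C1 >= 0" "\<forall>j. (LINT x|M. norm (U j x) powr p) <= C1" using UC by blast
  have Fz: "Fz ----> 0"
   unfolding Fz_def
  proof (rule frozen_term_limit[OF UW _ Y wW gd uU ug kd wc wk wd weak, where c'=\<phi> and B=L])
   show "AE x in M. (%j. c j x) ----> \<phi> x" using uU wc
   proof eventually_elim
    case (elim x)
    have "(%j. fst (U j x) - w j x) ----> 0" using tendsto_diff[OF elim(1) tendsto_fst[OF elim(2)]] by simp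
    then have "(%j. T' (fst (U j x) - w j x)) ----> T' 0" by (intro continuous_on_tendsto_compose[OF cT']) auto
    then have "(%j. T' (fst (U j x) - w j x)) ----> 1" by (simp add: T'_def)
    from tendsto_mult[OF tendsto_const[of "\<phi> x"] this] show ?case by (simp add: c_def)
   qed
   show "(LINT x|M. norm (U j x) powr p) <= C1" for j using C1 by blast
  qed (use cm c0L in auto)
  have key: "(LINT x|M. c j x * D j x) <= d * C' - Fz j" for j
  proof -
   let ?n = "N j"
   let ?t = "%x. T (fst (U j x) - w j x)"
   define V where "V x = (\<phi> x * ?t x, ?t x *\<^sub>R grad \<phi> x + c j x *\<^sub>R (snd (U j x) - grad (w j) x))" for x
   have VW: "V \<in> W" unfolding V_def c_def
    by (rule W_test[OF UW \<phi>(1) w(1) dT cT', of "max 1 (2 * d)"]) (use T'01 Tb in \<open>auto simp: le_max_iff_disj\<close>)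
   note s = sol_eq[OF U[of j] VW]
   have b: "(LINT x|M. norm (a x (U j x))) <= C" "(LINT x|M. G ?n (U j x)) <= C" "(LINT x|M. norm (E ?n (snd (U j x)))) <= C * (1 / (1 + \<kappa> ?n))"
    "(LINT x|M. H ?n x (fst (U j x)) * \<phi> x) <= C\<phi>"
    using C(2) C\<phi>(2) U[of j] by blast+
   have "C * (1 / (1 + \<kappa> ?n)) <= C * 1" using C(1) \<kappa>1[of ?n] by (intro mult_left_mono) auto
   then have b3: "(LINT x|M. norm (E ?n (snd (U j x)))) <= C" using b(3) by simp
   have LA: "LP q M (%x. a x (U j x))" and LE: "LP q M (%x. E ?n (snd (U j x)))" using A_LP(1)[OF LU] E_LP[OF LU] by blast+
   have tL: "LP p M (%x. ?t x *\<^sub>R grad \<phi> x)"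
    by (rule LP_mult_bounded[OF C1c_LP(3)[OF \<phi>(1) p0(2)] _ Tb p0(2)]) measurable
   have cL: "LP p M (%x. c j x *\<^sub>R (snd (U j x) - grad (w j) x))"
    by (rule LP_mult_bounded[OF LV cm _ p0(2), where B=L]) (use c0L in auto)
   have low: "(LINT x|M. Z x \<bullet> (?t x *\<^sub>R grad \<phi> x)) >= - (2 * d * L * C)" if Z: "LP q M Z" "(LINT x|M. norm (Z x)) <= C" for Z
   proof -
    have "- (2 * d * L * C) <= - (2 * d * L) * (LINT x|M. norm (Z x))"
     using mult_left_mono[OF Z(2), of "2 * d * L"] d L by simp
    also have "... = (LINT x|M. - (2 * d * L) * norm (Z x))" by simp
    also have "... <= (LINT x|M. Z x \<bullet> (?t x *\<^sub>R grad \<phi> x))"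
    proof (rule integral_mono[OF _ inner_int[OF Z(1) tL]])
     show "integrable M (%x. - (2 * d * L) * norm (Z x))" using LP_integrable[OF Z(1) q1(5)] by auto
     fix x
     have "\<bar>Z x \<bullet> (?t x *\<^sub>R grad \<phi> x)\<bar> <= norm (Z x) * (\<bar>?t x\<bar> * norm (grad \<phi> x))"
      using Cauchy_Schwarz_ineq2[of "Z x" "?t x *\<^sub>R grad \<phi> x"] by simp
     also have "... <= norm (Z x) * (2 * d * L)" using Tb L d by (intro mult_left_mono mult_mono) auto
     finally show "- (2 * d * L) * norm (Z x) <= Z x \<bullet> (?t x *\<^sub>R grad \<phi> x)" by (simp add: mult.commute abs_le_iff)
    qed
    finally show ?thesis .
   qed
   have A1: "(LINT x|M. a x (U j x) \<bullet> snd (V x)) = (LINT x|M. a x (U j x) \<bullet> (?t x *\<^sub>R grad \<phi> x)) + (LINT x|M. a x (U j x) \<bullet> (c j x *\<^sub>R (snd (U j x) - grad (w j) x)))"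
    using inner_int[OF LA tL] inner_int[OF LA cL] by (simp add: V_def inner_add_right)
   have A2: "(LINT x|M. E ?n (snd (U j x)) \<bullet> snd (V x)) = (LINT x|M. E ?n (snd (U j x)) \<bullet> (?t x *\<^sub>R grad \<phi> x)) + (LINT x|M. E ?n (snd (U j x)) \<bullet> (c j x *\<^sub>R (snd (U j x) - grad (w j) x)))"
    using inner_int[OF LE tL] inner_int[OF LE cL] by (simp add: V_def inner_add_right)
   \<comment> \<open>E vanishes at \<open>grad (w j)\<close>, whose norm is at most RE, so
     monotonicity alone gives the sign.\<close>
   have A3: "(LINT x|M. E ?n (snd (U j x)) \<bullet> (c j x *\<^sub>R (snd (U j x) - grad (w j) x))) >= 0"
   proof (intro lint_nonneg)
    fix x
    have "E ?n (snd (U j x)) \<bullet> (snd (U j x) - grad (w j) x) >= 0"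
     using E_mono[of ?n "snd (U j x)" "grad (w j) x"] E_zero[OF w(2)[of j x]] by simp
    then show "0 <= E ?n (snd (U j x)) \<bullet> (c j x *\<^sub>R (snd (U j x) - grad (w j) x))" using c0L by simp
   qed
   have A4: "(LINT x|M. G ?n (U j x) * fst (V x)) >= - (2 * d * L * C)"
   proof -
    have "- (2 * d * L * C) <= - (2 * d * L) * (LINT x|M. G ?n (U j x))"
     using mult_left_mono[OF b(2), of "2 * d * L"] d L by simp
    also have "... = (LINT x|M. - (2 * d * L) * G ?n (U j x))" by simp
    also have "... <= (LINT x|M. G ?n (U j x) * fst (V x))"
    proof (rule integral_mono[OF _ sol_ints(3)[OF UW VW]])
     show "integrable M (%x. - (2 * d * L) * G ?n (U j x))" using G_int[OF U] by auto
     fix x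
     have "\<bar>\<phi> x * ?t x\<bar> <= L * (2 * d)" unfolding abs_mult using L Tb by (intro mult_mono) auto
     then have "G ?n (U j x) * (- (L * (2 * d))) <= G ?n (U j x) * (\<phi> x * ?t x)"
      by (intro mult_left_mono G_nonneg) (auto simp: abs_le_iff)
     then show "- (2 * d * L) * G ?n (U j x) <= G ?n (U j x) * fst (V x)" by (simp add: V_def mult_ac)
    qed
    finally show ?thesis .
   qed
   have A5: "(LINT x|M. H ?n x (fst (U j x)) * fst (V x)) <= 2 * d * C\<phi>"
   proof -
    have "(LINT x|M. H ?n x (fst (U j x)) * fst (V x)) <= (LINT x|M. 2 * d * (H ?n x (fst (U j x)) * \<phi> x))"
    proof (rule integral_mono[OF sol_ints(4)[OF UW VW]])
     show "integrable M (%x. 2 * d * (H ?n x (fst (U j x)) * \<phi> x))" using sol_ints(4)[OF UW jet_W[OF \<phi>(1)]] by simp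
     fix x
     have "(H ?n x (fst (U j x)) * \<phi> x) * ?t x <= (H ?n x (fst (U j x)) * \<phi> x) * (2 * d)"
      using Tb[of "fst (U j x) - w j x"] by (intro mult_left_mono mult_nonneg_nonneg H_nonneg \<phi>) (auto simp: abs_le_iff)
     then show "H ?n x (fst (U j x)) * fst (V x) <= 2 * d * (H ?n x (fst (U j x)) * \<phi> x)" by (simp add: V_def mult_ac)
    qed
    also have "... = 2 * d * (LINT x|M. H ?n x (fst (U j x)) * \<phi> x)" by simp
    also have "... <= 2 * d * C\<phi>" using b(4) d by (intro mult_left_mono) auto
    finally show ?thesis .
   qed
   have A6: "(LINT x|M. c j x * D j x) = (LINT x|M. a x (U j x) \<bullet> (c j x *\<^sub>R (snd (U j x) - grad (w j) x))) - Fz j"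
   proof -
    have "LP q M (%x. c j x *\<^sub>R a x (fst (U j x), grad (w j) x))"
     by (rule LP_mult_bounded[OF A_LP(1)[OF Lp] cm _ q1(4), where B=L]) (use c0L in auto)
    from inner_int[OF this LV[of j]]
    have "(LINT x|M. a x (U j x) \<bullet> (c j x *\<^sub>R (snd (U j x) - grad (w j) x))) - Fz j
     = (LINT x|M. a x (U j x) \<bullet> (c j x *\<^sub>R (snd (U j x) - grad (w j) x)) - (c j x *\<^sub>R a x (fst (U j x), grad (w j) x)) \<bullet> (snd (U j x) - grad (w j) x))"
     unfolding Fz_def snd_jet using inner_int[OF LA cL] by simp
    also have "... = (LINT x|M. c j x * D j x)"
     by (intro Bochner_Integration.integral_cong) (auto simp: D_def inner_diff_left right_diff_distrib)
    finally show ?thesis by simp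
   qed
   have "d * C' = 2 * d * C\<phi> + 2 * d * L * C + 2 * d * L * C + 2 * d * L * C" by (simp add: C'_def algebra_simps)
   then show ?thesis using s A1 A2 A3 A4 A5 A6 low[OF LA b(1)] low[OF LE b3] by linarith
  qed
  define bb where "bb j = - 2 * Fz j + (1 / d) powr p * (LINT x|M. \<bar>fst (U j x) - w j x\<bar> powr p)" for j
  have "\<bar>R j\<bar> <= bb j + e" for j
  proof -
   have R0: "R j >= 0" unfolding R_def
   proof (rule integral_nonneg_AE)
    show "AE x in M. 0 <= min 1 (\<phi> x * D j x)" using D0[of j] by eventually_elim (simp add: \<phi>(2))
   qed
   have ic: "integrable M (%x. c j x * D j x)"
    by (rule lint_bound[of _ "%x. L * \<bar>D j x\<bar>"])
      (use Di cm c0L L in \<open>auto simp: abs_mult intro!: mult_right_mono AE_I2\<close>)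
   have iu: "integrable M (%x. \<bar>fst (U j x) - w j x\<bar> powr p)"
    using LP_int[OF LP_diff[OF LUs(2) Lw(1) p0(2)]] by simp
   have "R j <= (LINT x|M. 2 * (c j x * D j x) + (1 / d) powr p * \<bar>fst (U j x) - w j x\<bar> powr p)"
    unfolding R_def
   proof (rule integral_mono_AE[OF iR])
    show "integrable M (%x. 2 * (c j x * D j x) + (1 / d) powr p * \<bar>fst (U j x) - w j x\<bar> powr p)" using ic iu by auto
    show "AE x in M. min 1 (\<phi> x * D j x) <= 2 * (c j x * D j x) + (1 / d) powr p * \<bar>fst (U j x) - w j x\<bar> powr p"
     using D0[of j]
    proof eventually_elim
     case (elim x)
     define y where "y = fst (U j x) - w j x"
     have cD: "0 <= c j x * D j x" using c0L elim by simp
     show ?case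
     \<comment> \<open>Where |y| \<le> d the slope is at least 1/2; elsewhere 1 is at most
       (|y|/d)^p, whose integral tends to 0 by \<open>duw\<close>.\<close>
     proof (cases "\<bar>y\<bar> <= d")
      case True
      then have "\<bar>y / d\<bar> <= 1" using d(1) by simp
      then have "(y / d)^2 <= 1" by (simp add: abs_square_le_1)
      then have "inverse 2 <= T' y" unfolding T'_def using pos[of y] by (intro le_imp_inverse_le) auto
      then have "(\<phi> x * D j x) * inverse 2 <= (\<phi> x * D j x) * T' y"
       using elim \<phi>(2)[of x] by (intro mult_left_mono mult_nonneg_nonneg) auto
      then have "\<phi> x * D j x <= 2 * (c j x * D j x)" by (simp add: c_def y_def mult_ac)
      moreover have "(1 / d) powr p * \<bar>y\<bar> powr p >= 0" by simp
      ultimately show ?thesis unfolding y_def by linarith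
     next
      case False
      then have "1 <= 1 / d * \<bar>y\<bar>" using d(1) by (simp add: field_simps)
      then have "1 powr p <= (1 / d * \<bar>y\<bar>) powr p" using p0 by (intro powr_mono2) auto
      also have "(1 / d * \<bar>y\<bar>) powr p = (1 / d) powr p * \<bar>y\<bar> powr p" by (rule powr_mult)
      finally have "1 <= (1 / d) powr p * \<bar>y\<bar> powr p" by simp
      then show ?thesis using cD unfolding y_def by linarith
     qed
    qed
   qed
   also have "... = 2 * (LINT x|M. c j x * D j x) + (1 / d) powr p * (LINT x|M. \<bar>fst (U j x) - w j x\<bar> powr p)"
    using ic iu by simp
   also have "... <= bb j + e" using key[of j] d(2) by (simp add: bb_def)
   finally show ?thesis using R0 by simp
  qed
  moreover have "bb ----> - 2 * 0 + (1 / d) powr p * (LINT x|M. 0)"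
   unfolding bb_def by (intro tendsto_intros Fz duw)
  ultimately show "\<exists>b. b ----> 0 \<and> (\<forall>\<^sub>F j in sequentially. \<bar>R j\<bar> <= b j + e)"
   by (intro exI[of _ bb]) auto
 qed
 moreover have "(LINT x|M. norm (min 1 (\<phi> x * D j x))) = R j" for j
  unfolding R_def
 proof (rule integral_cong_AE)
  show "AE x in M. norm (min 1 (\<phi> x * D j x)) = min 1 (\<phi> x * D j x)" using D0[of j]
  proof eventually_elim
   case (elim x) then show ?case using \<phi>(2)[of x] by simp
  qed
 qed (use borel_measurable_integrable[OF iR] in auto)
 ultimately have "(%j. LINT x|M. norm (min 1 (\<phi> x * D j x))) ----> 0" by simp
 from tendsto_L1_AE_subseq[OF iR this] obtain t :: "nat => nat"
  where t: "strict_mono t" "AE x in M. (%j. min 1 (\<phi> x * D (t j) x)) ----> 0" by blast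
 have ut: "AE x in M. (%j. fst (U (t j) x)) ----> fst (Y x)" using uU
  by eventually_elim (rule filterlim_compose[OF _ filterlim_subseq[OF t(1)]])
 have wt: "AE x in M. (%j. grad (w (t j)) x) ----> snd (Y x)" using wc
 proof eventually_elim
  case (elim x)
  show ?case using filterlim_compose[OF tendsto_snd[OF elim] filterlim_subseq[OF t(1)]] by simp
 qed
 have D0': "AE x in M. \<forall>j. D j x >= 0" using D0 by (simp add: AE_all_countable)
 have "AE x in M. x \<in> K --> (%j. snd (U (t j) x)) ----> snd (Y x)"
 proof (rule gradient_AE[OF ut wt])
  show "AE x in M. x \<in> K --> (%j. (a x (U (t j) x) - a x (fst (U (t j) x), grad (w (t j)) x)) \<bullet> (snd (U (t j) x) - grad (w (t j)) x)) ----> 0"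
   using t(2) D0'
  proof eventually_elim
   case (elim x)
   show ?case
   proof
    assume x: "x \<in> K"
    have ev: "\<forall>\<^sub>F j in sequentially. min 1 (\<phi> x * D (t j) x) < 1" by (rule order_tendstoD(2)[OF elim(1)]) simp
    have "(%j. D (t j) x) ----> 0"
    proof (rule Lim_null_comparison[OF _ elim(1)])
     show "\<forall>\<^sub>F j in sequentially. norm (D (t j) x) <= min 1 (\<phi> x * D (t j) x)" using ev
     proof eventually_elim
      case (elim j)
      have "1 * D (t j) x <= \<phi> x * D (t j) x" using \<phi>(3)[OF x] D0' \<open>\<forall>j. D j x >= 0\<close> by (intro mult_right_mono) auto
      then show ?case using elim \<open>\<forall>j. D j x >= 0\<close> by auto
     qed
    qed
    then show "(%j. (a x (U (t j) x) - a x (fst (U (t j) x), grad (w (t j)) x)) \<bullet> (snd (U (t j) x) - grad (w (t j)) x)) ----> 0"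
     unfolding D_def .
   qed
  qed
 qed
 then show ?thesis using t(1) by blast
qed

end

section \<open>Passage to the limit\<close>

text \<open>The bounds c n vary and converge, as the right-hand sides of the tested equations
  do.\<close>

lemma fatou_lim:
 fixes f :: "nat => 'm => real"
 assumes i: "!!n. integrable M (f n)" and nn: "!!n. AE x in M. f n x >= 0" and le: "!!n. (LINT x|M. f n x) <= c n"
  and c: "c ----> R" and F: "F \<in> BM M" and conv: "AE x in M. (%n. f n x) ----> F x"
 shows "integrable M F" "(LINT x|M. F x) <= R"
proof -
 have *: "integrable M F \<and> (LINT x|M. F x) <= R + e" if "e > 0" for e
 proof -
  have "\<forall>\<^sub>F n in sequentially. c n < R + e" using c \<open>e > 0\<close> by (intro order_tendstoD) auto
  then obtain k where k: "\<forall>n\<ge>k. c n < R + e" unfolding eventually_sequentially by blast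
  have conv': "AE x in M. (%n. f (n + k) x) ----> F x" using conv
   by eventually_elim (rule LIMSEQ_ignore_initial_segment)
  have le': "(LINT x|M. f (n + k) x) <= R + e" for n using le[of "n + k"] k by (smt (verit) le_add2)
  show ?thesis using fatou_real(1,2)[OF i nn le' F conv'] by blast
 qed
 from *[of 1] show "integrable M F" by simp
 show "(LINT x|M. F x) <= R" by (rule field_le_epsilon) (use * in blast)
qed

text \<open>A nonincreasing C^1 cutoff, equal to 1 on the nonpositive half-line and to 0 from 1
  on.\<close>

definition cut :: "real => real" where "cut t = (max 0 (1 - (max 0 t)^2))^2"
definition cut' :: "real => real" where "cut' t = 2 * max 0 (1 - (max 0 t)^2) * (0 - 2 * max 0 t)"

lemma cut_deriv: "(cut has_field_derivative cut' t) (at t)"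
proof -
 have "((%t. 1 - (max 0 t)^2) has_field_derivative (0 - 2 * max 0 t)) (at t)"
  by (intro DERIV_diff DERIV_const DERIV_sq_pos)
 from DERIV_chain2[where f="%y::real. (max 0 y)^2" and g="%t. 1 - (max 0 t)^2" and x=t, OF DERIV_sq_pos this]
 show ?thesis unfolding cut_def[abs_def] cut'_def .
qed

lemma cut_props: "continuous_on UNIV cut" "continuous_on UNIV cut'" "0 <= cut t" "cut t <= 1" "cut' t <= 0"
 "t <= 0 ==> cut t = 1" "t <= 0 ==> cut' t = 0" "t >= 1 ==> cut t = 0" "t >= 1 ==> cut' t = 0" "\<bar>cut' t\<bar> <= 4"
proof -
 show "continuous_on UNIV cut" "continuous_on UNIV cut'" unfolding cut_def cut'_def
  by (intro continuous_intros continuous_on_max)+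
 show "0 <= cut t" by (simp add: cut_def)
 have m: "0 <= max 0 (1 - (max 0 t)^2)" "max 0 (1 - (max 0 t)^2) <= 1" by auto
 show "cut t <= 1" unfolding cut_def by (rule power_le_one[OF m])
 show "cut' t <= 0" unfolding cut'_def using m(1) by (intro mult_nonneg_nonpos) auto
 show "t <= 0 ==> cut t = 1" "t <= 0 ==> cut' t = 0" by (auto simp: cut_def cut'_def)
 have g: "max 0 (1 - (max 0 t)^2) = 0" if "t >= 1"
  using that power_mono[of 1 t 2] by simp
 show "t >= 1 ==> cut t = 0" "t >= 1 ==> cut' t = 0" unfolding cut_def cut'_def using g by auto
 show "\<bar>cut' t\<bar> <= 4"
 proof (cases "t >= 1")
  case True then show ?thesis unfolding cut'_def using g by simp
 next
  case False
  then have "max 0 t <= 1" by simp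
  then have "(2 * max 0 (1 - (max 0 t)^2)) * (2 * max 0 t) <= 2 * 2" using m by (intro mult_mono) auto
  moreover have "\<bar>cut' t\<bar> = (2 * max 0 (1 - (max 0 t)^2)) * (2 * max 0 t)"
   unfolding cut'_def using m(1) by (simp add: abs_mult)
  ultimately show ?thesis by linarith
 qed
qed

context dom
begin

text \<open>An exhaustion of \<Omega> by compact sets, expressed through test functions; it
  globalises what is obtained on supports.\<close>

lemma bump_sequence:
 "\<exists>\<phi>::nat => 'a => real. (\<forall>n. C1c \<Omega> (\<phi> n) \<and> (\<forall>x. \<phi> n x >= 0)) \<and> (\<forall>x\<in>\<Omega>. \<exists>N. \<forall>n\<ge>N. \<phi> n x >= 1)"
proof -
 obtain C :: "nat => 'a set" where C: "!!n. compact (C n)" "!!n. C n \<subseteq> \<Omega>" "!!K. compact K ==> K \<subseteq> \<Omega> ==> \<exists>N. \<forall>n\<ge>N. K \<subseteq> C n"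
  by (rule open_Union_compact_subsets[OF open_dom]) (erule that, auto)
 have "\<exists>\<phi>. C1c \<Omega> \<phi> \<and> (\<forall>x. \<phi> x >= 0) \<and> (\<forall>x\<in>C n. \<phi> x >= 1)" for n
  by (rule C1c_bump[OF open_dom C(1) C(2), of n]) auto
 from choice[OF allI[OF this]] obtain \<phi> where \<phi>: "\<forall>n. C1c \<Omega> (\<phi> n) \<and> (\<forall>x. \<phi> n x >= 0) \<and> (\<forall>x\<in>C n. \<phi> n x >= 1)" ..
 have "\<exists>N. \<forall>n\<ge>N. \<phi> n x >= 1" if x: "x \<in> \<Omega>" for x
 proof -
  obtain N where "\<forall>n\<ge>N. {x} \<subseteq> C n" using C(3)[of "{x}"] x by auto
  then show ?thesis using \<phi> by blast
 qed
 then show ?thesis using \<phi> by blast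
qed

end

section \<open>Limits of the source, the gradient term and the flux\<close>

context singular_limit
begin

text \<open>hY may take the value infinity; \<open>hY_fin\<close> shows that it is finite a.e., and
  from then on hr represents it.\<close>

definition hY :: "'a => ennreal" where "hY x = h (max 0 (fst (Y x))) * ennreal (f x)"
definition hr :: "'a => real" where "hr x = enn2real (hY x)"
definition gY :: "'a => real" where "gY x = g (max 0 (fst (Y x))) * norm (snd (Y x)) powr p"

lemma Ymeas [measurable]: "(%x. fst (Y x)) \<in> BM M" "(%x. snd (Y x)) \<in> BM M"
 using borel_measurable_fst_snd[OF LP_meas[OF W_LP[OF Y]]] by auto

lemma fmeas [measurable]: "f \<in> BM M" using f_int by auto

lemma hY_meas [measurable]: "hY \<in> BM M"
 unfolding hY_def
proof (intro borel_measurable_times_ennreal)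
 show "(%x. h (max 0 (fst (Y x)))) \<in> BM M"
  by (rule borel_measurable_continuous_on[OF h_cont' Ymeas(1)])
qed measurable

lemma hr_meas [measurable]: "hr \<in> BM M" unfolding hr_def by measurable

lemma gY_meas [measurable]: "gY \<in> BM M"
proof -
 have "continuous_on UNIV (%s. g (max 0 s))"
  by (rule continuous_on_compose2[OF g_cont]) (auto intro!: continuous_intros)
 from borel_measurable_continuous_on[OF this Ymeas(1)] show ?thesis unfolding gY_def by measurable
qed

lemma gY_nonneg: "gY x >= 0" unfolding gY_def by (intro mult_nonneg_nonneg g_nn) auto
lemma hr_nonneg: "hr x >= 0" by (simp add: hr_def)

lemma \<kappa>_lim: "filterlim n at_top sequentially ==> filterlim (%j. \<kappa> (n j)) at_top sequentially"
 unfolding \<kappa>_def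
 by (rule filterlim_compose[OF filterlim_real_sequentially]) (rule filterlim_compose[OF filterlim_Suc])

lemma min_lim:
 assumes "(y \<longlongrightarrow> l) sequentially" "filterlim c at_top sequentially"
 shows "(%j. min (y j) (c j :: real)) ----> l"
proof (rule Lim_transform_eventually[OF assms(1)])
 have "\<forall>\<^sub>F j in sequentially. y j < l + 1" using assms(1) by (intro order_tendstoD) auto
 moreover have "\<forall>\<^sub>F j in sequentially. c j >= l + 1" using assms(2) unfolding filterlim_at_top by blast
 ultimately show "\<forall>\<^sub>F j in sequentially. y j = min (y j) (c j)" by eventually_elim auto
qed

text \<open>For s = 0 the first factor of G has values in [0, 1] but need not converge. The
  gradients tend to 0 in that case, and so does the product.\<close>

lemma G_conv:
 assumes s: "sj ----> s" and x: "\<xi>j ----> \<xi>" and n: "filterlim n at_top sequentially" and s0: "s >= 0" and z: "s = 0 ==> \<xi> = 0"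
 shows "(%j. G (n j) (sj j, \<xi>j j)) ----> g (max 0 s) * norm \<xi> powr p"
proof -
 note k = \<kappa>_lim[OF n]
 have m: "(%j. max 0 (sj j)) ----> max 0 s" by (intro tendsto_intros s)
 have "(%j. min (max 0 (sj j)) (\<kappa> (n j))) ----> max 0 s" by (rule min_lim[OF m k])
 then have g2: "(%j. g (min (max 0 (sj j)) (\<kappa> (n j)))) ----> g (max 0 s)"
  using \<kappa>1 by (intro continuous_on_tendsto_compose[OF g_cont]) (auto intro!: always_eventually order_trans[OF zero_le_one])
 have "filterlim (%j. RE (n j) powr p) at_top sequentially"
 proof (rule filterlim_at_top_mono[OF filterlim_compose[OF filterlim_real_sequentially n]])
  show "\<forall>\<^sub>F j in sequentially. real (n j) <= RE (n j) powr p"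
  proof (intro always_eventually allI)
   fix j
   have "RE (n j) powr 1 <= RE (n j) powr p" using RE1(1) p0 by (intro powr_mono) auto
   then show "real (n j) <= RE (n j) powr p" using RE1(3)[of "n j"] RE1(2)[of "n j"] by simp
  qed
 qed
 moreover have "(%j. norm (\<xi>j j) powr p) ----> norm \<xi> powr p" using p0 by (intro tendsto_powr' tendsto_norm x tendsto_const) auto
 ultimately have g3: "(%j. min (norm (\<xi>j j) powr p) (RE (n j) powr p)) ----> norm \<xi> powr p" by (intro min_lim)
 show ?thesis
 proof (cases "s = 0")
  case False
  then have "s > 0" using s0 by simp
  have "filterlim (%j. \<kappa> (n j) * max 0 (sj j)) at_top sequentially"
   using \<open>s > 0\<close> by (intro filterlim_at_top_mult_tendsto_pos[OF m _ k]) auto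
  then have "(%j. min 1 (\<kappa> (n j) * max 0 (sj j))) ----> 1"
   using min_lim[OF tendsto_const] by blast
  from tendsto_mult[OF tendsto_mult[OF this g2] g3] show ?thesis by (simp add: G_def)
 next
  case True
  then have "\<xi> = 0" by (rule z)
  have "(%j. g (min (max 0 (sj j)) (\<kappa> (n j))) * min (norm (\<xi>j j) powr p) (RE (n j) powr p)) ----> g (max 0 s) * norm \<xi> powr p"
   by (intro tendsto_mult g2 g3)
  then have l: "(%j. g (min (max 0 (sj j)) (\<kappa> (n j))) * min (norm (\<xi>j j) powr p) (RE (n j) powr p)) ----> 0"
   using \<open>\<xi> = 0\<close> p0 by simp
  have "(%j. G (n j) (sj j, \<xi>j j)) ----> 0"
  proof (rule Lim_null_comparison[OF _ l], intro always_eventually allI)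
   fix j
   let ?r = "g (min (max 0 (sj j)) (\<kappa> (n j))) * min (norm (\<xi>j j) powr p) (RE (n j) powr p)"
   have "?r >= 0" using \<kappa>1[of "n j"] by (intro mult_nonneg_nonneg g_nn) auto
   then have "min 1 (\<kappa> (n j) * max 0 (sj j)) * ?r <= 1 * ?r" by (intro mult_right_mono) auto
   then show "norm (G (n j) (sj j, \<xi>j j)) <= ?r" using G_nonneg[of "n j" "(sj j, \<xi>j j)"] by (simp add: G_def mult.assoc)
  qed
  then show ?thesis using \<open>\<xi> = 0\<close> p0 by simp
 qed
qed

text \<open>Multiplication in \<open>ennreal\<close> is discontinuous at infinity times 0, so points
  with f = 0 are treated apart. Elsewhere the truncations of f and at height \<kappa> n become
  inactive, and the one of h tends to infinity.\<close>

lemma H_conv: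
 assumes s: "sj ----> s" and n: "filterlim n at_top sequentially" and s0: "s >= 0"
 shows "(%j. ennreal (H (n j) x (sj j))) ----> h (max 0 s) * ennreal (f x)"
proof (cases "f x = 0")
 case True
 have "min 0 (\<kappa> m) = 0" for m using \<kappa>1[of m] by simp
 with True show ?thesis by (simp add: H_def)
next
 case False
 note k = \<kappa>_lim[OF n]
 have "(%j. min (h (max 0 (sj j))) (ennreal (\<kappa> (n j)))) ----> min (h (max 0 s)) top"
 proof (rule tendsto_min)
  show "(%j. h (max 0 (sj j))) ----> h (max 0 s)" by (rule continuous_on_tendsto_compose[OF h_cont' s]) auto
  have "filterlim (%j. Suc (n j)) at_top sequentially" by (rule filterlim_compose[OF filterlim_Suc n])
  from filterlim_compose[OF of_nat_tendsto_top_ennreal this]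
  show "(%j. ennreal (\<kappa> (n j))) ----> top" by (simp add: \<kappa>_def ennreal_of_nat_eq_real_of_nat del: of_nat_Suc)
 qed
 then have "(%j. ennreal (hn (n j) (sj j))) ----> h (max 0 s)" by (simp add: ennreal_hn)
 then have l: "(%j. ennreal (hn (n j) (sj j)) * ennreal (f x)) ----> h (max 0 s) * ennreal (f x)"
  using False f_nn[of x] by (intro tendsto_mult_ennreal tendsto_const) auto
 show ?thesis
 proof (rule Lim_transform_eventually[OF l])
  have "\<forall>\<^sub>F j in sequentially. sj j < s + 1" using s by (intro order_tendstoD) auto
  moreover have "\<forall>\<^sub>F j in sequentially. \<kappa> (n j) >= s + 2" "\<forall>\<^sub>F j in sequentially. \<kappa> (n j) >= f x"
   using k unfolding filterlim_at_top by blast+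
  ultimately show "\<forall>\<^sub>F j in sequentially. ennreal (hn (n j) (sj j)) * ennreal (f x) = ennreal (H (n j) x (sj j))"
  proof eventually_elim
   case (elim j)
   then have "H (n j) x (sj j) = hn (n j) (sj j) * f x" by (simp add: H_def)
   then show ?case using hn_nonneg[of "n j" "sj j"] by (simp add: ennreal_mult f_nn)
  qed
 qed
qed

text \<open>Fatou's lemma with \<open>sol_rhs\<close> against an exhausting sequence of bumps. If
  h(0) is infinite, this says that f = 0 a.e. where the limit vanishes.\<close>

lemma hY_fin: "AE x in M. hY x < \<infinity>"
proof -
 from bump_sequence obtain \<phi> :: "nat => 'a => real" where
  \<phi>: "(\<forall>n. C1c \<Omega> (\<phi> n) \<and> (\<forall>x. \<phi> n x >= 0)) \<and> (\<forall>x\<in>\<Omega>. \<exists>N. \<forall>n\<ge>N. \<phi> n x >= 1)" ..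
 have "AE x in M. hY x * ennreal (\<phi> n x) \<noteq> \<infinity>" for n
 proof (rule nn_integral_PInf_AE)
  have C: "C1c \<Omega> (\<phi> n)" and nn: "\<phi> n x >= 0" for x using \<phi> by blast+
  have [measurable]: "\<phi> n \<in> BM M" using C1c_LP(2)[OF C p0(2)] by (auto simp: LP_def)
  obtain C\<phi> where C\<phi>: "C\<phi> >= 0" "\<forall>m V. sol m V --> (LINT x|M. H m x (fst (V x)) * \<phi> n x) <= C\<phi>"
   using sol_rhs[OF C nn] by blast
  show "(%x. hY x * ennreal (\<phi> n x)) \<in> BM M" by measurable
  have "(\<integral>\<^sup>+x. hY x * ennreal (\<phi> n x) \<partial>M) = (\<integral>\<^sup>+x. liminf (%j. ennreal (H (N j) x (fst (U j x)) * \<phi> n x)) \<partial>M)"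
  proof (rule nn_integral_cong_AE)
   show "AE x in M. hY x * ennreal (\<phi> n x) = liminf (%j. ennreal (H (N j) x (fst (U j x)) * \<phi> n x))"
    using uU Y_nonneg
   proof eventually_elim
    case (elim x)
    have "(%j. ennreal (\<phi> n x) * ennreal (H (N j) x (fst (U j x)))) ----> ennreal (\<phi> n x) * hY x"
     unfolding hY_def by (intro ennreal_tendsto_cmult H_conv elim Nlim) auto
    then have "(%j. ennreal (H (N j) x (fst (U j x)) * \<phi> n x)) ----> hY x * ennreal (\<phi> n x)"
     by (simp add: ennreal_mult[symmetric] H_nonneg nn mult.commute)
    then show ?case by (rule lim_imp_Liminf[symmetric, rotated]) simp
   qed
  qed
  also have "... <= liminf (%j. \<integral>\<^sup>+x. ennreal (H (N j) x (fst (U j x)) * \<phi> n x) \<partial>M)"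
  proof (rule nn_integral_liminf)
   show "(%x. ennreal (H (N j) x (fst (U j x)) * \<phi> n x)) \<in> BM M" for j
    using H_meas[OF borel_measurable_fst_snd(1)[OF LP_meas[OF W_LP[OF UW]]]] by measurable
  qed
  also have "... = liminf (%j. ennreal (LINT x|M. H (N j) x (fst (U j x)) * \<phi> n x))"
   using sol_ints(4)[OF UW jet_W[OF C]] by (subst nn_integral_eq_integral) (auto simp: H_nonneg nn)
  also have "... <= liminf (%j::nat. ennreal C\<phi>)"
   using C\<phi> U by (intro Liminf_mono always_eventually allI ennreal_leI) blast
  also have "... = ennreal C\<phi>" by (simp add: Liminf_const)
  finally show "(\<integral>\<^sup>+x. hY x * ennreal (\<phi> n x) \<partial>M) \<noteq> \<infinity>" by (auto simp: top_unique)
 qed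
 then have "AE x in M. \<forall>n. hY x * ennreal (\<phi> n x) \<noteq> \<infinity>" by (simp add: AE_all_countable)
 then show ?thesis
 proof (rule AE_mp, intro AE_I2 impI)
  fix x assume "x \<in> space M" and *: "\<forall>n. hY x * ennreal (\<phi> n x) \<noteq> \<infinity>"
  then have "x \<in> \<Omega>" by simp
  then obtain m where m: "\<forall>n\<ge>m. \<phi> n x >= 1" using \<phi> by blast
  have "hY x * ennreal (\<phi> m x) \<noteq> \<infinity>" using * by blast
  then show "hY x < \<infinity>" using m by (auto simp: ennreal_mult_eq_top_iff less_top)
 qed
qed

lemma H_conv_real:
 "AE x in M. (%j. H (N j) x (fst (U j x))) ----> hr x"
 using uU Y_nonneg hY_fin
proof eventually_elim
 case (elim x)
 have "(%j. ennreal (H (N j) x (fst (U j x)))) ----> ennreal (hr x)"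
  using H_conv[OF elim(1) Nlim elim(2), of x] elim(3) unfolding hr_def hY_def by simp
 then show ?case using H_nonneg hr_nonneg by (subst (asm) tendsto_ennreal_iff) auto
qed

lemma hr_int:
 assumes \<phi>: "C1c \<Omega> \<phi>" "!!x. \<phi> x >= 0" shows "integrable M (%x. hr x * \<phi> x)"
proof -
 obtain C where C: "C >= 0" "\<forall>m V. sol m V --> (LINT x|M. H m x (fst (V x)) * \<phi> x) <= C" using sol_rhs[OF \<phi>] by blast
 have m: "\<phi> \<in> BM M" using C1c_LP(2)[OF \<phi>(1) p0(2)] by (auto simp: LP_def)
 show ?thesis
 proof (rule fatou_real(1)[of M "%j x. H (N j) x (fst (U j x)) * \<phi> x" C])
  show "integrable M (%x. H (N j) x (fst (U j x)) * \<phi> x)" for j using sol_ints(4)[OF UW jet_W[OF \<phi>(1)]] by simp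
  show "(LINT x|M. H (N j) x (fst (U j x)) * \<phi> x) <= C" for j using C(2) U by blast
  show "AE x in M. (%j. H (N j) x (fst (U j x)) * \<phi> x) ----> hr x * \<phi> x"
   using H_conv_real by eventually_elim (intro tendsto_intros)
 qed (use \<phi> m H_nonneg in auto)
qed

text \<open>Coercivity at small multiples of \<eta> gives a nonnegative product of a(x, s, 0) with
  every \<eta>; taking \<eta> = -a(x, s, 0) leaves only 0.\<close>

lemma a_zero: "AE x in M. \<forall>s. a x (s, 0) = 0"
 using A_coer
proof eventually_elim
 case (elim x)
 have *: "a x (s, 0) \<bullet> \<eta> >= 0" for s \<eta>
 proof -
  have "(%n. (s, (1 / real (Suc n)) *\<^sub>R \<eta>)) ----> (s, 0 *\<^sub>R \<eta>)"
   by (intro tendsto_Pair tendsto_const tendsto_scaleR LIMSEQ_Suc[OF lim_1_over_n])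
  then have "(%n. a x (s, (1 / real (Suc n)) *\<^sub>R \<eta>)) ----> a x (s, 0)"
   by (intro continuous_on_tendsto_compose[OF A_cont]) auto
  then have "(%n. a x (s, (1 / real (Suc n)) *\<^sub>R \<eta>) \<bullet> \<eta>) ----> a x (s, 0) \<bullet> \<eta>" by (intro tendsto_intros)
  moreover have "a x (s, (1 / real (Suc n)) *\<^sub>R \<eta>) \<bullet> \<eta> >= 0" for n
  proof -
   have "0 <= \<alpha> * norm ((1 / real (Suc n)) *\<^sub>R \<eta>) powr p" using \<alpha>0 by simp
   also have "... <= a x (s, (1 / real (Suc n)) *\<^sub>R \<eta>) \<bullet> ((1 / real (Suc n)) *\<^sub>R \<eta>)"
    using elim[rule_format, of "(s, (1 / real (Suc n)) *\<^sub>R \<eta>)"] by simp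
   finally show ?thesis by (simp add: zero_le_divide_iff)
  qed
  ultimately show ?thesis by (intro LIMSEQ_le_const) auto
 qed
 show ?case
 proof
  fix s
  have "a x (s, 0) \<bullet> a x (s, 0) = 0" using *[of s "- a x (s, 0)"] inner_ge_zero[of "a x (s, 0)"] by simp
  then show "a x (s, 0) = 0" by simp
 qed
qed

text \<open>Flux and gradient vanish together with the function, so weights that have the wrong
  limit on its zero set do no harm.\<close>

lemma Y_zero: "AE x in M. fst (Y x) = 0 --> snd (Y x) = 0 \<and> a x (Y x) = 0"
 using gradient_zero_on_level[OF Y] a_zero
proof eventually_elim
 case (elim x)
 show ?case
 proof
  assume z: "fst (Y x) = 0"
  then have "snd (Y x) = 0" using elim(1) by blast
  then have "Y x = (fst (Y x), 0)" by (simp add: prod_eq_iff)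
  then show "snd (Y x) = 0 \<and> a x (Y x) = 0" using elim(2) \<open>snd (Y x) = 0\<close> by metis
 qed
qed

lemma t_Nlim: "strict_mono t ==> filterlim (%j. N (t j)) at_top sequentially"
 by (rule filterlim_compose[OF Nlim filterlim_subseq])

lemma t_u: "strict_mono t ==> AE x in M. (%j. fst (U (t j) x)) ----> fst (Y x)"
 using uU by eventually_elim (rule filterlim_compose[OF _ filterlim_subseq])

lemma G_conv_AE:
 assumes t: "strict_mono t" "AE x in M. x \<in> K --> (%j. snd (U (t j) x)) ----> snd (Y x)"
 shows "AE x in M. x \<in> K --> (%j. G (N (t j)) (U (t j) x)) ----> gY x"
 using t_u[OF t(1)] t(2) Y_zero Y_nonneg
proof eventually_elim
 case (elim x)
 show ?case
 proof
  assume "x \<in> K"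
  then show "(%j. G (N (t j)) (U (t j) x)) ----> gY x"
   using G_conv[OF elim(1) _ t_Nlim[OF t(1)] elim(4), of "%j. snd (U (t j) x)" "snd (Y x)"] elim by (simp add: gY_def)
 qed
qed

lemma supp:
 assumes "C1c \<Omega> \<phi>" shows "compact (closure {x. \<phi> x \<noteq> 0})" "closure {x. \<phi> x \<noteq> 0} \<subseteq> \<Omega>"
  "x \<notin> closure {x. \<phi> x \<noteq> 0} ==> \<phi> x = 0" "x \<notin> closure {x. \<phi> x \<noteq> 0} ==> grad \<phi> x = 0"
 using assms unfolding C1c_iff by blast+ (erule C1c_outside[OF assms])+

text \<open>The L^1 bound for G does not depend on the bump. A second application of Fatou's lemma,
  along the bumps, therefore makes gY integrable on all of \<Omega>, although the gradients are
  known to converge on compact sets only.\<close>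

lemma gY_int: "integrable M gY"
proof -
 obtain C where C: "C >= 0" "\<forall>n U. sol n U --> (LINT x|M. norm (snd (U x)) powr p) <= C \<and> (LINT x|M. G n (U x)) <= C"
  using sol_energy by blast
 from bump_sequence obtain \<phi> :: "nat => 'a => real" where
  \<phi>: "(\<forall>n. C1c \<Omega> (\<phi> n) \<and> (\<forall>x. \<phi> n x >= 0)) \<and> (\<forall>x\<in>\<Omega>. \<exists>N. \<forall>n\<ge>N. \<phi> n x >= 1)" ..
 have *: "integrable M (%x. min 1 (\<phi> n x) * gY x) \<and> (LINT x|M. min 1 (\<phi> n x) * gY x) <= C" for n
 proof -
  have Cn: "C1c \<Omega> (\<phi> n)" and nn: "\<phi> n x >= 0" for x using \<phi> by blast+
  have [measurable]: "\<phi> n \<in> BM M" using C1c_LP(2)[OF Cn p0(2)] by (auto simp: LP_def)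
  obtain t where t: "strict_mono t" "AE x in M. x \<in> closure {x. \<phi> n x \<noteq> 0} --> (%j. snd (U (t j) x)) ----> snd (Y x)"
   using gradient_subsequence[OF supp(1,2)[OF Cn]] by blast
  have bd: "0 <= min 1 (\<phi> n x)" "min 1 (\<phi> n x) <= 1" for x using nn by auto
  have le: "min 1 (\<phi> n x) * G m z <= G m z" for x m z
   using mult_right_mono[OF bd(2) G_nonneg, of x m z] by simp
  have i: "integrable M (%x. min 1 (\<phi> n x) * G (N (t j)) (U (t j) x))" for j
  proof (rule lint_bound[OF G_int[OF U]])
   show "(%x. min 1 (\<phi> n x) * G (N (t j)) (U (t j) x)) \<in> BM M"
    using borel_measurable_integrable[OF G_int[OF U]] by measurable
   show "AE x in M. norm (min 1 (\<phi> n x) * G (N (t j)) (U (t j) x)) <= norm (G (N (t j)) (U (t j) x))"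
    using le bd G_nonneg by (intro AE_I2) (simp add: abs_mult)
  qed
  have l: "(LINT x|M. min 1 (\<phi> n x) * G (N (t j)) (U (t j) x)) <= C" for j
  proof -
   have "(LINT x|M. min 1 (\<phi> n x) * G (N (t j)) (U (t j) x)) <= (LINT x|M. G (N (t j)) (U (t j) x))"
    by (intro integral_mono i G_int[OF U] le)
   also have "... <= C" using C(2) U by blast
   finally show ?thesis .
  qed
  have "AE x in M. (%j. min 1 (\<phi> n x) * G (N (t j)) (U (t j) x)) ----> min 1 (\<phi> n x) * gY x"
   using G_conv_AE[OF t]
  proof eventually_elim
   case (elim x)
   show ?case
   proof (cases "x \<in> closure {x. \<phi> n x \<noteq> 0}")
    case True then show ?thesis using elim by (intro tendsto_intros) auto
   next
    case False
    then have "\<phi> n x = 0" by (rule supp(3)[OF Cn])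
    then show ?thesis by simp
   qed
  qed
  then show ?thesis
   using fatou_real(1,2)[where F="%x. min 1 (\<phi> n x) * gY x", OF i _ l] bd G_nonneg by (auto simp: mult_nonneg_nonneg)
 qed
 show ?thesis
 proof (rule fatou_real(1)[of M "%n x. min 1 (\<phi> n x) * gY x" C])
  show "AE x in M. (%n. min 1 (\<phi> n x) * gY x) ----> gY x"
  proof (rule AE_I2)
   fix x assume "x \<in> space M"
   then obtain m where m: "\<forall>n\<ge>m. \<phi> n x >= 1" using \<phi> by auto
   show "(%n. min 1 (\<phi> n x) * gY x) ----> gY x"
    by (rule tendsto_eventually) (use m in \<open>auto simp: eventually_sequentially intro!: exI[of _ m]\<close>)
  qed
  show "AE x in M. min 1 (\<phi> n x) * gY x >= 0" for n using \<phi> gY_nonneg by (intro AE_I2 mult_nonneg_nonneg) auto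
 qed (use * in auto)
qed

text \<open>The gradients converge on K and the fields v j vanish off K, so the integrands converge
  a.e.; the L^q bound with q > 1 turns this into L^1 convergence. The flux of E is of order 1/(1 +
  \<kappa> n) in L^1.\<close>

lemma flux_limit:
 assumes t: "strict_mono t" "AE x in M. x \<in> K --> (%j. snd (U (t j) x)) ----> snd (Y x)"
  and v: "!!j. v j \<in> BM M" "v' \<in> BM M" "!!j x. norm (v j x) <= B" "!!j x. x \<notin> K ==> v j x = 0"
   "AE x in M. (%j. v j x) ----> v' x"
 shows "(%j. LINT x|M. a x (U (t j) x) \<bullet> v j x) ----> (LINT x|M. a x (Y x) \<bullet> v' x)"
  "(%j. LINT x|M. E (N (t j)) (snd (U (t j) x)) \<bullet> v j x) ----> 0"
  "!!j. integrable M (%x. a x (U (t j) x) \<bullet> v j x)" "!!j. integrable M (%x. E (N (t j)) (snd (U (t j) x)) \<bullet> v j x)"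
  "integrable M (%x. a x (Y x) \<bullet> v' x)"
proof -
 have B0: "B >= 0" using v(3) norm_ge_zero order_trans by blast
 have LU: "LP p M (U j)" for j by (rule W_LP[OF UW])
 have vL: "LP p M (v j)" for j by (rule LP_bounded[OF v(1) v(3) p0(2)])
 have LA: "LP q M (%x. a x (U j x))" for j by (rule A_LP(1)[OF LU])
 have LE: "LP q M (%x. E n (snd (U j x)))" for n j by (rule E_LP[OF LU])
 show ia: "integrable M (%x. a x (U (t j) x) \<bullet> v j x)" for j by (rule inner_int[OF LA vL])
 show ie: "integrable M (%x. E (N (t j)) (snd (U (t j) x)) \<bullet> v j x)" for j by (rule inner_int[OF LE vL])
 obtain C where C: "C >= 0" "\<forall>j. (LINT x|M. norm (U j x) powr p) <= C" using UC by blast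
 define CA where "CA = B powr q * ((LINT x|M. GA x) + 2 * KA * C)"
 have le: "norm (a x (U (t j) x) \<bullet> v j x) powr q <= B powr q * norm (a x (U (t j) x)) powr q" for j x
 proof -
  have "norm (a x (U (t j) x) \<bullet> v j x) <= norm (a x (U (t j) x)) * norm (v j x)" using Cauchy_Schwarz_ineq2 by simp
  also have "... <= B * norm (a x (U (t j) x))" by (subst mult.commute) (intro mult_right_mono v(3) norm_ge_zero)
  finally have "norm (a x (U (t j) x) \<bullet> v j x) powr q <= (B * norm (a x (U (t j) x))) powr q" using q1(4) by (intro powr_mono2) auto
  then show ?thesis by (simp only: powr_mult)
 qed
 have LS: "LP q M (%x. a x (U (t j) x) \<bullet> v j x)" for j
  by (rule LP_boundI[where g="%x. B powr q * norm (a x (U (t j) x)) powr q"])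
    (use le LP_int[OF LA] borel_measurable_integrable[OF ia] in auto)
 have SC: "(LINT x|M. norm (a x (U (t j) x) \<bullet> v j x) powr q) <= CA" for j
 proof -
  have "(LINT x|M. norm (a x (U (t j) x) \<bullet> v j x) powr q) <= (LINT x|M. B powr q * norm (a x (U (t j) x)) powr q)"
   by (intro integral_mono le LP_int[OF LS] integrable_mult_right LP_int[OF LA])
  also have "... = B powr q * (LINT x|M. norm (a x (U (t j) x)) powr q)" by simp
  also have "... <= CA" unfolding CA_def
  proof (rule mult_left_mono)
   have "2 * KA * (LINT x|M. norm (U (t j) x) powr p) <= 2 * KA * C" using C(2) KA0 by (intro mult_left_mono) auto
   then show "(LINT x|M. norm (a x (U (t j) x)) powr q) <= (LINT x|M. GA x) + 2 * KA * C"
    using A_LP(2)[OF LU[of "t j"]] by linarith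
  qed simp
  finally show ?thesis .
 qed
 have conv: "AE x in M. (%j. a x (U (t j) x) \<bullet> v j x) ----> a x (Y x) \<bullet> v' x"
  using t_u[OF t(1)] t(2) v(5)
 proof eventually_elim
  case (elim x)
  show ?case
  proof (cases "x \<in> K")
   case True
   then have "(%j. (fst (U (t j) x), snd (U (t j) x))) ----> (fst (Y x), snd (Y x))" using elim by (intro tendsto_Pair) auto
   then have "(%j. a x (U (t j) x)) ----> a x (Y x)" by (intro continuous_on_tendsto_compose[OF A_cont]) auto
   then show ?thesis using elim(3) by (rule tendsto_inner)
  next
   case False
   then have "v j x = 0" for j by (rule v(4))
   then have "(%j::nat. 0) ----> v' x" using elim(3) by simp
   then have "v' x = 0" by (simp add: LIMSEQ_const_iff)
   then show ?thesis using \<open>!!j. v j x = 0\<close> by simp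
  qed
 qed
 have mS: "(%x. a x (Y x) \<bullet> v' x) \<in> BM M" using Ameas[OF LP_meas[OF W_LP[OF Y]]] v(2) by auto
 note V = LP_fatou_vitali[OF LS SC mS conv q1(2)]
 show iY: "integrable M (%x. a x (Y x) \<bullet> v' x)" by (rule LP_integrable[OF V(1) q1(5)])
 have "(%j. (LINT x|M. a x (U (t j) x) \<bullet> v j x) - (LINT x|M. a x (Y x) \<bullet> v' x)) ----> 0"
 proof (rule Lim_null_comparison[OF _ V(3)], intro always_eventually allI)
  fix j
  have "(LINT x|M. a x (U (t j) x) \<bullet> v j x) - (LINT x|M. a x (Y x) \<bullet> v' x) = (LINT x|M. a x (U (t j) x) \<bullet> v j x - a x (Y x) \<bullet> v' x)"
   using ia iY by simp
  then show "norm ((LINT x|M. a x (U (t j) x) \<bullet> v j x) - (LINT x|M. a x (Y x) \<bullet> v' x)) <= (LINT x|M. norm (a x (U (t j) x) \<bullet> v j x - a x (Y x) \<bullet> v' x))"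
   by (simp only: integral_norm_bound)
 qed
 then show "(%j. LINT x|M. a x (U (t j) x) \<bullet> v j x) ----> (LINT x|M. a x (Y x) \<bullet> v' x)" by (simp add: LIM_zero_iff)
 obtain D where D: "D >= 0" "\<forall>n U. sol n U --> (LINT x|M. norm (snd (U x)) powr p) <= D \<and> (LINT x|M. G n (U x)) <= D \<and>
   (LINT x|M. norm (U x) powr p) <= D \<and> (LINT x|M. norm (a x (U x))) <= D \<and>
   (LINT x|M. norm (E n (snd (U x)))) <= D * (1 / (1 + \<kappa> n))" using sol_bounds by blast
 show "(%j. LINT x|M. E (N (t j)) (snd (U (t j) x)) \<bullet> v j x) ----> 0"
 proof (rule Lim_null_comparison)
  show "\<forall>\<^sub>F j in sequentially. norm (LINT x|M. E (N (t j)) (snd (U (t j) x)) \<bullet> v j x) <= B * (D * (1 / (1 + \<kappa> (N (t j)))))"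
  proof (intro always_eventually allI)
   fix j
   have "norm (LINT x|M. E (N (t j)) (snd (U (t j) x)) \<bullet> v j x) <= (LINT x|M. norm (E (N (t j)) (snd (U (t j) x)) \<bullet> v j x))"
    by (rule integral_norm_bound)
   also have "... <= (LINT x|M. B * norm (E (N (t j)) (snd (U (t j) x))))"
   proof (rule integral_mono)
    show "integrable M (%x. norm (E (N (t j)) (snd (U (t j) x)) \<bullet> v j x))" using ie by auto
    show "integrable M (%x. B * norm (E (N (t j)) (snd (U (t j) x))))" using LP_integrable[OF LE q1(5)] by auto
    fix x
    have "norm (E (N (t j)) (snd (U (t j) x)) \<bullet> v j x) <= norm (E (N (t j)) (snd (U (t j) x))) * norm (v j x)"
     using Cauchy_Schwarz_ineq2 by simp
    also have "... <= B * norm (E (N (t j)) (snd (U (t j) x)))" by (subst mult.commute) (intro mult_right_mono v(3) norm_ge_zero)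
    finally show "norm (E (N (t j)) (snd (U (t j) x)) \<bullet> v j x) <= B * norm (E (N (t j)) (snd (U (t j) x)))" .
   qed
   also have "... = B * (LINT x|M. norm (E (N (t j)) (snd (U (t j) x))))" by simp
   also have "... <= B * (D * (1 / (1 + \<kappa> (N (t j)))))"
   proof (rule mult_left_mono[OF _ B0])
    show "(LINT x|M. norm (E (N (t j)) (snd (U (t j) x)))) <= D * (1 / (1 + \<kappa> (N (t j))))" using D(2) U by blast
   qed
   finally show "norm (LINT x|M. E (N (t j)) (snd (U (t j) x)) \<bullet> v j x) <= B * (D * (1 / (1 + \<kappa> (N (t j)))))" .
  qed
  have "filterlim (%j. 1 + \<kappa> (N (t j))) at_top sequentially"
   by (rule filterlim_tendsto_add_at_top[OF tendsto_const \<kappa>_lim[OF t_Nlim[OF t(1)]]])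
  then have "(%j. 1 / (1 + \<kappa> (N (t j)))) ----> 0"
   by (intro tendsto_divide_0[OF tendsto_const] filterlim_at_top_imp_at_infinity)
  then show "(%j. B * (D * (1 / (1 + \<kappa> (N (t j)))))) ----> 0" by (intro tendsto_mult_right_zero)
 qed
qed

end

section \<open>The tested equation and the exponential weight\<close>

context singular
begin

text \<open>The test function is \<phi> T(u), with its gradient split so that each integral exists
  by itself. The limit passages treat the pieces differently: some converge, some are dropped for
  their sign, some go through Fatou's lemma.\<close>

lemma test_identity:
 assumes X: "sol n X" and \<phi>: "C1c \<Omega> \<phi>"
  and T: "!!s. (T has_field_derivative T' s) (at s)" "continuous_on UNIV T'" "!!s. \<bar>T' s\<bar> <= B" "!!s. \<bar>T s\<bar> <= B"
 shows "integrable M (%x. a x (X x) \<bullet> (T (fst (X x)) *\<^sub>R grad \<phi> x))" "integrable M (%x. E n (snd (X x)) \<bullet> (T (fst (X x)) *\<^sub>R grad \<phi> x))"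
  "integrable M (%x. \<phi> x * T' (fst (X x)) * (a x (X x) \<bullet> snd (X x)))" "integrable M (%x. \<phi> x * T' (fst (X x)) * (E n (snd (X x)) \<bullet> snd (X x)))"
  "integrable M (%x. G n (X x) * (\<phi> x * T (fst (X x))))" "integrable M (%x. H n x (fst (X x)) * (\<phi> x * T (fst (X x))))"
  "(LINT x|M. a x (X x) \<bullet> (T (fst (X x)) *\<^sub>R grad \<phi> x)) + (LINT x|M. E n (snd (X x)) \<bullet> (T (fst (X x)) *\<^sub>R grad \<phi> x))
   + (LINT x|M. \<phi> x * T' (fst (X x)) * (a x (X x) \<bullet> snd (X x))) + (LINT x|M. \<phi> x * T' (fst (X x)) * (E n (snd (X x)) \<bullet> snd (X x)))
   + (LINT x|M. G n (X x) * (\<phi> x * T (fst (X x)))) = (LINT x|M. H n x (fst (X x)) * (\<phi> x * T (fst (X x))))"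
proof -
 have XW: "X \<in> W" by (rule sol_W[OF X])
 note L = W_LP[OF XW]
 have z: "grad (%x::'a. 0::real) x = 0" for x by (rule C1_const(2))
 have V: "(%x. (\<phi> x * T (fst (X x)), T (fst (X x)) *\<^sub>R grad \<phi> x + (\<phi> x * T' (fst (X x))) *\<^sub>R snd (X x))) \<in> W" (is "?V \<in> W")
  using W_test[OF XW \<phi> C1c_zero T] by (simp add: z)
 note iV = sol_ints[OF XW V]
 have cT: "continuous_on UNIV T" by (rule DERIV_continuous_on) (use T(1) in \<open>auto intro: has_field_derivative_at_within\<close>)
 obtain C where C: "C > 0" "\<forall>x. norm (jet \<phi> x) <= C \<and> \<bar>\<phi> x\<bar> <= C \<and> norm (grad \<phi> x) <= C" using C1c_bounded[OF \<phi>] by blast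
 have B0: "B >= 0" using T(3) abs_ge_zero order_trans by blast
 have LT: "LP p M (%x. T (fst (X x)) *\<^sub>R grad \<phi> x)"
 proof (rule LP_bounded[OF _ _ p0(2)])
  show "(%x. T (fst (X x)) *\<^sub>R grad \<phi> x) \<in> BM M"
   by (intro borel_measurable_scaleR borel_measurable_continuous_on[OF cT borel_measurable_fst_snd(1)[OF LP_meas[OF L]]]
     LP_meas[OF C1c_LP(3)[OF \<phi> p0(2)]])
  show "norm (T (fst (X x)) *\<^sub>R grad \<phi> x) <= B * C" for x using T(4) C B0 by (auto intro!: mult_mono)
 qed
 show i1: "integrable M (%x. a x (X x) \<bullet> (T (fst (X x)) *\<^sub>R grad \<phi> x))" by (rule inner_int[OF A_LP(1)[OF L] LT])
 show i2: "integrable M (%x. E n (snd (X x)) \<bullet> (T (fst (X x)) *\<^sub>R grad \<phi> x))" by (rule inner_int[OF E_LP[OF L] LT])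
 show i5: "integrable M (%x. G n (X x) * (\<phi> x * T (fst (X x))))" "integrable M (%x. H n x (fst (X x)) * (\<phi> x * T (fst (X x))))"
  using iV(3,4)[of n] by simp_all
 have e3: "(%x. \<phi> x * T' (fst (X x)) * (a x (X x) \<bullet> snd (X x))) = (%x. a x (X x) \<bullet> snd (?V x) - a x (X x) \<bullet> (T (fst (X x)) *\<^sub>R grad \<phi> x))"
  and e4: "(%x. \<phi> x * T' (fst (X x)) * (E n (snd (X x)) \<bullet> snd (X x))) = (%x. E n (snd (X x)) \<bullet> snd (?V x) - E n (snd (X x)) \<bullet> (T (fst (X x)) *\<^sub>R grad \<phi> x))"
  by (auto simp: inner_add_right)
 show i3: "integrable M (%x. \<phi> x * T' (fst (X x)) * (a x (X x) \<bullet> snd (X x)))" unfolding e3 by (rule Bochner_Integration.integrable_diff[OF iV(1) i1])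
 show i4: "integrable M (%x. \<phi> x * T' (fst (X x)) * (E n (snd (X x)) \<bullet> snd (X x)))" unfolding e4 by (rule Bochner_Integration.integrable_diff[OF iV(2) i2])
 show "(LINT x|M. a x (X x) \<bullet> (T (fst (X x)) *\<^sub>R grad \<phi> x)) + (LINT x|M. E n (snd (X x)) \<bullet> (T (fst (X x)) *\<^sub>R grad \<phi> x))
   + (LINT x|M. \<phi> x * T' (fst (X x)) * (a x (X x) \<bullet> snd (X x))) + (LINT x|M. \<phi> x * T' (fst (X x)) * (E n (snd (X x)) \<bullet> snd (X x)))
   + (LINT x|M. G n (X x) * (\<phi> x * T (fst (X x)))) = (LINT x|M. H n x (fst (X x)) * (\<phi> x * T (fst (X x))))"
  using sol_eq[OF X V] unfolding e3 e4 Bochner_Integration.integral_diff[OF iV(1) i1] Bochner_Integration.integral_diff[OF iV(2) i2] by simp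
qed

text \<open>For T = exp(-\<Lambda>) times a nonincreasing cutoff the differential inequality for T
  follows from \<alpha> \<Lambda>' = g. Coercivity then lets the flux term outweigh the gradient
  term.\<close>

lemma bracket_nonpos:
 fixes T T' A r Gz s :: real
 assumes "T >= 0" "T' <= 0" "\<alpha> * T' + g s * T <= 0" "\<alpha> * r <= A" "Gz <= g s * r" "r >= 0"
 shows "T' * A + Gz * T <= 0"
proof -
 have "T' * A <= T' * (\<alpha> * r)" using assms by (intro mult_left_mono_neg)
 moreover have "Gz * T <= g s * r * T" using assms by (intro mult_right_mono)
 moreover have "T' * (\<alpha> * r) + g s * r * T = r * (\<alpha> * T' + g s * T)" by (simp add: algebra_simps)
 moreover have "... <= 0" using assms by (intro mult_nonneg_nonpos)
 ultimately show ?thesis by linarith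
qed

lemma G_le:
 assumes "0 <= fst z" "fst z <= \<kappa> n" shows "G n z <= g (fst z) * norm (snd z) powr p"
proof -
 have "G n z <= 1 * g (fst z) * norm (snd z) powr p"
  unfolding G_def using assms g_nn[OF assms(1)] by (intro mult_mono mult_nonneg_nonneg) auto
 then show ?thesis by simp
qed

text \<open>g may be unbounded, whereas \<Lambda> must be bounded for exp(-\<Lambda>) and
  exp(\<Lambda>) to enter test functions. So g/\<alpha> is kept on [0, k + 1] and cut off to a
  compact support.\<close>

lemma cutoff_weight:
 assumes k: "k >= 0"
 shows "\<exists>\<Lambda> \<eta> B. (\<forall>s. (\<Lambda> has_field_derivative \<eta> s) (at s)) \<and> continuous_on UNIV \<eta> \<and> (\<forall>s. 0 <= \<eta> s) \<and>
  (\<forall>s. 0 <= s \<and> s <= k + 1 --> \<eta> s = g s / \<alpha>) \<and> (\<forall>s. \<bar>\<Lambda> s\<bar> <= B \<and> \<eta> s <= B)"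
proof -
 \<comment> \<open>The clamp extends g continuously to all reals; the two cutoffs make \<eta> vanish
   outside [-1, k + 2].\<close>
 define \<eta> where "\<eta> s = g (min (max 0 s) (k + 1)) / \<alpha> * (cut (- s) * cut (s - (k + 1)))" for s
 have cc: "continuous_on UNIV \<eta>" unfolding \<eta>_def using k \<alpha>0
  by (intro continuous_on_mult continuous_on_divide g_cut_cont continuous_on_compose2[OF cut_props(1)] continuous_intros) auto
 have "\<exists>F. \<forall>x::real. -\<infinity> < ereal x --> ereal x < \<infinity> --> (F has_vector_derivative \<eta> x) (at x)"
  by (rule einterval_antiderivative) (use cc in \<open>auto simp: continuous_on_eq_continuous_at\<close>)
 then obtain \<Lambda> where "\<forall>x. (\<Lambda> has_vector_derivative \<eta> x) (at x)" by auto
 then have D: "(\<Lambda> has_field_derivative \<eta> s) (at s)" for s by (simp add: has_real_derivative_iff_has_vector_derivative)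
 have \<eta>0: "\<eta> s >= 0" for s unfolding \<eta>_def using k \<alpha>0 cut_props(3) by (intro mult_nonneg_nonneg divide_nonneg_pos g_nn) auto
 have up: "\<Lambda> x <= \<Lambda> y" if "x <= y" for x y by (rule DERIV_nonneg_imp_nondecreasing[OF that]) (use D \<eta>0 in blast)
 have \<eta>z: "\<eta> s = 0" if "s <= -1 \<or> s >= k + 2" for s using that cut_props(8)[of "- s"] cut_props(8)[of "s - (k + 1)"] by (auto simp: \<eta>_def)
 have r: "\<Lambda> s <= \<Lambda> (k + 2)" for s
 proof (cases "s <= k + 2")
  case False
  then have "k + 2 <= s" by simp
  then show ?thesis
  proof (rule DERIV_nonpos_imp_nonincreasing)
   fix x assume "k + 2 <= x"
   then show "\<exists>y. (\<Lambda> has_field_derivative y) (at x) \<and> y <= 0" using D[of x] \<eta>z[of x] by auto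
  qed
 qed (rule up)
 have l: "\<Lambda> (-1) <= \<Lambda> s" for s
 proof (cases "s <= -1")
  case True
  then show ?thesis
  proof (rule DERIV_nonpos_imp_nonincreasing)
   fix x assume "x <= (-1::real)"
   then show "\<exists>y. (\<Lambda> has_field_derivative y) (at x) \<and> y <= 0" using D[of x] \<eta>z[of x] by auto
  qed
 qed (use up[of "-1" s] in simp)
 obtain B where B: "B >= 0" "\<forall>s. 0 <= s \<and> s <= k + 1 --> g s <= B" using g_bound[of "k + 1"] k by auto
 have \<eta>B: "\<eta> s <= B / \<alpha>" for s
 proof -
  have "cut (- s) * cut (s - (k + 1)) <= 1 * 1" using cut_props(3,4) by (intro mult_mono) auto
  moreover have "g (min (max 0 s) (k + 1)) / \<alpha> <= B / \<alpha>" using B(2) k \<alpha>0 by (intro divide_right_mono) auto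
  ultimately have "\<eta> s <= B / \<alpha> * (1 * 1)" unfolding \<eta>_def using B(1) \<alpha>0 cut_props(3,4) by (intro mult_mono mult_nonneg_nonneg divide_nonneg_pos) auto
  then show ?thesis by simp
 qed
 define C where "C = \<bar>\<Lambda> (-1)\<bar> + \<bar>\<Lambda> (k + 2)\<bar> + B / \<alpha>"
 have "B / \<alpha> >= 0" using B(1) \<alpha>0 by simp
 then have "\<bar>\<Lambda> s\<bar> <= C \<and> \<eta> s <= C" for s using r[of s] l[of s] \<eta>B[of s] unfolding C_def by linarith
 moreover have "\<eta> s = g s / \<alpha>" if "0 <= s" "s <= k + 1" for s
  using that cut_props(6)[of "- s"] cut_props(6)[of "s - (k + 1)"] by (simp add: \<eta>_def)
 ultimately show ?thesis using D cc \<eta>0 by blast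
qed

end

section \<open>The upper inequality\<close>

context singular_limit
begin

lemma AE_coer: "AE x in M. \<alpha> * norm (snd (Y x)) powr p <= a x (Y x) \<bullet> snd (Y x)"
 using A_coer by eventually_elim blast

lemma U_range: "AE x in M. 0 <= fst (U j x) \<and> fst (U j x) <= \<kappa> (N j)" by (rule sol_range[OF U])

lemma aY_LP: "LP q M (%x. a x (Y x))" by (rule A_LP(1)[OF W_LP[OF Y]])

lemma bounded_flux_int:
 fixes v :: "'a => 'a"
 assumes v: "v \<in> BM M" "!!x. norm (v x) <= B"
 shows "integrable M (%x. a x (Y x) \<bullet> v x)"
 by (rule inner_int[OF aY_LP LP_bounded[OF v p0(2)]])

lemma T_meas: "continuous_on UNIV T ==> (%x. T (fst (Y x))) \<in> BM M" for T :: "real => real"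
 by (rule borel_measurable_continuous_on[OF _ Ymeas(1)])

text \<open>The weight \<open>Z d\<close> is nondecreasing, so the terms with its derivative are
  nonnegative and are dropped. Letting d tend to 0 loses nothing, because the flux and gY vanish
  where the limit function is 0.\<close>

lemma upper:
 assumes \<phi>: "C1c \<Omega> \<phi>" and \<phi>0: "!!x. \<phi> x >= 0"
 shows "(LINT x|M. a x (Y x) \<bullet> grad \<phi> x) + (LINT x|M. gY x * \<phi> x) <= (LINT x|M. hr x * \<phi> x)"
proof -
 let ?K = "closure {x. \<phi> x \<noteq> 0}"
 obtain t where t: "strict_mono t" "AE x in M. x \<in> ?K --> (%j. snd (U (t j) x)) ----> snd (Y x)"
  using gradient_subsequence[OF supp(1,2)[OF \<phi>]] by blast
 obtain L where L: "L > 0" "\<forall>x. norm (jet \<phi> x) <= L \<and> \<bar>\<phi> x\<bar> <= L \<and> norm (grad \<phi> x) <= L" using C1c_bounded[OF \<phi>] by blast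
 have [measurable]: "\<phi> \<in> BM M" "grad \<phi> \<in> BM M" using C1c_LP(2,3)[OF \<phi> p0(2)] by (auto simp: LP_def)
 note hi = hr_int[OF \<phi> \<phi>0]
 have gi: "integrable M (%x. gY x * \<phi> x)"
  by (rule lint_bound[OF integrable_mult_right[OF gY_int, of L]])
    (use L gY_nonneg \<phi>0 in \<open>auto simp: abs_mult mult.commute intro!: mult_right_mono\<close>)
 \<comment> \<open>Rises from 0 at s = d to 1 at s = 2 d.\<close>
 define Z where "Z d s = 1 - cut (s / d - 1)" for d s :: real
 have Zc: "continuous_on UNIV (Z d)" if "d > 0" for d
  unfolding Z_def by (intro continuous_on_diff continuous_on_const continuous_on_compose2[OF cut_props(1)]) (use that in \<open>auto intro!: continuous_intros\<close>)
 have Z01: "0 <= Z d s" "Z d s <= 1" for d s unfolding Z_def using cut_props(3,4) by auto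
 have *: "integrable M (%x. gY x * (\<phi> x * Z d (fst (Y x)))) \<and> (LINT x|M. gY x * (\<phi> x * Z d (fst (Y x)))) \<le>
   (LINT x|M. hr x * \<phi> x) - (LINT x|M. a x (Y x) \<bullet> (Z d (fst (Y x)) *\<^sub>R grad \<phi> x))" if d: "d > 0" for d
 proof -
  let ?Z' = "%s. - (cut' (s / d - 1) * (1 / d))"
  have Z': "(Z d has_field_derivative ?Z' s) (at s)" "continuous_on UNIV ?Z'" "\<bar>?Z' s\<bar> <= 1 + 4 / d" "\<bar>Z d s\<bar> <= 1 + 4 / d" "?Z' s >= 0" for s
  proof -
   have "((%s. s / d - 1) has_field_derivative (1 / d - 0)) (at s)"
    by (intro DERIV_diff DERIV_const DERIV_cdivide DERIV_ident)
   from DERIV_diff[OF DERIV_const[of 1] DERIV_chain2[where f=cut and g="%s. s / d - 1" and x=s, OF cut_deriv this]]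
   show "(Z d has_field_derivative ?Z' s) (at s)" unfolding Z_def[abs_def] by simp
   show "continuous_on UNIV ?Z'"
    by (intro continuous_on_minus continuous_on_mult continuous_on_const continuous_on_compose2[OF cut_props(2)]) (use d in \<open>auto intro!: continuous_intros\<close>)
   have "\<bar>?Z' s\<bar> <= 4 / d" using cut_props(10)[of "s / d - 1"] d by (simp add: abs_mult divide_right_mono)
   then show "\<bar>?Z' s\<bar> <= 1 + 4 / d" by simp
   have "4 / d >= 0" using d by simp
   then show "\<bar>Z d s\<bar> <= 1 + 4 / d" using Z01[of d s] by linarith
   show "?Z' s >= 0" using cut_props(5)[of "s / d - 1"] d by (simp add: mult_nonpos_nonneg divide_nonpos_pos)
  qed
  have Zz: "Z d s = 0" if "s <= d" for s using that d cut_props(6)[of "s / d - 1"] by (simp add: Z_def)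
  \<comment> \<open>Where \<open>Z d\<close> is nonzero the source is at most |B| f, which gives an
    integrable majorant.\<close>
  obtain B where B: "\<forall>s\<ge>d. h s <= ennreal B" using h_bd[OF d] by blast
  have hB: "hn n s <= \<bar>B\<bar>" if "s >= d" for n s
  proof -
   have "ennreal (hn n s) <= ennreal \<bar>B\<bar>"
    using B that d unfolding ennreal_hn by (intro min.coboundedI1) (auto simp: max_def intro: order_trans[OF _ ennreal_leI])
   then show ?thesis by (simp add: ennreal_le_iff)
  qed
  have m: "(%x. Z d (fst (Y x))) \<in> BM M" "(%x. Z d (fst (U j x))) \<in> BM M" for j
   using T_meas[OF Zc[OF d]] borel_measurable_continuous_on[OF Zc[OF d] borel_measurable_fst_snd(1)[OF LP_meas[OF W_LP[OF UW]]]] by auto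
  note TI = test_identity[OF U \<phi> Z'(1-4)]
  have Zlim: "AE x in M. (%j. Z d (fst (U (t j) x))) ----> Z d (fst (Y x))"
   using t_u[OF t(1)] by eventually_elim (intro continuous_on_tendsto_compose[OF Zc[OF d]], auto)
  note fl = flux_limit[OF t, of "%j x. Z d (fst (U (t j) x)) *\<^sub>R grad \<phi> x" "%x. Z d (fst (Y x)) *\<^sub>R grad \<phi> x" L]
  have lim: "(%j. LINT x|M. a x (U (t j) x) \<bullet> (Z d (fst (U (t j) x)) *\<^sub>R grad \<phi> x)) ----> (LINT x|M. a x (Y x) \<bullet> (Z d (fst (Y x)) *\<^sub>R grad \<phi> x))"
   "(%j. LINT x|M. E (N (t j)) (snd (U (t j) x)) \<bullet> (Z d (fst (U (t j) x)) *\<^sub>R grad \<phi> x)) ----> 0"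
  proof (goal_cases)
   have nb: "norm (Z d s *\<^sub>R grad \<phi> x) <= L" for s x
   proof -
    have "norm (Z d s *\<^sub>R grad \<phi> x) <= 1 * L" unfolding norm_scaleR using Z01[of d s] L by (intro mult_mono) auto
    then show ?thesis by simp
   qed
   have o: "x \<notin> ?K ==> Z d s *\<^sub>R grad \<phi> x = 0" for s x using supp(4)[OF \<phi>, of x] by simp
   have c: "AE x in M. (%j. Z d (fst (U (t j) x)) *\<^sub>R grad \<phi> x) ----> Z d (fst (Y x)) *\<^sub>R grad \<phi> x"
    using Zlim by eventually_elim (intro tendsto_intros)
   { case 1 show ?case by (rule fl(1)) (use m nb o c in auto) next case 2 show ?case by (rule fl(2)) (use m nb o c in auto) }
  qed
  have rlim: "(%j. LINT x|M. H (N (t j)) x (fst (U (t j) x)) * (\<phi> x * Z d (fst (U (t j) x)))) ----> (LINT x|M. hr x * (\<phi> x * Z d (fst (Y x))))"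
  proof (rule integral_dominated_convergence[where w="%x. \<bar>B\<bar> * L * f x"])
   show "AE x in M. (%j. H (N (t j)) x (fst (U (t j) x)) * (\<phi> x * Z d (fst (U (t j) x)))) ----> hr x * (\<phi> x * Z d (fst (Y x)))"
    using H_conv_real Zlim
   proof eventually_elim
    case (elim x)
    show ?case by (intro tendsto_mult tendsto_const elim(2) filterlim_compose[OF elim(1) filterlim_subseq[OF t(1)]])
   qed
   show "AE x in M. norm (H (N (t j)) x (fst (U (t j) x)) * (\<phi> x * Z d (fst (U (t j) x)))) <= \<bar>B\<bar> * L * f x" for j
   proof (rule AE_I2)
    fix x
    show "norm (H (N (t j)) x (fst (U (t j) x)) * (\<phi> x * Z d (fst (U (t j) x)))) <= \<bar>B\<bar> * L * f x"
    proof (cases "fst (U (t j) x) <= d")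
     case True
     show ?thesis using Zz[OF True] L(1) f_nn[of x] by simp
    next
     case False
     have "H (N (t j)) x (fst (U (t j) x)) <= \<bar>B\<bar> * f x"
      using H_le[of "N (t j)" x "fst (U (t j) x)"] mult_right_mono[OF hB[of "fst (U (t j) x)" "N (t j)"] f_nn[of x]] False by linarith
     moreover have "\<phi> x * Z d (fst (U (t j) x)) <= L * 1" using L \<phi>0 Z01 by (intro mult_mono) (auto simp: abs_le_iff)
     ultimately have "H (N (t j)) x (fst (U (t j) x)) * (\<phi> x * Z d (fst (U (t j) x))) <= (\<bar>B\<bar> * f x) * (L * 1)"
      by (rule mult_mono) (use H_nonneg \<phi>0 Z01 f_nn in auto)
     then show ?thesis using H_nonneg \<phi>0 Z01 by (simp add: abs_mult ac_simps)
    qed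
   qed
  qed (use TI(6) f_int m in auto)
  let ?c = "%j. (LINT x|M. H (N (t j)) x (fst (U (t j) x)) * (\<phi> x * Z d (fst (U (t j) x))))
    - (LINT x|M. a x (U (t j) x) \<bullet> (Z d (fst (U (t j) x)) *\<^sub>R grad \<phi> x)) - (LINT x|M. E (N (t j)) (snd (U (t j) x)) \<bullet> (Z d (fst (U (t j) x)) *\<^sub>R grad \<phi> x))"
  have le: "(LINT x|M. G (N (t j)) (U (t j) x) * (\<phi> x * Z d (fst (U (t j) x)))) <= ?c j" for j
  proof -
   have "(LINT x|M. \<phi> x * ?Z' (fst (U (t j) x)) * (E (N (t j)) (snd (U (t j) x)) \<bullet> snd (U (t j) x))) >= 0"
    by (intro lint_nonneg mult_nonneg_nonneg \<phi>0 Z'(5) E_inner_nonneg)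
   moreover have "(LINT x|M. \<phi> x * ?Z' (fst (U (t j) x)) * (a x (U (t j) x) \<bullet> snd (U (t j) x))) >= 0"
   proof (rule integral_nonneg_AE)
    show "AE x in M. \<phi> x * ?Z' (fst (U (t j) x)) * (a x (U (t j) x) \<bullet> snd (U (t j) x)) >= 0"
     using A_coer
    proof eventually_elim
     case (elim x)
     have "0 <= \<alpha> * norm (snd (U (t j) x)) powr p" using \<alpha>0 by simp
     also have "... <= a x (U (t j) x) \<bullet> snd (U (t j) x)" using elim by blast
     finally show ?case by (intro mult_nonneg_nonneg \<phi>0 Z'(5))
    qed
   qed
   ultimately show ?thesis using TI(7)[of "t j"] by linarith
  qed
  have cl: "?c ----> (LINT x|M. hr x * (\<phi> x * Z d (fst (Y x)))) - (LINT x|M. a x (Y x) \<bullet> (Z d (fst (Y x)) *\<^sub>R grad \<phi> x)) - 0"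
   by (intro tendsto_diff rlim lim)
  have Gc: "AE x in M. (%j. G (N (t j)) (U (t j) x) * (\<phi> x * Z d (fst (U (t j) x)))) ----> gY x * (\<phi> x * Z d (fst (Y x)))"
   using G_conv_AE[OF t] Zlim
  proof eventually_elim
   case (elim x)
   show ?case
   proof (cases "x \<in> ?K")
    case True then show ?thesis using elim by (intro tendsto_intros) auto
   next
    case False
    then have "\<phi> x = 0" by (rule supp(3)[OF \<phi>])
    then show ?thesis by simp
   qed
  qed
  have nn: "AE x in M. G (N (t j)) (U (t j) x) * (\<phi> x * Z d (fst (U (t j) x))) >= 0" for j
   by (intro AE_I2 mult_nonneg_nonneg G_nonneg \<phi>0 Z01)
  have mF: "(%x. gY x * (\<phi> x * Z d (fst (Y x)))) \<in> BM M" using m by measurable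
  note F = fatou_lim[OF TI(5) nn le cl mF Gc]
  have "(LINT x|M. hr x * (\<phi> x * Z d (fst (Y x)))) <= (LINT x|M. hr x * \<phi> x)"
  proof (rule integral_mono')
   fix x
   have "hr x * \<phi> x * Z d (fst (Y x)) <= hr x * \<phi> x * 1" using Z01 hr_nonneg \<phi>0 by (intro mult_left_mono mult_nonneg_nonneg) auto
   then show "hr x * (\<phi> x * Z d (fst (Y x))) <= hr x * \<phi> x" by (simp add: ac_simps)
  qed (use hi hr_nonneg \<phi>0 in \<open>auto\<close>)
  then show ?thesis using F by auto
 qed
 let ?e = "%n. 1 / real (Suc n)"
 have e0: "?e n > 0" for n by simp
 have Z1: "AE x in M. fst (Y x) > 0 --> (%n. Z (?e n) (fst (Y x))) ----> 1"
 proof (rule AE_I2, rule impI)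
  fix x assume p: "fst (Y x) > 0"
  have "\<forall>\<^sub>F n in sequentially. 2 * ?e n < fst (Y x)"
   using p by (intro order_tendstoD(2)[OF tendsto_mult_right_zero[OF LIMSEQ_Suc[OF lim_1_over_n]]]) auto
  then show "(%n. Z (?e n) (fst (Y x))) ----> 1"
  proof (intro tendsto_eventually, eventually_elim)
   case (elim n)
   then have "fst (Y x) / ?e n - 1 >= 1" by (simp add: field_simps)
   then show ?case unfolding Z_def using cut_props(8) by simp
  qed
 qed
 have mZ: "(%x. Z (?e n) (fst (Y x))) \<in> BM M" for n by (rule T_meas[OF Zc[OF e0]])
 have ai: "integrable M (%x. norm (a x (Y x)))" using LP_integrable[OF aY_LP q1(5)] by auto
 have am: "(%x. a x (Y x)) \<in> BM M" by (rule LP_meas[OF aY_LP])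
 have al: "(%n. LINT x|M. a x (Y x) \<bullet> (Z (?e n) (fst (Y x)) *\<^sub>R grad \<phi> x)) ----> (LINT x|M. a x (Y x) \<bullet> grad \<phi> x)"
 proof (rule integral_dominated_convergence[where w="%x. norm (a x (Y x)) * L"])
  show "AE x in M. (%n. a x (Y x) \<bullet> (Z (?e n) (fst (Y x)) *\<^sub>R grad \<phi> x)) ----> a x (Y x) \<bullet> grad \<phi> x"
   using Z1 Y_zero Y_nonneg
  proof eventually_elim
   case (elim x)
   show ?case
   proof (cases "fst (Y x) = 0")
    case False
    then have "(%n. a x (Y x) \<bullet> (Z (?e n) (fst (Y x)) *\<^sub>R grad \<phi> x)) ----> a x (Y x) \<bullet> (1 *\<^sub>R grad \<phi> x)" using elim by (intro tendsto_intros) auto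
    then show ?thesis by simp
   qed (use elim in simp)
  qed
  show "AE x in M. norm (a x (Y x) \<bullet> (Z (?e n) (fst (Y x)) *\<^sub>R grad \<phi> x)) <= norm (a x (Y x)) * L" for n
  proof (rule AE_I2)
   fix x
   have "norm (Z (?e n) (fst (Y x)) *\<^sub>R grad \<phi> x) <= 1 * L" unfolding norm_scaleR using Z01[of "?e n" "fst (Y x)"] L by (intro mult_mono) auto
   then show "norm (a x (Y x) \<bullet> (Z (?e n) (fst (Y x)) *\<^sub>R grad \<phi> x)) <= norm (a x (Y x)) * L"
    using Cauchy_Schwarz_ineq2[of "a x (Y x)" "Z (?e n) (fst (Y x)) *\<^sub>R grad \<phi> x"]
     mult_left_mono[of "norm (Z (?e n) (fst (Y x)) *\<^sub>R grad \<phi> x)" L "norm (a x (Y x))"] by simp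
  qed
  show "(%x. a x (Y x) \<bullet> grad \<phi> x) \<in> BM M" using am by measurable
  show "(%x. a x (Y x) \<bullet> (Z (?e n) (fst (Y x)) *\<^sub>R grad \<phi> x)) \<in> BM M" for n using am mZ by measurable
 qed (use ai in simp)
 have gl: "AE x in M. (%n. gY x * (\<phi> x * Z (?e n) (fst (Y x)))) ----> gY x * \<phi> x"
  using Z1 Y_zero Y_nonneg
 proof eventually_elim
  case (elim x)
  show ?case
  proof (cases "fst (Y x) = 0")
   case False
   then have "(%n. gY x * (\<phi> x * Z (?e n) (fst (Y x)))) ----> gY x * (\<phi> x * 1)" using elim by (intro tendsto_intros) auto
   then show ?thesis by simp
  next
   case True
   then have "gY x = 0" using elim p0 by (simp add: gY_def)
   then show ?thesis by simp
  qed
 qed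
 have nn: "AE x in M. gY x * (\<phi> x * Z (?e n) (fst (Y x))) >= 0" for n by (intro AE_I2 mult_nonneg_nonneg gY_nonneg \<phi>0 Z01)
 have "(LINT x|M. gY x * \<phi> x) <= (LINT x|M. hr x * \<phi> x) - (LINT x|M. a x (Y x) \<bullet> grad \<phi> x)"
  by (rule fatou_lim(2)[where f="%n x. gY x * (\<phi> x * Z (?e n) (fst (Y x)))", OF _ nn _ tendsto_diff[OF tendsto_const al] _ gl])
    (use *[OF e0] gi in auto)
 then show ?thesis by simp
qed

end

section \<open>The lower inequality and the weak equation\<close>

context singular_limit
begin

text \<open>Flux and gradient term are combined into a bracket of one sign. The source minus \<phi>
  times the bracket is then nonnegative, and Fatou's lemma applies to the combination, although the
  integrals of its parts need not converge.\<close>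

lemma weighted_inequality:
 assumes \<phi>: "C1c \<Omega> \<phi>" "!!x. \<phi> x >= 0"
  and T: "!!s. (T has_field_derivative T' s) (at s)" "continuous_on UNIV T'" "!!s. \<bar>T' s\<bar> <= B" "!!s. \<bar>T s\<bar> <= B"
  and T0: "!!s. T s >= 0" "!!s. s >= 0 ==> T' s <= 0" "!!s. s >= 0 ==> \<alpha> * T' s + g s * T s <= 0"
 defines "br \<equiv> %x. T' (fst (Y x)) * (a x (Y x) \<bullet> snd (Y x)) + gY x * T (fst (Y x))"
 shows "AE x in M. br x <= 0" "integrable M (%x. hr x * \<phi> x * T (fst (Y x)) - \<phi> x * br x)"
  "(LINT x|M. hr x * \<phi> x * T (fst (Y x)) - \<phi> x * br x) <= (LINT x|M. a x (Y x) \<bullet> (T (fst (Y x)) *\<^sub>R grad \<phi> x))"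
proof -
 let ?K = "closure {x. \<phi> x \<noteq> 0}"
 obtain t where t: "strict_mono t" "AE x in M. x \<in> ?K --> (%j. snd (U (t j) x)) ----> snd (Y x)"
  using gradient_subsequence[OF supp(1,2)[OF \<phi>(1)]] by blast
 obtain L where L: "L > 0" "\<forall>x. norm (jet \<phi> x) <= L \<and> \<bar>\<phi> x\<bar> <= L \<and> norm (grad \<phi> x) <= L" using C1c_bounded[OF \<phi>(1)] by blast
 have [measurable]: "\<phi> \<in> BM M" "grad \<phi> \<in> BM M" using C1c_LP(2,3)[OF \<phi>(1) p0(2)] by (auto simp: LP_def)
 have cT: "continuous_on UNIV T" by (rule DERIV_continuous_on) (use T(1) in \<open>auto intro: has_field_derivative_at_within\<close>)
 have [measurable]: "(%x. T (fst (Y x))) \<in> BM M" "(%x. T' (fst (Y x))) \<in> BM M" "(%x. a x (Y x)) \<in> BM M"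
  using T_meas[OF cT] T_meas[OF T(2)] LP_meas[OF aY_LP] by auto
 have mU: "(%x. T (fst (U j x))) \<in> BM M" for j
  using borel_measurable_continuous_on[OF cT borel_measurable_fst_snd(1)[OF LP_meas[OF W_LP[OF UW]]]] .
 have B0: "B >= 0" using T(3) abs_ge_zero order_trans by blast
 show "AE x in M. br x <= 0"
  using AE_coer Y_nonneg
 proof eventually_elim
  case (elim x)
  then show ?case unfolding br_def
   using bracket_nonpos[OF T0(1) T0(2)[OF elim(2)] T0(3)[OF elim(2)], of "norm (snd (Y x)) powr p" "a x (Y x) \<bullet> snd (Y x)" "gY x"] by (simp add: gY_def)
 qed
 note TI = test_identity[OF U \<phi>(1) T]
 define bj where "bj j x = T' (fst (U (t j) x)) * (a x (U (t j) x) \<bullet> snd (U (t j) x)) + G (N (t j)) (U (t j) x) * T (fst (U (t j) x))" for j x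
 have bj0: "AE x in M. bj j x <= 0" for j
  using A_coer U_range[of "t j"]
 proof eventually_elim
  case (elim x)
  then have e: "0 <= fst (U (t j) x)" "fst (U (t j) x) <= \<kappa> (N (t j))" "\<alpha> * norm (snd (U (t j) x)) powr p <= a x (U (t j) x) \<bullet> snd (U (t j) x)" by blast+
  show ?case unfolding bj_def by (rule bracket_nonpos[OF T0(1) T0(2)[OF e(1)] T0(3)[OF e(1)] e(3) G_le[OF e(1,2)]]) simp
 qed
 define Fj where "Fj j x = H (N (t j)) x (fst (U (t j) x)) * (\<phi> x * T (fst (U (t j) x))) -
   \<phi> x * T' (fst (U (t j) x)) * (a x (U (t j) x) \<bullet> snd (U (t j) x)) - G (N (t j)) (U (t j) x) * (\<phi> x * T (fst (U (t j) x)))" for j x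
 have Fe: "Fj j x = H (N (t j)) x (fst (U (t j) x)) * (\<phi> x * T (fst (U (t j) x))) - \<phi> x * bj j x" for j x
  unfolding Fj_def bj_def by (simp add: algebra_simps)
 have Fi: "integrable M (Fj j)" for j
  unfolding Fj_def by (intro Bochner_Integration.integrable_diff TI)
 have F0: "AE x in M. Fj j x >= 0" for j
  using bj0[of j]
 proof eventually_elim
  case (elim x)
  have "H (N (t j)) x (fst (U (t j) x)) * (\<phi> x * T (fst (U (t j) x))) >= 0" by (intro mult_nonneg_nonneg H_nonneg \<phi> T0)
  moreover have "\<phi> x * bj j x <= 0" using \<phi> elim by (intro mult_nonneg_nonpos)
  ultimately show ?case unfolding Fe by linarith
 qed
 let ?c = "%j. (LINT x|M. a x (U (t j) x) \<bullet> (T (fst (U (t j) x)) *\<^sub>R grad \<phi> x)) + (LINT x|M. E (N (t j)) (snd (U (t j) x)) \<bullet> (T (fst (U (t j) x)) *\<^sub>R grad \<phi> x))"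
 have le: "(LINT x|M. Fj j x) <= ?c j" for j
 proof -
  \<comment> \<open>T' is nonpositive on the range of the solutions, so this term has the sign that
    allows dropping it.\<close>
  have "(LINT x|M. \<phi> x * T' (fst (U (t j) x)) * (E (N (t j)) (snd (U (t j) x)) \<bullet> snd (U (t j) x))) <= (LINT x|M. 0)"
  proof (rule integral_mono_AE[OF TI(4)])
   show "AE x in M. \<phi> x * T' (fst (U (t j) x)) * (E (N (t j)) (snd (U (t j) x)) \<bullet> snd (U (t j) x)) <= 0"
    using U_range[of "t j"] by eventually_elim (intro mult_nonpos_nonneg mult_nonneg_nonpos \<phi> T0 E_inner_nonneg, auto)
  qed simp
  moreover have "(LINT x|M. Fj j x) = (LINT x|M. H (N (t j)) x (fst (U (t j) x)) * (\<phi> x * T (fst (U (t j) x)))) -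
   (LINT x|M. \<phi> x * T' (fst (U (t j) x)) * (a x (U (t j) x) \<bullet> snd (U (t j) x))) - (LINT x|M. G (N (t j)) (U (t j) x) * (\<phi> x * T (fst (U (t j) x))))"
   unfolding Fj_def using TI(3,5,6) by simp
  ultimately show ?thesis using TI(7)[of "t j"] by simp
 qed
 have Tlim: "AE x in M. (%j. T (fst (U (t j) x))) ----> T (fst (Y x)) \<and> (%j. T' (fst (U (t j) x))) ----> T' (fst (Y x))"
  using t_u[OF t(1)]
 proof eventually_elim
  case (elim x)
  show ?case using continuous_on_tendsto_compose[OF cT elim] continuous_on_tendsto_compose[OF T(2) elim] by auto
 qed
 have cl: "?c ----> (LINT x|M. a x (Y x) \<bullet> (T (fst (Y x)) *\<^sub>R grad \<phi> x)) + 0"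
 proof (rule tendsto_add)
  note fl = flux_limit[OF t, of "%j x. T (fst (U (t j) x)) *\<^sub>R grad \<phi> x" "%x. T (fst (Y x)) *\<^sub>R grad \<phi> x" "B * L"]
  have nb: "norm (T s *\<^sub>R grad \<phi> x) <= B * L" for s x
   unfolding norm_scaleR using T(4)[of s] L B0 by (intro mult_mono) auto
  have o: "x \<notin> ?K ==> T s *\<^sub>R grad \<phi> x = 0" for s x using supp(4)[OF \<phi>(1), of x] by simp
  have c: "AE x in M. (%j. T (fst (U (t j) x)) *\<^sub>R grad \<phi> x) ----> T (fst (Y x)) *\<^sub>R grad \<phi> x"
   using Tlim by eventually_elim (intro tendsto_intros, blast)
  show "(%j. LINT x|M. a x (U (t j) x) \<bullet> (T (fst (U (t j) x)) *\<^sub>R grad \<phi> x)) ----> (LINT x|M. a x (Y x) \<bullet> (T (fst (Y x)) *\<^sub>R grad \<phi> x))"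
   by (rule fl(1)) (use mU nb o c in auto)
  show "(%j. LINT x|M. E (N (t j)) (snd (U (t j) x)) \<bullet> (T (fst (U (t j) x)) *\<^sub>R grad \<phi> x)) ----> 0"
   by (rule fl(2)) (use mU nb o c in auto)
 qed
 have lim: "AE x in M. (%j. Fj j x) ----> hr x * \<phi> x * T (fst (Y x)) - \<phi> x * br x"
  using H_conv_real G_conv_AE[OF t] t(2) t_u[OF t(1)] Tlim
 proof eventually_elim
  case (elim x)
  show ?case
  proof (cases "x \<in> ?K")
   case False
   then have "\<phi> x = 0" by (rule supp(3)[OF \<phi>(1)])
   then show ?thesis unfolding Fj_def by simp
  next
   case True
   have s: "(%j. snd (U (t j) x)) ----> snd (Y x)" using elim(2,3) True by blast
   have "(%j. (fst (U (t j) x), snd (U (t j) x))) ----> (fst (Y x), snd (Y x))" by (intro tendsto_Pair elim(4) s)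
   then have A: "(%j. a x (U (t j) x)) ----> a x (Y x)" by (intro continuous_on_tendsto_compose[OF A_cont]) auto
   have H': "(%j. H (N (t j)) x (fst (U (t j) x))) ----> hr x" by (rule filterlim_compose[OF elim(1) filterlim_subseq[OF t(1)]])
   have "(%j. H (N (t j)) x (fst (U (t j) x)) * (\<phi> x * T (fst (U (t j) x))) - \<phi> x * bj j x) ----> hr x * (\<phi> x * T (fst (Y x))) - \<phi> x * br x"
    unfolding bj_def br_def using elim True by (intro tendsto_intros A s H') auto
   then show ?thesis by (simp add: Fe[abs_def] mult.assoc)
  qed
 qed
 have mF: "(%x. hr x * \<phi> x * T (fst (Y x)) - \<phi> x * br x) \<in> BM M" unfolding br_def by measurable
 from fatou_lim[OF Fi F0 le cl mF lim]
 show "integrable M (%x. hr x * \<phi> x * T (fst (Y x)) - \<phi> x * br x)"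
  "(LINT x|M. hr x * \<phi> x * T (fst (Y x)) - \<phi> x * br x) <= (LINT x|M. a x (Y x) \<bullet> (T (fst (Y x)) *\<^sub>R grad \<phi> x))" by simp_all
qed

text \<open>The weight exp(-\<Lambda>(u)) is undone by the test functions \<phi> exp(\<Lambda>(w
  j)): \<open>weighted_inequality\<close> asks for C^1 test functions, so the smooth w j stand for
  u. In the limit the weights combine to the cutoff of u at level k.\<close>

lemma lower_truncated:
 assumes \<phi>: "C1c \<Omega> \<phi>" "!!x. \<phi> x >= 0" and k: "k >= 0"
 defines "ck \<equiv> %x. cut (fst (Y x) - k)"
 shows "(LINT x|M. hr x * \<phi> x * ck x) <= (LINT x|M. ck x * (a x (Y x) \<bullet> grad \<phi> x)) + (LINT x|M. gY x * \<phi> x * ck x)"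
proof -
 from cutoff_weight[OF k] obtain \<Lambda> \<eta> :: "real => real" and B where
  *: "(\<forall>s. (\<Lambda> has_field_derivative \<eta> s) (at s)) \<and> continuous_on UNIV \<eta> \<and> (\<forall>s. 0 <= \<eta> s) \<and>
  (\<forall>s. 0 <= s \<and> s <= k + 1 --> \<eta> s = g s / \<alpha>) \<and> (\<forall>s. \<bar>\<Lambda> s\<bar> <= B \<and> \<eta> s <= B)" by blast
 then have \<Lambda>d: "(\<Lambda> has_field_derivative \<eta> s) (at s)" and \<eta>c: "continuous_on UNIV \<eta>" and \<eta>0: "0 <= \<eta> s" "\<eta> s <= B"
  and \<eta>g: "0 <= s ==> s <= k + 1 ==> \<eta> s = g s / \<alpha>" and \<Lambda>B: "\<bar>\<Lambda> s\<bar> <= B" for s by blast+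
 have B0: "B >= 0" using \<eta>0 order_trans by blast
 have \<Lambda>c: "continuous_on UNIV \<Lambda>" by (rule DERIV_continuous_on) (use \<Lambda>d in \<open>auto intro: has_field_derivative_at_within\<close>)
 define T where "T s = exp (- \<Lambda> s) * cut (s - k)" for s
 define T' where "T' s = exp (- \<Lambda> s) * (cut' (s - k) - \<eta> s * cut (s - k))" for s
 define P where "P s = exp (\<Lambda> s)" for s
 define P' where "P' s = exp (\<Lambda> s) * \<eta> s" for s
 define C where "C = exp B * (4 + B)"
 have eb: "exp (\<Lambda> s) <= exp B" "exp (- \<Lambda> s) <= exp B" for s using \<Lambda>B[of s] by auto
 have CB: "exp B <= C" "exp B * B <= C" "C >= 0" unfolding C_def using B0 by (auto simp: mult_left_mono)
 have Td: "(T has_field_derivative T' s) (at s)" for s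
 proof -
  have 1: "((%s. exp (- \<Lambda> s)) has_field_derivative exp (- \<Lambda> s) * - \<eta> s) (at s)"
   by (rule DERIV_chain2[where f=exp and g="%s. - \<Lambda> s" and x=s, OF DERIV_exp DERIV_minus[OF \<Lambda>d]])
  have "((%s. s - k) has_field_derivative (1 - 0)) (at s)" by (intro DERIV_diff DERIV_ident DERIV_const)
  from DERIV_mult[OF 1 DERIV_chain2[where f=cut and g="%s. s - k" and x=s, OF cut_deriv this]]
  show ?thesis unfolding T_def[abs_def] T'_def by (simp add: algebra_simps)
 qed
 have Tc: "continuous_on UNIV T'" unfolding T'_def
  by (intro continuous_on_mult continuous_on_diff continuous_on_exp continuous_on_minus \<Lambda>c \<eta>c
    continuous_on_compose2[OF cut_props(1)] continuous_on_compose2[OF cut_props(2)] continuous_intros) auto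
 have TB: "\<bar>T s\<bar> <= C" for s
 proof -
  have "exp (- \<Lambda> s) * cut (s - k) <= exp B * 1" using eb cut_props(3,4) by (intro mult_mono) auto
  then show ?thesis using CB cut_props(3)[of "s - k"] unfolding T_def by (simp add: abs_mult)
 qed
 have T'B: "\<bar>T' s\<bar> <= C" for s
 proof -
  have "\<eta> s * cut (s - k) <= B * 1" using \<eta>0 cut_props(3,4) B0 by (intro mult_mono) auto
  moreover have "0 <= \<eta> s * cut (s - k)" using \<eta>0 cut_props(3) by simp
  ultimately have "\<bar>cut' (s - k) - \<eta> s * cut (s - k)\<bar> <= 4 + B" using cut_props(10)[of "s - k"] by linarith
  then have "exp (- \<Lambda> s) * \<bar>cut' (s - k) - \<eta> s * cut (s - k)\<bar> <= exp B * (4 + B)" using eb by (intro mult_mono) auto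
  then show ?thesis by (simp add: T'_def C_def abs_mult)
 qed
 have T0: "T s >= 0" for s unfolding T_def using cut_props(3) by simp
 have T'0: "T' s <= 0" if "s >= 0" for s
 proof -
  have "0 <= \<eta> s * cut (s - k)" using \<eta>0 cut_props(3) by simp
  then have "cut' (s - k) - \<eta> s * cut (s - k) <= 0" using cut_props(5)[of "s - k"] by linarith
  then show ?thesis unfolding T'_def by (intro mult_nonneg_nonpos) auto
 qed
 have Tg: "\<alpha> * T' s + g s * T s <= 0" if s: "s >= 0" for s
 proof -
  have "g s * cut (s - k) = \<alpha> * \<eta> s * cut (s - k)"
   using \<eta>g[OF s] \<alpha>0 cut_props(8)[of "s - k"] by (cases "s <= k + 1") auto
  then have "\<alpha> * T' s + g s * T s = exp (- \<Lambda> s) * (\<alpha> * cut' (s - k))" unfolding T_def T'_def by (simp add: algebra_simps)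
  also have "... <= 0" using \<alpha>0 cut_props(5) by (intro mult_nonneg_nonpos) auto
  finally show ?thesis .
 qed
 have Pd: "(P has_field_derivative P' s) (at s)" for s
  unfolding P_def[abs_def] P'_def by (rule DERIV_chain2[where f=exp and g=\<Lambda> and x=s, OF DERIV_exp \<Lambda>d])
 have Pc: "continuous_on UNIV P'" "continuous_on UNIV P" unfolding P'_def P_def by (intro continuous_intros \<Lambda>c \<eta>c)+
 have PB: "0 <= P s" "\<bar>P s\<bar> <= C" "\<bar>P' s\<bar> <= C" for s
 proof -
  show "0 <= P s" "\<bar>P s\<bar> <= C" using order_trans[OF eb(1)[of s] CB(1)] by (simp_all add: P_def)
  have "exp (\<Lambda> s) * \<eta> s <= exp B * B" using eb \<eta>0 B0 by (intro mult_mono) auto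
  then show "\<bar>P' s\<bar> <= C" using \<eta>0 CB by (simp add: P'_def abs_mult)
 qed
 have PT: "P s * T s = cut (s - k)" "P' s * T s = \<eta> s * cut (s - k)" "P s * T' s = cut' (s - k) - \<eta> s * cut (s - k)" for s
  unfolding P_def P'_def T_def T'_def by (simp_all add: exp_minus field_simps)
 obtain L where L: "L > 0" "\<forall>x. norm (jet \<phi> x) <= L \<and> \<bar>\<phi> x\<bar> <= L \<and> norm (grad \<phi> x) <= L" using C1c_bounded[OF \<phi>(1)] by blast
 define \<phi>j where "\<phi>j j x = \<phi> x * P (w j x)" for j x
 have \<phi>jC: "C1c \<Omega> (\<phi>j j)" "grad (\<phi>j j) x = \<phi> x *\<^sub>R (P' (w j x) *\<^sub>R grad (w j) x) + P (w j x) *\<^sub>R grad \<phi> x" for j x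
 proof -
  note c = C1_compose[OF C1c_C1[OF w(1)[of j]] Pd Pc(1)]
  show "C1c \<Omega> (\<phi>j j)" unfolding \<phi>j_def[abs_def] by (rule C1c_mult[OF \<phi>(1) c(1)])
  show "grad (\<phi>j j) x = \<phi> x *\<^sub>R (P' (w j x) *\<^sub>R grad (w j) x) + P (w j x) *\<^sub>R grad \<phi> x"
   unfolding \<phi>j_def[abs_def] using C1_mult(2)[OF C1c_C1[OF \<phi>(1)] c(1)] c(2) by simp
 qed
 have \<phi>j0: "\<phi>j j x >= 0" for j x unfolding \<phi>j_def using \<phi> PB by simp
 define br where "br x = T' (fst (Y x)) * (a x (Y x) \<bullet> snd (Y x)) + gY x * T (fst (Y x))" for x
 have WI: "AE x in M. br x <= 0" "integrable M (%x. hr x * \<phi>j j x * T (fst (Y x)) - \<phi>j j x * br x)"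
  "(LINT x|M. hr x * \<phi>j j x * T (fst (Y x)) - \<phi>j j x * br x) <= (LINT x|M. a x (Y x) \<bullet> (T (fst (Y x)) *\<^sub>R grad (\<phi>j j) x))" for j
  unfolding br_def by (rule weighted_inequality[OF \<phi>jC(1) \<phi>j0 Td Tc T'B TB T0]; (erule T'0 | erule Tg))+
 have [measurable]: "\<phi> \<in> BM M" "grad \<phi> \<in> BM M" using C1c_LP(2,3)[OF \<phi>(1) p0(2)] by (auto simp: LP_def)
 have am [measurable]: "(%x. a x (Y x)) \<in> BM M" by (rule LP_meas[OF aY_LP])
 have Tcc: "continuous_on UNIV T" by (rule DERIV_continuous_on) (use Td in \<open>auto intro: has_field_derivative_at_within\<close>)
 have ckm [measurable]: "ck \<in> BM M" unfolding ck_def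
  by (rule T_meas[where T="%s. cut (s - k)"]) (intro continuous_on_compose2[OF cut_props(1)] continuous_intros, auto)
 have [measurable]: "(%x. T (fst (Y x))) \<in> BM M" "(%x. T' (fst (Y x))) \<in> BM M"
   "(%x. P (fst (Y x))) \<in> BM M" "(%x. P' (fst (Y x))) \<in> BM M" "(%x. \<eta> (fst (Y x))) \<in> BM M"
  using T_meas[OF Tcc] T_meas[OF Tc] T_meas[OF Pc(1)] T_meas[OF Pc(2)] T_meas[OF \<eta>c] by auto
 have ck01: "0 <= ck x" "ck x <= 1" for x unfolding ck_def using cut_props(3,4) by auto
 let ?V = "%x. T (fst (Y x)) *\<^sub>R (\<phi> x *\<^sub>R (P' (fst (Y x)) *\<^sub>R snd (Y x)) + P (fst (Y x)) *\<^sub>R grad \<phi> x)"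
 have wlim: "AE x in M. (%j. w j x) ----> fst (Y x) \<and> (%j. grad (w j) x) ----> snd (Y x)"
  using wc
 proof eventually_elim
  case (elim x)
  then show ?case using tendsto_fst[OF elim] tendsto_snd[OF elim] by simp
 qed
 have Plim: "AE x in M. (%j. P (w j x)) ----> P (fst (Y x)) \<and> (%j. P' (w j x)) ----> P' (fst (Y x))"
  using wlim
 proof eventually_elim
  case (elim x)
  show ?case using continuous_on_tendsto_compose[OF Pc(2) conjunct1[OF elim]] continuous_on_tendsto_compose[OF Pc(1) conjunct1[OF elim]] by auto
 qed
 have rl: "(%j. LINT x|M. a x (Y x) \<bullet> (T (fst (Y x)) *\<^sub>R grad (\<phi>j j) x)) ----> (LINT x|M. a x (Y x) \<bullet> ?V x)"
 \<comment> \<open>The gradient of w j occurs linearly; Young's inequality separates it from the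
   fixed flux, and kd majorises its p-th power.\<close>
 proof (rule integral_dominated_convergence[where w="%x. C * L * C * (norm (a x (Y x)) + (norm (a x (Y x)) powr q + kd x))"])
  show "AE x in M. (%j. a x (Y x) \<bullet> (T (fst (Y x)) *\<^sub>R grad (\<phi>j j) x)) ----> a x (Y x) \<bullet> ?V x"
   using wlim Plim unfolding \<phi>jC(2) by eventually_elim (intro tendsto_intros, blast+)
  show "integrable M (%x. C * L * C * (norm (a x (Y x)) + (norm (a x (Y x)) powr q + kd x)))"
   using LP_integrable[OF aY_LP q1(5)] LP_int[OF aY_LP] kd by auto
  show "(%x. a x (Y x) \<bullet> ?V x) \<in> BM M" by measurable
  show "(%x. a x (Y x) \<bullet> (T (fst (Y x)) *\<^sub>R grad (\<phi>j j) x)) \<in> BM M" for j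
   using LP_meas[OF C1c_LP(3)[OF \<phi>jC(1) p0(2)]] by measurable
  show "AE x in M. norm (a x (Y x) \<bullet> (T (fst (Y x)) *\<^sub>R grad (\<phi>j j) x)) <= C * L * C * (norm (a x (Y x)) + (norm (a x (Y x)) powr q + kd x))" for j
   using wk
  proof eventually_elim
   case (elim x)
   let ?A = "norm (a x (Y x))" and ?w = "norm (grad (w j) x)"
   have "?w <= norm (jet (w j) x)" using norm_fst_snd_le(2)[of "jet (w j) x"] by simp
   then have "?w powr p <= norm (jet (w j) x) powr p" using p0 by (intro powr_mono2) auto
   then have wp: "?w powr p <= kd x" using elim order_trans by blast
   have y: "?A * ?w <= ?A powr q + ?w powr p" by (rule young_powr[OF p1 q1(1)]) auto
   have "norm (\<phi> x *\<^sub>R (P' (w j x) *\<^sub>R grad (w j) x)) <= L * (C * ?w)"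
    unfolding norm_scaleR real_norm_def using L PB(3) CB(3) by (intro mult_mono mult_nonneg_nonneg) auto
   moreover have "norm (P (w j x) *\<^sub>R grad \<phi> x) <= C * L"
    unfolding norm_scaleR using L PB CB by (intro mult_mono) auto
   ultimately have n: "norm (grad (\<phi>j j) x) <= L * C * (1 + ?w)"
    unfolding \<phi>jC(2) by (intro norm_triangle_le) (simp add: algebra_simps)
   have "norm (T (fst (Y x)) *\<^sub>R grad (\<phi>j j) x) <= C * (L * C * (1 + ?w))"
    unfolding norm_scaleR using TB n CB(3) by (intro mult_mono) auto
   then have "norm (a x (Y x) \<bullet> (T (fst (Y x)) *\<^sub>R grad (\<phi>j j) x)) <= ?A * (C * (L * C * (1 + ?w)))"
    using order_trans[OF Cauchy_Schwarz_ineq2 mult_left_mono[OF _ norm_ge_zero]] unfolding real_norm_def by blast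
   also have "... = C * L * C * (?A + ?A * ?w)" by (simp add: algebra_simps)
   also have "... <= C * L * C * (?A + (?A powr q + kd x))" using y wp L(1) CB(3) by (intro mult_left_mono) auto
   finally show ?case .
  qed
 qed
 let ?F = "%x. hr x * (\<phi> x * P (fst (Y x))) * T (fst (Y x)) - (\<phi> x * P (fst (Y x))) * br x"
 have Fl: "AE x in M. (%j. hr x * \<phi>j j x * T (fst (Y x)) - \<phi>j j x * br x) ----> ?F x"
  using Plim unfolding \<phi>j_def by eventually_elim (intro tendsto_intros, blast+)
 have F0: "AE x in M. hr x * \<phi>j j x * T (fst (Y x)) - \<phi>j j x * br x >= 0" for j
  using WI(1)
 proof eventually_elim
  case (elim x)
  have "hr x * \<phi>j j x * T (fst (Y x)) >= 0" using hr_nonneg \<phi>j0 T0 by simp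
  moreover have "\<phi>j j x * br x <= 0" using \<phi>j0 elim by (intro mult_nonneg_nonpos)
  ultimately show ?case by linarith
 qed
 have mF: "?F \<in> BM M" unfolding br_def by measurable
 note F = fatou_lim[OF WI(2) F0 WI(3) rl mF Fl]
 have ia: "integrable M (%x. ck x * (a x (Y x) \<bullet> grad \<phi> x))"
 proof -
  have "norm (ck x *\<^sub>R grad \<phi> x) <= 1 * L" for x unfolding norm_scaleR using ck01[of x] L by (intro mult_mono) auto
  from bounded_flux_int[OF _ this] show ?thesis by simp
 qed
 have ib: "integrable M (%x. \<eta> (fst (Y x)) * ck x * \<phi> x * (a x (Y x) \<bullet> snd (Y x)))"
 proof (rule lint_bound)
  have i: "integrable M (%x. a x (Y x) \<bullet> snd (Y x))" by (rule inner_int[OF aY_LP LP_snd[OF W_LP[OF Y] p0(2)]])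
  show "integrable M (%x. B * 1 * L * (a x (Y x) \<bullet> snd (Y x)))" using i by simp
  show "AE x in M. norm (\<eta> (fst (Y x)) * ck x * \<phi> x * (a x (Y x) \<bullet> snd (Y x))) <= norm (B * 1 * L * (a x (Y x) \<bullet> snd (Y x)))"
  proof (rule AE_I2)
   fix x
   have "\<bar>\<eta> (fst (Y x)) * ck x * \<phi> x\<bar> <= B * 1 * L"
    unfolding abs_mult using \<eta>0 ck01 L B0 by (intro mult_mono mult_nonneg_nonneg) auto
   then show "norm (\<eta> (fst (Y x)) * ck x * \<phi> x * (a x (Y x) \<bullet> snd (Y x))) <= norm (B * 1 * L * (a x (Y x) \<bullet> snd (Y x)))"
    unfolding real_norm_def abs_mult[of _ "a x (Y x) \<bullet> snd (Y x)"] by (rule mult_right_mono[OF order_trans[OF _ abs_ge_self] abs_ge_zero])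
  qed
 qed measurable
 have ig: "integrable M (%x. gY x * \<phi> x * ck x)"
 proof (rule lint_bound[OF integrable_mult_left[OF gY_int, of L]])
  show "AE x in M. norm (gY x * \<phi> x * ck x) <= norm (gY x * L)"
  proof (rule AE_I2)
   fix x
   have "\<phi> x * ck x <= L * 1" using L \<phi> ck01 by (intro mult_mono) (auto simp: abs_le_iff)
   then have "gY x * (\<phi> x * ck x) <= gY x * L" using gY_nonneg by (intro mult_left_mono) auto
   then show "norm (gY x * \<phi> x * ck x) <= norm (gY x * L)" using gY_nonneg[of x] \<phi>(2)[of x] ck01[of x] L(1) by (simp add: abs_mult mult.assoc)
  qed
 qed measurable
 have e: "a x (Y x) \<bullet> ?V x = ck x * (a x (Y x) \<bullet> grad \<phi> x) + \<eta> (fst (Y x)) * ck x * \<phi> x * (a x (Y x) \<bullet> snd (Y x))" for x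
  using PT(1,2)[of "fst (Y x)"] by (simp add: inner_add_right ck_def distrib_left mult.assoc[symmetric]) (simp add: mult.commute mult.left_commute)
 \<comment> \<open>Writing out ?F, the \<eta>-terms of the bracket and of the flux cancel, and so do
   the gradient terms. Besides the source there remains the term with \<open>cut'\<close>, which has
   the right sign and is dropped.\<close>
 have ae: "AE x in M. hr x * \<phi> x * ck x <= ?F x - \<eta> (fst (Y x)) * ck x * \<phi> x * (a x (Y x) \<bullet> snd (Y x)) + gY x * \<phi> x * ck x"
   using AE_coer
  proof eventually_elim
   case (elim x)
   have "0 <= \<alpha> * norm (snd (Y x)) powr p" using \<alpha>0 by simp
   then have "\<phi> x * (cut' (fst (Y x) - k) * (a x (Y x) \<bullet> snd (Y x))) <= 0"
    using elim \<phi> cut_props(5) by (intro mult_nonneg_nonpos mult_nonpos_nonneg) auto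
   moreover have "?F x = hr x * \<phi> x * (P (fst (Y x)) * T (fst (Y x))) - \<phi> x * ((P (fst (Y x)) * T' (fst (Y x))) * (a x (Y x) \<bullet> snd (Y x)) + gY x * (P (fst (Y x)) * T (fst (Y x))))"
    unfolding br_def by (simp add: algebra_simps)
   ultimately show ?case unfolding PT by (simp add: ck_def algebra_simps)
  qed
 have "0 <= hr x * \<phi> x * ck x" for x using hr_nonneg \<phi> ck01 by simp
 then have "AE x in M. 0 <= ?F x - \<eta> (fst (Y x)) * ck x * \<phi> x * (a x (Y x) \<bullet> snd (Y x)) + gY x * \<phi> x * ck x"
  using ae by (auto elim!: eventually_mono intro: order_trans)
 from integral_mono_AE'[OF _ ae this]
 have "(LINT x|M. hr x * \<phi> x * ck x) <= (LINT x|M. ?F x - \<eta> (fst (Y x)) * ck x * \<phi> x * (a x (Y x) \<bullet> snd (Y x)) + gY x * \<phi> x * ck x)"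
  using F(1) ib ig by auto
 also have "... = (LINT x|M. ?F x) - (LINT x|M. \<eta> (fst (Y x)) * ck x * \<phi> x * (a x (Y x) \<bullet> snd (Y x))) + (LINT x|M. gY x * \<phi> x * ck x)"
  using F(1) ib ig by (subst Bochner_Integration.integral_add) auto
 also have "... <= (LINT x|M. ck x * (a x (Y x) \<bullet> grad \<phi> x)) + (LINT x|M. gY x * \<phi> x * ck x)"
  using F(2) unfolding e Bochner_Integration.integral_add[OF ia ib] by simp
 finally show ?thesis .
qed

text \<open>The truncation level tends to infinity; the three untruncated integrands are integrable
  and dominate.\<close>

lemma lower:
 assumes \<phi>: "C1c \<Omega> \<phi>" "!!x. \<phi> x >= 0"
 shows "(LINT x|M. hr x * \<phi> x) <= (LINT x|M. a x (Y x) \<bullet> grad \<phi> x) + (LINT x|M. gY x * \<phi> x)"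
proof -
 obtain L where L: "L > 0" "\<forall>x. norm (jet \<phi> x) <= L \<and> \<bar>\<phi> x\<bar> <= L \<and> norm (grad \<phi> x) <= L" using C1c_bounded[OF \<phi>(1)] by blast
 have [measurable]: "\<phi> \<in> BM M" "grad \<phi> \<in> BM M" using C1c_LP(2,3)[OF \<phi>(1) p0(2)] by (auto simp: LP_def)
 have am [measurable]: "(%x. a x (Y x)) \<in> BM M" by (rule LP_meas[OF aY_LP])
 define c where "c n x = cut (fst (Y x) - real n)" for n x
 have cm [measurable]: "c n \<in> BM M" for n unfolding c_def
  by (rule T_meas[where T="%s. cut (s - real n)"]) (intro continuous_on_compose2[OF cut_props(1)] continuous_intros, auto)
 have c01: "0 <= c n x" "c n x <= 1" for n x unfolding c_def using cut_props(3,4) by auto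
 have cl: "(%n. c n x) ----> 1" for x
 proof (rule tendsto_eventually)
  obtain m where "fst (Y x) <= real m" using real_arch_simple by blast
  then have "c n x = 1" if "n >= m" for n unfolding c_def using that by (intro cut_props(6)) simp
  then show "\<forall>\<^sub>F n in sequentially. c n x = 1" unfolding eventually_sequentially by blast
 qed
 have lim: "(%n. LINT x|M. v x * c n x) ----> (LINT x|M. v x)" if v: "integrable M v" for v
 proof (rule integral_dominated_convergence[where w="%x. norm (v x)"])
  show "AE x in M. (%n. v x * c n x) ----> v x" using tendsto_mult[OF tendsto_const cl] by (intro AE_I2) fastforce
  show "AE x in M. norm (v x * c n x) <= norm (v x)" for n
   using c01 by (intro AE_I2) (auto simp: abs_mult intro!: mult_left_le)
 qed (use v borel_measurable_integrable[OF v] in auto)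
 have gi: "integrable M (%x. gY x * \<phi> x)"
  by (rule lint_bound[OF integrable_mult_right[OF gY_int, of L]])
    (use L gY_nonneg \<phi> in \<open>auto simp: abs_mult mult.commute intro!: mult_right_mono\<close>)
 have ai: "integrable M (%x. a x (Y x) \<bullet> grad \<phi> x)" by (rule bounded_flux_int[of _ L]) (use L in auto)
 show ?thesis
 proof (rule LIMSEQ_le[OF lim[OF hr_int[OF \<phi>]] tendsto_add[OF lim[OF ai] lim[OF gi]]], intro exI[of _ 0] allI impI)
  show "(LINT x|M. hr x * \<phi> x * c n x) <= (LINT x|M. (a x (Y x) \<bullet> grad \<phi> x) * c n x) + (LINT x|M. gY x * \<phi> x * c n x)" for n
   using lower_truncated[OF \<phi>, of "real n"] by (simp add: c_def[abs_def] mult.commute)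
 qed
qed

text \<open>Both inequalities concern nonnegative test functions, and the positive part of \<phi> is
  in general not C^1. So \<phi> is written as (\<phi> + L \<psi>) - L \<psi> with \<psi> >= 1 on its
  support and L a bound for |\<phi>|.\<close>

lemma weak_equation:
 assumes \<phi>: "C1c \<Omega> \<phi>"
 shows "(LINT x|M. a x (Y x) \<bullet> grad \<phi> x) + (LINT x|M. gY x * \<phi> x) = (LINT x|M. hr x * \<phi> x)"
proof -
 define R where "R \<psi> \<longleftrightarrow> integrable M (%x. a x (Y x) \<bullet> grad \<psi> x) \<and> integrable M (%x. gY x * \<psi> x) \<and> integrable M (%x. hr x * \<psi> x) \<and>
  (LINT x|M. a x (Y x) \<bullet> grad \<psi> x) + (LINT x|M. gY x * \<psi> x) = (LINT x|M. hr x * \<psi> x)" for \<psi>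
 have pos: "R \<psi>" if \<psi>: "C1c \<Omega> \<psi>" "!!x. \<psi> x >= 0" for \<psi>
 proof -
  obtain L where L: "L > 0" "\<forall>x. norm (jet \<psi> x) <= L \<and> \<bar>\<psi> x\<bar> <= L \<and> norm (grad \<psi> x) <= L" using C1c_bounded[OF \<psi>(1)] by blast
  have m: "\<psi> \<in> BM M" "grad \<psi> \<in> BM M" using C1c_LP(2,3)[OF \<psi>(1) p0(2)] by (auto simp: LP_def)
  have "integrable M (%x. gY x * \<psi> x)"
   by (rule lint_bound[OF integrable_mult_right[OF gY_int, of L]])
     (use L gY_nonneg \<psi> m in \<open>auto simp: abs_mult mult.commute intro!: mult_right_mono\<close>)
  moreover have "integrable M (%x. a x (Y x) \<bullet> grad \<psi> x)" by (rule bounded_flux_int[of _ L]) (use L m in auto)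
  ultimately show ?thesis unfolding R_def using hr_int[OF \<psi>] upper[OF \<psi>] lower[OF \<psi>] by auto
 qed
 obtain \<psi> where \<psi>: "C1c \<Omega> \<psi>" "!!x. \<psi> x >= 0" "!!x. x \<in> closure {x. \<phi> x \<noteq> 0} ==> \<psi> x >= 1"
  by (rule C1c_bump[OF open_dom supp(1,2)[OF \<phi>]]) (erule that, auto)
 obtain L where L: "L > 0" "\<forall>x. norm (jet \<phi> x) <= L \<and> \<bar>\<phi> x\<bar> <= L \<and> norm (grad \<phi> x) <= L" using C1c_bounded[OF \<phi>] by blast
 have s: "C1c \<Omega> (%x. L * \<psi> x)" by (rule C1c_scale[OF \<psi>(1)])
 have t: "C1c \<Omega> (%x. \<phi> x + L * \<psi> x)" by (rule C1c_add[OF \<phi> s])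
 have "\<phi> x + L * \<psi> x >= 0" for x
 proof (cases "x \<in> closure {x. \<phi> x \<noteq> 0}")
  case True
  then have "L * 1 <= L * \<psi> x" using \<psi>(3) L(1) by (intro mult_left_mono) auto
  moreover have "\<bar>\<phi> x\<bar> <= L" using L(2) by blast
  ultimately show ?thesis by linarith
 next
  case False
  then have "\<phi> x = 0" by (rule supp(3)[OF \<phi>])
  then show ?thesis using \<psi>(2) L(1) by simp
 qed
 then have 1: "R (%x. \<phi> x + L * \<psi> x)" by (intro pos t)
 have 2: "R (%x. L * \<psi> x)" using \<psi>(2) L(1) by (intro pos s) simp
 have g: "grad \<phi> x = grad (%x. \<phi> x + L * \<psi> x) x - grad (%x. L * \<psi> x) x" for x
  using C1_add(2)[OF C1c_C1[OF \<phi>] C1c_C1[OF s]] by simp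
 have d: "v * \<phi> x = v * (\<phi> x + L * \<psi> x) - v * (L * \<psi> x)" for v x by (simp add: algebra_simps)
 show ?thesis
  using 1 2 unfolding R_def g inner_diff_right d[of "gY _"] d[of "hr _"]
  by (simp add: Bochner_Integration.integral_diff del: C1_add)
qed

end

section \<open>Translation between the locales and the original formulation\<close>

lemma borel_measurable_lebesgue_on_AE:
 fixes u v :: "'a::euclidean_space => 'b::euclidean_space"
 assumes "u \<in> borel_measurable (lebesgue_on S)" "AE x in lebesgue_on S. u x = v x" and S: "S \<in> sets lebesgue"
 shows "v \<in> borel_measurable (lebesgue_on S)"
proof -
 have "AE x in lebesgue. x \<in> S --> u x = v x" using assms(2) S by (subst (asm) AE_restrict_space_iff) auto
 then have "AE x in lebesgue. (if x \<in> S then u x else 0) = (if x \<in> S then v x else 0)" by eventually_elim auto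
 from borel_measurable_AE[OF borel_measurable_if_I[OF assms(1) S] this] show ?thesis by (rule borel_measurable_if_D)
qed

context dom
begin

lemma restrict_compact:
 assumes "compact K" "K \<subseteq> \<Omega>"
 shows "lebesgue_on K = restrict_space M K" "K \<inter> space M \<in> sets M"
proof -
 have 1: "\<Omega> \<in> sets lebesgue" using dom_lmeasurable by auto
 have 2: "K \<in> sets lebesgue" using assms(1) by (intro lmeasurable_compact[THEN fmeasurableD])
 show "lebesgue_on K = restrict_space M K" using 1 2 assms(2) by (subst restrict_restrict_space) (auto simp: Int_absorb1)
 show "K \<inter> space M \<in> sets M" using 1 2 assms(2) by (auto simp: sets_restrict_space_iff Int_absorb2)
qed

lemma L1loc_integrable:
 fixes v :: "'a => 'b::{banach,second_countable_topology}"
 assumes "integrable M v" shows "L1loc_on \<Omega> v"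
 unfolding L1loc_on_def
proof (intro conjI allI impI)
 fix K assume K: "compact K \<and> K \<subseteq> \<Omega>"
 then have r: "lebesgue_on K = restrict_space M K" "K \<inter> space M \<in> sets M" using restrict_compact by blast+
 have "K \<in> sets M" using r(2) K by (simp add: Int_absorb2)
 then show "integrable (lebesgue_on K) v" unfolding r(1) integrable_restrict_space[OF r(2)]
  by (intro integrable_mult_indicator assms)
qed (use assms in auto)

end

context singular_limit
begin

text \<open>The positive part agrees a.e. with the first component of Y and is nonnegative
  everywhere, so g and h are evaluated in their domain. The smooth w serve as the approximating
  sequence in \<open>W1p0\<close>.\<close>

lemma is_solution_limit:
 assumes a': "AE x in M. \<forall>s \<xi>. a' x s \<xi> = a x (s, \<xi>)" and f': "!!x. f x = max 0 (f' x)"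
 shows "is_solution p \<Omega> a' g h f' (%x. max 0 (fst (Y x))) (%x. snd (Y x))"
  "integrable M (%x. g (max 0 (fst (Y x))) * norm (snd (Y x)) powr p)"
proof -
 let ?u = "%x. max 0 (fst (Y x))" and ?G = "%x. snd (Y x)"
 have \<Omega>s: "\<Omega> \<in> sets lebesgue" using dom_lmeasurable by auto
 have LY: "LP p M Y" by (rule W_LP[OF Y])
 have uY: "AE x in M. ?u x = fst (Y x)" using Y_nonneg by eventually_elim simp
 have LG: "LP p M ?G" by (rule LP_snd[OF LY p0(2)])
 have L1: "LP p M (%x. fst (Y x))" by (rule LP_fst[OF LY p0(2)])
 have um: "?u \<in> BM M" by measurable
 have Lu: "LP p M ?u"
  by (rule LP_boundI[OF um LP_int[OF L1]]) (use uY in eventually_elim, simp)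
 have p1': "p >= 1" using p1 by simp
 have aY: "AE x in M. a x (Y x) = a' x (?u x) (?G x)" using a' uY by eventually_elim simp
 have am: "(%x. a' x (?u x) (?G x)) \<in> BM M" by (rule borel_measurable_lebesgue_on_AE[OF LP_meas[OF aY_LP] aY \<Omega>s])
 have ai: "integrable M (%x. a' x (?u x) (?G x))"
  by (rule integrable_cong_AE_imp[OF LP_integrable[OF aY_LP q1(5)] am]) (use aY in auto)
 have hY': "h (?u x) * ennreal (f' x) = hY x" for x
  unfolding hY_def f' by (cases "f' x >= 0") (auto simp: ennreal_neg max_def)
 have gY': "(%x. g (?u x) * norm (?G x) powr p) = gY" by (auto simp: gY_def)
 have W1: "W1p0 p \<Omega> ?u ?G"
  unfolding W1p0_def weak_grad_def
 proof (intro conjI allI impI exI[of _ w])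
  show "Lp_on p \<Omega> ?u" "Lp_on p \<Omega> ?G" using Lu LG by (auto simp: Lp_on_def LP_def)
  show "L1loc_on \<Omega> ?u" "L1loc_on \<Omega> ?G" by (intro L1loc_integrable LP_integrable[OF _ p1'] Lu LG)+
  show "C1c \<Omega> (w k)" for k by (rule w(1))
  show "(LINT x|M. ?u x *\<^sub>R grad \<phi> x) = - (LINT x|M. \<phi> x *\<^sub>R ?G x)" if \<phi>: "C1c \<Omega> \<phi>" for \<phi>
  proof -
   have [measurable]: "grad \<phi> \<in> BM M" using C1c_LP(3)[OF \<phi> p0(2)] by (auto simp: LP_def)
   have "(LINT x|M. ?u x *\<^sub>R grad \<phi> x) = (LINT x|M. fst (Y x) *\<^sub>R grad \<phi> x)"
    by (rule integral_cong_AE) (use uY in auto)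
   then show ?thesis using W_weak[OF Y \<phi>] by simp
  qed
  note d = dst_fst_snd_le[OF jet_LP[OF w(1)] LY]
  have wm [measurable]: "w k \<in> BM M" for k using C1c_LP(2)[OF w(1) p0(2)] by (auto simp: LP_def)
  have e1: "(LINT x|M. \<bar>w k x - ?u x\<bar> powr p) = dst (%x. fst (jet (w k) x)) (%x. fst (Y x))" for k
   unfolding dst_def by (rule integral_cong_AE) (use uY in auto)
  show "(%k. LINT x|M. \<bar>w k x - ?u x\<bar> powr p) ----> 0" unfolding e1
   by (rule Lim_null_comparison[OF _ wd]) (use d(1) in \<open>simp add: abs_of_nonneg[OF dst_nonneg]\<close>)
  have e2: "(LINT x|M. norm (grad (w k) x - ?G x) powr p) = dst (%x. snd (jet (w k) x)) (%x. snd (Y x))" for k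
   unfolding dst_def by simp
  show "(%k. LINT x|M. norm (grad (w k) x - ?G x) powr p) ----> 0" unfolding e2
   by (rule Lim_null_comparison[OF _ wd]) (use d(2) in \<open>simp add: abs_of_nonneg[OF dst_nonneg]\<close>)
 qed
 have nn: "(\<integral>\<^sup>+ x. hY x \<partial>lebesgue_on K) < \<infinity>" if K: "compact K" "K \<subseteq> \<Omega>" for K
 proof -
  obtain \<psi> where \<psi>: "C1c \<Omega> \<psi>" "!!x. \<psi> x >= 0" "!!x. x \<in> K ==> \<psi> x >= 1"
   by (rule C1c_bump[OF open_dom K]) (erule that, auto)
  have "(\<integral>\<^sup>+ x. hY x \<partial>lebesgue_on K) = (\<integral>\<^sup>+ x. hY x * indicator K x \<partial>M)"
   unfolding restrict_compact(1)[OF K] by (rule nn_integral_restrict_space[OF restrict_compact(2)[OF K]])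
  also have "... <= (\<integral>\<^sup>+ x. ennreal (hr x * \<psi> x) \<partial>M)"
  proof (rule nn_integral_mono_AE)
   show "AE x in M. hY x * indicator K x <= ennreal (hr x * \<psi> x)"
    using hY_fin
   proof eventually_elim
    case (elim x)
    have e: "ennreal (hr x * \<psi> x) = hY x * ennreal (\<psi> x)"
     using elim \<psi>(2) hr_nonneg by (simp add: hr_def ennreal_mult)
    show ?case
    proof (cases "x \<in> K")
     case True
     then have "1 <= ennreal (\<psi> x)" using \<psi>(3) by (simp add: ennreal_1[symmetric] ennreal_leI del: ennreal_1)
     then have "hY x * 1 <= hY x * ennreal (\<psi> x)" by (intro mult_left_mono) auto
     then show ?thesis unfolding e using True by (simp only: indicator_simps)
    qed simp
   qed
  qed
  also have "... < \<infinity>" using hr_int[OF \<psi>(1,2)] hr_nonneg \<psi>(2) by (subst nn_integral_eq_integral) auto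
  finally show ?thesis .
 qed
 have eq: "(LINT x|M. a' x (?u x) (?G x) \<bullet> grad \<phi> x) + (LINT x|M. gY x * \<phi> x) = (LINT x|M. hr x * \<phi> x)" if \<phi>: "C1c \<Omega> \<phi>" for \<phi>
 proof -
  have [measurable]: "grad \<phi> \<in> BM M" using C1c_LP(3)[OF \<phi> p0(2)] by (auto simp: LP_def)
  have "(LINT x|M. a' x (?u x) (?G x) \<bullet> grad \<phi> x) = (LINT x|M. a x (Y x) \<bullet> grad \<phi> x)"
   by (rule integral_cong_AE) (use am LP_meas[OF aY_LP] aY in auto)
  then show ?thesis using weak_equation[OF \<phi>] by simp
 qed
 show "integrable M (%x. g (?u x) * norm (?G x) powr p)" unfolding gY' by (rule gY_int)
 show "is_solution p \<Omega> a' g h f' ?u ?G"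
  unfolding is_solution_def hY'
 proof (intro conjI allI impI)
  show "W1p0 p \<Omega> ?u ?G" by (rule W1)
  show "AE x in M. ?u x >= 0" by simp
  show "L1loc_on \<Omega> (%x. a' x (?u x) (?G x))" by (rule L1loc_integrable[OF ai])
  show "L1loc_on \<Omega> (%x. g (?u x) * norm (?G x) powr p)" unfolding gY' by (rule L1loc_integrable[OF gY_int])
  show "hY \<in> BM M" by (rule hY_meas)
  show "(\<integral>\<^sup>+ x. hY x \<partial>lebesgue_on K) < \<infinity>" if "compact K \<and> K \<subseteq> \<Omega>" for K using nn that by blast
  show "(LINT x|M. a' x (?u x) (?G x) \<bullet> grad \<phi> x) + (LINT x|M. g (?u x) * norm (?G x) powr p * \<phi> x) = (LINT x|M. enn2real (hY x) * \<phi> x)"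
   if "C1c \<Omega> \<phi>" for \<phi> using eq[OF that] by (simp add: gY_def hr_def)
 qed
qed

end

lemma Hp_singular:
 fixes p :: real and \<Omega> :: "'a::euclidean_space set" and a :: "'a => real => 'a => 'a"
 assumes H: "Hp p \<Omega> a g h f"
 shows "\<exists>a' \<alpha> \<beta> b s0 c0 Ch. singular \<Omega> p a' \<alpha> \<beta> b g h (%x. max 0 (f x)) s0 c0 Ch \<and>
  (AE x in lebesgue_on \<Omega>. \<forall>s \<xi>. a x s \<xi> = a' x (s, \<xi>))"
proof -
 have basic: "bounded \<Omega>" "open \<Omega>" "1 < p" "\<forall>s \<xi>. (%x. a x s \<xi>) \<in> borel_measurable (lebesgue_on \<Omega>)"
  "AE x in lebesgue_on \<Omega>. continuous_on UNIV (%(s, \<xi>). a x s \<xi>)"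
  "continuous_on {0..} g" "\<forall>s\<ge>0. g s >= 0" "Liminf at_top (%s. ereal (g s)) > 0"
  "continuous_on {0..} h" "\<forall>s>0. h s < \<infinity>" "\<forall>\<delta>>0. \<exists>M. \<forall>s\<ge>\<delta>. h s <= ennreal M"
  "integrable (lebesgue_on \<Omega>) f"
  using H unfolding Hp_def by - (elim conjE, assumption)+
 have ex1: "\<exists>\<alpha> \<beta> b. \<alpha> > 0 \<and> \<beta> > 0 \<and> Lp_on (p / (p - 1)) \<Omega> b \<and> (\<forall>x. b x >= 0) \<and>
    (AE x in lebesgue_on \<Omega>. \<forall>s \<xi> \<xi>'. a x s \<xi> \<bullet> \<xi> >= \<alpha> * norm \<xi> powr p \<and>
      norm (a x s \<xi>) <= \<beta> * (b x + \<bar>s\<bar> powr (p - 1) + norm \<xi> powr (p - 1)) \<and>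
      (\<xi> \<noteq> \<xi>' --> (a x s \<xi> - a x s \<xi>') \<bullet> (\<xi> - \<xi>') > 0))"
  and ex2: "\<exists>\<gamma> c1 s1. 0 <= \<gamma> \<and> \<gamma> <= 1 \<and> c1 > 0 \<and> s1 > 0 \<and> (\<forall>s. 0 < s \<and> s <= s1 --> h s <= ennreal (c1 * s powr (- \<gamma>)))"
  using H unfolding Hp_def by - (elim conjE, assumption)+
 from ex1 obtain \<alpha> \<beta> :: real and b :: "'a => real" where ab: "\<alpha> > 0" "\<beta> > 0" "Lp_on (p / (p - 1)) \<Omega> b"
  "AE x in lebesgue_on \<Omega>. \<forall>s \<xi> \<xi>'. a x s \<xi> \<bullet> \<xi> >= \<alpha> * norm \<xi> powr p \<and>
      norm (a x s \<xi>) <= \<beta> * (b x + \<bar>s\<bar> powr (p - 1) + norm \<xi> powr (p - 1)) \<and>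
      (\<xi> \<noteq> \<xi>' --> (a x s \<xi> - a x s \<xi>') \<bullet> (\<xi> - \<xi>') > 0)" by blast
 from ex2 obtain \<gamma> c1 s1 :: real where hs: "0 <= \<gamma>" "\<gamma> <= 1" "c1 > 0" "s1 > 0"
  "\<forall>s. 0 < s \<and> s <= s1 --> h s <= ennreal (c1 * s powr (- \<gamma>))" by blast
 interpret D: dom \<Omega> p by unfold_locales (fact basic)+
 have good: "AE x in D.M. continuous_on UNIV (%(s, \<xi>). a x s \<xi>) \<and> (\<forall>s \<xi> \<xi>'. a x s \<xi> \<bullet> \<xi> >= \<alpha> * norm \<xi> powr p \<and>
      norm (a x s \<xi>) <= \<beta> * (b x + \<bar>s\<bar> powr (p - 1) + norm \<xi> powr (p - 1)) \<and>
      (\<xi> \<noteq> \<xi>' --> (a x s \<xi> - a x s \<xi>') \<bullet> (\<xi> - \<xi>') > 0))"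
  using basic(5) ab(4) by eventually_elim blast
 obtain Nn where Nn: "!!x. x \<in> space D.M - Nn ==> continuous_on UNIV (%(s, \<xi>). a x s \<xi>) \<and> (\<forall>s \<xi> \<xi>'. a x s \<xi> \<bullet> \<xi> >= \<alpha> * norm \<xi> powr p \<and>
      norm (a x s \<xi>) <= \<beta> * (b x + \<bar>s\<bar> powr (p - 1) + norm \<xi> powr (p - 1)) \<and>
      (\<xi> \<noteq> \<xi>' --> (a x s \<xi> - a x s \<xi>') \<bullet> (\<xi> - \<xi>') > 0))" "Nn \<in> null_sets D.M"
  by (rule AE_E3[OF good]) (rule that)
 \<comment> \<open>The set where all pointwise conditions hold. Off it a is replaced by 0, a change
   on a null set only, which makes continuity hold everywhere.\<close>
 define S where "S = space D.M - Nn"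
 have S: "S \<in> sets D.M" unfolding S_def using Nn(2) by auto
 have AES: "AE x in D.M. x \<in> S" using AE_not_in[OF Nn(2)] AE_space by eventually_elim (simp add: S_def)
 note SP = Nn(1)[folded S_def]
 define a' where "a' x z = (if x \<in> S then a x (fst z) (snd z) else 0)" for x and z :: "real \<times> 'a"
 have AEa: "AE x in D.M. \<forall>s \<xi>. a x s \<xi> = a' x (s, \<xi>)" using AES by eventually_elim (simp add: a'_def)
 \<comment> \<open>Any c strictly between 0 and the lower limit of g serves as c0; the maximum with
   1 below provides s0 >= 1.\<close>
 obtain c where c: "0 < ereal c" "ereal c < Liminf at_top (%s. ereal (g s))" using ereal_dense2[OF basic(8)] by blast
 from less_LiminfD[OF c(2)] have "eventually (%s. c < g s) at_top" by simp
 then obtain s2 where s2: "\<forall>s\<ge>s2. c < g s" unfolding eventually_at_top_linorder by blast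
 obtain B where B: "\<forall>s\<ge>s1. h s <= ennreal B" using basic(11) hs(4) by blast
 \<comment> \<open>The first summand covers s \<le> s1, where c1 s^(-\<gamma>) arctan s \<le> c1
   s^(1-\<gamma>) \<le> c1 s1^(1-\<gamma>) because \<gamma> \<le> 1. The second covers s > s1, where
   h \<le> B and arctan \<le> 2.\<close>
 define Ch where "Ch = c1 * s1 powr (1 - \<gamma>) + \<bar>B\<bar> * 2"
 have pos: "c1 * s1 powr (1 - \<gamma>) >= 0" using hs by simp
 have Chb: "h s * ennreal (arctan s) <= ennreal Ch" if s: "s > 0" for s
 proof -
  have at: "0 <= arctan s" using s by simp
  show ?thesis
  proof (cases "s <= s1")
   case True
   have "h s * ennreal (arctan s) <= ennreal (c1 * s powr (- \<gamma>)) * ennreal s"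
    using hs(5) s True arctan_le_self[of s] by (intro mult_mono ennreal_leI) auto
   also have "... = ennreal (c1 * s powr (- \<gamma>) * s)" using hs s by (simp add: ennreal_mult)
   also have "... <= ennreal Ch"
   proof (rule ennreal_leI)
    have "s powr (- \<gamma>) * s = s powr (1 - \<gamma>)" using s by (simp add: powr_diff powr_minus divide_inverse)
    moreover have "s powr (1 - \<gamma>) <= s1 powr (1 - \<gamma>)" using s True hs by (intro powr_mono2) auto
    ultimately have "c1 * (s powr (- \<gamma>) * s) <= c1 * s1 powr (1 - \<gamma>)" using hs by (intro mult_left_mono) auto
    then show "c1 * s powr (- \<gamma>) * s <= Ch" unfolding Ch_def by simp
   qed
   finally show ?thesis .
  next
   case False
   have "h s <= ennreal \<bar>B\<bar>" using B False order_trans[OF _ ennreal_leI[of B "\<bar>B\<bar>"]] by auto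
   then have "h s * ennreal (arctan s) <= ennreal \<bar>B\<bar> * ennreal 2"
    using arctan_abs_le_2[of s] by (intro mult_mono ennreal_leI) auto
   also have "... = ennreal (\<bar>B\<bar> * 2)" by (rule ennreal_mult[symmetric]) auto
   also have "... <= ennreal Ch" using pos by (intro ennreal_leI) (simp add: Ch_def)
   finally show ?thesis .
  qed
 qed
 have "singular \<Omega> p a' \<alpha> \<beta> (%x. \<beta> * b x) g h (%x. max 0 (f x)) (max 1 s2) c Ch"
 proof unfold_locales
  show "(%x. a' x z) \<in> borel_measurable D.M" for z
   unfolding a'_def by (rule measurable_If_set[OF basic(4)[rule_format] borel_measurable_const]) (use S sets.sets_into_space[OF S] in \<open>simp add: Int_absorb2\<close>)
  show "continuous_on UNIV (a' x)" for x
   using SP[of x] unfolding a'_def by (cases "x \<in> S") (auto simp: case_prod_unfold)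
  show "LP D.q D.M (%x. \<beta> * b x)"
   using ab(3) LP_scaleR[of D.q D.M b \<beta>] by (auto simp: LP_def Lp_on_def D.q_def)
  show "AE x in D.M. \<forall>z. \<alpha> * norm (snd z) powr p <= a' x z \<bullet> snd z"
   using AES by eventually_elim (use SP in \<open>simp add: a'_def\<close>)
  show "AE x in D.M. \<forall>z. norm (a' x z) <= \<beta> * b x + \<beta> * (\<bar>fst z\<bar> powr (p - 1) + norm (snd z) powr (p - 1))"
   using AES
  proof eventually_elim
   case (elim x)
   show ?case using SP[OF elim] elim by (simp add: a'_def distrib_left add.assoc)
  qed
  show "AE x in D.M. \<forall>s \<xi> \<xi>'. \<xi> \<noteq> \<xi>' --> 0 < (a' x (s, \<xi>) - a' x (s, \<xi>')) \<bullet> (\<xi> - \<xi>')"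
   using AES
  proof eventually_elim
   case (elim x)
   show ?case using SP[OF elim] elim by (simp add: a'_def)
  qed
  show "max 1 s2 <= s ==> c <= g s" for s using s2 by (meson less_imp_le max.boundedE)
  show "0 <= Ch" unfolding Ch_def using pos by simp
  show "integrable D.M (%x. max 0 (f x))" using basic(12) by (intro Bochner_Integration.integrable_max) auto
  show "0 < c" using c(1) by simp
 qed (use ab basic Chb in auto)
 with AEa show ?thesis by blast
qed

theorem mainTheorem2:
  fixes p :: real and \<Omega> :: "'a::euclidean_space set"
    and a :: "'a \<Rightarrow> real \<Rightarrow> 'a \<Rightarrow> 'a" and g :: "real \<Rightarrow> real"
    and h :: "real \<Rightarrow> ennreal" and f :: "'a \<Rightarrow> real"
  assumes "Hp p \<Omega> a g h f"
  shows "\<exists>u G. is_solution p \<Omega> a g h f u G \<and>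
           integrable (lebesgue_on \<Omega>) (\<lambda>x. g (u x) * norm (G x) powr p)"
proof -
 obtain a' :: "'a => real \<times> 'a => 'a" and \<alpha> \<beta> :: real and b :: "'a => real" and s0 c0 Ch :: real where
  S: "singular \<Omega> p a' \<alpha> \<beta> b g h (%x. max 0 (f x)) s0 c0 Ch"
  and a: "AE x in lebesgue_on \<Omega>. \<forall>s \<xi>. a x s \<xi> = a' x (s, \<xi>)" using Hp_singular[OF assms] by blast
 obtain U :: "nat => 'a => real \<times> 'a" and N :: "nat => nat" and Y :: "'a => real \<times> 'a" and gd kd :: "'a => real" and w :: "nat => 'a => real" where
  "singular_limit \<Omega> p a' \<alpha> \<beta> b g h (%x. max 0 (f x)) s0 c0 Ch U N Y gd kd w"
  using singular.singular_limit_exists[OF S] by blast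
 from singular_limit.is_solution_limit[OF this a refl] show ?thesis by blast
qed

end
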